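(* Let $H$ be a real Lie group with Lie algebra $\mathfrak h$, $\pi:P\to M$ a principal $H$-bundle, $\alpha\in A^1_{\mathrm{Ad}}(P,\mathfrak h)$ an admissible tensorial 1-form of type $\mathrm{Ad}$ and $A$ a connection on $P$ such that $(\alpha,A)$ satisfies $$D_A\alpha=0,\qquad \Omega_A=\tfrac12[\alpha\wedge\alpha].$$ Let $g$ be an $\mathrm{Ad}_H$-invariant non-degenerate symmetric bilinear form on $\mathfrak h$, and let $(Y,J)$ be a Riemann surface. Endow $P$ with the complex structure $J^\alpha_A$ and the pseudo-Hermitian metric $\mathfrak g^\alpha_A$, and $M$ with the pseudo-Riemannian metric $g^\alpha_M$. (1) Let $f:Y\to P$ be a space-like, $\omega^{\alpha,g}_A$-isotropic, holomorphic immersion. Then: (a) The composition $\varphi:=\pi\circ f:Y\to M$ is a space-like conformal immersion. (b) The mean curvature vector field $\vec{\mathfrak H}_\varphi\in A^0(Y,\varphi^*(T_M))$ of $\varphi$ is given by $$\vec{\mathfrak H}_\varphi=\varphi^*([\cdot,\cdot]_\alpha)/\mathrm{vol}_\varphi,\qquad ( * )$$ where $[\cdot,\cdot]_\alpha$ is regarded as an element of $A^2(M,T_M)$ and $\varphi^*([\cdot,\cdot]_\alpha)\in A^2(Y,\varphi^*(T_M))$ is its pull-back via $\varphi$. In other words, for any $y\in Y$ and any $\varphi^*(g^\alpha_M)$-orthonormal basis $(u,v)$ of $T_yY$ with $v=Ju$, one has $\vec{\mathfrak H}_\varphi(y)=[\varphi_{*y}(u),\varphi_{*y}(v)]_\alpha$.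 (2) Conversely, let $\varphi:Y\to M$ be a space-like conformal immersion whose mean curvature vector field is given by $( * )$. Then the sheaf of local holomorphic lifts of $\varphi$ to $P$ (which coincides with the sheaf of local holomorphic lifts of $\varphi$ which are space-like $\omega^{\alpha,g}_A$-isotropic immersions) is isomorphic to the sheaf of local sections of the principal $H$-bundle $\varphi^*(P)\to Y$ which are parallel with respect to a flat connection $B_\varphi$ on this bundle. In particular, if $Y$ is simply connected, then $\varphi$ admits a holomorphic lift $f:Y\to P$, which is unique up to right translation by an element of $H$, and which is a space-like $\omega^{\alpha,g}_A$-isotropic immersion.
   Context: **Principal bundles.** $H$ need not be connected. $V\subset T_P$ is the vertical subbundle of $\pi:P\to M$. A tensorial 1-form of type $\mathrm{Ad}$ is $\alpha\in A^1(P,\mathfrak h)$ vanishing on $V$ with $R_h^*\alpha=\mathrm{Ad}_{h^{-1}}\alpha$ for $h\in H$; the space of these is $A^1_{\mathrm{Ad}}(P,\mathfrak h)$. It is admissible if for every $\xi\in P$ the induced map $T_\xi P/V_\xi\to\mathfrak h$ is an isomorphism (so $\dim M=\dim H$). A connection $A\subset T_P$ is an $H$-invariant distribution complementary to $V$; $\theta\in A^1(P,\mathfrak h)$ is its connection form (zero on $A$, inverse of the infinitesimal action on $V$). Convention: $[\beta\wedge\gamma](u,v)=[\beta(u),\gamma(v)]-[\beta(v),\gamma(u)]$. $\Omega_A=d\theta+\frac12[\theta\wedge\theta]$ is the curvature form and $D_A\alpha=d\alpha+[\theta\wedge\alpha]$ the exterior covariant derivative. **Almost complex structure.** $J^\alpha_A$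 on $P$: for $u\in A_\xi$, $J^\alpha_A(u)$ is the vector in $V_\xi$ with $\theta(J^\alpha_Au)=\alpha(u)$; for $v\in V_\xi$, $J^\alpha_A(v)=-w$ where $w\in A_\xi$ is the vector with $\alpha(w)=\theta(v)$. It is known that $J^\alpha_A$ is integrable if and only if $D_A\alpha=0$ and $\Omega_A=\frac12[\alpha\wedge\alpha]$. **Structures on $M$ and $P$.** For $u,v\in T_\xi P$: - $[\cdot,\cdot]_\alpha:T_M\times_MT_M\to T_M$ is the well-defined fibrewise Lie bracket with $[\pi_*u,\pi_*v]_\alpha=\pi_*w$, where $w\in T_\xi P$ satisfies $\alpha(w)=[\alpha(u),\alpha(v)]$. - $g^\alpha_M(\pi_*u,\pi_*v)=g(\alpha(u),\alpha(v))$ (pseudo-Riemannian metric on $M$). - $\mathfrak g^\alpha_A(u,v)=g(\alpha(u),\alpha(v))+g(\theta(u),\theta(v))$ (pseudo-Riemannian metric on $P$, pseudo-Hermitian for $J^\alpha_A$). - $\omega^{\alpha,g}_A(u,v)=g^{\mathbb C}(\eta(u),\eta(v))$, where $\eta=\theta-i\alpha\in A^1(P,\mathfrak h^{\mathbb C})$ and $g^{\mathbb C}$ is the $\mathbb C$-bilinear extension of $g$ to $\mathfrak h^{\mathbb C}$. **Immersions.** $f:Y\to P$ is $\omega^{\alpha,g}_A$-isotropic if $\omega^{\alpha,g}_A(f_*v,f_*v)=0$ for all $v\in T_Y$. An immersion into a pseudo-Riemannian manifold is space-like if the pulled back metric is positive definite. A space-like immersion $\varphi:(Y,J)\to M$ is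 conformal if $\varphi^*(g^\alpha_M)$ is $J$-invariant. $\mathrm{vol}_\varphi$ is the volume form of $\varphi^*(g^\alpha_M)$ for the complex orientation of $Y$. The mean curvature vector field is $\vec{\mathfrak H}_\varphi=\frac1{\dim Y}$ times the trace (with respect to the induced metric) of the second fundamental form of $\varphi$, i.e. $\frac12\sum_{i=1}^2(\nabla_{V_i}\varphi_*V_i)^\perp$ for a local orthonormal frame $(V_1,V_2)$ of $Y$ and $\nabla$ the pull-back of the Levi-Civita connection of $g^\alpha_M$. A lift of $\varphi$ is a map $f$ with $\pi\circ f=\varphi$. *)

theory Defs
  imports "HOL-Analysis.Analysis" "HOL-Algebra.Group"
begin

section \<open>Smooth maps between open subsets of Euclidean spaces\<close>

text \<open>As usual, \<open>f\<close> is of class \<open>C\<^sup>k\<^sup>+\<^sup>1\<close> if it is differentiable and all its directional derivatives are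
  of class \<open>C\<^sup>k\<close>.  The predicates are only meant for open \<open>S\<close>.\<close>

primrec Ck_on :: "nat \<Rightarrow> 'a::real_normed_vector set \<Rightarrow> ('a \<Rightarrow> 'b::real_normed_vector) \<Rightarrow> bool" where
  "Ck_on 0 S f \<longleftrightarrow> continuous_on S f"
| "Ck_on (Suc k) S f \<longleftrightarrow>
     (\<forall>x\<in>S. f differentiable (at x)) \<and> (\<forall>v. Ck_on k S (\<lambda>x. frechet_derivative f (at x) v))"

definition smooth_on :: "'a::real_normed_vector set \<Rightarrow> ('a \<Rightarrow> 'b::real_normed_vector) \<Rightarrow> bool" where
  "smooth_on S f \<longleftrightarrow> (\<forall>k. Ck_on k S f)"


section \<open>Manifolds and tangent maps\<close>

text \<open>A chart is a pair of its domain and its coordinate map. A manifold is given by an atlas (not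
  necessarily maximal); its underlying set is the union of the chart domains, with the subspace
  topology of the ambient type.\<close>

type_synonym ('a, 'e) chart = "'a set \<times> ('a \<Rightarrow> 'e)"
type_synonym ('a, 'e) atlas = "('a, 'e) chart set"

definition points :: "('a, 'e) atlas \<Rightarrow> 'a set" where
  "points A = (\<Union>c\<in>A. fst c)"

definition open_in :: "('a::topological_space, 'e) atlas \<Rightarrow> 'a set \<Rightarrow> bool" where
  "open_in A U \<longleftrightarrow> openin (top_of_set (points A)) U"

definition chart_inv :: "('a, 'e) chart \<Rightarrow> 'e \<Rightarrow> 'a" where
  "chart_inv c = inv_into (fst c) (snd c)"

definition manifold ::
  "('a::{t2_space,second_countable_topology}, 'e::euclidean_space) atlas \<Rightarrow> bool" where
  "manifold A \<longleftrightarrow>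
     (\<forall>c\<in>A. open_in A (fst c) \<and> open (snd c ` fst c) \<and>
        homeomorphism (fst c) (snd c ` fst c) (snd c) (chart_inv c)) \<and>
     (\<forall>c\<in>A. \<forall>d\<in>A. smooth_on (snd c ` (fst c \<inter> fst d)) (snd d \<circ> chart_inv c))"

definition prod_atlas :: "('a, 'e) atlas \<Rightarrow> ('b, 'f) atlas \<Rightarrow> ('a \<times> 'b, 'e \<times> 'f) atlas" where
  "prod_atlas A B = {(fst c \<times> fst d, \<lambda>(x, y). (snd c x, snd d y)) |c d. c \<in> A \<and> d \<in> B}"

definition smooth_map ::
  "('a::topological_space, 'e::euclidean_space) atlas \<Rightarrow>
   ('b::topological_space, 'f::euclidean_space) atlas \<Rightarrow> 'a set \<Rightarrow> ('a \<Rightarrow> 'b) \<Rightarrow> bool" where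
  "smooth_map A B U f \<longleftrightarrow> open_in A U \<and> f ` U \<subseteq> points B \<and> continuous_on U f \<and>
     (\<forall>c\<in>A. \<forall>d\<in>B. smooth_on (snd c ` (U \<inter> fst c \<inter> f -` fst d)) (snd d \<circ> f \<circ> chart_inv c))"

text \<open>Every point \<open>p\<close> gets a preferred chart \<open>pref A p\<close> around it, and \<open>T\<^sub>pA\<close> is the model vector
  space \<open>'e\<close>: a vector \<open>v :: 'e\<close>, regarded as an element of \<open>T\<^sub>pA\<close>, is the tangent vector at \<open>p\<close> with
  coordinates \<open>v\<close> in the chart \<open>pref A p\<close>. Coordinates with respect to other charts are obtained by
  the usual transformation law: \<open>chart_coord A c p v\<close> are the coordinates in the chart \<open>c\<close> of
  \<open>v \<in> T\<^sub>pA\<close>, and \<open>chart_vec A c x w\<close> is the vector at \<open>chart_inv c x\<close> with coordinates \<open>w\<close> in \<open>c\<close>.\<close>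

definition pref :: "('a, 'e) atlas \<Rightarrow> 'a \<Rightarrow> ('a, 'e) chart" where
  "pref A p = (SOME c. c \<in> A \<and> p \<in> fst c)"

definition pref_pt :: "('a, 'e) atlas \<Rightarrow> 'a \<Rightarrow> 'e" where
  "pref_pt A p = snd (pref A p) p"

definition tmap :: "('a, 'e::euclidean_space) atlas \<Rightarrow> ('b, 'f::euclidean_space) atlas \<Rightarrow>
    ('a \<Rightarrow> 'b) \<Rightarrow> 'a \<Rightarrow> 'e \<Rightarrow> 'f" where
  "tmap A B f p =
     frechet_derivative (snd (pref B (f p)) \<circ> f \<circ> chart_inv (pref A p)) (at (pref_pt A p))"

definition chart_coord :: "('a, 'e::euclidean_space) atlas \<Rightarrow> ('a, 'e) chart \<Rightarrow> 'a \<Rightarrow> 'e \<Rightarrow> 'e" where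
  "chart_coord A c p = frechet_derivative (snd c \<circ> chart_inv (pref A p)) (at (pref_pt A p))"

definition chart_vec :: "('a, 'e::euclidean_space) atlas \<Rightarrow> ('a, 'e) chart \<Rightarrow> 'e \<Rightarrow> 'e \<Rightarrow> 'e" where
  "chart_vec A c x = frechet_derivative (snd (pref A (chart_inv c x)) \<circ> chart_inv c) (at x)"


section \<open>Vector fields and vector-valued 1-forms\<close>

definition smooth_field :: "('a::topological_space, 'e::euclidean_space) atlas \<Rightarrow> 'a set \<Rightarrow>
    ('a \<Rightarrow> 'e) \<Rightarrow> bool" where
  "smooth_field A U V \<longleftrightarrow> open_in A U \<and>
     (\<forall>c\<in>A. smooth_on (snd c ` (U \<inter> fst c))
        (\<lambda>x. chart_coord A c (chart_inv c x) (V (chart_inv c x))))"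

definition field_bracket :: "('a, 'e::euclidean_space) atlas \<Rightarrow> ('a \<Rightarrow> 'e) \<Rightarrow> ('a \<Rightarrow> 'e) \<Rightarrow> 'a \<Rightarrow> 'e" where
  "field_bracket A V W p =
     (let c = pref A p;
          loc = (\<lambda>Z x. chart_coord A c (chart_inv c x) (Z (chart_inv c x)))
      in frechet_derivative (loc W) (at (pref_pt A p)) (V p) -
         frechet_derivative (loc V) (at (pref_pt A p)) (W p))"

definition smooth_form :: "('a::topological_space, 'e::euclidean_space) atlas \<Rightarrow>
    ('a \<Rightarrow> 'e \<Rightarrow> 'k::euclidean_space) \<Rightarrow> bool" where
  "smooth_form A \<beta> \<longleftrightarrow> (\<forall>p\<in>points A. linear (\<beta> p)) \<and>
     (\<forall>c\<in>A. \<forall>w. smooth_on (snd c ` fst c) (\<lambda>x. \<beta> (chart_inv c x) (chart_vec A c x w)))"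

text \<open>Convention: \<open>d\<beta>(V,W) = V(\<beta>(W)) - W(\<beta>(V)) - \<beta>([V,W])\<close>, without a factor \<open>1/2\<close>.\<close>

definition ext_d :: "('a, 'e::euclidean_space) atlas \<Rightarrow>
    ('a \<Rightarrow> 'e \<Rightarrow> 'k::euclidean_space) \<Rightarrow> 'a \<Rightarrow> 'e \<Rightarrow> 'e \<Rightarrow> 'k" where
  "ext_d A \<beta> p u v =
     (let c = pref A p;
          loc = (\<lambda>w x. \<beta> (chart_inv c x) (chart_vec A c x w))
      in frechet_derivative (loc v) (at (pref_pt A p)) u -
         frechet_derivative (loc u) (at (pref_pt A p)) v)"

text \<open>A smooth distribution is locally spanned by a frame of smooth vector fields.\<close>

definition smooth_distribution :: "('a::topological_space, 'e::euclidean_space) atlas \<Rightarrow>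
    ('a \<Rightarrow> 'e set) \<Rightarrow> bool" where
  "smooth_distribution A D \<longleftrightarrow> (\<forall>p\<in>points A. \<exists>U (k::nat) V. p \<in> U \<and> open_in A U \<and>
     (\<forall>i<k. smooth_field A U (V i)) \<and>
     (\<forall>q\<in>U. D q = span ((\<lambda>i. V i q) ` {..<k}) \<and> dim (D q) = k))"


section \<open>Lie groups\<close>

definition lie_group :: "'h::{t2_space,second_countable_topology} monoid \<Rightarrow>
    ('h, 'k::euclidean_space) atlas \<Rightarrow> bool" where
  "lie_group G H \<longleftrightarrow> group G \<and> manifold H \<and> carrier G = points H \<and>
     smooth_map (prod_atlas H H) H (points H \<times> points H) (\<lambda>(a, b). a \<otimes>\<^bsub>G\<^esub> b) \<and>
     smooth_map H H (points H) (\<lambda>a. inv\<^bsub>G\<^esub> a)"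

text \<open>The Lie algebra is the tangent space at the unit, i.e. the type \<open>'k\<close>, with the bracket of
  left-invariant vector fields.\<close>

definition left_field :: "'h monoid \<Rightarrow> ('h, 'k::euclidean_space) atlas \<Rightarrow> 'k \<Rightarrow> 'h \<Rightarrow> 'k" where
  "left_field G H Z a = tmap H H (\<lambda>b. a \<otimes>\<^bsub>G\<^esub> b) \<one>\<^bsub>G\<^esub> Z"

definition lie_bracket :: "'h monoid \<Rightarrow> ('h, 'k::euclidean_space) atlas \<Rightarrow> 'k \<Rightarrow> 'k \<Rightarrow> 'k" where
  "lie_bracket G H Z Z' = field_bracket H (left_field G H Z) (left_field G H Z') \<one>\<^bsub>G\<^esub>"

definition Ad :: "'h monoid \<Rightarrow> ('h, 'k::euclidean_space) atlas \<Rightarrow> 'h \<Rightarrow> 'k \<Rightarrow> 'k" where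
  "Ad G H a = tmap H H (\<lambda>b. a \<otimes>\<^bsub>G\<^esub> b \<otimes>\<^bsub>G\<^esub> inv\<^bsub>G\<^esub> a) \<one>\<^bsub>G\<^esub>"

definition ad_invariant_form :: "'h monoid \<Rightarrow> ('h, 'k::euclidean_space) atlas \<Rightarrow>
    ('k \<Rightarrow> 'k \<Rightarrow> real) \<Rightarrow> bool" where
  "ad_invariant_form G H g \<longleftrightarrow> bilinear g \<and> (\<forall>Z Z'. g Z Z' = g Z' Z) \<and>
     (\<forall>Z. (\<forall>Z'. g Z Z' = 0) \<longrightarrow> Z = 0) \<and>
     (\<forall>a\<in>carrier G. \<forall>Z Z'. g (Ad G H a Z) (Ad G H a Z') = g Z Z')"


section \<open>Principal bundles, connections and tensorial forms\<close>

record ('h, 'k, 'p, 'q, 'm, 'n) pbundle =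
  grp :: "'h monoid"
  grpM :: "('h, 'k) atlas"
  tot :: "('p, 'q) atlas"
  base :: "('m, 'n) atlas"
  act :: "'p \<Rightarrow> 'h \<Rightarrow> 'p"
  proj :: "'p \<Rightarrow> 'm"

definition principal_bundle ::
  "('h::{t2_space,second_countable_topology}, 'k::euclidean_space,
    'p::{t2_space,second_countable_topology}, 'q::euclidean_space,
    'm::{t2_space,second_countable_topology}, 'n::euclidean_space) pbundle \<Rightarrow> bool" where
  "principal_bundle X \<longleftrightarrow>
     lie_group (grp X) (grpM X) \<and> manifold (tot X) \<and> manifold (base X) \<and>
     smooth_map (tot X) (base X) (points (tot X)) (proj X) \<and>
     smooth_map (prod_atlas (tot X) (grpM X)) (tot X) (points (tot X) \<times> points (grpM X))
       (\<lambda>(\<xi>, a). act X \<xi> a) \<and>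
     (\<forall>\<xi>\<in>points (tot X). act X \<xi> \<one>\<^bsub>grp X\<^esub> = \<xi> \<and>
        (\<forall>a\<in>points (grpM X). proj X (act X \<xi> a) = proj X \<xi> \<and>
           (\<forall>b\<in>points (grpM X). act X \<xi> (a \<otimes>\<^bsub>grp X\<^esub> b) = act X (act X \<xi> a) b))) \<and>
     (\<forall>x\<in>points (base X). \<exists>U \<Phi> \<Psi>. x \<in> U \<and> open_in (base X) U \<and>
        (let E = {\<xi> \<in> points (tot X). proj X \<xi> \<in> U} in
          smooth_map (prod_atlas (base X) (grpM X)) (tot X) (U \<times> points (grpM X)) \<Phi> \<and>
          smooth_map (tot X) (prod_atlas (base X) (grpM X)) E \<Psi> \<and>
          \<Phi> ` (U \<times> points (grpM X)) = E \<and> \<Psi> ` E = U \<times> points (grpM X) \<and>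
          (\<forall>t\<in>U \<times> points (grpM X). \<Psi> (\<Phi> t) = t) \<and> (\<forall>\<xi>\<in>E. \<Phi> (\<Psi> \<xi>) = \<xi>) \<and>
          (\<forall>z\<in>U. \<forall>a\<in>points (grpM X). proj X (\<Phi> (z, a)) = z \<and>
             (\<forall>b\<in>points (grpM X). \<Phi> (z, a \<otimes>\<^bsub>grp X\<^esub> b) = act X (\<Phi> (z, a)) b))))"

definition tproj where
  "tproj X = tmap (tot X) (base X) (proj X)"

definition tright where
  "tright X a = tmap (tot X) (tot X) (\<lambda>\<xi>. act X \<xi> a)"

definition vert where
  "vert X \<xi> = {u. tproj X \<xi> u = 0}"

text \<open>The infinitesimal action of the Lie algebra.\<close>

definition fund where
  "fund X \<xi> = tmap (grpM X) (tot X) (\<lambda>a. act X \<xi> a) \<one>\<^bsub>grp X\<^esub>"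

definition brk where
  "brk X = lie_bracket (grp X) (grpM X)"

definition tensorial_form where
  "tensorial_form X \<alpha> \<longleftrightarrow> smooth_form (tot X) \<alpha> \<and>
     (\<forall>\<xi>\<in>points (tot X). (\<forall>u\<in>vert X \<xi>. \<alpha> \<xi> u = 0) \<and>
        (\<forall>a\<in>points (grpM X). \<forall>u.
           \<alpha> (act X \<xi> a) (tright X a \<xi> u) = Ad (grp X) (grpM X) (inv\<^bsub>grp X\<^esub> a) (\<alpha> \<xi> u)))"

text \<open>\<open>C\<close> ranges over the elements of the quotient of the tangent space at \<open>\<xi>\<close> by \<open>vert X \<xi>\<close>.\<close>

definition admissible where
  "admissible X \<alpha> \<longleftrightarrow>
     (\<forall>\<xi>\<in>points (tot X). \<forall>Z. \<exists>!C. C \<in> range (\<lambda>u. (\<lambda>v. u + v) ` vert X \<xi>) \<and> \<alpha> \<xi> ` C = {Z})"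

definition connection where
  "connection X A \<longleftrightarrow> smooth_distribution (tot X) A \<and>
     (\<forall>\<xi>\<in>points (tot X). subspace (A \<xi>) \<and> A \<xi> \<inter> vert X \<xi> = {0} \<and>
        (\<forall>t. \<exists>u\<in>A \<xi>. \<exists>v\<in>vert X \<xi>. t = u + v) \<and>
        (\<forall>a\<in>points (grpM X). tright X a \<xi> ` A \<xi> = A (act X \<xi> a)))"

definition conn_form where
  "conn_form X A \<xi> u = (THE Z. u - fund X \<xi> Z \<in> A \<xi>)"

definition wedge_br ::
  "('k \<Rightarrow> 'k \<Rightarrow> 'k::euclidean_space) \<Rightarrow> ('q \<Rightarrow> 'k) \<Rightarrow> ('q \<Rightarrow> 'k) \<Rightarrow> 'q \<Rightarrow> 'q \<Rightarrow> 'k" where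
  "wedge_br br \<beta> \<gamma> u v = br (\<beta> u) (\<gamma> v) - br (\<beta> v) (\<gamma> u)"

definition curvature where
  "curvature X A \<xi> u v = ext_d (tot X) (conn_form X A) \<xi> u v +
     (1/2) *\<^sub>R wedge_br (brk X) (conn_form X A \<xi>) (conn_form X A \<xi>) u v"

definition cov_d where
  "cov_d X A \<alpha> \<xi> u v = ext_d (tot X) \<alpha> \<xi> u v + wedge_br (brk X) (conn_form X A \<xi>) (\<alpha> \<xi>) u v"

definition flat_connection where
  "flat_connection X A \<longleftrightarrow> connection X A \<and>
     (\<forall>\<xi>\<in>points (tot X). \<forall>u v. curvature X A \<xi> u v = 0)"


section \<open>The structures induced by an admissible form and a connection\<close>

text \<open>On \<open>t = u + v\<close> with \<open>u\<close> horizontal and \<open>v\<close> vertical.\<close>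

definition cplxJ where
  "cplxJ X A \<alpha> \<xi> t = (THE r. \<exists>u v s w. t = u + v \<and> u \<in> A \<xi> \<and> v \<in> vert X \<xi> \<and>
     s \<in> vert X \<xi> \<and> conn_form X A \<xi> s = \<alpha> \<xi> u \<and>
     w \<in> A \<xi> \<and> \<alpha> \<xi> w = conn_form X A \<xi> v \<and> r = s - w)"

definition bracketM where
  "bracketM X \<alpha> x a b = (THE c. \<exists>\<xi> u v w. \<xi> \<in> points (tot X) \<and> proj X \<xi> = x \<and>
     tproj X \<xi> u = a \<and> tproj X \<xi> v = b \<and> \<alpha> \<xi> w = brk X (\<alpha> \<xi> u) (\<alpha> \<xi> v) \<and> c = tproj X \<xi> w)"

definition metricM where
  "metricM X \<alpha> g x a b = (THE r::real. \<exists>\<xi> u v. \<xi> \<in> points (tot X) \<and> proj X \<xi> = x \<and>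
     tproj X \<xi> u = a \<and> tproj X \<xi> v = b \<and> r = g (\<alpha> \<xi> u) (\<alpha> \<xi> v))"

definition metricP where
  "metricP X A \<alpha> g \<xi> u v =
     g (\<alpha> \<xi> u) (\<alpha> \<xi> v) + (g (conn_form X A \<xi> u) (conn_form X A \<xi> v) :: real)"

text \<open>The complexified Lie algebra consists of pairs \<open>(Z\<^sub>1, Z\<^sub>2)\<close>, standing for \<open>Z\<^sub>1 + \<i> Z\<^sub>2\<close>.\<close>

definition complexify_form :: "('k \<Rightarrow> 'k \<Rightarrow> real) \<Rightarrow> 'k \<times> 'k \<Rightarrow> 'k \<times> 'k \<Rightarrow> complex" where
  "complexify_form g Z W = Complex (g (fst Z) (fst W) - g (snd Z) (snd W))
                                   (g (fst Z) (snd W) + g (snd Z) (fst W))"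

definition eta where
  "eta X A \<alpha> \<xi> u = (conn_form X A \<xi> u, - \<alpha> \<xi> u)"

definition omega where
  "omega X A \<alpha> g \<xi> u v = complexify_form g (eta X A \<alpha> \<xi> u) (eta X A \<alpha> \<xi> v)"


section \<open>Riemann surfaces and their immersions\<close>

text \<open>On a Riemann surface every tangent space is the model space \<open>complex\<close> in a chart of the
  holomorphic atlas, so that the complex structure is multiplication by \<open>\<i>\<close>.\<close>

definition riemann_surface ::
  "('y::{t2_space,second_countable_topology}, complex) atlas \<Rightarrow> bool" where
  "riemann_surface Y \<longleftrightarrow> manifold Y \<and>
     (\<forall>c\<in>Y. \<forall>d\<in>Y. (snd d \<circ> chart_inv c) holomorphic_on (snd c ` (fst c \<inter> fst d)))"

definition surfJ :: "complex \<Rightarrow> complex" where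
  "surfJ v = \<i> * v"

definition pullback_metric where
  "pullback_metric Y B q f y u v = (q (f y) (tmap Y B f y u) (tmap Y B f y v) :: real)"

definition immersion where
  "immersion Y B U f \<longleftrightarrow> smooth_map Y B U f \<and> (\<forall>y\<in>U. inj (tmap Y B f y))"

definition spacelike_immersion where
  "spacelike_immersion Y B q U f \<longleftrightarrow> immersion Y B U f \<and>
     (\<forall>y\<in>U. \<forall>v. v \<noteq> 0 \<longrightarrow> pullback_metric Y B q f y v v > 0)"

definition conformal where
  "conformal Y B q U f \<longleftrightarrow> (\<forall>y\<in>U. \<forall>u v.
     pullback_metric Y B q f y (surfJ u) (surfJ v) = pullback_metric Y B q f y u v)"

definition isotropic where
  "isotropic Y X A \<alpha> g U f \<longleftrightarrow> (\<forall>y\<in>U. \<forall>v.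
     omega X A \<alpha> g (f y) (tmap Y (tot X) f y v) (tmap Y (tot X) f y v) = 0)"

definition holomorphic_map where
  "holomorphic_map Y X A \<alpha> U f \<longleftrightarrow> smooth_map Y (tot X) U f \<and>
     (\<forall>y\<in>U. \<forall>v. tmap Y (tot X) f y (surfJ v) = cplxJ X A \<alpha> (f y) (tmap Y (tot X) f y v))"


section \<open>Mean curvature\<close>

text \<open>The Christoffel symbol at \<open>x\<close>, in the preferred chart at \<open>x\<close>, of the Levi-Civita connection of
  \<open>q\<close>: the unique bilinear map which is symmetric (the connection \<open>d + \<Gamma>\<close> is torsion-free) and
  satisfies \<open>D\<^sub>a(q(b,c)) = q(\<Gamma>(a,b),c) + q(b,\<Gamma>(a,c))\<close> for constant coordinate fields \<open>b\<close>, \<open>c\<close>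
  (it is compatible with \<open>q\<close>).\<close>

definition christoffel :: "('m, 'n::euclidean_space) atlas \<Rightarrow> ('m \<Rightarrow> 'n \<Rightarrow> 'n \<Rightarrow> real) \<Rightarrow>
    'm \<Rightarrow> 'n \<Rightarrow> 'n \<Rightarrow> 'n" where
  "christoffel M q x = (THE \<Gamma>. bilinear \<Gamma> \<and> (\<forall>a b. \<Gamma> a b = \<Gamma> b a) \<and>
     (\<forall>a b c. frechet_derivative
        (\<lambda>z. q (chart_inv (pref M x) z) (chart_vec M (pref M x) z b) (chart_vec M (pref M x) z c))
        (at (pref_pt M x)) a = q x (\<Gamma> a b) c + q x b (\<Gamma> a c)))"

text \<open>The covariant derivative at \<open>y\<close> in direction \<open>v\<close> of a vector field \<open>s\<close> along \<open>\<phi>\<close>, with respect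
  to the pull-back by \<open>\<phi>\<close> of the Levi-Civita connection.\<close>

definition pullback_nabla :: "('y, 'f::euclidean_space) atlas \<Rightarrow> ('m, 'n::euclidean_space) atlas \<Rightarrow>
    ('m \<Rightarrow> 'n \<Rightarrow> 'n \<Rightarrow> real) \<Rightarrow> ('y \<Rightarrow> 'm) \<Rightarrow> ('y \<Rightarrow> 'n) \<Rightarrow> 'y \<Rightarrow> 'f \<Rightarrow> 'n" where
  "pullback_nabla Y M q \<phi> s y v =
     frechet_derivative
       (\<lambda>z. chart_coord M (pref M (\<phi> y)) (\<phi> (chart_inv (pref Y y) z)) (s (chart_inv (pref Y y) z)))
       (at (pref_pt Y y)) v +
     christoffel M q (\<phi> y) (tmap Y M \<phi> y v) (s y)"

definition normal_part where
  "normal_part Y M q \<phi> y a = (THE n. a - n \<in> range (tmap Y M \<phi> y) \<and>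
     (\<forall>v. q (\<phi> y) n (tmap Y M \<phi> y v) = (0::real)))"

definition orthonormal_pair where
  "orthonormal_pair q u v \<longleftrightarrow> q u u = (1::real) \<and> q v v = 1 \<and> q u v = 0"

definition mean_curvature :: "('y::topological_space, complex) atlas \<Rightarrow>
    ('m, 'n::euclidean_space) atlas \<Rightarrow> ('m \<Rightarrow> 'n \<Rightarrow> 'n \<Rightarrow> real) \<Rightarrow> ('y \<Rightarrow> 'm) \<Rightarrow> 'y \<Rightarrow> 'n" where
  "mean_curvature Y M q \<phi> y = (THE h. \<exists>U V\<^sub>1 V\<^sub>2. y \<in> U \<and>
     smooth_field Y U V\<^sub>1 \<and> smooth_field Y U V\<^sub>2 \<and>
     (\<forall>z\<in>U. orthonormal_pair (pullback_metric Y M q \<phi> z) (V\<^sub>1 z) (V\<^sub>2 z)) \<and>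
     h = (1/2) *\<^sub>R
       (normal_part Y M q \<phi> y (pullback_nabla Y M q \<phi> (\<lambda>z. tmap Y M \<phi> z (V\<^sub>1 z)) y (V\<^sub>1 y)) +
        normal_part Y M q \<phi> y (pullback_nabla Y M q \<phi> (\<lambda>z. tmap Y M \<phi> z (V\<^sub>2 z)) y (V\<^sub>2 y))))"

text \<open>For the complex orientation \<open>(u, v)\<close> is positively oriented iff \<open>Im (cnj u * v) > 0\<close>; in
  particular \<open>(u, \<i> u)\<close> is positively oriented for \<open>u \<noteq> 0\<close>.\<close>

definition vol_form :: "(complex \<Rightarrow> complex \<Rightarrow> real) \<Rightarrow> complex \<Rightarrow> complex \<Rightarrow> real" where
  "vol_form q = (THE \<nu>. bilinear \<nu> \<and> (\<forall>u. \<nu> u u = 0) \<and>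
     (\<forall>u v. orthonormal_pair q u v \<and> Im (cnj u * v) > 0 \<longrightarrow> \<nu> u v = 1))"

text \<open>The quotient of 2-forms \<open>\<phi>\<^sup>*[\<cdot>,\<cdot>]\<^sub>\<alpha>/vol\<^sub>\<phi>\<close> is the section of \<open>\<phi>\<^sup>*(T\<^sub>M)\<close> by which \<open>vol\<^sub>\<phi>\<close> has to be
  multiplied to get \<open>\<phi>\<^sup>*[\<cdot>,\<cdot>]\<^sub>\<alpha>\<close>.\<close>

definition mean_curvature_eq where
  "mean_curvature_eq Y X \<alpha> g \<phi> \<longleftrightarrow> (\<forall>y\<in>points Y. \<forall>u v.
     bracketM X \<alpha> (\<phi> y) (tmap Y (base X) \<phi> y u) (tmap Y (base X) \<phi> y v) =
     vol_form (pullback_metric Y (base X) (metricM X \<alpha> g) \<phi> y) u v *\<^sub>R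
       mean_curvature Y (base X) (metricM X \<alpha> g) \<phi> y)"


section \<open>Pull-back bundles, lifts and parallel sections\<close>

definition local_section where
  "local_section X W s \<longleftrightarrow> smooth_map (base X) (tot X) W s \<and> (\<forall>x\<in>W. proj X (s x) = x)"

text \<open>The element \<open>a\<close> of the group with \<open>\<xi>' = \<xi> a\<close>.\<close>

definition translator where
  "translator X \<xi> \<xi>' = (THE a. a \<in> points (grpM X) \<and> act X \<xi> a = \<xi>')"

text \<open>The charts of the pull-back bundle come from the local trivializations \<open>(y, s(\<phi>(y))a) \<mapsto> (y, a)\<close>
  given by local sections \<open>s\<close> of the bundle.\<close>

definition pullback_atlas where
  "pullback_atlas Y X \<phi> =
     {({(y, \<xi>). y \<in> fst c \<and> \<phi> y \<in> W \<and> \<xi> \<in> points (tot X) \<and> proj X \<xi> = \<phi> y \<and>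
          translator X (s (\<phi> y)) \<xi> \<in> fst d},
       \<lambda>(y, \<xi>). (snd c y, snd d (translator X (s (\<phi> y)) \<xi>)))
      | c W s d. c \<in> Y \<and> local_section X W s \<and> d \<in> grpM X}"

definition pullback_bundle where
  "pullback_bundle Y X \<phi> =
     \<lparr>grp = grp X, grpM = grpM X, tot = pullback_atlas Y X \<phi>, base = Y,
      act = (\<lambda>(y, \<xi>) a. (y, act X \<xi> a)), proj = fst\<rparr>"

text \<open>Sections over \<open>U\<close> of the sheaves below are functions which are \<open>undefined\<close> outside \<open>U\<close>; the
  restriction maps are given by \<^const>\<open>restrict\<close>.\<close>

definition holomorphic_lifts where
  "holomorphic_lifts Y X A \<alpha> \<phi> U =
     {f \<in> extensional U. holomorphic_map Y X A \<alpha> U f \<and> (\<forall>y\<in>U. proj X (f y) = \<phi> y)}"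

definition parallel_sections where
  "parallel_sections X B U =
     {s \<in> extensional U. local_section X U s \<and>
        (\<forall>y\<in>U. \<forall>v. tmap (base X) (tot X) s y v \<in> B (s y))}"

definition sheaves_isomorphic :: "('y::topological_space, 'e) atlas \<Rightarrow>
    ('y set \<Rightarrow> ('y \<Rightarrow> 'a) set) \<Rightarrow> ('y set \<Rightarrow> ('y \<Rightarrow> 'b) set) \<Rightarrow> bool" where
  "sheaves_isomorphic Y F G \<longleftrightarrow> (\<exists>\<Psi>.
     (\<forall>U. open_in Y U \<longrightarrow> bij_betw (\<Psi> U) (F U) (G U)) \<and>
     (\<forall>U V. open_in Y U \<and> open_in Y V \<and> V \<subseteq> U \<longrightarrow>
        (\<forall>f\<in>F U. \<Psi> V (restrict f V) = restrict (\<Psi> U f) V)))"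

end

theory Submission
  imports Defs
begin

text \<open>For a section \<open>\<sigma>\<close> of \<open>P\<close> along \<open>\<phi>\<close> put \<open>\<beta>\<^sub>\<sigma> = \<sigma>\<^sup>*\<theta> + \<sigma>\<^sup>*\<alpha> \<circ> J\<close>. Then \<open>\<sigma>\<close> is holomorphic iff \<open>\<beta>\<^sub>\<sigma> = 0\<close>, and a
  gauge change \<open>\<sigma> b\<close> transforms \<open>\<beta>\<close> like a connection form, so holomorphic lifts are the parallel sections
  of a connection on \<open>\<phi>\<^sup>*P\<close>. If \<open>\<phi>\<close> is conformal, the two equations for \<open>(\<alpha>, A)\<close> and the invariance of \<open>g\<close>
  identify its curvature \<open>d\<beta> + [\<beta>, \<beta>]\<close> at \<open>(1, \<i>)\<close> with \<open>2[\<alpha>, \<alpha>](1, \<i>)\<close> minus a multiple of the mean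
  curvature vector: the mean curvature equation says that the connection is flat. Flatness yields
  local lifts by the Frobenius theorem, and global ones by monodromy.\<close>

section \<open>Calculus of smooth maps\<close>

text \<open>Write \<beta>(w) = t(w) + a(\<i> w), with t and a the pull-backs of \<theta> and
  \<alpha>. The twist by \<i> makes d\<beta>(1, \<i>) contain the trace of the derivative of a
  instead of its antisymmetric part; this is how a mean curvature enters a curvature. One bracket
  [a(1), a(\<i>)] comes from the curvature equation, the other from the two a-terms in
  [\<beta>, \<beta>]. The mixed brackets turn derivatives of a into covariant ones: D_A \<alpha> = 0
  and the invariance of g make d + [t, .] the Levi-Civita connection in the frame \<alpha>.
  Conformality makes the trace normal, so nothing tangential has to be subtracted. At each point
  this is an equivalence, and it serves both directions: a given lift makes \<beta> a pull-back of
  the Maurer-Cartan form, hence flat. The connection on \<phi>^*P is constructed from its parallel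
  sections, as the field of tangent planes of graphs of lifts, so it comes after the Frobenius
  theorem. Tangent vectors are coordinates in a preferred chart that jumps from point to point;
  smoothness has to be tested in fixed charts throughout.\<close>

abbreviation FD :: "('a::real_normed_vector \<Rightarrow> 'b::real_normed_vector) \<Rightarrow> 'a \<Rightarrow> 'a \<Rightarrow> 'b" where
  "FD f x \<equiv> frechet_derivative f (at x)"

lemma has_FD: "f differentiable (at x) \<Longrightarrow> (f has_derivative FD f x) (at x)"
  by (simp add: frechet_derivative_works[symmetric])

lemma FD_eqI: "(f has_derivative D) (at x) \<Longrightarrow> FD f x = D"
  by (rule frechet_derivative_at[symmetric])

lemma has_derivative_cong_open:
  assumes "open S" "x \<in> S" "\<And>y. y \<in> S \<Longrightarrow> f y = g y"
  shows "(f has_derivative D) (at x) \<longleftrightarrow> (g has_derivative D) (at x)"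
  using assms has_derivative_transform_within_open[of f D x UNIV S g]
    has_derivative_transform_within_open[of g D x UNIV S f] by auto

lemma FD_cong_open:
  assumes "open S" "x \<in> S" "\<And>y. y \<in> S \<Longrightarrow> f y = g y"
  shows "FD f x = FD g x"
  unfolding frechet_derivative_def using has_derivative_cong_open[OF assms] by simp

lemma differentiable_cong_open:
  assumes "open S" "x \<in> S" "\<And>y. y \<in> S \<Longrightarrow> f y = g y"
  shows "f differentiable (at x) \<longleftrightarrow> g differentiable (at x)"
  unfolding differentiable_def using has_derivative_cong_open[OF assms] by simp

lemma FD_linear: "f differentiable (at x) \<Longrightarrow> linear (FD f x)"
  using has_FD has_derivative_linear by blast

section \<open>Closure properties of maps of class \<open>Ck_on\<close>\<close>

lemma Ck_on_cong:
  assumes "open S" "\<And>x. x \<in> S \<Longrightarrow> f x = g x"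
  shows "Ck_on k S f \<longleftrightarrow> Ck_on k S g"
  using assms(2)
proof (induction k arbitrary: f g)
  case 0
  then show ?case by (simp cong: continuous_on_cong)
next
  case (Suc k)
  have "FD f x v = FD g x v" if "x \<in> S" for x v
    using FD_cong_open[OF \<open>open S\<close> that Suc.prems] by simp
  then show ?case
    using Suc.IH[of "\<lambda>x. FD f x v" "\<lambda>x. FD g x v" for v]
      differentiable_cong_open[OF \<open>open S\<close> _ Suc.prems] by auto
qed

lemma Ck_on_subset: "Ck_on k S f \<Longrightarrow> T \<subseteq> S \<Longrightarrow> Ck_on k T f"
  by (induction k arbitrary: f) (auto intro: continuous_on_subset)

lemma Ck_on_local:
  assumes "\<And>x. x \<in> S \<Longrightarrow> \<exists>T. open T \<and> x \<in> T \<and> Ck_on k T f"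
  shows "Ck_on k S f"
  using assms
proof (induction k arbitrary: f)
  case 0
  have "isCont f x" if "x \<in> S" for x
    using 0[OF that] by (auto simp: continuous_on_eq_continuous_at)
  then show ?case by (simp add: continuous_at_imp_continuous_on)
next
  case (Suc k)
  show ?case
  proof (simp, intro conjI ballI allI)
    show "f differentiable (at x)" if "x \<in> S" for x
      using Suc.prems[OF that] by auto
    show "Ck_on k S (\<lambda>x. FD f x v)" for v
      by (rule Suc.IH) (use Suc.prems in fastforce)
  qed
qed

lemma Ck_on_SucD: "Ck_on (Suc k) S f \<Longrightarrow> Ck_on k S f"
proof (induction k arbitrary: f)
  case 0
  then show ?case
    by (auto intro!: continuous_at_imp_continuous_on differentiable_imp_continuous_within)
qed auto

lemma Ck_on_const: "open S \<Longrightarrow> Ck_on k S (\<lambda>x. c)"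
  by (induction k arbitrary: c) auto

lemma Ck_on_linear:
  assumes "bounded_linear L" "open S" "Ck_on k S f"
  shows "Ck_on k S (\<lambda>x. L (f x))"
  using assms(3)
proof (induction k arbitrary: f)
  case 0
  then show ?case
    using bounded_linear.continuous_on[OF assms(1)] by simp
next
  case (Suc k)
  have D: "((\<lambda>x. L (f x)) has_derivative (\<lambda>v. L (FD f x v))) (at x)" if "x \<in> S" for x
    using Suc.prems that by (intro bounded_linear.has_derivative[OF assms(1)] has_FD) auto
  have "Ck_on k S (\<lambda>x. FD (\<lambda>x. L (f x)) x v)" for v
  proof -
    have "Ck_on k S (\<lambda>x. L (FD f x v))" using Suc by auto
    then show ?thesis
      by (subst Ck_on_cong[OF assms(2), of _ "\<lambda>x. L (FD f x v)"]) (auto simp: FD_eqI[OF D])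
  qed
  then show ?case using D by (auto simp: differentiable_def)
qed

lemma Ck_on_add:
  assumes "open S" "Ck_on k S f" "Ck_on k S g"
  shows "Ck_on k S (\<lambda>x. f x + g x)"
  using assms(2,3)
proof (induction k arbitrary: f g)
  case 0
  then show ?case by (simp add: continuous_on_add)
next
  case (Suc k)
  have D: "((\<lambda>x. f x + g x) has_derivative (\<lambda>v. FD f x v + FD g x v)) (at x)" if "x \<in> S" for x
    using Suc.prems that by (intro has_derivative_add has_FD) auto
  have "Ck_on k S (\<lambda>x. FD (\<lambda>x. f x + g x) x v)" for v
  proof -
    have "Ck_on k S (\<lambda>x. FD f x v + FD g x v)" using Suc by auto
    then show ?thesis
      by (subst Ck_on_cong[OF assms(1), of _ "\<lambda>x. FD f x v + FD g x v"]) (auto simp: FD_eqI[OF D])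
  qed
  then show ?case using D by (auto simp: differentiable_def)
qed

lemma Ck_on_bilinear:
  assumes "bounded_bilinear B" "open S" "Ck_on k S f" "Ck_on k S g"
  shows "Ck_on k S (\<lambda>x. B (f x) (g x))"
  using assms(3,4)
proof (induction k arbitrary: f g)
  case 0
  then show ?case by (simp add: bounded_bilinear.continuous_on[OF assms(1)])
next
  case (Suc k)
  have D: "((\<lambda>x. B (f x) (g x)) has_derivative (\<lambda>v. B (f x) (FD g x v) + B (FD f x v) (g x))) (at x)"
    if "x \<in> S" for x
    using Suc.prems that by (intro bounded_bilinear.FDERIV[OF assms(1)] has_FD) auto
  have "Ck_on k S (\<lambda>x. FD (\<lambda>x. B (f x) (g x)) x v)" for v
  proof -
    have "Ck_on k S (\<lambda>x. B (f x) (FD g x v) + B (FD f x v) (g x))"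
      using Suc.prems Ck_on_SucD[OF Suc.prems(1)] Ck_on_SucD[OF Suc.prems(2)]
      by (intro Ck_on_add[OF assms(2)] Suc.IH) auto
    then show ?thesis
      by (subst Ck_on_cong[OF assms(2)]) (auto simp: FD_eqI[OF D])
  qed
  then show ?case using D by (auto simp: differentiable_def)
qed

lemma Ck_on_sum:
  assumes "open S" "finite I" "\<And>i. i \<in> I \<Longrightarrow> Ck_on k S (f i)"
  shows "Ck_on k S (\<lambda>x. \<Sum>i\<in>I. f i x)"
  using assms(2,3) by (induction I rule: finite_induct) (auto intro: Ck_on_add[OF assms(1)] Ck_on_const[OF assms(1)])

lemma Ck_on_Pair:
  assumes "open S" "Ck_on k S f" "Ck_on k S g"
  shows "Ck_on k S (\<lambda>x. (f x, g x))"
proof -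
  have 1: "bounded_linear (\<lambda>a. (a, 0))" "bounded_linear (\<lambda>b. (0, b))"
    by (intro bounded_linear_Pair bounded_linear_ident bounded_linear_zero)+
  show ?thesis
    using Ck_on_add[OF assms(1) Ck_on_linear[OF 1(1) assms(1,2)] Ck_on_linear[OF 1(2) assms(1,3)]]
    by simp
qed

text \<open>Families of linear maps are only ever controlled on fixed vectors; expansion in the
  finite \<open>Basis\<close> turns such data into statements about vectors that vary as
  well.\<close>

lemma linear_basis_sum:
  fixes L :: "'a::euclidean_space \<Rightarrow> 'b::real_normed_vector"
  assumes "linear L"
  shows "L w = (\<Sum>b\<in>Basis. (w \<bullet> b) *\<^sub>R L b)"
  by (metis (mono_tags, lifting) assms euclidean_representation linear_cmul linear_sum sum.cong)

text \<open>\<open>c\<close> holds the constants belonging to the basis vectors and \<open>m\<close>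
  a common factor that may depend on the points involved, so that the sum of the \<open>c b\<close>
  is a uniform constant.\<close>

lemma basis_sum_bound:
  fixes D :: "'b::euclidean_space \<Rightarrow> 'c::real_normed_vector"
  assumes "linear D" "\<And>b. b \<in> Basis \<Longrightarrow> norm (D b) \<le> c b * m" "m \<ge> 0" "\<And>b. c b \<ge> 0"
  shows "norm (D v) \<le> (\<Sum>b\<in>Basis. c b) * m * norm v"
proof -
  have "norm (D v) \<le> (\<Sum>b\<in>Basis. norm v * (c b * m))"
    unfolding linear_basis_sum[OF assms(1), of v]
  proof (rule sum_norm_le)
    fix b :: 'b assume b: "b \<in> Basis"
    have "norm ((v \<bullet> b) *\<^sub>R D b) = \<bar>v \<bullet> b\<bar> * norm (D b)" by simp
    also have "\<dots> \<le> norm v * (c b * m)"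
      using assms(2)[OF b] b by (intro mult_mono) (auto simp: Basis_le_norm)
    finally show "norm ((v \<bullet> b) *\<^sub>R D b) \<le> norm v * (c b * m)" .
  qed
  also have "\<dots> = (\<Sum>b\<in>Basis. c b) * m * norm v"
    by (simp add: sum_distrib_left[symmetric] sum_distrib_right[symmetric] algebra_simps)
  finally show ?thesis .
qed

lemma Ck_on_apply:
  fixes L :: "'a::real_normed_vector \<Rightarrow> 'b::euclidean_space \<Rightarrow> 'c::real_normed_vector"
  assumes "open S" "\<And>x. x \<in> S \<Longrightarrow> linear (L x)" "\<And>w. Ck_on k S (\<lambda>x. L x w)" "Ck_on k S f"
  shows "Ck_on k S (\<lambda>x. L x (f x))"
proof -
  have "Ck_on k S (\<lambda>x. \<Sum>b\<in>Basis. (f x \<bullet> b) *\<^sub>R L x b)"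
    by (intro Ck_on_sum assms(1) finite_Basis Ck_on_bilinear[OF bounded_bilinear_scaleR] assms(3)
        Ck_on_linear[OF bounded_linear_inner_left] assms(4))
  then show ?thesis
    by (subst Ck_on_cong[OF assms(1)]) (auto intro: linear_basis_sum assms(2))
qed

text \<open>The derivative of the composite is \<open>FD g (f x)\<close> applied to the moving
  vector \<open>FD f x v\<close>, so the induction step is an instance of
  \<open>Ck_on_apply\<close>. The map \<open>g\<close> varies in the induction because it is
  replaced by its directional derivatives.\<close>

lemma Ck_on_compose:
  fixes f :: "'a::real_normed_vector \<Rightarrow> 'b::euclidean_space"
  assumes "open S" "open T" "Ck_on k S f" "Ck_on k T g" "f ` S \<subseteq> T"
  shows "Ck_on k S (\<lambda>x. g (f x))"
  using assms(3,4)
proof (induction k arbitrary: g)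
  case 0
  then show ?case using assms(5) by (auto intro: continuous_on_compose2)
next
  case (Suc k)
  have D: "((\<lambda>x. g (f x)) has_derivative (\<lambda>v. FD g (f x) (FD f x v))) (at x)" if "x \<in> S" for x
  proof -
    have "f x \<in> T" using assms(5) that by auto
    then show ?thesis
      using Suc.prems that by (intro has_derivative_compose[of f _ x UNIV g] has_FD) auto
  qed
  have "Ck_on k S (\<lambda>x. FD (\<lambda>x. g (f x)) x v)" for v
  proof -
    have "Ck_on k S (\<lambda>x. FD g (f x) (FD f x v))"
    proof (rule Ck_on_apply[OF assms(1)])
      show "linear (FD g (f x))" if "x \<in> S" for x
        using Suc.prems that assms(5) by (intro FD_linear) auto
      show "Ck_on k S (\<lambda>x. FD g (f x) w)" for w
        using Suc.prems Ck_on_SucD[OF Suc.prems(1)] by (intro Suc.IH) auto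
    qed (use Suc.prems in auto)
    then show ?thesis
      by (subst Ck_on_cong[OF assms(1)]) (auto simp: FD_eqI[OF D])
  qed
  then show ?case using D by (auto simp: differentiable_def)
qed

lemma smooth_on_Ck: "smooth_on S f \<Longrightarrow> Ck_on k S f"
  by (simp add: smooth_on_def)

lemma smooth_on_differentiable: "smooth_on S f \<Longrightarrow> x \<in> S \<Longrightarrow> f differentiable (at x)"
  using smooth_on_Ck[of S f "Suc 0"] by simp

lemma smooth_on_has_FD: "smooth_on S f \<Longrightarrow> x \<in> S \<Longrightarrow> (f has_derivative FD f x) (at x)"
  by (intro has_FD smooth_on_differentiable)

lemma smooth_on_FD_linear: "smooth_on S f \<Longrightarrow> x \<in> S \<Longrightarrow> linear (FD f x)"
  by (intro FD_linear smooth_on_differentiable)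

lemma smooth_on_continuous: "smooth_on S f \<Longrightarrow> continuous_on S f"
  using smooth_on_Ck[of S f 0] by simp

lemma smooth_on_FD: "smooth_on S f \<Longrightarrow> smooth_on S (\<lambda>x. FD f x v)"
  unfolding smooth_on_def
proof
  show "Ck_on k S (\<lambda>x. FD f x v)" if "\<forall>k. Ck_on k S f" for k
    using that[rule_format, of "Suc k"] by simp
qed

lemma smooth_on_cong:
  assumes "open S" "\<And>x. x \<in> S \<Longrightarrow> f x = g x"
  shows "smooth_on S f \<longleftrightarrow> smooth_on S g"
  unfolding smooth_on_def using Ck_on_cong[OF assms] by simp

lemma smooth_on_subset: "smooth_on S f \<Longrightarrow> T \<subseteq> S \<Longrightarrow> smooth_on T f"
  unfolding smooth_on_def using Ck_on_subset by blast

lemma smooth_on_local: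
  "(\<And>x. x \<in> S \<Longrightarrow> \<exists>T. open T \<and> x \<in> T \<and> smooth_on T f) \<Longrightarrow> smooth_on S f"
  unfolding smooth_on_def by (meson Ck_on_local)

lemma smooth_on_const: "open S \<Longrightarrow> smooth_on S (\<lambda>x. c)"
  by (simp add: smooth_on_def Ck_on_const)

lemma smooth_on_id: "open S \<Longrightarrow> smooth_on S (\<lambda>x. x)"
  unfolding smooth_on_def
proof (intro allI)
  show "Ck_on k S (\<lambda>x. x)" if "open S" for k
    using that by (cases k) (auto intro: Ck_on_const)
qed

lemma smooth_on_linear: "bounded_linear L \<Longrightarrow> open S \<Longrightarrow> smooth_on S f \<Longrightarrow> smooth_on S (\<lambda>x. L (f x))"
  by (simp add: smooth_on_def Ck_on_linear)

lemma smooth_on_add: "open S \<Longrightarrow> smooth_on S f \<Longrightarrow> smooth_on S g \<Longrightarrow> smooth_on S (\<lambda>x. f x + g x)"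
  by (simp add: smooth_on_def Ck_on_add)

lemma smooth_on_bilinear:
  "bounded_bilinear B \<Longrightarrow> open S \<Longrightarrow> smooth_on S f \<Longrightarrow> smooth_on S g \<Longrightarrow> smooth_on S (\<lambda>x. B (f x) (g x))"
  by (simp add: smooth_on_def Ck_on_bilinear)

lemma smooth_on_sum:
  "open S \<Longrightarrow> finite I \<Longrightarrow> (\<And>i. i \<in> I \<Longrightarrow> smooth_on S (f i)) \<Longrightarrow> smooth_on S (\<lambda>x. \<Sum>i\<in>I. f i x)"
  by (simp add: smooth_on_def Ck_on_sum)

lemma smooth_on_Pair: "open S \<Longrightarrow> smooth_on S f \<Longrightarrow> smooth_on S g \<Longrightarrow> smooth_on S (\<lambda>x. (f x, g x))"
  by (simp add: smooth_on_def Ck_on_Pair)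

lemma smooth_on_fst: "open S \<Longrightarrow> smooth_on S fst"
  and smooth_on_snd: "open S \<Longrightarrow> smooth_on S snd"
  using smooth_on_linear[OF bounded_linear_fst _ smooth_on_id] smooth_on_linear[OF bounded_linear_snd _ smooth_on_id]
  by auto

lemma smooth_on_compose:
  fixes f :: "'a::real_normed_vector \<Rightarrow> 'b::euclidean_space"
  assumes "open S" "open T" "smooth_on S f" "smooth_on T g" "f ` S \<subseteq> T"
  shows "smooth_on S (\<lambda>x. g (f x))"
  using assms by (auto simp: smooth_on_def intro: Ck_on_compose)

lemma smooth_on_apply:
  fixes L :: "'a::real_normed_vector \<Rightarrow> 'b::euclidean_space \<Rightarrow> 'c::real_normed_vector"
  assumes "open S" "\<And>x. x \<in> S \<Longrightarrow> linear (L x)" "\<And>w. smooth_on S (\<lambda>x. L x w)" "smooth_on S f"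
  shows "smooth_on S (\<lambda>x. L x (f x))"
  unfolding smooth_on_def
  using Ck_on_apply[of S L _ f, OF assms(1,2) smooth_on_Ck[OF assms(3)] smooth_on_Ck[OF assms(4)]] by blast

lemma FD_compose:
  assumes "f differentiable (at x)" "g differentiable (at (f x))"
  shows "FD (\<lambda>x. g (f x)) x v = FD g (f x) (FD f x v)"
  using FD_eqI[OF has_derivative_compose[OF has_FD[OF assms(1)] has_FD[OF assms(2)]]] by simp

lemma FD_linear_comp:
  assumes "bounded_linear L" "f differentiable (at x)"
  shows "FD (\<lambda>x. L (f x)) x v = L (FD f x v)"
  using FD_eqI[OF bounded_linear.has_derivative[OF assms(1) has_FD[OF assms(2)]]] by simp

lemma FD_add:
  assumes "f differentiable (at x)" "g differentiable (at x)"
  shows "FD (\<lambda>x. f x + g x) x v = FD f x v + FD g x v"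
  using FD_eqI[OF has_derivative_add[OF has_FD[OF assms(1)] has_FD[OF assms(2)]]] by simp

lemma FD_bilinear:
  assumes "bounded_bilinear B" "f differentiable (at x)" "g differentiable (at x)"
  shows "FD (\<lambda>x. B (f x) (g x)) x v = B (f x) (FD g x v) + B (FD f x v) (g x)"
  using FD_eqI[OF bounded_bilinear.FDERIV[OF assms(1) has_FD[OF assms(2)] has_FD[OF assms(3)]]] by simp

text \<open>Follows from the product rule for \<open>scaleR\<close> in the basis expansion. The
  first summand differentiates the family with the vector frozen, the second the vector with the
  family frozen.\<close>

lemma has_derivative_apply:
  fixes L :: "'a::real_normed_vector \<Rightarrow> 'b::euclidean_space \<Rightarrow> 'c::real_normed_vector"
  assumes "open S" "x \<in> S" "\<And>x. x \<in> S \<Longrightarrow> linear (L x)"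
    and dL: "\<And>w. (\<lambda>x. L x w) differentiable (at x)" and df: "f differentiable (at x)"
  shows "((\<lambda>x. L x (f x)) has_derivative (\<lambda>v. FD (\<lambda>y. L y (f x)) x v + L x (FD f x v))) (at x)"
proof -
  have 1: "((\<lambda>x. \<Sum>b\<in>Basis. (f x \<bullet> b) *\<^sub>R L x b) has_derivative
      (\<lambda>v. \<Sum>b\<in>Basis. (f x \<bullet> b) *\<^sub>R FD (\<lambda>x. L x b) x v + (FD f x v \<bullet> b) *\<^sub>R L x b)) (at x)"
    by (intro has_derivative_sum bounded_bilinear.FDERIV[OF bounded_bilinear_scaleR]
        bounded_linear.has_derivative[OF bounded_linear_inner_left] has_FD dL df)
  have 2: "((\<lambda>y. \<Sum>b\<in>Basis. (f x \<bullet> b) *\<^sub>R L y b) has_derivative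
      (\<lambda>v. \<Sum>b\<in>Basis. (f x \<bullet> b) *\<^sub>R FD (\<lambda>x. L x b) x v)) (at x)"
    by (intro has_derivative_sum has_derivative_scaleR_right has_FD dL)
  have 3: "((\<lambda>y. L y (f x)) has_derivative
      (\<lambda>v. \<Sum>b\<in>Basis. (f x \<bullet> b) *\<^sub>R FD (\<lambda>x. L x b) x v)) (at x)"
    by (subst has_derivative_cong_open[OF assms(1,2), where g="\<lambda>y. \<Sum>b\<in>Basis. (f x \<bullet> b) *\<^sub>R L y b"])
      (rule linear_basis_sum[OF assms(3)] 2 | assumption)+
  have 4: "((\<lambda>y. L y (f y)) has_derivative
      (\<lambda>v. \<Sum>b\<in>Basis. (f x \<bullet> b) *\<^sub>R FD (\<lambda>x. L x b) x v + (FD f x v \<bullet> b) *\<^sub>R L x b)) (at x)"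
    by (subst has_derivative_cong_open[OF assms(1,2), where g="\<lambda>y. \<Sum>b\<in>Basis. (f y \<bullet> b) *\<^sub>R L y b"])
      (rule linear_basis_sum[OF assms(3)] 1 | assumption)+
  show ?thesis
    using 4 by (simp add: FD_eqI[OF 3] linear_basis_sum[OF assms(3)[OF assms(2)], of "FD f x _"] sum.distrib)
qed

lemma FD_apply:
  fixes L :: "'a::real_normed_vector \<Rightarrow> 'b::euclidean_space \<Rightarrow> 'c::real_normed_vector"
  assumes "open S" "x \<in> S" "\<And>x. x \<in> S \<Longrightarrow> linear (L x)"
    and "\<And>w. (\<lambda>x. L x w) differentiable (at x)" and "f differentiable (at x)"
  shows "FD (\<lambda>x. L x (f x)) x v = FD (\<lambda>y. L y (f x)) x v + L x (FD f x v)"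
  using FD_eqI[OF has_derivative_apply[OF assms]] by simp

text \<open>Differentiation at \<open>x\<close> sees only a neighbourhood of \<open>x\<close>, and
  there additivity and homogeneity of \<open>L y\<close> are identities between functions of
  \<open>y\<close>.\<close>

lemma FD_family_linear:
  fixes L :: "'a::real_normed_vector \<Rightarrow> 'b::euclidean_space \<Rightarrow> 'c::real_normed_vector"
  assumes "open S" "x \<in> S" "\<And>x. x \<in> S \<Longrightarrow> linear (L x)"
    and dL: "\<And>w. (\<lambda>x. L x w) differentiable (at x)"
  shows "linear (\<lambda>w. FD (\<lambda>y. L y w) x v)"
proof (rule linearI)
  fix w w' c
  have "FD (\<lambda>y. L y (w + w')) x = FD (\<lambda>y. L y w + L y w') x"
    by (rule FD_cong_open[OF assms(1,2)]) (simp add: linear_add assms(3))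
  then show "FD (\<lambda>y. L y (w + w')) x v = FD (\<lambda>y. L y w) x v + FD (\<lambda>y. L y w') x v"
    by (simp add: FD_add[OF dL dL])
  have "FD (\<lambda>y. L y (c *\<^sub>R w)) x = FD (\<lambda>y. c *\<^sub>R L y w) x"
    by (rule FD_cong_open[OF assms(1,2)]) (simp add: linear_cmul assms(3))
  then show "FD (\<lambda>y. L y (c *\<^sub>R w)) x v = c *\<^sub>R FD (\<lambda>y. L y w) x v"
    by (simp add: FD_linear_comp[OF bounded_linear_scaleR_right dL])
qed

text \<open>The derivative of a power is a multiple of another power, hence the induction for all
  exponents \<open>r\<close> at once. The exponent -1/2 will turn a conformal frame into an
  orthonormal one.\<close>

lemma smooth_on_powr: "smooth_on {0<..} (\<lambda>x::real. x powr r)"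
  unfolding smooth_on_def
proof (intro allI)
  show "Ck_on k {0<..} (\<lambda>x::real. x powr r)" for k
  proof (induction k arbitrary: r)
    case 0
    show ?case by (auto intro!: continuous_intros)
  next
    case (Suc k)
    have D: "((\<lambda>x. x powr r) has_derivative (\<lambda>v. (r * x powr (r - 1)) * v)) (at x)" if "x > 0" for x :: real
      using has_real_derivative_powr[OF that, of r] by (simp add: has_field_derivative_def)
    have "Ck_on k {0<..} (\<lambda>x. (r * v) * x powr (r - 1))" for v
      by (rule Ck_on_linear[OF bounded_linear_mult_right _ Suc.IH]) simp
    then have "Ck_on k {0<..} (\<lambda>x. FD (\<lambda>x::real. x powr r) x v)" for v
      by (subst Ck_on_cong[of _ _ "\<lambda>x. (r * v) * x powr (r - 1)"]) (auto simp: FD_eqI[OF D])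
    then show ?case using D by (auto simp: differentiable_def)
  qed
qed

text \<open>Since \<open>r\<close> vanishes at \<open>x\<close>, the error
  \<open>r y *\<^sub>R (c y - c x)\<close> is a product of a term of first order and a term tending
  to 0, so continuity of \<open>c\<close> is enough. This breaks the circle in differentiating an
  inverse that is not yet known to be differentiable.\<close>

lemma has_derivative_scaleR_zero:
  fixes r :: "'a::real_normed_vector \<Rightarrow> real"
  assumes "(r has_derivative r') (at x)" "r x = 0" "isCont c x"
  shows "((\<lambda>y. r y *\<^sub>R c y) has_derivative (\<lambda>v. r' v *\<^sub>R c x)) (at x)"
proof -
  have bl: "bounded_linear r'" using assms(1) has_derivative_bounded_linear by blast
  obtain K where K: "K > 0" "\<And>v. norm (r' v) \<le> norm v * K"
    using bounded_linear.pos_bounded[OF bl] by blast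
  have 1: "((\<lambda>y. r y *\<^sub>R (c y - c x)) has_derivative (\<lambda>v. 0)) (at x)"
    unfolding has_derivative_at_alt
  proof (intro conjI allI impI)
    fix e :: real assume e: "e > 0"
    obtain d1 where d1: "d1 > 0" "\<And>y. norm (y - x) < d1 \<Longrightarrow> norm (r y - r x - r' (y - x)) \<le> 1 * norm (y - x)"
      using assms(1) unfolding has_derivative_at_alt by (meson zero_less_one)
    obtain d2 where d2: "d2 > 0" "\<And>y. dist y x < d2 \<Longrightarrow> dist (c y) (c x) < e / (K + 1)"
      using assms(3) e K(1) unfolding continuous_at_eps_delta by (metis add_pos_pos zero_less_divide_iff zero_less_one)
    show "\<exists>d>0. \<forall>y. norm (y - x) < d \<longrightarrow>
        norm (r y *\<^sub>R (c y - c x) - r x *\<^sub>R (c x - c x) - 0) \<le> e * norm (y - x)"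
    proof (intro exI[of _ "min d1 d2"] conjI allI impI)
      fix y assume y: "norm (y - x) < min d1 d2"
      have "norm (r y) \<le> norm (r y - r x - r' (y - x)) + norm (r' (y - x))"
        using assms(2) norm_triangle_sub[of "r y" "r' (y - x)"] by simp
      also have "\<dots> \<le> (K + 1) * norm (y - x)"
        using d1(2)[of y] K(2)[of "y - x"] y by (simp add: algebra_simps)
      finally have a: "norm (r y) \<le> (K + 1) * norm (y - x)" .
      have b: "norm (c y - c x) \<le> e / (K + 1)"
        using d2(2)[of y] y by (simp add: dist_norm less_imp_le)
      have "norm (r y *\<^sub>R (c y - c x)) = norm (r y) * norm (c y - c x)" by simp
      also have "\<dots> \<le> ((K + 1) * norm (y - x)) * (e / (K + 1))"
        using a b K(1) by (intro mult_mono) auto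
      also have "\<dots> = e * norm (y - x)" using K(1) by (simp add: field_simps)
      finally show "norm (r y *\<^sub>R (c y - c x) - r x *\<^sub>R (c x - c x) - 0) \<le> e * norm (y - x)"
        using assms(2) by simp
    qed (use d1 d2 in auto)
  qed auto
  have 2: "((\<lambda>y. r y *\<^sub>R c x) has_derivative (\<lambda>v. r' v *\<^sub>R c x)) (at x)"
    by (intro has_derivative_scaleR_left assms(1))
  show ?thesis
    using has_derivative_add[OF 1 2] by (simp add: algebra_simps)
qed

text \<open>\<open>M\<close> is only assumed to be a pointwise inverse of the smooth family
  \<open>L\<close>; its smoothness is the point of the locale. It is applied to left-invariant
  fields in a chart of a Lie group and to the frame that determines a connection form.\<close>

locale inverse_family =
  fixes S :: "'a::euclidean_space set" and L :: "'a \<Rightarrow> 'b::euclidean_space \<Rightarrow> 'c::euclidean_space"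
    and M :: "'a \<Rightarrow> 'c \<Rightarrow> 'b"
  assumes S: "open S" and lin: "\<And>x. x \<in> S \<Longrightarrow> linear (L x)"
    and sm: "\<And>w. smooth_on S (\<lambda>x. L x w)"
    and M_L: "\<And>x w. x \<in> S \<Longrightarrow> M x (L x w) = w" and L_M: "\<And>x w. x \<in> S \<Longrightarrow> L x (M x w) = w"
begin

lemma M_linear: "x \<in> S \<Longrightarrow> linear (M x)"
proof (rule linearI)
  fix w w' c assume x: "x \<in> S"
  show "M x (w + w') = M x w + M x w'"
    using M_L[OF x, of "M x w + M x w'"] by (simp add: linear_add[OF lin[OF x]] L_M[OF x])
  show "M x (c *\<^sub>R w) = c *\<^sub>R M x w"
    using M_L[OF x, of "c *\<^sub>R M x w"] by (simp add: linear_cmul[OF lin[OF x]] L_M[OF x])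
qed

lemma M_isCont:
  assumes x: "x \<in> S"
  shows "isCont (\<lambda>y. M y w) x"
proof -
  have "bounded_linear (M x)" using M_linear[OF x] linear_conv_bounded_linear by blast
  then obtain K where K: "K > 0" "\<And>v. norm (M x v) \<le> norm v * K"
    using bounded_linear.pos_bounded by blast
  define N where "N y = (\<Sum>b\<in>Basis. norm (L y b - L x b))" for y
  have Nb: "norm (L y a - L x a) \<le> norm a * N y" if "y \<in> S" for y a
    using basis_sum_bound[OF linear_compose_sub[OF lin[OF that] lin[OF x]], of "\<lambda>b. norm (L y b - L x b)" 1 a]
    by (simp add: N_def mult.commute)
  have contL: "isCont (\<lambda>y. L y b) x" for b
    using smooth_on_continuous[OF sm] x S by (simp add: continuous_on_eq_continuous_at)
  have "isCont N x" unfolding N_def by (intro continuous_intros contL)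
  then have N0: "(N \<longlongrightarrow> 0) (at x)" by (simp add: isCont_def N_def)
  \<comment> \<open>The bound 1/(2K) makes the term with \<open>norm a * N y\<close>, after
    multiplication by \<open>K\<close>, at most half of \<open>norm a\<close>, so that it can be
    absorbed on the left.\<close>
  have ev: "\<forall>\<^sub>F y in at x. y \<in> S \<and> N y < 1 / (2 * K)"
    using eventually_at_in_open'[OF S x] order_tendstoD(2)[OF N0, of "1 / (2 * K)"] K(1)
    by (auto elim: eventually_conj)
  have "((\<lambda>y. 2 * K * (norm (M x w) * N y)) \<longlongrightarrow> 2 * K * (norm (M x w) * 0)) (at x)"
    by (intro tendsto_intros N0)
  then have lim: "((\<lambda>y. 2 * K * (norm (M x w) * N y)) \<longlongrightarrow> 0) (at x)" by simp
  have "\<forall>\<^sub>F y in at x. norm (M y w - M x w) \<le> 2 * K * (norm (M x w) * N y)"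
    using ev
  proof eventually_elim
    case (elim y)
    define a where "a = M y w - M x w"
    have y: "y \<in> S" using elim by simp
    \<comment> \<open>Both \<open>L y (M y w)\<close> and \<open>L x (M x w)\<close> equal
      \<open>w\<close>, so the unknown difference of the inverses is traded for a difference of
      values of \<open>L\<close>.\<close>
    have La: "L y a = - (L y (M x w) - L x (M x w))"
      by (simp add: a_def linear_diff[OF lin[OF y]] L_M[OF y] L_M[OF x])
    have "norm a = norm (M x (L x a))" by (simp add: M_L[OF x])
    also have "\<dots> \<le> norm (L x a) * K" by (rule K(2))
    also have "L x a = L y a - (L y a - L x a)" by simp
    also have "norm \<dots> \<le> norm (L y a) + norm (L y a - L x a)" by (rule norm_triangle_ineq4)
    also have "\<dots> \<le> norm (M x w) * N y + norm a * N y"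
      using Nb[OF y, of a] Nb[OF y, of "M x w"] by (simp add: La norm_minus_commute)
    also have "\<dots> \<le> norm (M x w) * N y + norm a * (1 / (2 * K))"
      using elim by (intro add_left_mono mult_left_mono) auto
    finally have "norm a \<le> (norm (M x w) * N y + norm a * (1 / (2 * K))) * K"
      using K(1) by (simp add: mult_right_mono)
    then have "norm a \<le> 2 * K * (norm (M x w) * N y)" using K(1) by (simp add: field_simps)
    then show ?case by (simp add: a_def)
  qed
  then have "((\<lambda>y. norm (M y w - M x w)) \<longlongrightarrow> 0) (at x)"
    by (intro Lim_null_comparison[OF _ lim]) simp
  then show ?thesis
    by (simp add: isCont_def tendsto_norm_zero_iff LIM_zero_iff)
qed

text \<open>From \<open>M y w = M x w - M y (l y)\<close>, where
  \<open>l y = L y (M x w) - L x (M x w)\<close> vanishes at \<open>x\<close>: the components of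
  \<open>l\<close> are the vanishing factors required by \<open>has_derivative_scaleR_zero\<close>,
  and the factors \<open>M y b\<close> are continuous.\<close>

lemma M_has_derivative:
  assumes x: "x \<in> S"
  shows "((\<lambda>y. M y w) has_derivative (\<lambda>v. - M x (FD (\<lambda>y. L y (M x w)) x v))) (at x)"
proof -
  define l where "l y = L y (M x w) - L x (M x w)" for y
  have dl: "(l has_derivative FD (\<lambda>y. L y (M x w)) x) (at x)"
    unfolding l_def using has_derivative_diff[OF smooth_on_has_FD[OF sm x] has_derivative_const] by simp
  have "((\<lambda>y. \<Sum>b\<in>Basis. (l y \<bullet> b) *\<^sub>R M y b) has_derivative
      (\<lambda>v. \<Sum>b\<in>Basis. (FD (\<lambda>y. L y (M x w)) x v \<bullet> b) *\<^sub>R M x b)) (at x)"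
    by (intro has_derivative_sum has_derivative_scaleR_zero M_isCont[OF x]
        bounded_linear.has_derivative[OF bounded_linear_inner_left] dl) (simp add: l_def)
  then have 1: "((\<lambda>y. \<Sum>b\<in>Basis. (l y \<bullet> b) *\<^sub>R M y b) has_derivative
      (\<lambda>v. M x (FD (\<lambda>y. L y (M x w)) x v))) (at x)"
    by (simp add: linear_basis_sum[OF M_linear[OF x], symmetric])
  have 2: "M y w = M x w - (\<Sum>b\<in>Basis. (l y \<bullet> b) *\<^sub>R M y b)" if y: "y \<in> S" for y
  proof -
    have "(\<Sum>b\<in>Basis. (l y \<bullet> b) *\<^sub>R M y b) = M y (l y)"
      by (simp add: linear_basis_sum[OF M_linear[OF y], symmetric])
    also have "\<dots> = M x w - M y w"
      by (simp add: l_def linear_diff[OF M_linear[OF y]] M_L[OF y] L_M[OF x])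
    finally show ?thesis by simp
  qed
  show ?thesis
    by (subst has_derivative_cong_open[OF S x 2], assumption)
      (use has_derivative_diff[OF has_derivative_const 1] in simp)
qed

text \<open>Bootstrapping: the derivative is expressed by \<open>M\<close> itself and the smooth
  family \<open>L\<close>, so each degree of differentiability of \<open>M\<close> yields the next
  one.\<close>

lemma smooth_inverse: "smooth_on S (\<lambda>x. M x w)"
  unfolding smooth_on_def
proof (intro allI)
  show "Ck_on k S (\<lambda>x. M x w)" for k
  proof (induction k arbitrary: w)
    case 0
    then show ?case using M_isCont by (simp add: continuous_at_imp_continuous_on)
  next
    case (Suc k)
    have dL: "(\<lambda>y. L y a) differentiable (at x)" if "x \<in> S" for x a
      using sm that by (rule smooth_on_differentiable)
    have "Ck_on k S (\<lambda>x. - M x (FD (\<lambda>y. L y (M x w)) x v))" for v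
    proof (intro Ck_on_linear[OF bounded_linear_minus[OF bounded_linear_ident] S] Ck_on_apply[OF S M_linear Suc.IH])
      show "Ck_on k S (\<lambda>x. FD (\<lambda>y. L y (M x w)) x v)"
        by (intro Ck_on_apply[OF S FD_family_linear[OF S _ lin dL] _ Suc.IH] smooth_on_Ck smooth_on_FD sm)
    qed
    then have "Ck_on k S (\<lambda>x. FD (\<lambda>y. M y w) x v)" for v
      by (subst Ck_on_cong[OF S]) (auto simp: FD_eqI[OF M_has_derivative])
    then show ?case using M_has_derivative by (auto simp: differentiable_def)
  qed
qed

end

text \<open>On a small parallelogram, \<open>f (p s t) - f (p 0 t)\<close> is the integral of the
  derivative in direction \<open>u\<close>. Differentiating it in \<open>t\<close> at 0, under the
  integral sign, and then in \<open>s\<close> at 0 produces the two mixed derivatives.\<close>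

lemma second_derivative_symmetric:
  fixes f :: "'a::real_normed_vector \<Rightarrow> 'b::euclidean_space"
  assumes S: "open S" "smooth_on S f" "x \<in> S"
  shows "FD (\<lambda>y. FD f y u) x v = FD (\<lambda>y. FD f y v) x u"
proof -
  define p where "p s t = x + s *\<^sub>R u + t *\<^sub>R v" for s t :: real
  have "open ((\<lambda>q. p (fst q) (snd q)) -` S)"
    unfolding p_def by (intro open_vimage S(1) continuous_intros)
  moreover have "(0, 0) \<in> (\<lambda>q. p (fst q) (snd q)) -` S" using S(3) by (simp add: p_def)
  ultimately obtain e where e: "e > 0" "ball (0, 0) e \<subseteq> (\<lambda>q. p (fst q) (snd q)) -` S"
    using open_contains_ball by blast
  \<comment> \<open>The norm of a pair is at most the sum of the norms, and 2h < e.\<close>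
  define h where "h = e / 3"
  have h: "h > 0" using e(1) by (simp add: h_def)
  have pS: "p s t \<in> S" if "s \<in> {0..h}" "t \<in> {0..h}" for s t
  proof -
    have "norm (s, t) < e" using norm_Pair_le[of s t] that e(1) by (auto simp: h_def)
    then have "(s, t) \<in> ball (0, 0) e" by (simp add: zero_prod_def[symmetric])
    then show ?thesis using e(2) by auto
  qed
  have line: "((\<lambda>s. F (p s t)) has_vector_derivative FD F (p s t) u) (at s within A)"
    "((\<lambda>t. F (p s t)) has_vector_derivative FD F (p s t) v) (at t within A)"
    if F: "smooth_on S F" "p s t \<in> S" for F :: "'a \<Rightarrow> 'b" and s t A
  proof -
    have d: "((\<lambda>s. p s t) has_vector_derivative u) (at s within A)" "((\<lambda>t. p s t) has_vector_derivative v) (at t within A)"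
      unfolding p_def by (auto intro!: derivative_eq_intros)
    show "((\<lambda>s. F (p s t)) has_vector_derivative FD F (p s t) u) (at s within A)"
      "((\<lambda>t. F (p s t)) has_vector_derivative FD F (p s t) v) (at t within A)"
      using d[THEN vector_derivative_diff_chain_within, OF has_derivative_at_withinI[OF smooth_on_has_FD[OF F]]]
      by (simp_all add: o_def)
  qed
  have cont: "continuous_on T (\<lambda>q. F (p (k1 q) (k2 q)))"
    if "smooth_on S F" "continuous_on T k1" "continuous_on T k2" "k1 ` T \<subseteq> {0..h}" "k2 ` T \<subseteq> {0..h}"
    for F :: "'a \<Rightarrow> 'b" and T :: "'z::topological_space set" and k1 k2
    by (rule continuous_on_compose2[OF smooth_on_continuous[OF that(1)]])
      (use that pS in \<open>auto simp: p_def image_subset_iff intro!: continuous_intros\<close>)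
  note Du = smooth_on_FD[OF S(2), of u] and Dv = smooth_on_FD[OF S(2), of v]
  \<comment> \<open>The derivative at t = 0 of the fundamental theorem along \<open>s\<close>.
    Derivatives within \<open>{0..h}\<close> are one-sided there, which still determines them
    uniquely.\<close>
  have *: "FD f (p s 0) v - FD f (p 0 0) v = integral {0..s} (\<lambda>\<sigma>. FD (\<lambda>y. FD f y u) (p \<sigma> 0) v)" if s: "s \<in> {0..h}" for s
  proof -
    have i: "((\<lambda>\<sigma>. FD f (p \<sigma> t) u) has_integral f (p s t) - f (p 0 t)) {0..s}" if t: "t \<in> {0..h}" for t
      by (rule fundamental_theorem_of_calculus) (use s t in \<open>auto intro!: line(1)[OF S(2)] pS\<close>)
    have "((\<lambda>t. integral (cbox 0 s) (\<lambda>\<sigma>. FD f (p \<sigma> t) u)) has_vector_derivative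
        integral (cbox 0 s) (\<lambda>\<sigma>. FD (\<lambda>y. FD f y u) (p \<sigma> 0) v)) (at 0 within {0..h})"
    proof (rule leibniz_rule_vector_derivative)
      show "((\<lambda>t. FD f (p \<sigma> t) u) has_vector_derivative FD (\<lambda>y. FD f y u) (p \<sigma> t) v) (at t within {0..h})"
        if "t \<in> {0..h}" "\<sigma> \<in> cbox 0 s" for t \<sigma> by (rule line(2)[OF Du pS]) (use that s in auto)
      show "(\<lambda>\<sigma>. FD f (p \<sigma> t) u) integrable_on cbox 0 s" if "t \<in> {0..h}" for t
        using i[OF that] by (auto simp: integrable_on_def)
      have "continuous_on ({0..h} \<times> cbox 0 s) (\<lambda>q. FD (\<lambda>y. FD f y u) (p (snd q) (fst q)) v)"
        by (rule cont[OF smooth_on_FD[OF Du]]) (use s in \<open>auto intro!: continuous_intros\<close>)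
      then show "continuous_on ({0..h} \<times> cbox 0 s) (\<lambda>(t, \<sigma>). FD (\<lambda>y. FD f y u) (p \<sigma> t) v)"
        by (simp add: case_prod_unfold)
    qed (use h in auto)
    moreover have "((\<lambda>t. integral (cbox 0 s) (\<lambda>\<sigma>. FD f (p \<sigma> t) u)) has_vector_derivative
        FD f (p s 0) v - FD f (p 0 0) v) (at 0 within {0..h})"
    proof (rule has_vector_derivative_transform)
      show "((\<lambda>t. f (p s t) - f (p 0 t)) has_vector_derivative FD f (p s 0) v - FD f (p 0 0) v) (at 0 within {0..h})"
        by (intro has_vector_derivative_diff line(2)[OF S(2)] pS) (use s h in auto)
    qed (use i integral_unique h in auto)
    ultimately show ?thesis
      using h by (auto intro!: vector_derivative_unique_within_closed_interval[of 0 h 0])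
  qed
  have "((\<lambda>s. integral {0..s} (\<lambda>\<sigma>. FD (\<lambda>y. FD f y u) (p \<sigma> 0) v)) has_vector_derivative FD (\<lambda>y. FD f y u) (p 0 0) v) (at 0 within {0..h})"
    by (rule integral_has_vector_derivative, rule cont[OF smooth_on_FD[OF Du]]) (use h in \<open>auto intro!: continuous_intros\<close>)
  moreover have "((\<lambda>s. integral {0..s} (\<lambda>\<sigma>. FD (\<lambda>y. FD f y u) (p \<sigma> 0) v)) has_vector_derivative FD (\<lambda>y. FD f y v) (p 0 0) u) (at 0 within {0..h})"
  proof (rule has_vector_derivative_transform)
    show "((\<lambda>s. FD f (p s 0) v - FD f (p 0 0) v) has_vector_derivative FD (\<lambda>y. FD f y v) (p 0 0) u) (at 0 within {0..h})"
      using has_vector_derivative_diff[OF line(1)[OF Dv pS] has_vector_derivative_const, of 0 0] h by simp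
  qed (use * h in auto)
  ultimately have "FD (\<lambda>y. FD f y u) (p 0 0) v = FD (\<lambda>y. FD f y v) (p 0 0) u"
    using h by (auto intro!: vector_derivative_unique_within_closed_interval[of 0 h 0])
  then show ?thesis by (simp add: p_def)
qed

section \<open>Smooth maps between manifolds\<close>

text \<open>Euclidean space as a manifold. With it, \<^const>\<open>chart_coord\<close> and \<^const>\<open>chart_vec\<close> become instances
  of \<^const>\<open>tmap\<close>, so that one chain rule covers all changes of coordinates.\<close>

definition eucl :: "('e, 'e::euclidean_space) atlas" where
  "eucl = {(UNIV, id)}"

lemma points_eucl [simp]: "points eucl = UNIV"
  by (simp add: points_def eucl_def)

lemma open_in_eucl [simp]: "open_in eucl U \<longleftrightarrow> open U"
  by (simp add: open_in_def)

lemma eucl_chart: "(UNIV, id) \<in> eucl"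
  by (simp add: eucl_def)

lemma chart_inv_eucl [simp]: "chart_inv (UNIV, id) = (\<lambda>x. x)"
  by (simp add: chart_inv_def id_def)

lemma pref_eucl [simp]: "pref eucl p = (UNIV, id)"
  unfolding pref_def eucl_def by (rule some_equality) auto

lemma pref_pt_eucl [simp]: "pref_pt eucl p = p"
  by (simp add: pref_pt_def)

lemma mf_eucl [simp]: "manifold (eucl :: ('e, 'e::euclidean_space) atlas)"
proof -
  have "smooth_on UNIV (\<lambda>x :: 'e. x)"
    by (simp add: smooth_on_id)
  then show ?thesis
    by (auto simp: manifold_def eucl_def open_in_def points_def homeomorphism_def o_def)
qed

lemma open_in_points [simp]: "open_in A (points A)"
  by (simp add: open_in_def)

lemma open_in_subset: "open_in A U \<Longrightarrow> U \<subseteq> points A"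
  by (simp add: open_in_def openin_imp_subset)

lemma open_in_mem: "open_in A U \<Longrightarrow> p \<in> U \<Longrightarrow> p \<in> points A"
  using open_in_subset by auto

lemma open_in_Int: "open_in A U \<Longrightarrow> open_in A V \<Longrightarrow> open_in A (U \<inter> V)"
  by (simp add: open_in_def openin_Int)

lemma open_in_vimage:
  assumes "open_in A U" "continuous_on U f" "f ` U \<subseteq> points B" "open_in B V"
  shows "open_in A {p \<in> U. f p \<in> V}"
proof -
  have "openin (top_of_set U) (U \<inter> f -` V)"
    by (rule continuous_openin_preimage[OF assms(2), of "points B"]) (use assms(3,4) in \<open>simp_all add: open_in_def image_subset_iff_funcset\<close>)
  then have "openin (top_of_set (points A)) (U \<inter> f -` V)"
    by (rule openin_trans) (use assms(1) in \<open>simp add: open_in_def\<close>)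
  moreover have "{p \<in> U. f p \<in> V} = U \<inter> f -` V" by auto
  ultimately show ?thesis by (simp add: open_in_def)
qed

lemma open_in_local:
  assumes "\<And>p. p \<in> U \<Longrightarrow> \<exists>V. p \<in> V \<and> open_in A V \<and> V \<subseteq> U"
  shows "open_in A U"
  unfolding open_in_def by (subst openin_subopen) (use assms in \<open>auto simp: open_in_def\<close>)

lemma pref_in:
  assumes "p \<in> points A"
  shows "pref A p \<in> A" "p \<in> fst (pref A p)"
proof -
  have "\<exists>c. c \<in> A \<and> p \<in> fst c" using assms by (auto simp: points_def)
  from someI_ex[OF this] show "pref A p \<in> A" "p \<in> fst (pref A p)" by (auto simp: pref_def)
qed

section \<open>Charts of a single manifold\<close>

context
  fixes A and c
  assumes A: "manifold A" and c: "c \<in> A"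
begin

lemma chart_open: "open_in A (fst c)"
  and chart_image_open: "open (snd c ` fst c)"
  and chart_homeo: "homeomorphism (fst c) (snd c ` fst c) (snd c) (chart_inv c)"
  using A c by (auto simp: manifold_def)

lemma chart_subset: "fst c \<subseteq> points A"
  using c by (auto simp: points_def)

lemma chart_inv_snd [simp]: "p \<in> fst c \<Longrightarrow> chart_inv c (snd c p) = p"
  using chart_homeo by (auto simp: homeomorphism_def)

lemma snd_chart_inv: "x \<in> snd c ` fst c \<Longrightarrow> snd c (chart_inv c x) = x"
  and chart_inv_in: "x \<in> snd c ` fst c \<Longrightarrow> chart_inv c x \<in> fst c"
  using chart_homeo by (auto simp: homeomorphism_def)

lemma open_chart_image:
  assumes "open_in A U"
  shows "open (snd c ` (U \<inter> fst c))"
proof -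
  have "openin (top_of_set (fst c)) (U \<inter> fst c)"
  proof -
    obtain T where T: "open T" "U = points A \<inter> T"
      using assms by (auto simp: open_in_def openin_open)
    then have "U \<inter> fst c = fst c \<inter> T" using chart_subset by auto
    then show ?thesis using T(1) by (auto simp: openin_open)
  qed
  then have "openin (top_of_set (snd c ` fst c)) (snd c ` (U \<inter> fst c))"
    using homeomorphism_imp_open_map[OF chart_homeo] by simp
  then show ?thesis using chart_image_open openin_open_trans by blast
qed

lemma open_chart_image': "open_in A U \<Longrightarrow> U \<subseteq> fst c \<Longrightarrow> open (snd c ` U)"
  using open_chart_image[of U] by (simp add: inf.absorb1)

lemma continuous_chart: "continuous_on (fst c) (snd c)"
  and continuous_chart_inv: "continuous_on (snd c ` fst c) (chart_inv c)"
  using chart_homeo by (auto simp: homeomorphism_def)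

lemma chart_transition:
  "d \<in> A \<Longrightarrow> smooth_on (snd c ` (fst c \<inter> fst d)) (\<lambda>x. snd d (chart_inv c x))"
  using A c by (auto simp: manifold_def o_def)

end

text \<open>One pair of charts around each point is enough: transition maps carry smoothness to
  every other pair, and continuity follows because charts are homeomorphisms. As
  \<open>smooth_map\<close> quantifies over all charts, this is the usual way to establish
  it.\<close>

lemma smap_local:
  assumes A: "manifold A" and B: "manifold B"
    and loc: "\<And>p. p \<in> U \<Longrightarrow> \<exists>V c d. p \<in> V \<and> open_in A V \<and> V \<subseteq> U \<and> c \<in> A \<and> d \<in> B \<and> V \<subseteq> fst c \<and>
      f ` V \<subseteq> fst d \<and> smooth_on (snd c ` V) (\<lambda>x. snd d (f (chart_inv c x)))"
  shows "smooth_map A B U f"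
proof -
  have U: "open_in A U" by (rule open_in_local) (use loc in blast)
  have fU: "f ` U \<subseteq> points B"
    using loc chart_subset[OF B] by (fastforce simp: image_subset_iff)
  have cont: "continuous_on U f"
    unfolding continuous_on_eq_continuous_within
  proof
    fix p assume p: "p \<in> U"
    obtain V c d where V: "p \<in> V" "open_in A V" "V \<subseteq> U" "c \<in> A" "d \<in> B" "V \<subseteq> fst c"
      "f ` V \<subseteq> fst d" "smooth_on (snd c ` V) (\<lambda>x. snd d (f (chart_inv c x)))"
      using loc[OF p] by blast
    have "continuous_on V (\<lambda>q. chart_inv d (snd d (f (chart_inv c (snd c q)))))"
    proof (rule continuous_on_compose2[OF continuous_chart_inv[OF B V(5)]])
      show "continuous_on V (\<lambda>q. snd d (f (chart_inv c (snd c q))))"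
        by (rule continuous_on_compose2[OF smooth_on_continuous[OF V(8)]
              continuous_on_subset[OF continuous_chart[OF A V(4)] V(6)]]) simp
      show "(\<lambda>q. snd d (f (chart_inv c (snd c q)))) ` V \<subseteq> snd d ` fst d"
        using V(6,7) chart_inv_snd[OF A V(4)] by (auto simp: subset_iff)
    qed
    then have "continuous_on V f"
      by (rule continuous_on_eq) (use V in \<open>auto simp: subset_iff chart_inv_snd[OF A V(4)] chart_inv_snd[OF B V(5)]\<close>)
    moreover obtain T where T: "open T" "V = points A \<inter> T"
      using V(2) by (auto simp: open_in_def openin_open)
    moreover have "at p within U = at p within V"
      by (rule at_within_nhd[of p T]) (use T V U open_in_subset in blast)+
    ultimately show "continuous (at p within U) f"
      using V(1) by (simp add: continuous_on_eq_continuous_within)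
  qed
  have "smooth_on (snd c' ` (U \<inter> fst c' \<inter> f -` fst d')) (snd d' \<circ> f \<circ> chart_inv c')"
    if c': "c' \<in> A" and d': "d' \<in> B" for c' d'
  proof (rule smooth_on_local)
    fix x assume "x \<in> snd c' ` (U \<inter> fst c' \<inter> f -` fst d')"
    then obtain p where p: "x = snd c' p" "p \<in> U" "p \<in> fst c'" "f p \<in> fst d'" by auto
    obtain V c d where V: "p \<in> V" "open_in A V" "V \<subseteq> U" "c \<in> A" "d \<in> B" "V \<subseteq> fst c"
      "f ` V \<subseteq> fst d" "smooth_on (snd c ` V) (\<lambda>x. snd d (f (chart_inv c x)))"
      using loc[OF p(2)] by blast
    \<comment> \<open>On \<open>W\<close> both source charts and both target charts are available,
      so the representation in \<open>c'\<close>, \<open>d'\<close> is the one in \<open>c\<close>,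
      \<open>d\<close> composed with two transition maps.\<close>
    define W where "W = {q \<in> U. f q \<in> fst d'} \<inter> V \<inter> fst c'"
    have W: "open_in A W" unfolding W_def
      by (intro open_in_Int open_in_vimage[OF U cont fU] chart_open[OF B d'] V(2) chart_open[OF A c'])
    have Wc': "W \<subseteq> fst c'" by (auto simp: W_def)
    have o1: "open (snd c' ` W)" by (rule open_chart_image'[OF A c' W Wc'])
    have o2: "open (snd c ` V)" by (rule open_chart_image'[OF A V(4,2,6)])
    have o3: "open (snd d ` (fst d \<inter> fst d'))"
      using open_chart_image[OF B V(5) chart_open[OF B d']] by (simp add: Int_commute)
    have t1: "smooth_on (snd c' ` W) (\<lambda>x. snd c (chart_inv c' x))"
      by (rule smooth_on_subset[OF chart_transition[OF A c' V(4)]]) (use V(6) in \<open>auto simp: W_def\<close>)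
    have "smooth_on (snd c' ` W) (\<lambda>x. snd d (f (chart_inv c (snd c (chart_inv c' x)))))"
      by (rule smooth_on_compose[OF o1 o2 t1 V(8)]) (auto simp: W_def chart_inv_snd[OF A c'])
    then have t2: "smooth_on (snd c' ` W) (\<lambda>x. snd d (f (chart_inv c' x)))"
      by (subst (asm) smooth_on_cong[OF o1, of _ "\<lambda>x. snd d (f (chart_inv c' x))"])
        (use V(6) in \<open>auto simp: W_def chart_inv_snd[OF A c'] chart_inv_snd[OF A V(4)] subset_iff\<close>)
    have "smooth_on (snd c' ` W) (\<lambda>x. snd d' (chart_inv d (snd d (f (chart_inv c' x)))))"
      by (rule smooth_on_compose[OF o1 o3 t2 chart_transition[OF B V(5) d']])
        (use V(7) in \<open>auto simp: W_def chart_inv_snd[OF A c']\<close>)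
    then have "smooth_on (snd c' ` W) (snd d' \<circ> f \<circ> chart_inv c')"
      by (subst (asm) smooth_on_cong[OF o1, of _ "snd d' \<circ> f \<circ> chart_inv c'"])
        (use V(7) in \<open>auto simp: W_def chart_inv_snd[OF A c'] chart_inv_snd[OF B V(5)] image_subset_iff\<close>)
    then show "\<exists>T. open T \<and> x \<in> T \<and> smooth_on T (snd d' \<circ> f \<circ> chart_inv c')"
      using o1 p V(1) by (intro exI[of _ "snd c' ` W"]) (auto simp: W_def)
  qed
  then show ?thesis using U fU cont by (auto simp: smooth_map_def)
qed

lemma smap_open: "smooth_map A B U f \<Longrightarrow> open_in A U"
  and smap_image: "smooth_map A B U f \<Longrightarrow> f ` U \<subseteq> points B"
  and smap_continuous: "smooth_map A B U f \<Longrightarrow> continuous_on U f"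
  by (auto simp: smooth_map_def)

lemma smap_in: "smooth_map A B U f \<Longrightarrow> p \<in> U \<Longrightarrow> f p \<in> points B"
  and smap_dom: "smooth_map A B U f \<Longrightarrow> p \<in> U \<Longrightarrow> p \<in> points A"
  using smap_image[of A B U f] open_in_mem[OF smap_open, of A B U f p] by auto

lemma smap_vimage: "smooth_map A B U f \<Longrightarrow> open_in B V \<Longrightarrow> open_in A {p \<in> U. f p \<in> V}"
  by (rule open_in_vimage[of A U f B V]) (auto simp: smooth_map_def)

lemma smooth_mapD:
  "smooth_map A B U f \<Longrightarrow> c \<in> A \<Longrightarrow> d \<in> B \<Longrightarrow>
    smooth_on (snd c ` (U \<inter> fst c \<inter> f -` fst d)) (\<lambda>x. snd d (f (chart_inv c x)))"
  by (auto simp: smooth_map_def o_def)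

context
  fixes A and B
  assumes A: "manifold A" and B: "manifold B"
begin

lemma smap_chartwise:
  assumes f: "smooth_map A B U f" and p: "p \<in> U"
    and c: "c \<in> A" "p \<in> fst c" and d: "d \<in> B" "f p \<in> fst d"
  obtains V where "p \<in> V" "open_in A V" "V \<subseteq> U" "V \<subseteq> fst c" "f ` V \<subseteq> fst d"
    "open (snd c ` V)" "smooth_on (snd c ` V) (\<lambda>x. snd d (f (chart_inv c x)))"
proof
  let ?V = "{p \<in> U. f p \<in> fst d} \<inter> fst c"
  show V: "open_in A ?V"
    by (intro open_in_Int smap_vimage[OF f] chart_open[OF B d(1)] chart_open[OF A c(1)])
  show "open (snd c ` ?V)" by (rule open_chart_image'[OF A c(1) V]) auto
  show "smooth_on (snd c ` ?V) (\<lambda>x. snd d (f (chart_inv c x)))"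
    by (rule smooth_on_subset[OF smooth_mapD[OF f c(1) d(1)]]) auto
qed (use p c d in auto)

lemma smap_locally:
  assumes "\<And>p. p \<in> U \<Longrightarrow> \<exists>V. p \<in> V \<and> V \<subseteq> U \<and> smooth_map A B V f"
  shows "smooth_map A B U f"
proof (rule smap_local[OF A B])
  fix p assume p: "p \<in> U"
  obtain V where V: "p \<in> V" "V \<subseteq> U" "smooth_map A B V f" using assms[OF p] by blast
  let ?c = "pref A p" and ?d = "pref B (f p)"
  have c: "?c \<in> A" "p \<in> fst ?c" using pref_in[OF smap_dom[OF V(3,1)]] by auto
  have d: "?d \<in> B" "f p \<in> fst ?d" using pref_in[OF smap_in[OF V(3,1)]] by auto
  obtain W where "p \<in> W" "open_in A W" "W \<subseteq> V" "W \<subseteq> fst ?c" "f ` W \<subseteq> fst ?d"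
    "open (snd ?c ` W)" "smooth_on (snd ?c ` W) (\<lambda>x. snd ?d (f (chart_inv ?c x)))"
    using smap_chartwise[OF V(3,1) c d] .
  then show "\<exists>V c d. p \<in> V \<and> open_in A V \<and> V \<subseteq> U \<and> c \<in> A \<and> d \<in> B \<and> V \<subseteq> fst c \<and>
      f ` V \<subseteq> fst d \<and> smooth_on (snd c ` V) (\<lambda>x. snd d (f (chart_inv c x)))"
    using c d V(2) by (intro exI[of _ W] exI[of _ ?c] exI[of _ ?d]) auto
qed

lemma smap_subset:
  assumes f: "smooth_map A B U f" and "open_in A V" "V \<subseteq> U"
  shows "smooth_map A B V f"
proof -
  have "smooth_on (snd c ` (V \<inter> fst c \<inter> f -` fst d)) (snd d \<circ> f \<circ> chart_inv c)"
    if "c \<in> A" "d \<in> B" for c d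
    by (rule smooth_on_subset) (use assms that in \<open>auto simp: smooth_map_def\<close>)
  then show ?thesis
    using assms(2) order_trans[OF image_mono[OF assms(3)] smap_image[OF f]]
      continuous_on_subset[OF smap_continuous[OF f] assms(3)]
    by (auto simp: smooth_map_def)
qed

lemma smap_cong:
  assumes f: "smooth_map A B U f" and eq: "\<And>p. p \<in> U \<Longrightarrow> f p = g p"
  shows "smooth_map A B U g"
proof (rule smap_local[OF A B])
  fix p assume p: "p \<in> U"
  let ?c = "pref A p" and ?d = "pref B (f p)"
  have c: "?c \<in> A" "p \<in> fst ?c" using pref_in[OF smap_dom[OF f p]] by auto
  have d: "?d \<in> B" "f p \<in> fst ?d" using pref_in[OF smap_in[OF f p]] by auto
  obtain W where W: "p \<in> W" "open_in A W" "W \<subseteq> U" "W \<subseteq> fst ?c" "f ` W \<subseteq> fst ?d"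
    "open (snd ?c ` W)" "smooth_on (snd ?c ` W) (\<lambda>x. snd ?d (f (chart_inv ?c x)))"
    using smap_chartwise[OF f p c d] .
  have "smooth_on (snd ?c ` W) (\<lambda>x. snd ?d (g (chart_inv ?c x)))"
    by (subst smooth_on_cong[OF W(6), of _ "\<lambda>x. snd ?d (f (chart_inv ?c x))"])
      (use W eq c in \<open>auto simp: chart_inv_snd[OF A c(1)] subset_iff\<close>)
  then show "\<exists>V c d. p \<in> V \<and> open_in A V \<and> V \<subseteq> U \<and> c \<in> A \<and> d \<in> B \<and> V \<subseteq> fst c \<and>
      g ` V \<subseteq> fst d \<and> smooth_on (snd c ` V) (\<lambda>x. snd d (g (chart_inv c x)))"
    using c d W eq by (intro exI[of _ W] exI[of _ ?c] exI[of _ ?d]) (auto simp: image_subset_iff subset_iff)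
qed

lemma local_rep_differentiable:
  assumes f: "smooth_map A B U f" and p: "p \<in> U"
  shows "(\<lambda>x. snd (pref B (f p)) (f (chart_inv (pref A p) x))) differentiable (at (pref_pt A p))"
proof -
  let ?c = "pref A p" and ?d = "pref B (f p)"
  have c: "?c \<in> A" "p \<in> fst ?c" using pref_in[OF smap_dom[OF f p]] by auto
  have d: "?d \<in> B" "f p \<in> fst ?d" using pref_in[OF smap_in[OF f p]] by auto
  obtain W where W: "p \<in> W" "open_in A W" "W \<subseteq> U" "W \<subseteq> fst ?c" "f ` W \<subseteq> fst ?d"
    "open (snd ?c ` W)" "smooth_on (snd ?c ` W) (\<lambda>x. snd ?d (f (chart_inv ?c x)))"
    using smap_chartwise[OF f p c d] .
  show ?thesis
    by (rule smooth_on_differentiable[OF W(7)]) (use W(1) in \<open>auto simp: pref_pt_def\<close>)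
qed

lemma tmap_linear: "smooth_map A B U f \<Longrightarrow> p \<in> U \<Longrightarrow> linear (tmap A B f p)"
  using FD_linear[OF local_rep_differentiable] by (simp add: tmap_def o_def)

lemma tmap_cong:
  assumes "open_in A U" "p \<in> U" "\<And>q. q \<in> U \<Longrightarrow> f q = g q"
  shows "tmap A B f p = tmap A B g p"
proof -
  let ?c = "pref A p"
  have c: "?c \<in> A" "p \<in> fst ?c" using pref_in[OF open_in_mem[OF assms(1,2)]] by auto
  have "open (snd ?c ` (U \<inter> fst ?c))" by (rule open_chart_image[OF A c(1) assms(1)])
  then show ?thesis
    unfolding tmap_def assms(3)[OF assms(2)]
    by (rule FD_cong_open) (use assms c in \<open>auto simp: pref_pt_def chart_inv_snd[OF A c(1)]\<close>)
qed

lemma smap_const: "open_in A U \<Longrightarrow> b \<in> points B \<Longrightarrow> smooth_map A B U (\<lambda>p. b)"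
proof (rule smap_local[OF A B])
  fix p assume U: "open_in A U" "b \<in> points B" "p \<in> U"
  let ?c = "pref A p" and ?V = "U \<inter> fst (pref A p)"
  have c: "?c \<in> A" "p \<in> fst ?c" using pref_in[OF open_in_mem[OF U(1,3)]] by auto
  have V: "open_in A ?V" by (intro open_in_Int U chart_open[OF A c(1)])
  show "\<exists>V c d. p \<in> V \<and> open_in A V \<and> V \<subseteq> U \<and> c \<in> A \<and> d \<in> B \<and> V \<subseteq> fst c \<and>
      (\<lambda>p. b) ` V \<subseteq> fst d \<and> smooth_on (snd c ` V) (\<lambda>x. snd d b)"
    using c U V pref_in[OF U(2)] open_chart_image'[OF A c(1) V]
    by (intro exI[of _ ?V] exI[of _ ?c] exI[of _ "pref B b"]) (auto intro: smooth_on_const)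
qed

lemma tmap_const: "p \<in> points A \<Longrightarrow> tmap A B (\<lambda>q. b) p = (\<lambda>v. 0)"
  by (simp add: tmap_def o_def)

end

text \<open>The tangent map of \<open>f\<close> is measured in the preferred chart at
  \<open>f p\<close>, the very chart from which the tangent map of \<open>g\<close> starts, so the
  Euclidean chain rule applies without transition factors. Both claims share the same shrunken chart
  domain.\<close>

lemma smap_compose:
  assumes A: "manifold A" and B: "manifold B" and C: "manifold C"
    and f: "smooth_map A B U f" and g: "smooth_map B C V g" and fU: "f ` U \<subseteq> V"
  shows smooth_compose: "smooth_map A C U (\<lambda>p. g (f p))"
    and tmap_compose: "p \<in> U \<Longrightarrow> tmap A C (\<lambda>p. g (f p)) p v = tmap B C g (f p) (tmap A B f p v)"
proof -
  have *: "\<exists>W. p \<in> W \<and> open_in A W \<and> W \<subseteq> U \<and> W \<subseteq> fst (pref A p) \<and> (\<lambda>p. g (f p)) ` W \<subseteq> fst (pref C (g (f p))) \<and>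
     smooth_on (snd (pref A p) ` W) (\<lambda>x. snd (pref C (g (f p))) (g (f (chart_inv (pref A p) x)))) \<and>
     tmap A C (\<lambda>p. g (f p)) p v = tmap B C g (f p) (tmap A B f p v)"
    if p: "p \<in> U" for p v
  proof -
    have q: "f p \<in> V" using fU p by auto
    let ?c = "pref A p" and ?d = "pref B (f p)" and ?e = "pref C (g (f p))"
    have c: "?c \<in> A" "p \<in> fst ?c" using pref_in[OF smap_dom[OF f p]] by auto
    have d: "?d \<in> B" "f p \<in> fst ?d" using pref_in[OF smap_in[OF f p]] by auto
    have e: "?e \<in> C" "g (f p) \<in> fst ?e" using pref_in[OF smap_in[OF g q]] by auto
    obtain W1 where W1: "p \<in> W1" "open_in A W1" "W1 \<subseteq> U" "W1 \<subseteq> fst ?c" "f ` W1 \<subseteq> fst ?d"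
      "open (snd ?c ` W1)" "smooth_on (snd ?c ` W1) (\<lambda>x. snd ?d (f (chart_inv ?c x)))"
      using smap_chartwise[OF A B f p c d] .
    obtain W2 where W2: "f p \<in> W2" "open_in B W2" "W2 \<subseteq> V" "W2 \<subseteq> fst ?d" "g ` W2 \<subseteq> fst ?e"
      "open (snd ?d ` W2)" "smooth_on (snd ?d ` W2) (\<lambda>x. snd ?e (g (chart_inv ?d x)))"
      using smap_chartwise[OF B C g q d e] .
    define W where "W = {q \<in> U. f q \<in> W2} \<inter> W1"
    have W: "open_in A W" unfolding W_def by (intro open_in_Int smap_vimage[OF f] W1 W2)
    have Wc: "W \<subseteq> fst ?c" using W1 by (auto simp: W_def)
    have oW: "open (snd ?c ` W)" by (rule open_chart_image'[OF A c(1) W Wc])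
    have s1: "smooth_on (snd ?c ` W) (\<lambda>x. snd ?d (f (chart_inv ?c x)))"
      by (rule smooth_on_subset[OF W1(7)]) (auto simp: W_def)
    have eq: "snd ?e (g (chart_inv ?d (snd ?d (f (chart_inv ?c x))))) = snd ?e (g (f (chart_inv ?c x)))"
      if "x \<in> snd ?c ` W" for x
      using that Wc W2(4) by (auto simp: W_def chart_inv_snd[OF A c(1)] chart_inv_snd[OF B d(1)] subset_iff)
    have "smooth_on (snd ?c ` W) (\<lambda>x. snd ?e (g (chart_inv ?d (snd ?d (f (chart_inv ?c x))))))"
      by (rule smooth_on_compose[OF oW W2(6) s1 W2(7)]) (use Wc in \<open>auto simp: W_def chart_inv_snd[OF A c(1)] subset_iff\<close>)
    then have s2: "smooth_on (snd ?c ` W) (\<lambda>x. snd ?e (g (f (chart_inv ?c x))))"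
      using smooth_on_cong[OF oW, of "\<lambda>x. snd ?e (g (chart_inv ?d (snd ?d (f (chart_inv ?c x)))))"
        "\<lambda>x. snd ?e (g (f (chart_inv ?c x)))"] eq by simp
    have pW: "p \<in> W" using p W1 W2 by (auto simp: W_def)
    have "tmap A C (\<lambda>p. g (f p)) p v = FD (\<lambda>x. snd ?e (g (chart_inv ?d (snd ?d (f (chart_inv ?c x)))))) (pref_pt A p) v"
      unfolding tmap_def o_def
      by (rule fun_cong[OF FD_cong_open[OF oW]]) (use pW eq in \<open>auto simp: pref_pt_def\<close>)
    also have "\<dots> = FD (\<lambda>x. snd ?e (g (chart_inv ?d x))) (snd ?d (f (chart_inv ?c (pref_pt A p))))
        (FD (\<lambda>x. snd ?d (f (chart_inv ?c x))) (pref_pt A p) v)"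
    proof (rule FD_compose[where g="\<lambda>x. snd ?e (g (chart_inv ?d x))"])
      show "(\<lambda>x. snd ?d (f (chart_inv ?c x))) differentiable at (pref_pt A p)"
        by (rule local_rep_differentiable[OF A B f p])
      show "(\<lambda>x. snd ?e (g (chart_inv ?d x))) differentiable at (snd ?d (f (chart_inv ?c (pref_pt A p))))"
        using local_rep_differentiable[OF B C g q] by (simp add: pref_pt_def chart_inv_snd[OF A c])
    qed
    also have "\<dots> = tmap B C g (f p) (tmap A B f p v)"
      by (simp add: tmap_def o_def pref_pt_def chart_inv_snd[OF A c])
    finally have tm: "tmap A C (\<lambda>p. g (f p)) p v = tmap B C g (f p) (tmap A B f p v)" .
    show ?thesis
      using pW W Wc s2 tm W1 W2 by (intro exI[of _ W]) (auto simp: W_def image_subset_iff)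
  qed
  show "smooth_map A C U (\<lambda>p. g (f p))"
  proof (rule smap_local[OF A C])
    fix p assume p: "p \<in> U"
    have "p \<in> points A" "g (f p) \<in> points C"
      using smap_dom[OF f p] smap_in[OF g] fU p by auto
    from pref_in[OF this(1)] pref_in[OF this(2)] *[OF p]
    show "\<exists>V c d. p \<in> V \<and> open_in A V \<and> V \<subseteq> U \<and> c \<in> A \<and> d \<in> C \<and> V \<subseteq> fst c \<and>
      (\<lambda>p. g (f p)) ` V \<subseteq> fst d \<and> smooth_on (snd c ` V) (\<lambda>x. snd d (g (f (chart_inv c x))))"
      by meson
  qed
  show "p \<in> U \<Longrightarrow> tmap A C (\<lambda>p. g (f p)) p v = tmap B C g (f p) (tmap A B f p v)"
    using * by blast
qed

lemma smap_eucl_iff: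
  fixes A :: "('a::{t2_space,second_countable_topology}, 'e::euclidean_space) atlas"
    and f :: "'a \<Rightarrow> 'f::euclidean_space"
  assumes A: "manifold A"
  shows "smooth_map A eucl U f \<longleftrightarrow>
    open_in A U \<and> (\<forall>c\<in>A. smooth_on (snd c ` (U \<inter> fst c)) (\<lambda>x. f (chart_inv c x)))"
proof (intro iffI conjI ballI)
  fix c assume "smooth_map A eucl U f" "c \<in> A"
  then show "smooth_on (snd c ` (U \<inter> fst c)) (\<lambda>x. f (chart_inv c x))"
    using smooth_mapD[of A eucl U f c "(UNIV, id)"] by (simp add: eucl_def)
next
  assume *: "open_in A U \<and> (\<forall>c\<in>A. smooth_on (snd c ` (U \<inter> fst c)) (\<lambda>x. f (chart_inv c x)))"
  show "smooth_map A eucl U f"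
  proof (rule smap_local[OF A mf_eucl])
    fix p assume "p \<in> U"
    then have "pref A p \<in> A" "p \<in> fst (pref A p)" using pref_in[OF open_in_mem] * by auto
    with * \<open>p \<in> U\<close> show "\<exists>V c d. p \<in> V \<and> open_in A V \<and> V \<subseteq> U \<and> c \<in> A \<and> d \<in> eucl \<and> V \<subseteq> fst c \<and>
      f ` V \<subseteq> fst d \<and> smooth_on (snd c ` V) (\<lambda>x. snd d (f (chart_inv c x)))"
      by (intro exI[of _ "U \<inter> fst (pref A p)"] exI[of _ "pref A p"] exI[of _ "(UNIV, id)"])
        (auto simp: eucl_def open_in_Int chart_open[OF A])
  qed
qed (simp add: smap_open)

lemma smap_eucl_local:
  fixes A :: "('a::{t2_space,second_countable_topology}, 'e::euclidean_space) atlas"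
    and f :: "'a \<Rightarrow> 'f::euclidean_space"
  assumes A: "manifold A"
    and "\<And>p. p \<in> U \<Longrightarrow> \<exists>V c. p \<in> V \<and> open_in A V \<and> V \<subseteq> U \<and> c \<in> A \<and> V \<subseteq> fst c \<and>
      smooth_on (snd c ` V) (\<lambda>x. f (chart_inv c x))"
  shows "smooth_map A eucl U f"
proof (rule smap_local[OF A mf_eucl])
  fix p assume "p \<in> U"
  then obtain V c where "p \<in> V" "open_in A V" "V \<subseteq> U" "c \<in> A" "V \<subseteq> fst c"
      "smooth_on (snd c ` V) (\<lambda>x. f (chart_inv c x))"
    using assms(2) by blast
  then show "\<exists>V c d. p \<in> V \<and> open_in A V \<and> V \<subseteq> U \<and> c \<in> A \<and> d \<in> eucl \<and> V \<subseteq> fst c \<and>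
      f ` V \<subseteq> fst d \<and> smooth_on (snd c ` V) (\<lambda>x. snd d (f (chart_inv c x)))"
    by (intro exI[of _ V] exI[of _ c] exI[of _ "(UNIV, id)"]) (auto simp: eucl_def)
qed

lemma smap_eucl_eucl:
  fixes f :: "'e::euclidean_space \<Rightarrow> 'f::euclidean_space"
  shows "smooth_map eucl eucl U f \<longleftrightarrow> open U \<and> smooth_on U f"
  by (simp add: smap_eucl_iff) (simp add: eucl_def)

lemma tmap_eucl_eucl [simp]: "tmap eucl eucl f p = FD f p"
  by (simp add: tmap_def o_def)

lemma chart_coord_tmap: "chart_coord A c p = tmap A eucl (snd c) p"
  by (simp add: chart_coord_def tmap_def o_def)

lemma chart_vec_tmap: "chart_vec A c x = tmap eucl A (chart_inv c) x"
  by (simp add: chart_vec_def tmap_def o_def)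

context
  fixes A
  assumes A: "manifold A"
begin

lemma smap_id: "open_in A U \<Longrightarrow> smooth_map A A U (\<lambda>p. p)"
proof (rule smap_local[OF A A])
  fix p assume U: "open_in A U" "p \<in> U"
  let ?c = "pref A p" and ?V = "U \<inter> fst (pref A p)"
  have c: "?c \<in> A" "p \<in> fst ?c" using pref_in[OF open_in_mem[OF U]] by auto
  have V: "open_in A ?V" by (intro open_in_Int U chart_open[OF A c(1)])
  have oV: "open (snd ?c ` ?V)" by (rule open_chart_image[OF A c(1) U(1)])
  have "smooth_on (snd ?c ` ?V) (\<lambda>x. snd ?c (chart_inv ?c x))"
    by (subst smooth_on_cong[OF oV, of _ "\<lambda>x. x"]) (auto simp: chart_inv_snd[OF A c(1)] smooth_on_id[OF oV])
  then show "\<exists>V c d. p \<in> V \<and> open_in A V \<and> V \<subseteq> U \<and> c \<in> A \<and> d \<in> A \<and> V \<subseteq> fst c \<and>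
      (\<lambda>p. p) ` V \<subseteq> fst d \<and> smooth_on (snd c ` V) (\<lambda>x. snd d (chart_inv c x))"
    using c U V by (intro exI[of _ ?V] exI[of _ ?c]) auto
qed

lemma tmap_id:
  assumes "p \<in> points A"
  shows "tmap A A (\<lambda>q. q) p v = v"
proof -
  let ?c = "pref A p"
  have c: "?c \<in> A" "p \<in> fst ?c" using pref_in[OF assms] by auto
  have "FD (\<lambda>x. snd ?c (chart_inv ?c x)) (snd ?c p) = FD (\<lambda>x. x) (snd ?c p)"
    by (rule FD_cong_open[OF chart_image_open[OF A c(1)]]) (use c in \<open>auto simp: chart_inv_snd[OF A c(1)]\<close>)
  then show ?thesis by (simp add: tmap_def o_def pref_pt_def)
qed

lemma smap_chart: "c \<in> A \<Longrightarrow> smooth_map A eucl (fst c) (snd c)"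
  using chart_transition[OF A] chart_open[OF A] by (auto simp: smap_eucl_iff[OF A] Int_commute)

lemma smap_chart_inv:
  assumes c: "c \<in> A"
  shows "smooth_map eucl A (snd c ` fst c) (chart_inv c)"
proof (rule smap_local[OF mf_eucl A])
  let ?S = "snd c ` fst c"
  have o: "open ?S" by (rule chart_image_open[OF A c])
  fix x assume x: "x \<in> ?S"
  have "smooth_on ?S (\<lambda>x. snd c (chart_inv c x))"
    by (subst smooth_on_cong[OF o, of _ "\<lambda>x. x"]) (auto simp: snd_chart_inv[OF A c] smooth_on_id[OF o])
  then show "\<exists>V ca d. x \<in> V \<and> open_in eucl V \<and> V \<subseteq> ?S \<and> ca \<in> eucl \<and> d \<in> A \<and> V \<subseteq> fst ca \<and>
      chart_inv c ` V \<subseteq> fst d \<and> smooth_on (snd ca ` V) (\<lambda>y. snd d (chart_inv c (chart_inv ca y)))"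
    using x o c chart_inv_in[OF A c] eucl_chart by (intro exI[of _ ?S] exI[of _ "(UNIV,id)"] exI[of _ c]) auto
qed

lemma chart_coord_vec:
  assumes c: "c \<in> A" and x: "x \<in> snd c ` fst c"
  shows "chart_coord A c (chart_inv c x) (chart_vec A c x w) = w"
proof -
  have "tmap eucl eucl (\<lambda>x. snd c (chart_inv c x)) x w = tmap A eucl (snd c) (chart_inv c x) (tmap eucl A (chart_inv c) x w)"
    by (rule tmap_compose[OF mf_eucl A mf_eucl smap_chart_inv[OF c] smap_chart[OF c] _ x])
      (auto simp: chart_inv_in[OF A c])
  moreover have "tmap eucl eucl (\<lambda>x. snd c (chart_inv c x)) x = tmap eucl eucl (\<lambda>x. x) x"
    by (rule tmap_cong[OF mf_eucl mf_eucl, of "snd c ` fst c"])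
       (auto simp: chart_image_open[OF A c] x chart_inv_snd[OF A c])
  ultimately show ?thesis by (simp add: chart_coord_tmap chart_vec_tmap)
qed

lemma chart_vec_coord:
  assumes c: "c \<in> A" and p: "p \<in> fst c"
  shows "chart_vec A c (snd c p) (chart_coord A c p v) = v"
proof -
  have pA: "p \<in> points A" using p chart_subset[OF A c] by auto
  have "tmap A A (\<lambda>x. chart_inv c (snd c x)) p v = tmap eucl A (chart_inv c) (snd c p) (tmap A eucl (snd c) p v)"
    by (rule tmap_compose[OF A mf_eucl A smap_chart[OF c] smap_chart_inv[OF c] _ p]) auto
  moreover have "tmap A A (\<lambda>x. chart_inv c (snd c x)) p = tmap A A (\<lambda>x. x) p"
    by (rule tmap_cong[OF A A, of "fst c"]) (auto simp: chart_open[OF A c] p chart_inv_snd[OF A c])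
  ultimately show ?thesis by (simp add: chart_coord_tmap chart_vec_tmap tmap_id[OF pA])
qed

lemma chart_coord_pref: "p \<in> points A \<Longrightarrow> chart_coord A (pref A p) p v = v"
  using tmap_id[of p v] by (simp add: chart_coord_def tmap_def o_def)

lemma chart_vec_pref: "p \<in> points A \<Longrightarrow> chart_vec A (pref A p) (pref_pt A p) v = v"
  using chart_vec_coord[of "pref A p" p v] pref_in[of p A] by (simp add: chart_coord_pref pref_pt_def)

lemma linear_chart_coord: "c \<in> A \<Longrightarrow> p \<in> fst c \<Longrightarrow> linear (chart_coord A c p)"
  unfolding chart_coord_tmap using tmap_linear[OF A mf_eucl smap_chart] by blast

lemma linear_chart_vec: "c \<in> A \<Longrightarrow> x \<in> snd c ` fst c \<Longrightarrow> linear (chart_vec A c x)"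
  unfolding chart_vec_tmap using tmap_linear[OF mf_eucl A smap_chart_inv] by blast

end

text \<open>\<open>tmap\<close> refers to the preferred charts at \<open>p\<close> and
  \<open>f p\<close>, which jump as \<open>p\<close> moves. In fixed charts the tangent map becomes
  an ordinary derivative, which can be differentiated again.\<close>

lemma tmap_in_charts:
  assumes A: "manifold A" and B: "manifold B" and f: "smooth_map A B U f"
    and c: "c \<in> A" and d: "d \<in> B" and x: "x \<in> snd c ` (U \<inter> fst c \<inter> f -` fst d)"
  shows "tmap A B f (chart_inv c x) (chart_vec A c x w) =
    chart_vec B d (snd d (f (chart_inv c x))) (FD (\<lambda>x. snd d (f (chart_inv c x))) x w)"
    and "(\<lambda>x. snd d (f (chart_inv c x))) differentiable (at x)"
proof -
  let ?V = "{p \<in> U. f p \<in> fst d} \<inter> fst c"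
  obtain p where p: "p \<in> U" "p \<in> fst c" "f p \<in> fst d" "x = snd c p" using x by auto
  note ci = chart_inv_snd[OF A c]
  have V: "open_in A ?V"
    by (intro open_in_Int smap_vimage[OF f] chart_open[OF B d(1)] chart_open[OF A c(1)])
  have o: "open (snd c ` ?V)" by (rule open_chart_image'[OF A c(1) V]) auto
  have s1: "smooth_map eucl A (snd c ` ?V) (chart_inv c)"
    by (rule smap_subset[OF mf_eucl A smap_chart_inv[OF A c]]) (use o in auto)
  have s2: "smooth_map eucl B (snd c ` ?V) (\<lambda>x. f (chart_inv c x))"
    by (rule smooth_compose[OF mf_eucl A B s1 f]) (auto simp: ci)
  have s3: "smooth_map eucl eucl (snd c ` ?V) (\<lambda>x. snd d (f (chart_inv c x)))"
    by (rule smooth_compose[OF mf_eucl B mf_eucl s2 smap_chart[OF B d]]) (auto simp: ci)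
  have xV: "x \<in> snd c ` ?V" using p by auto
  show "(\<lambda>x. snd d (f (chart_inv c x))) differentiable (at x)"
    using s3 xV smooth_on_differentiable by (auto simp: smap_eucl_eucl)
  have "tmap A B f (chart_inv c x) (chart_vec A c x w) = tmap eucl B (\<lambda>x. f (chart_inv c x)) x w"
    unfolding chart_vec_tmap by (rule tmap_compose[OF mf_eucl A B s1 f _ xV, symmetric]) (auto simp: ci)
  also have "\<dots> = tmap eucl B (\<lambda>x. chart_inv d (snd d (f (chart_inv c x)))) x w"
    by (rule fun_cong[OF tmap_cong[OF mf_eucl B, of "snd c ` ?V"]])
       (use o xV in \<open>auto simp: ci chart_inv_snd[OF B d]\<close>)
  also have "\<dots> = tmap eucl B (chart_inv d) (snd d (f (chart_inv c x))) (tmap eucl eucl (\<lambda>x. snd d (f (chart_inv c x))) x w)"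
    by (rule tmap_compose[OF mf_eucl mf_eucl B s3 smap_chart_inv[OF B d] _ xV]) (auto simp: ci)
  finally show "tmap A B f (chart_inv c x) (chart_vec A c x w) =
    chart_vec B d (snd d (f (chart_inv c x))) (FD (\<lambda>x. snd d (f (chart_inv c x))) x w)"
    by (simp add: chart_vec_tmap)
qed

section \<open>Product manifolds\<close>

lemma points_prod [simp]: "points (prod_atlas A B) = points A \<times> points B"
proof (intro Set.set_eqI iffI)
  fix x assume "x \<in> points A \<times> points B"
  then obtain c d where "c \<in> A" "fst x \<in> fst c" "d \<in> B" "snd x \<in> fst d"
    by (auto simp: points_def)
  then have "(fst c \<times> fst d, \<lambda>(x, y). (snd c x, snd d y)) \<in> prod_atlas A B" "x \<in> fst c \<times> fst d"
    unfolding prod_atlas_def by (blast, simp add: mem_Times_iff)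
  then show "x \<in> points (prod_atlas A B)" unfolding points_def by (metis UN_I fst_conv)
qed (auto simp: points_def prod_atlas_def)

lemma prod_atlas_eucl [simp]: "prod_atlas eucl eucl = eucl"
  by (auto simp: prod_atlas_def eucl_def id_def)

lemma open_in_Times: "open_in A U \<Longrightarrow> open_in B V \<Longrightarrow> open_in (prod_atlas A B) (U \<times> V)"
  by (simp add: open_in_def openin_Times)

lemma image_prod_chart: "(\<lambda>(x, y). (f x, g y)) ` (S \<times> T) = f ` S \<times> g ` T"
  by auto

context
  fixes A and B
  assumes A: "manifold A" and B: "manifold B"
begin

lemma chart_inv_prod:
  assumes c: "c \<in> A" and d: "d \<in> B" and x: "x \<in> snd c ` fst c" "y \<in> snd d ` fst d"
  shows "chart_inv (fst c \<times> fst d, \<lambda>(x, y). (snd c x, snd d y)) (x, y) = (chart_inv c x, chart_inv d y)"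
proof -
  have "inj_on (\<lambda>(x, y). (snd c x, snd d y)) (fst c \<times> fst d)"
    by (rule inj_onI) (auto, metis chart_inv_snd[OF A c], metis chart_inv_snd[OF B d])
  from inv_into_f_f[OF this, of "(chart_inv c x, chart_inv d y)"] show ?thesis
    using x by (simp add: chart_inv_def[of "(_, _)"] snd_chart_inv[OF A c] snd_chart_inv[OF B d]
        chart_inv_in[OF A c] chart_inv_in[OF B d])
qed

lemma manifold_prod: "manifold (prod_atlas A B)"
proof -
  have 1: "open_in (prod_atlas A B) (fst e) \<and> open (snd e ` fst e) \<and>
      homeomorphism (fst e) (snd e ` fst e) (snd e) (chart_inv e)" if e: "e \<in> prod_atlas A B" for e
  proof -
    obtain c d where c: "c \<in> A" and d: "d \<in> B"
      and [simp]: "e = (fst c \<times> fst d, \<lambda>(x, y). (snd c x, snd d y))"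
      using e by (auto simp: prod_atlas_def)
    note ci = chart_inv_prod[OF c d]
    have im: "snd e ` fst e = snd c ` fst c \<times> snd d ` fst d" by (simp add: image_prod_chart)
    have "continuous_on (fst c \<times> fst d) (\<lambda>x. (snd c (fst x), snd d (snd x)))"
      by (intro continuous_on_Pair continuous_on_compose2[OF continuous_chart[OF A c]]
          continuous_on_compose2[OF continuous_chart[OF B d]] continuous_intros) auto
    then have cont1: "continuous_on (fst e) (snd e)" by (simp add: case_prod_unfold)
    have "continuous_on (snd c ` fst c \<times> snd d ` fst d) (\<lambda>x. (chart_inv c (fst x), chart_inv d (snd x)))"
      by (intro continuous_on_Pair continuous_on_compose2[OF continuous_chart_inv[OF A c]]
          continuous_on_compose2[OF continuous_chart_inv[OF B d]] continuous_intros) auto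
    then have cont2: "continuous_on (snd e ` fst e) (chart_inv e)"
      unfolding im by (rule continuous_on_eq) (auto simp: ci)
    have "homeomorphism (fst e) (snd e ` fst e) (snd e) (chart_inv e)"
      unfolding homeomorphism_def
    proof (intro conjI ballI cont1 cont2)
      show inv: "chart_inv e (snd e q) = q" if "q \<in> fst e" for q
        using that by (auto simp: ci chart_inv_snd[OF A c] chart_inv_snd[OF B d])
      show "chart_inv e ` snd e ` fst e = fst e"
        using inv by (auto simp: image_image cong: image_cong)
      show "snd e (chart_inv e r) = r" if "r \<in> snd e ` fst e" for r
        using that inv by (auto simp del: \<open>e = _\<close>)
    qed simp
    then show ?thesis
      unfolding im using c d
      by (auto simp: open_in_Times chart_open[OF A] chart_open[OF B] open_Times chart_image_open[OF A] chart_image_open[OF B])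
  qed
  have 2: "smooth_on (snd e ` (fst e \<inter> fst e')) (snd e' \<circ> chart_inv e)"
    if e: "e \<in> prod_atlas A B" and e': "e' \<in> prod_atlas A B" for e e'
  proof -
    obtain c d where c: "c \<in> A" and d: "d \<in> B"
      and ee: "e = (fst c \<times> fst d, \<lambda>(x, y). (snd c x, snd d y))"
      using e by (auto simp: prod_atlas_def)
    obtain c' d' where c': "c' \<in> A" and d': "d' \<in> B"
      and ee': "e' = (fst c' \<times> fst d', \<lambda>(x, y). (snd c' x, snd d' y))"
      using e' by (auto simp: prod_atlas_def)
    let ?S = "snd c ` (fst c \<inter> fst c')" and ?T = "snd d ` (fst d \<inter> fst d')"
    have im: "snd e ` (fst e \<inter> fst e') = ?S \<times> ?T"
      by (simp add: ee ee' Times_Int_Times image_prod_chart)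
    have oS: "open ?S" using open_chart_image[OF A c chart_open[OF A c']] by (simp add: Int_commute)
    have oT: "open ?T" using open_chart_image[OF B d chart_open[OF B d']] by (simp add: Int_commute)
    have oST: "open (?S \<times> ?T)" by (intro open_Times oS oT)
    have "smooth_on (?S \<times> ?T) (\<lambda>z. (snd c' (chart_inv c (fst z)), snd d' (chart_inv d (snd z))))"
      by (intro smooth_on_Pair oST smooth_on_compose[OF oST oS smooth_on_fst[OF oST] chart_transition[OF A c c']]
          smooth_on_compose[OF oST oT smooth_on_snd[OF oST] chart_transition[OF B d d']]) auto
    then show ?thesis
      unfolding im
      by (subst smooth_on_cong[OF oST, of _ "\<lambda>z. (snd c' (chart_inv c (fst z)), snd d' (chart_inv d (snd z)))"])
        (auto simp: ee ee' chart_inv_prod[OF c d] simp del: chart_inv_snd)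
  qed
  show ?thesis using 1 2 by (auto simp: manifold_def)
qed

lemma smap_fst: "open_in (prod_atlas A B) U \<Longrightarrow> smooth_map (prod_atlas A B) A U fst"
  and smap_snd: "open_in (prod_atlas A B) U \<Longrightarrow> smooth_map (prod_atlas A B) B U snd"
proof -
  have *: "\<exists>V e c d. p \<in> V \<and> open_in (prod_atlas A B) V \<and> V \<subseteq> U \<and> c \<in> A \<and> d \<in> B \<and> e \<in> prod_atlas A B \<and> V \<subseteq> fst e \<and>
    fst ` V \<subseteq> fst c \<and> snd ` V \<subseteq> fst d \<and> smooth_on (snd e ` V) (\<lambda>x. snd c (fst (chart_inv e x))) \<and>
    smooth_on (snd e ` V) (\<lambda>x. snd d (snd (chart_inv e x)))"
    if U: "open_in (prod_atlas A B) U" and p: "p \<in> U" for p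
  proof -
    obtain a b where ab: "p = (a, b)" "a \<in> points A" "b \<in> points B"
      using open_in_subset[OF U] p by auto
    let ?c = "pref A a" and ?d = "pref B b"
    note c = pref_in[OF ab(2)] and d = pref_in[OF ab(3)]
    let ?e = "(fst ?c \<times> fst ?d, \<lambda>(x, y). (snd ?c x, snd ?d y))"
    have e: "?e \<in> prod_atlas A B" unfolding prod_atlas_def using c d by blast
    let ?V = "U \<inter> fst ?e"
    have V: "open_in (prod_atlas A B) ?V" by (intro open_in_Int U chart_open[OF manifold_prod e])
    have o: "open (snd ?e ` ?V)" by (rule open_chart_image[OF manifold_prod e U])
    have s1: "smooth_on (snd ?e ` ?V) (\<lambda>x. snd ?c (fst (chart_inv ?e x)))"
      by (subst smooth_on_cong[OF o, of _ fst])
        (use smooth_on_fst[OF o] in \<open>auto simp: chart_inv_prod[OF c(1) d(1)] chart_inv_snd[OF A c(1)]\<close>)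
    have s2: "smooth_on (snd ?e ` ?V) (\<lambda>x. snd ?d (snd (chart_inv ?e x)))"
      by (subst smooth_on_cong[OF o, of _ snd])
        (use smooth_on_snd[OF o] in \<open>auto simp: chart_inv_prod[OF c(1) d(1)] chart_inv_snd[OF B d(1)]\<close>)
    show ?thesis
      using V s1 s2 e c d p ab by (intro exI[of _ ?V] exI[of _ ?e] exI[of _ ?c] exI[of _ ?d]) auto
  qed
  show "open_in (prod_atlas A B) U \<Longrightarrow> smooth_map (prod_atlas A B) A U fst"
    by (rule smap_local[OF manifold_prod A]) (use * in meson)
  show "open_in (prod_atlas A B) U \<Longrightarrow> smooth_map (prod_atlas A B) B U snd"
    by (rule smap_local[OF manifold_prod B]) (use * in meson)
qed

lemma smap_Pair:
  assumes N: "manifold N" and f: "smooth_map N A U f" and g: "smooth_map N B U g"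
  shows "smooth_map N (prod_atlas A B) U (\<lambda>n. (f n, g n))"
proof (rule smap_local[OF N manifold_prod])
  fix p assume p: "p \<in> U"
  let ?e = "pref N p" and ?c = "pref A (f p)" and ?d = "pref B (g p)"
  have e: "?e \<in> N" "p \<in> fst ?e" using pref_in[OF smap_dom[OF f p]] by auto
  have c: "?c \<in> A" "f p \<in> fst ?c" using pref_in[OF smap_in[OF f p]] by auto
  have d: "?d \<in> B" "g p \<in> fst ?d" using pref_in[OF smap_in[OF g p]] by auto
  obtain W1 where W1: "p \<in> W1" "open_in N W1" "W1 \<subseteq> U" "W1 \<subseteq> fst ?e" "f ` W1 \<subseteq> fst ?c"
      "open (snd ?e ` W1)" "smooth_on (snd ?e ` W1) (\<lambda>x. snd ?c (f (chart_inv ?e x)))"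
    using smap_chartwise[OF N A f p e c] .
  obtain W2 where W2: "p \<in> W2" "open_in N W2" "W2 \<subseteq> U" "W2 \<subseteq> fst ?e" "g ` W2 \<subseteq> fst ?d"
      "open (snd ?e ` W2)" "smooth_on (snd ?e ` W2) (\<lambda>x. snd ?d (g (chart_inv ?e x)))"
    using smap_chartwise[OF N B g p e d] .
  let ?W = "W1 \<inter> W2" and ?k = "(fst ?c \<times> fst ?d, \<lambda>(x, y). (snd ?c x, snd ?d y))"
  have k: "?k \<in> prod_atlas A B" unfolding prod_atlas_def using c d by blast
  have W: "open_in N ?W" by (intro open_in_Int W1 W2)
  have o: "open (snd ?e ` ?W)" by (rule open_chart_image'[OF N e(1) W]) (use W1 in auto)
  have "smooth_on (snd ?e ` ?W) (\<lambda>x. (snd ?c (f (chart_inv ?e x)), snd ?d (g (chart_inv ?e x))))"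
    by (intro smooth_on_Pair o smooth_on_subset[OF W1(7)] smooth_on_subset[OF W2(7)]) auto
  then show "\<exists>V c d. p \<in> V \<and> open_in N V \<and> V \<subseteq> U \<and> c \<in> N \<and> d \<in> prod_atlas A B \<and> V \<subseteq> fst c \<and>
      (\<lambda>n. (f n, g n)) ` V \<subseteq> fst d \<and> smooth_on (snd c ` V) (\<lambda>x. snd d (f (chart_inv c x), g (chart_inv c x)))"
    using W W1 W2 e k by (intro exI[of _ ?W] exI[of _ ?e] exI[of _ ?k]) auto
qed

text \<open>The preferred chart of the product at a point may differ from the product of the
  preferred charts of the factors, so a tangent vector of the product is not simply the pair of its
  components. It is still determined by its two projections, because every chart of the product
  atlas is a product chart.\<close>

lemma tmap_prod_inj:
  assumes p: "p \<in> points A \<times> points B"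
    and eq: "tmap (prod_atlas A B) A fst p w = tmap (prod_atlas A B) A fst p w'"
      "tmap (prod_atlas A B) B snd p w = tmap (prod_atlas A B) B snd p w'"
  shows "w = w'"
proof -
  let ?P = "prod_atlas A B" and ?e = "pref (prod_atlas A B) p"
  have pP: "p \<in> points ?P" using p by simp
  note e = pref_in[OF pP]
  obtain c d where c: "c \<in> A" and d: "d \<in> B"
      and ee: "?e = (fst c \<times> fst d, \<lambda>(x, y). (snd c x, snd d y))"
    using e(1) by (auto simp: prod_atlas_def)
  have pc: "fst p \<in> fst c" "snd p \<in> fst d" using e(2) unfolding ee by auto
  have oe: "open_in ?P (fst ?e)" by (rule chart_open[OF manifold_prod e(1)])
  have 1: "fst (snd ?e q) = snd c (fst q)" "snd (snd ?e q) = snd d (snd q)" for q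
    unfolding ee by (simp_all add: case_prod_unfold)
  have se: "smooth_map ?P eucl (fst ?e) (snd ?e)" by (rule smap_chart[OF manifold_prod e(1)])
  have f: "smooth_map eucl eucl UNIV fst" "smooth_map eucl eucl UNIV snd"
    by (simp_all add: smap_eucl_eucl smooth_on_fst smooth_on_snd)
  have f1: "smooth_map ?P A (fst ?e) fst" by (rule smap_fst[OF oe])
  have f2: "smooth_map ?P B (fst ?e) snd" by (rule smap_snd[OF oe])
  have FDf: "FD fst z u = fst u" "FD snd z u = snd u" for z u
    using FD_eqI[OF has_derivative_fst[OF has_derivative_ident]] FD_eqI[OF has_derivative_snd[OF has_derivative_ident]]
    by metis+
  have A1: "fst u = tmap A eucl (snd c) (fst p) (tmap ?P A fst p u)" for u
  proof -
    have "fst u = FD fst (snd ?e p) (chart_coord ?P ?e p u)"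
      by (simp add: FDf chart_coord_pref[OF manifold_prod pP])
    also have "\<dots> = tmap ?P eucl (\<lambda>q. fst (snd ?e q)) p u"
      unfolding chart_coord_tmap
      using tmap_compose[OF manifold_prod mf_eucl mf_eucl se f(1) _ e(2)] by simp
    also have "\<dots> = tmap A eucl (snd c) (fst p) (tmap ?P A fst p u)"
      unfolding 1 by (rule tmap_compose[OF manifold_prod A mf_eucl f1 smap_chart[OF A c] _ e(2)]) (auto simp: ee)
    finally show ?thesis .
  qed
  have B1: "snd u = tmap B eucl (snd d) (snd p) (tmap ?P B snd p u)" for u
  proof -
    have "snd u = FD snd (snd ?e p) (chart_coord ?P ?e p u)"
      by (simp add: FDf chart_coord_pref[OF manifold_prod pP])
    also have "\<dots> = tmap ?P eucl (\<lambda>q. snd (snd ?e q)) p u"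
      unfolding chart_coord_tmap
      using tmap_compose[OF manifold_prod mf_eucl mf_eucl se f(2) _ e(2)] by simp
    also have "\<dots> = tmap B eucl (snd d) (snd p) (tmap ?P B snd p u)"
      unfolding 1 by (rule tmap_compose[OF manifold_prod B mf_eucl f2 smap_chart[OF B d] _ e(2)]) (auto simp: ee)
    finally show ?thesis .
  qed
  show ?thesis
    using A1[of w] A1[of w'] B1[of w] B1[of w'] eq by (simp add: prod_eq_iff)
qed

text \<open>The tangent vector of the pair is the sum of its two partial vectors, since both have
  the same projections; linearity of the tangent map of \<open>F\<close> does the rest.\<close>

lemma tmap_Pair:
  assumes N: "manifold N" and C: "manifold C"
    and f: "smooth_map N A U f" and g: "smooth_map N B U g"
    and F: "smooth_map (prod_atlas A B) C (V \<times> W) F"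
    and V: "open_in A V" "f ` U \<subseteq> V" and W: "open_in B W" "g ` U \<subseteq> W" and p: "p \<in> U"
  shows "tmap N C (\<lambda>n. F (f n, g n)) p v =
    tmap A C (\<lambda>a. F (a, g p)) (f p) (tmap N A f p v) + tmap B C (\<lambda>b. F (f p, b)) (g p) (tmap N B g p v)"
proof -
  let ?P = "prod_atlas A B"
  have fp: "f p \<in> V" "g p \<in> W" using p V W by auto
  have fp': "f p \<in> points A" "g p \<in> points B" using smap_in[OF f p] smap_in[OF g p] by auto
  have VW: "open_in ?P (V \<times> W)" by (intro open_in_Times V W)
  have i1: "smooth_map A A V (\<lambda>a. a)" "smooth_map A B V (\<lambda>a. g p)"
    "smooth_map B A W (\<lambda>a. f p)" "smooth_map B B W (\<lambda>a. a)"
    using smap_id[OF A V(1)] smap_const[OF A B V(1) fp'(2)]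
      smap_id[OF B W(1)] smap_const[OF B A W(1) fp'(1)] by auto
  note P1 = smap_Pair[OF A i1(1,2)] and P2 = smap_Pair[OF B i1(3,4)] and P0 = smap_Pair[OF N f g]
  have F0: "smooth_map ?P A (V \<times> W) fst" "smooth_map ?P B (V \<times> W) snd"
    using smap_fst[OF VW] smap_snd[OF VW] by auto
  have im: "(\<lambda>n. (f n, g n)) ` U \<subseteq> V \<times> W" using V W by auto
  have pr: "tmap N A f p v = tmap ?P A fst (f p, g p) (tmap N ?P (\<lambda>n. (f n, g n)) p v)"
    "tmap N B g p v = tmap ?P B snd (f p, g p) (tmap N ?P (\<lambda>n. (f n, g n)) p v)"
    using tmap_compose[OF N manifold_prod A P0 F0(1) im p] tmap_compose[OF N manifold_prod B P0 F0(2) im p] by auto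
  have pr1: "u = tmap ?P A fst (f p, g p) (tmap A ?P (\<lambda>a. (a, g p)) (f p) u)"
    "0 = tmap ?P B snd (f p, g p) (tmap A ?P (\<lambda>a. (a, g p)) (f p) u)" for u
    using tmap_compose[OF A manifold_prod A P1 F0(1) _ fp(1), of u] tmap_compose[OF A manifold_prod B P1 F0(2) _ fp(1), of u] fp
      tmap_id[OF A fp'(1)] tmap_const[OF A B fp'(1)] by auto
  have pr2: "0 = tmap ?P A fst (f p, g p) (tmap B ?P (\<lambda>b. (f p, b)) (g p) u)"
    "u = tmap ?P B snd (f p, g p) (tmap B ?P (\<lambda>b. (f p, b)) (g p) u)" for u
    using tmap_compose[OF B manifold_prod A P2 F0(1) _ fp(2), of u] tmap_compose[OF B manifold_prod B P2 F0(2) _ fp(2), of u] fp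
      tmap_id[OF B fp'(2)] tmap_const[OF B A fp'(2)] by auto
  have pVW: "(f p, g p) \<in> V \<times> W" using fp by simp
  have lin: "linear (tmap ?P A fst (f p, g p))" "linear (tmap ?P B snd (f p, g p))" "linear (tmap ?P C F (f p, g p))"
    using tmap_linear[OF manifold_prod A F0(1) pVW] tmap_linear[OF manifold_prod B F0(2) pVW]
      tmap_linear[OF manifold_prod C F pVW] by auto
  have dec: "tmap N ?P (\<lambda>n. (f n, g n)) p v =
      tmap A ?P (\<lambda>a. (a, g p)) (f p) (tmap N A f p v) + tmap B ?P (\<lambda>b. (f p, b)) (g p) (tmap N B g p v)"
    by (rule tmap_prod_inj[of "(f p, g p)"])
      (use fp' in \<open>auto simp: linear_add[OF lin(1)] linear_add[OF lin(2)] pr1[symmetric] pr2[symmetric] pr[symmetric]\<close>)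
  have "tmap N C (\<lambda>n. F (f n, g n)) p v = tmap ?P C F (f p, g p) (tmap N ?P (\<lambda>n. (f n, g n)) p v)"
    by (rule tmap_compose[OF N manifold_prod C P0 F _ p]) (use V W in auto)
  also have "\<dots> = tmap A C (\<lambda>a. F (a, g p)) (f p) (tmap N A f p v) + tmap B C (\<lambda>b. F (f p, b)) (g p) (tmap N B g p v)"
    unfolding dec linear_add[OF lin(3)]
    by (subst (1 2) tmap_compose[OF _ manifold_prod C _ F, symmetric])
       (use fp in \<open>auto simp: A B intro: P1 P2\<close>)
  finally show ?thesis .
qed

end

text \<open>In a chart that is the identity on the Euclidean factor, the partial derivative is the
  total derivative in direction \<open>(w, 0)\<close>, hence jointly smooth.\<close>

lemma smap_partial:
  fixes B :: "('b::{t2_space,second_countable_topology}, 'f::euclidean_space) atlas"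
    and F :: "'e::euclidean_space \<times> 'b \<Rightarrow> 'g::euclidean_space"
  assumes B: "manifold B" and F: "smooth_map (prod_atlas eucl B) eucl W F"
  shows "smooth_map (prod_atlas eucl B) eucl W (\<lambda>q. FD (\<lambda>z. F (z, snd q)) (fst q) w)"
proof (rule smap_eucl_local[OF manifold_prod[OF mf_eucl B]])
  let ?P = "prod_atlas eucl B :: ('e \<times> 'b, 'e \<times> 'f) atlas"
  note P = manifold_prod[OF mf_eucl B]
  fix p assume p: "p \<in> W"
  have pP: "p \<in> points ?P" by (rule smap_dom[OF F p])
  let ?d = "pref B (snd p)"
  have d: "?d \<in> B" "snd p \<in> fst ?d" using pref_in[of "snd p" B] pP by auto
  let ?e = "((UNIV :: 'e set) \<times> fst ?d, \<lambda>(x :: 'e, y). (x, snd ?d y))"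
  have e: "?e \<in> ?P" unfolding prod_atlas_def eucl_def
    by (intro CollectI exI[of _ "(UNIV, id)"] exI[of _ ?d] conjI d(1)) auto
  have ci: "chart_inv ?e (x, y) = (x, chart_inv ?d y)" if "y \<in> snd ?d ` fst ?d" for x y
    using chart_inv_prod[OF mf_eucl B _ d(1), of "(UNIV, id)" x y] that by (simp add: eucl_def)
  let ?V = "W \<inter> fst ?e"
  have V: "open_in ?P ?V" by (intro open_in_Int smap_open[OF F] chart_open[OF P e])
  have o: "open (snd ?e ` ?V)" by (rule open_chart_image[OF P e smap_open[OF F]])
  define G where "G = (\<lambda>x. F (chart_inv ?e x))"
  have G: "smooth_on (snd ?e ` ?V) G"
    using F e unfolding smap_eucl_iff[OF P] G_def by blast
  have eq: "FD (\<lambda>z. F (z, snd (chart_inv ?e x))) (fst (chart_inv ?e x)) w = FD G x (w, 0)"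
    if x: "x \<in> snd ?e ` ?V" for x
  proof -
    obtain z y where zy: "x = (z, y)" by (cases x)
    have y: "y \<in> snd ?d ` fst ?d" using x zy by auto
    have dz: "((\<lambda>z. (z, y)) has_derivative (\<lambda>w. (w, 0))) (at z)"
      by (auto intro!: derivative_eq_intros)
    have "((\<lambda>z. G (z, y)) has_derivative (\<lambda>w. FD G (z, y) (w, 0))) (at z)"
      using has_derivative_compose[OF dz smooth_on_has_FD[OF G x[unfolded zy]]] .
    moreover have "(\<lambda>z. G (z, y)) = (\<lambda>z. F (z, chart_inv ?d y))"
      by (simp add: G_def ci[OF y])
    ultimately show ?thesis using FD_eqI by (fastforce simp: zy ci[OF y])
  qed
  have "smooth_on (snd ?e ` ?V) (\<lambda>x. FD (\<lambda>z. F (z, snd (chart_inv ?e x))) (fst (chart_inv ?e x)) w)"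
    by (subst smooth_on_cong[OF o eq]) (assumption | rule smooth_on_FD[OF G])+
  then show "\<exists>V c. p \<in> V \<and> open_in ?P V \<and> V \<subseteq> W \<and> c \<in> ?P \<and> V \<subseteq> fst c \<and>
      smooth_on (snd c ` V) (\<lambda>x. FD (\<lambda>z. F (z, snd (chart_inv c x))) (fst (chart_inv c x)) w)"
    using V e p d by (intro exI[of _ ?V] exI[of _ ?e]) (auto simp: mem_Times_iff)
qed

text \<open>A tangent vector depending on \<open>n\<close> is produced as the derivative at
  \<open>z n\<close> of the map sending \<open>x\<close> to \<open>F (x, n)\<close>; its smooth
  dependence on \<open>n\<close> is read in one fixed chart \<open>c\<close>, since the preferred
  chart at its foot point jumps.\<close>

lemma smooth_partial_coord:
  fixes B :: "('b::{t2_space,second_countable_topology}, 'f::euclidean_space) atlas"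
    and C :: "('c::{t2_space,second_countable_topology}, 'g::euclidean_space) atlas"
    and F :: "'e::euclidean_space \<times> 'b \<Rightarrow> 'c"
  assumes B: "manifold B" and C: "manifold C" and F: "smooth_map (prod_atlas eucl B) C W F"
    and z: "smooth_map B eucl U z" and c: "c \<in> C" and W: "\<And>n. n \<in> U \<Longrightarrow> (z n, n) \<in> W \<and> F (z n, n) \<in> fst c"
  shows "smooth_map B eucl U (\<lambda>n. chart_coord C c (F (z n, n)) (tmap eucl C (\<lambda>x. F (x, n)) (z n) w))"
proof -
  have EB: "manifold (prod_atlas (eucl :: ('e, 'e) atlas) B)" by (rule manifold_prod[OF mf_eucl B])
  let ?W = "{p \<in> W. F p \<in> fst c}"
  have oW: "open_in (prod_atlas eucl B) ?W" by (rule smap_vimage[OF F chart_open[OF C c]])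
  have F': "smooth_map (prod_atlas eucl B) C ?W F" by (rule smap_subset[OF EB C F oW]) auto
  have G: "smooth_map (prod_atlas eucl B) eucl ?W (\<lambda>p. snd c (F p))"
    by (rule smooth_compose[OF EB C mf_eucl F' smap_chart[OF C c]]) auto
  have p: "smooth_map B (prod_atlas eucl B) U (\<lambda>n. (z n, n))"
    by (rule smap_Pair[OF mf_eucl B B z smap_id[OF B smap_open[OF z]]])
  have pW: "(\<lambda>n. (z n, n)) ` U \<subseteq> ?W" using W by auto
  have "smooth_map B eucl U (\<lambda>n. FD (\<lambda>x. snd c (F (x, n))) (z n) w)"
    using smooth_compose[OF B EB mf_eucl p smap_partial[OF B G] pW] by simp
  moreover have "FD (\<lambda>x. snd c (F (x, n))) (z n) w = chart_coord C c (F (z n, n)) (tmap eucl C (\<lambda>x. F (x, n)) (z n) w)"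
    if n: "n \<in> U" for n
  proof -
    let ?S = "{x \<in> UNIV. (x, n) \<in> ?W}"
    have i: "smooth_map eucl (prod_atlas eucl B) UNIV (\<lambda>x. (x, n))"
      by (rule smap_Pair[OF mf_eucl B mf_eucl smap_id[OF mf_eucl]
            smap_const[OF mf_eucl B _ smap_dom[OF z n]]]) auto
    have S: "open_in eucl ?S" by (rule smap_vimage[OF i oW])
    have sl: "smooth_map eucl C ?S (\<lambda>x. F (x, n))"
      by (rule smooth_compose[OF mf_eucl EB C smap_subset[OF mf_eucl EB i S] F]) auto
    have "tmap eucl eucl (\<lambda>x. snd c (F (x, n))) (z n) w =
        tmap C eucl (snd c) (F (z n, n)) (tmap eucl C (\<lambda>x. F (x, n)) (z n) w)"
      by (rule tmap_compose[OF mf_eucl C mf_eucl sl smap_chart[OF C c]]) (use W n in auto)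
    then show ?thesis by (simp add: chart_coord_tmap)
  qed
  ultimately show ?thesis by (rule smap_cong[OF B mf_eucl])
qed

text \<open>Fields are obtained as derivatives of a family of maps passing through \<open>n\<close>
  at the parameter \<open>z n\<close>: fundamental fields from the group action, horizontal fields
  from translated lifts.\<close>

lemma smooth_field_partial:
  fixes B :: "('b::{t2_space,second_countable_topology}, 'f::euclidean_space) atlas"
    and F :: "'e::euclidean_space \<times> 'b \<Rightarrow> 'b"
  assumes B: "manifold B" and F: "smooth_map (prod_atlas eucl B) B W F" and z: "smooth_map B eucl U z"
    and W: "\<And>n. n \<in> U \<Longrightarrow> (z n, n) \<in> W \<and> F (z n, n) = n" and V: "\<And>n. n \<in> U \<Longrightarrow> V n = tmap eucl B (\<lambda>x. F (x, n)) (z n) w"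
  shows "smooth_field B U V"
  unfolding smooth_field_def
proof (intro conjI ballI)
  show oU: "open_in B U" by (rule smap_open[OF z])
  fix c assume c: "c \<in> B"
  have z': "smooth_map B eucl (U \<inter> fst c) z"
    by (rule smap_subset[OF B mf_eucl z open_in_Int[OF oU chart_open[OF B c]]]) auto
  have "smooth_map B eucl (U \<inter> fst c) (\<lambda>n. chart_coord B c (F (z n, n)) (tmap eucl B (\<lambda>x. F (x, n)) (z n) w))"
    by (rule smooth_partial_coord[OF B B F z' c]) (use W in auto)
  then have "smooth_map B eucl (U \<inter> fst c) (\<lambda>n. chart_coord B c n (V n))"
    by (rule smap_cong[OF B mf_eucl]) (simp add: W V)
  then have "smooth_on (snd c ` (U \<inter> fst c \<inter> fst c)) (\<lambda>x. chart_coord B c (chart_inv c x) (V (chart_inv c x)))"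
    using c unfolding smap_eucl_iff[OF B] by blast
  then show "smooth_on (snd c ` (U \<inter> fst c)) (\<lambda>x. chart_coord B c (chart_inv c x) (V (chart_inv c x)))"
    by (simp add: Int_assoc)
qed

section \<open>Vector-valued 1-forms\<close>

text \<open>The local version of \<open>smooth_form\<close>: pull-backs by local sections and local
  lifts live on open subsets only.\<close>

definition form_on :: "('a::topological_space, 'e::euclidean_space) atlas \<Rightarrow> 'a set \<Rightarrow>
    ('a \<Rightarrow> 'e \<Rightarrow> 'k::euclidean_space) \<Rightarrow> bool" where
  "form_on A U \<beta> \<longleftrightarrow> open_in A U \<and> (\<forall>p\<in>U. linear (\<beta> p)) \<and>
     (\<forall>c\<in>A. \<forall>w. smooth_on (snd c ` (U \<inter> fst c)) (\<lambda>x. \<beta> (chart_inv c x) (chart_vec A c x w)))"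

lemma smooth_form_iff: "manifold A \<Longrightarrow> smooth_form A \<beta> \<longleftrightarrow> form_on A (points A) \<beta>"
  by (auto simp: smooth_form_def form_on_def inf_absorb2 chart_subset)

lemma form_on_linear: "form_on A U \<beta> \<Longrightarrow> p \<in> U \<Longrightarrow> linear (\<beta> p)"
  and form_on_open: "form_on A U \<beta> \<Longrightarrow> open_in A U"
  and form_on_smooth: "form_on A U \<beta> \<Longrightarrow> c \<in> A \<Longrightarrow>
    smooth_on (snd c ` (U \<inter> fst c)) (\<lambda>x. \<beta> (chart_inv c x) (chart_vec A c x w))"
  by (auto simp: form_on_def)

lemma form_on_eucl:
  "form_on eucl U \<beta> \<longleftrightarrow> open U \<and> (\<forall>p\<in>U. linear (\<beta> p)) \<and> (\<forall>w. smooth_on U (\<lambda>x. \<beta> x w))"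
proof -
  have "chart_vec eucl (UNIV, id) x w = w" for x w :: 'a
    by (simp add: chart_vec_tmap)
  then show ?thesis by (simp add: form_on_def) (simp add: eucl_def)
qed

context
  fixes A
  assumes A: "manifold A"
begin

lemma form_on_local:
  assumes lin: "\<And>p. p \<in> U \<Longrightarrow> linear (\<beta> p)"
    and loc: "\<And>p. p \<in> U \<Longrightarrow> \<exists>V c. p \<in> V \<and> open_in A V \<and> V \<subseteq> U \<and> c \<in> A \<and> V \<subseteq> fst c \<and>
      (\<forall>w. smooth_on (snd c ` V) (\<lambda>x. \<beta> (chart_inv c x) (chart_vec A c x w)))"
  shows "form_on A U \<beta>"
  unfolding form_on_def
proof (intro conjI ballI allI lin)
  show "open_in A U"
  proof (rule open_in_local)
    show "\<exists>V. p \<in> V \<and> open_in A V \<and> V \<subseteq> U" if "p \<in> U" for p using loc[OF that] by blast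
  qed
  fix c' w assume c': "c' \<in> A"
  show "smooth_on (snd c' ` (U \<inter> fst c')) (\<lambda>x. \<beta> (chart_inv c' x) (chart_vec A c' x w))"
  proof (rule smooth_on_local)
    fix x assume "x \<in> snd c' ` (U \<inter> fst c')"
    then obtain p where p: "p \<in> U" "p \<in> fst c'" "x = snd c' p" by auto
    obtain V c where V: "p \<in> V" "open_in A V" "V \<subseteq> U" "c \<in> A" "V \<subseteq> fst c"
      "\<And>w. smooth_on (snd c ` V) (\<lambda>x. \<beta> (chart_inv c x) (chart_vec A c x w))"
      using loc[OF p(1)] by blast
    let ?W = "V \<inter> fst c'" and ?t = "\<lambda>y. snd c (chart_inv c' y)"
    note ci' = chart_inv_snd[OF A c'] and ci = chart_inv_snd[OF A V(4)]
    have W: "open_in A ?W" by (intro open_in_Int V chart_open[OF A c'])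
    have o: "open (snd c' ` ?W)" by (rule open_chart_image[OF A c' V(2)])
    have oV: "open (snd c ` V)" by (rule open_chart_image'[OF A V(4,2,5)])
    have st: "smooth_on (snd c' ` ?W) ?t"
      by (rule smooth_on_subset[OF chart_transition[OF A c' V(4)]]) (use V(5) in auto)
    \<comment> \<open>A constant vector in the chart \<open>c'\<close> is the moving vector
      \<open>FD ?t y w\<close> in the chart \<open>c\<close>.\<close>
    have eq: "\<beta> (chart_inv c' y) (chart_vec A c' y w) =
        \<beta> (chart_inv c (?t y)) (chart_vec A c (?t y) (FD ?t y w))" if y: "y \<in> snd c' ` ?W" for y
    proof -
      obtain q where q: "q \<in> V" "q \<in> fst c'" "y = snd c' q" using y by auto
      have "tmap A A (\<lambda>p. p) (chart_inv c' y) (chart_vec A c' y w) = chart_vec A c (?t y) (FD ?t y w)"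
        by (rule tmap_in_charts(1)[OF A A smap_id[OF A open_in_points] c' V(4)])
          (use q V(5) chart_subset[OF A c'] in auto)
      moreover have "chart_inv c' y \<in> points A" using q ci' chart_subset[OF A c'] by auto
      ultimately show ?thesis using q V(5) by (auto simp: tmap_id[OF A] ci' ci subset_iff)
    qed
    have im: "?t ` snd c' ` ?W \<subseteq> snd c ` V" by (auto simp: ci')
    have "smooth_on (snd c' ` ?W) (\<lambda>y. \<beta> (chart_inv c (?t y)) (chart_vec A c (?t y) (FD ?t y w)))"
    proof (rule smooth_on_apply[where L="\<lambda>y u. \<beta> (chart_inv c (?t y)) (chart_vec A c (?t y) u)", OF o])
      show "linear (\<lambda>u. \<beta> (chart_inv c (?t y)) (chart_vec A c (?t y) u))" if "y \<in> snd c' ` ?W" for y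
      proof -
        have "?t y \<in> snd c ` V" using im that by blast
        then have "linear (chart_vec A c (?t y))" "linear (\<beta> (chart_inv c (?t y)))"
          using V(3,5) by (auto intro!: linear_chart_vec[OF A V(4)] lin simp: ci subset_iff)
        from linear_compose[OF this] show ?thesis by (simp add: o_def)
      qed
      show "smooth_on (snd c' ` ?W) (\<lambda>y. \<beta> (chart_inv c (?t y)) (chart_vec A c (?t y) w))" for w
        by (rule smooth_on_compose[OF o oV st V(6) im])
    qed (rule smooth_on_FD[OF st])
    then have "smooth_on (snd c' ` ?W) (\<lambda>y. \<beta> (chart_inv c' y) (chart_vec A c' y w))"
      by (subst smooth_on_cong[OF o eq])
    then show "\<exists>T. open T \<and> x \<in> T \<and> smooth_on T (\<lambda>x. \<beta> (chart_inv c' x) (chart_vec A c' x w))"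
      using o p V(1) by blast
  qed
qed

lemma form_on_add:
  assumes "form_on A U \<beta>" "form_on A U \<gamma>"
  shows "form_on A U (\<lambda>p u. \<beta> p u + \<gamma> p u)"
  unfolding form_on_def
  using assms open_chart_image[OF A _ form_on_open[OF assms(1)]]
  by (auto simp: form_on_def intro!: linear_compose_add smooth_on_add)

lemma form_rep_differentiable:
  assumes \<beta>: "form_on A U \<beta>" and p: "p \<in> U"
  shows "(\<lambda>x. \<beta> (chart_inv (pref A p) x) (chart_vec A (pref A p) x w)) differentiable (at (pref_pt A p))"
  using smooth_on_differentiable[OF form_on_smooth[OF \<beta> pref_in(1)[OF open_in_mem[OF form_on_open[OF \<beta>] p]]]]
    pref_in(2)[OF open_in_mem[OF form_on_open[OF \<beta>] p]] p by (auto simp: pref_pt_def)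

lemma ext_d_cong:
  assumes "open_in A U" "p \<in> U" "\<And>q u. q \<in> U \<Longrightarrow> \<beta> q u = \<gamma> q u"
  shows "ext_d A \<beta> p u v = ext_d A \<gamma> p u v"
proof -
  note c = pref_in[OF open_in_mem[OF assms(1,2)]]
  have o: "open (snd (pref A p) ` (U \<inter> fst (pref A p)))" by (rule open_chart_image[OF A c(1) assms(1)])
  have "FD (\<lambda>x. \<beta> (chart_inv (pref A p) x) (chart_vec A (pref A p) x w)) (pref_pt A p) =
    FD (\<lambda>x. \<gamma> (chart_inv (pref A p) x) (chart_vec A (pref A p) x w)) (pref_pt A p)" for w
    by (rule FD_cong_open[OF o]) (use c assms in \<open>auto simp: pref_pt_def chart_inv_snd[OF A c(1)]\<close>)
  then show ?thesis by (simp add: ext_d_def)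
qed

lemma ext_d_compose_linear:
  assumes "linear L" "form_on A U \<beta>" "p \<in> U"
  shows "ext_d A (\<lambda>p u. L (\<beta> p u)) p u v = L (ext_d A \<beta> p u v)"
  using linear_conv_bounded_linear[of L] assms(1)
  by (simp add: ext_d_def Let_def FD_linear_comp[OF _ form_rep_differentiable[OF assms(2,3)], of L] linear_diff)

lemma ext_d_skew: "ext_d A \<beta> p u v = - ext_d A \<beta> p v u"
  by (simp add: ext_d_def Let_def)

lemma ext_d_bilinear:
  assumes \<beta>: "form_on A U \<beta>" and p: "p \<in> U"
  shows "bilinear (ext_d A \<beta> p)"
proof -
  let ?c = "pref A p"
  note c = pref_in[OF open_in_mem[OF form_on_open[OF \<beta>] p]]
  let ?S = "snd ?c ` (U \<inter> fst ?c)" and ?l = "\<lambda>w x. \<beta> (chart_inv ?c x) (chart_vec A ?c x w)"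
  have o: "open ?S" by (rule open_chart_image[OF A c(1) form_on_open[OF \<beta>]])
  have x: "pref_pt A p \<in> ?S" using c p by (auto simp: pref_pt_def)
  have l: "linear (\<lambda>w. ?l w y)" if "y \<in> ?S" for y
  proof -
    have "linear (chart_vec A ?c y)" "linear (\<beta> (chart_inv ?c y))"
      using that by (auto intro!: linear_chart_vec[OF A c(1)] form_on_linear[OF \<beta>] simp: chart_inv_snd[OF A c(1)])
    from linear_compose[OF this] show ?thesis by (simp add: o_def)
  qed
  have 1: "linear (FD (?l v) (pref_pt A p))" for v
    by (rule FD_linear[OF form_rep_differentiable[OF \<beta> p]])
  have 2: "linear (\<lambda>v. FD (?l v) (pref_pt A p) u)" for u
    using FD_family_linear[OF o x l form_rep_differentiable[OF \<beta> p], of u] by simp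
  show ?thesis
    unfolding bilinear_def ext_d_def Let_def by (intro conjI allI linear_compose_sub 1 2)
qed

end

context
  fixes N and M and \<beta> :: "'b::{t2_space,second_countable_topology} \<Rightarrow> 'f::euclidean_space \<Rightarrow> 'k::euclidean_space"
  assumes N: "manifold N" and M: "manifold (M :: ('b, 'f) atlas)"
begin

lemma pull_in_charts:
  assumes f: "smooth_map N M U f" and \<beta>: "form_on M V \<beta>" and fU: "f ` U \<subseteq> V" and p: "p \<in> U"
  obtains W where "p \<in> W" "open_in N W" "W \<subseteq> U" "W \<subseteq> fst (pref N p)" "open (snd (pref N p) ` W)"
    "smooth_on (snd (pref N p) ` W) (\<lambda>x. snd (pref M (f p)) (f (chart_inv (pref N p) x)))"
    "\<And>w x. x \<in> snd (pref N p) ` W \<Longrightarrow>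
      \<beta> (f (chart_inv (pref N p) x)) (tmap N M f (chart_inv (pref N p) x) (chart_vec N (pref N p) x w)) =
      \<beta> (chart_inv (pref M (f p)) (snd (pref M (f p)) (f (chart_inv (pref N p) x))))
        (chart_vec M (pref M (f p)) (snd (pref M (f p)) (f (chart_inv (pref N p) x)))
          (FD (\<lambda>x. snd (pref M (f p)) (f (chart_inv (pref N p) x))) x w))"
    "(\<lambda>x. snd (pref M (f p)) (f (chart_inv (pref N p) x))) ` snd (pref N p) ` W \<subseteq>
      snd (pref M (f p)) ` (V \<inter> fst (pref M (f p)))"
proof -
  let ?c = "pref N p" and ?d = "pref M (f p)"
  have c: "?c \<in> N" "p \<in> fst ?c" using pref_in[OF smap_dom[OF f p]] by auto
  have d: "?d \<in> M" "f p \<in> fst ?d" using pref_in[OF smap_in[OF f p]] by auto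
  obtain W where W: "p \<in> W" "open_in N W" "W \<subseteq> U" "W \<subseteq> fst ?c" "f ` W \<subseteq> fst ?d"
    "open (snd ?c ` W)" "smooth_on (snd ?c ` W) (\<lambda>x. snd ?d (f (chart_inv ?c x)))"
    using smap_chartwise[OF N M f p c d] .
  show thesis
  proof (rule that[OF W(1-4,6,7)])
    fix w x assume x: "x \<in> snd ?c ` W"
    then obtain q where q: "q \<in> W" "x = snd ?c q" by auto
    then have x': "x \<in> snd ?c ` (U \<inter> fst ?c \<inter> f -` fst ?d)"
      using W(3-5) by (intro image_eqI[of _ _ q]) auto
    have "chart_inv ?d (snd ?d (f (chart_inv ?c x))) = f (chart_inv ?c x)"
      using x' by (auto simp: chart_inv_snd[OF N c(1)] chart_inv_snd[OF M d(1)])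
    then show "\<beta> (f (chart_inv ?c x)) (tmap N M f (chart_inv ?c x) (chart_vec N ?c x w)) =
      \<beta> (chart_inv ?d (snd ?d (f (chart_inv ?c x)))) (chart_vec M ?d (snd ?d (f (chart_inv ?c x)))
          (FD (\<lambda>x. snd ?d (f (chart_inv ?c x))) x w))"
      by (simp add: tmap_in_charts(1)[OF N M f c(1) d(1) x'])
  qed (use W fU in \<open>auto simp: chart_inv_snd[OF N c(1)] subset_iff\<close>)
qed

lemma form_on_pull:
  assumes f: "smooth_map N M U f" and \<beta>: "form_on M V \<beta>" and fU: "f ` U \<subseteq> V"
  shows "form_on N U (\<lambda>p u. \<beta> (f p) (tmap N M f p u))"
proof (rule form_on_local[OF N])
  fix p assume p: "p \<in> U"
  show "linear (\<lambda>u. \<beta> (f p) (tmap N M f p u))"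
    using linear_compose[OF tmap_linear[OF N M f p] form_on_linear[OF \<beta>, of "f p"]] fU p by (auto simp: o_def)
  let ?c = "pref N p" and ?d = "pref M (f p)"
  have c: "?c \<in> N" "p \<in> fst ?c" using pref_in[OF smap_dom[OF f p]] by auto
  have d: "?d \<in> M" "f p \<in> fst ?d" using pref_in[OF smap_in[OF f p]] by auto
  let ?f = "\<lambda>x. snd ?d (f (chart_inv ?c x))" and ?T = "snd ?d ` (V \<inter> fst ?d)"
  obtain W where W: "p \<in> W" "open_in N W" "W \<subseteq> U" "W \<subseteq> fst ?c" "open (snd ?c ` W)"
    "smooth_on (snd ?c ` W) ?f"
    "\<And>w x. x \<in> snd ?c ` W \<Longrightarrow> \<beta> (f (chart_inv ?c x)) (tmap N M f (chart_inv ?c x) (chart_vec N ?c x w)) =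
      \<beta> (chart_inv ?d (?f x)) (chart_vec M ?d (?f x) (FD ?f x w))"
    "?f ` snd ?c ` W \<subseteq> ?T"
    using pull_in_charts[OF f \<beta> fU p] by metis
  have oT: "open ?T" by (rule open_chart_image[OF M d(1) form_on_open[OF \<beta>]])
  have "smooth_on (snd ?c ` W) (\<lambda>x. \<beta> (f (chart_inv ?c x)) (tmap N M f (chart_inv ?c x) (chart_vec N ?c x w)))" for w
  proof (subst smooth_on_cong[OF W(5) W(7)], assumption,
      rule smooth_on_apply[where L="\<lambda>x u. \<beta> (chart_inv ?d (?f x)) (chart_vec M ?d (?f x) u)", OF W(5)])
    show "smooth_on (snd ?c ` W) (\<lambda>x. \<beta> (chart_inv ?d (?f x)) (chart_vec M ?d (?f x) w))" for w
      by (rule smooth_on_compose[OF W(5) oT W(6) form_on_smooth[OF \<beta> d(1)] W(8)])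
    show "linear (\<lambda>u. \<beta> (chart_inv ?d (?f x)) (chart_vec M ?d (?f x) u))" if "x \<in> snd ?c ` W" for x
    proof -
      have "?f x \<in> ?T" using W(8) that by blast
      then have "linear (chart_vec M ?d (?f x))" "linear (\<beta> (chart_inv ?d (?f x)))"
        by (auto intro!: linear_chart_vec[OF M d(1)] form_on_linear[OF \<beta>] simp: chart_inv_snd[OF M d(1)])
      from linear_compose[OF this] show ?thesis by (simp add: o_def)
    qed
  qed (rule smooth_on_FD[OF W(6)])
  then show "\<exists>V c. p \<in> V \<and> open_in N V \<and> V \<subseteq> U \<and> c \<in> N \<and> V \<subseteq> fst c \<and>
      (\<forall>w. smooth_on (snd c ` V) (\<lambda>x. \<beta> (f (chart_inv c x)) (tmap N M f (chart_inv c x) (chart_vec N c x w))))"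
    using W c by blast
qed

text \<open>Besides the pulled back derivative of \<beta>, the product rule produces the form
  applied to a second derivative of \<open>f\<close>; the latter is symmetric and cancels in the
  antisymmetrization. All structure equations are transported by this lemma.\<close>

lemma ext_d_pull:
  assumes f: "smooth_map N M U f" and \<beta>: "form_on M V \<beta>" and fU: "f ` U \<subseteq> V" and p: "p \<in> U"
  shows "ext_d N (\<lambda>p u. \<beta> (f p) (tmap N M f p u)) p u v = ext_d M \<beta> (f p) (tmap N M f p u) (tmap N M f p v)"
proof -
  let ?c = "pref N p" and ?d = "pref M (f p)"
  have c: "?c \<in> N" "p \<in> fst ?c" using pref_in[OF smap_dom[OF f p]] by auto
  have d: "?d \<in> M" "f p \<in> fst ?d" using pref_in[OF smap_in[OF f p]] by auto
  let ?f = "\<lambda>x. snd ?d (f (chart_inv ?c x))" and ?T = "snd ?d ` (V \<inter> fst ?d)"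
  let ?x = "pref_pt N p" and ?b = "\<lambda>w y. \<beta> (chart_inv ?d y) (chart_vec M ?d y w)"
  obtain W where W: "p \<in> W" "open_in N W" "W \<subseteq> U" "W \<subseteq> fst ?c" "open (snd ?c ` W)"
    "smooth_on (snd ?c ` W) ?f"
    "\<And>w x. x \<in> snd ?c ` W \<Longrightarrow> \<beta> (f (chart_inv ?c x)) (tmap N M f (chart_inv ?c x) (chart_vec N ?c x w)) =
      ?b (FD ?f x w) (?f x)"
    "?f ` snd ?c ` W \<subseteq> ?T"
    using pull_in_charts[OF f \<beta> fU p] by metis
  have x: "?x \<in> snd ?c ` W" using W(1) by (simp add: pref_pt_def)
  have fx: "?f ?x = pref_pt M (f p)" by (simp add: pref_pt_def chart_inv_snd[OF N c])
  have tm: "tmap N M f p = FD ?f ?x" by (simp add: tmap_def o_def)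
  have fxT: "?f ?x \<in> ?T" using W(8) x by blast
  have sb: "smooth_on ?T (?b w)" for w by (rule form_on_smooth[OF \<beta> d(1)])
  have db: "(\<lambda>x. ?b w (?f x)) differentiable (at ?x)" for w
    using smooth_on_compose[OF W(5) open_chart_image[OF M d(1) form_on_open[OF \<beta>]] W(6) sb W(8)] x smooth_on_differentiable by blast
  have lin: "linear (\<lambda>w. ?b w (?f x))" if "x \<in> snd ?c ` W" for x
  proof -
    have "?f x \<in> ?T" using W(8) that by blast
    then have "linear (chart_vec M ?d (?f x))" "linear (\<beta> (chart_inv ?d (?f x)))"
      by (auto intro!: linear_chart_vec[OF M d(1)] form_on_linear[OF \<beta>] simp: chart_inv_snd[OF M d(1)])
    from linear_compose[OF this] show ?thesis by (simp add: o_def)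
  qed
  have D: "FD (\<lambda>x. \<beta> (f (chart_inv ?c x)) (tmap N M f (chart_inv ?c x) (chart_vec N ?c x w))) ?x u =
    FD (?b (tmap N M f p w)) (pref_pt M (f p)) (tmap N M f p u) + ?b (FD (\<lambda>x. FD ?f x w) ?x u) (?f ?x)" for w u
  proof -
    have "FD (\<lambda>x. \<beta> (f (chart_inv ?c x)) (tmap N M f (chart_inv ?c x) (chart_vec N ?c x w))) ?x u =
       FD (\<lambda>x. ?b (FD ?f x w) (?f x)) ?x u"
      by (rule fun_cong[OF FD_cong_open[OF W(5) x W(7)]])
    also have "\<dots> = FD (\<lambda>x. ?b (FD ?f ?x w) (?f x)) ?x u + ?b (FD (\<lambda>x. FD ?f x w) ?x u) (?f ?x)"
      by (rule FD_apply[where L="\<lambda>x w. ?b w (?f x)", OF W(5) x lin db])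
        (auto intro: smooth_on_differentiable[OF smooth_on_FD[OF W(6)] x])
    also have "FD (\<lambda>x. ?b (FD ?f ?x w) (?f x)) ?x u = FD (?b (FD ?f ?x w)) (?f ?x) (FD ?f ?x u)"
      by (rule FD_compose[where g="?b (FD ?f ?x w)", OF smooth_on_differentiable[OF W(6) x]
            smooth_on_differentiable[OF sb fxT]])
    finally show ?thesis unfolding fx tm .
  qed
  have "FD (\<lambda>x. FD ?f x w) ?x u = FD (\<lambda>x. FD ?f x u) ?x w" for u w
    by (rule second_derivative_symmetric[OF W(5,6) x])
  then show ?thesis by (simp add: ext_d_def Let_def D)
qed

end

section \<open>Riemann surfaces\<close>

context
  fixes Y :: "('y::{t2_space,second_countable_topology}, complex) atlas"
  assumes Y: "riemann_surface Y"
begin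

lemma riemann_manifold: "manifold Y"
  using Y by (simp add: riemann_surface_def)

text \<open>\<open>chart_vec\<close> is the derivative of a holomorphic transition map, that is,
  multiplication by a complex number.\<close>

lemma chart_vec_mult_i:
  assumes c: "c \<in> Y" and x: "x \<in> snd c ` fst c"
  shows "chart_vec Y c x (\<i> * w) = \<i> * chart_vec Y c x w"
proof -
  note M = riemann_manifold
  let ?d = "pref Y (chart_inv c x)"
  have p: "chart_inv c x \<in> fst c" using chart_inv_in[OF M c x] .
  then have d: "?d \<in> Y" "chart_inv c x \<in> fst ?d" using pref_in[of "chart_inv c x" Y] chart_subset[OF M c] by auto
  have h: "(snd ?d \<circ> chart_inv c) holomorphic_on (snd c ` (fst c \<inter> fst ?d))"
    using Y c d by (auto simp: riemann_surface_def)
  have o: "open (snd c ` (fst c \<inter> fst ?d))"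
    using open_chart_image[OF M c chart_open[OF M d(1)]] by (simp add: Int_commute)
  have "x \<in> snd c ` (fst c \<inter> fst ?d)" using d p snd_chart_inv[OF M c x] by (metis IntI imageI)
  then have "(snd ?d \<circ> chart_inv c has_field_derivative deriv (snd ?d \<circ> chart_inv c) x) (at x)"
    using holomorphic_derivI[OF h o] by blast
  then have "chart_vec Y c x = (*) (deriv (snd ?d \<circ> chart_inv c) x)"
    unfolding chart_vec_def has_field_derivative_def by (rule FD_eqI)
  then show ?thesis by simp
qed

lemma form_on_mult_i:
  assumes "form_on Y U \<beta>"
  shows "form_on Y U (\<lambda>p u. \<beta> p (\<i> * u))"
  unfolding form_on_def
proof (intro conjI ballI allI)
  have l: "linear (\<lambda>u::complex. \<i> * u)" by (simp add: linear_iff algebra_simps)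
  show "linear (\<lambda>u. \<beta> p (\<i> * u))" if "p \<in> U" for p
    using linear_compose[OF l form_on_linear[OF assms that]] by (simp add: o_def)
  show "smooth_on (snd c ` (U \<inter> fst c)) (\<lambda>x. \<beta> (chart_inv c x) (\<i> * chart_vec Y c x w))" if c: "c \<in> Y" for c w
  proof -
    have o: "open (snd c ` (U \<inter> fst c))" by (rule open_chart_image[OF riemann_manifold c form_on_open[OF assms]])
    show ?thesis
      by (subst smooth_on_cong[OF o, of _ "\<lambda>x. \<beta> (chart_inv c x) (chart_vec Y c x (\<i> * w))"])
        (auto simp: chart_vec_mult_i[OF c] intro!: form_on_smooth[OF assms c])
  qed
qed (rule form_on_open[OF assms])

end

section \<open>Lie groups\<close>

locale lie =
  fixes G :: "'h::{t2_space,second_countable_topology} monoid" (structure)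
    and H :: "('h, 'k::euclidean_space) atlas"
  assumes lie_group: "lie_group G H"
begin

lemma group_G: "group G" and H: "manifold H" and carrier: "carrier G = points H"
  and mult_smooth: "smooth_map (prod_atlas H H) H (points H \<times> points H) (\<lambda>(a, b). a \<otimes> b)"
  and inv_smooth: "smooth_map H H (points H) (\<lambda>a. inv a)"
  using lie_group by (auto simp: lie_group_def)

sublocale group G by (rule group_G)

lemma one_in [simp]: "\<one> \<in> points H" and mult_in [simp]: "a \<in> points H \<Longrightarrow> b \<in> points H \<Longrightarrow> a \<otimes> b \<in> points H"
  and inv_in [simp]: "a \<in> points H \<Longrightarrow> inv a \<in> points H"
  using one_closed m_closed inv_closed by (auto simp: carrier)

lemma grp_simps [simp]:
  "a \<in> points H \<Longrightarrow> \<one> \<otimes> a = a" "a \<in> points H \<Longrightarrow> a \<otimes> \<one> = a"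
  "a \<in> points H \<Longrightarrow> inv a \<otimes> a = \<one>" "a \<in> points H \<Longrightarrow> a \<otimes> inv a = \<one>"
  "a \<in> points H \<Longrightarrow> inv (inv a) = a"
  by (auto simp: carrier[symmetric] inv_one)

lemma grp_assoc: "a \<in> points H \<Longrightarrow> b \<in> points H \<Longrightarrow> c \<in> points H \<Longrightarrow> a \<otimes> b \<otimes> c = a \<otimes> (b \<otimes> c)"
  and grp_inv_mult: "a \<in> points H \<Longrightarrow> b \<in> points H \<Longrightarrow> inv (a \<otimes> b) = inv b \<otimes> inv a"
  by (auto simp: carrier[symmetric] m_assoc inv_mult_group)

lemma grp_cancel [simp]:
  "a \<in> points H \<Longrightarrow> b \<in> points H \<Longrightarrow> inv a \<otimes> (a \<otimes> b) = b"
  "a \<in> points H \<Longrightarrow> b \<in> points H \<Longrightarrow> a \<otimes> (inv a \<otimes> b) = b"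
  by (simp_all add: grp_assoc[symmetric])

lemma smooth_mult:
  assumes N: "manifold N" and f: "smooth_map N H U f" and g: "smooth_map N H U g"
  shows "smooth_map N H U (\<lambda>n. f n \<otimes> g n)"
  using smooth_compose[OF N manifold_prod[OF H H] H smap_Pair[OF H H N f g] mult_smooth]
    smap_image[OF f] smap_image[OF g] by auto

lemma smooth_inv:
  assumes N: "manifold N" and f: "smooth_map N H U f"
  shows "smooth_map N H U (\<lambda>n. inv (f n))"
  by (rule smooth_compose[OF N H H f inv_smooth smap_image[OF f]])

lemmas smooth_idH = smap_id[OF H open_in_points]

lemma smooth_left: "a \<in> points H \<Longrightarrow> smooth_map H H (points H) (\<lambda>b. a \<otimes> b)"
  and smooth_right: "a \<in> points H \<Longrightarrow> smooth_map H H (points H) (\<lambda>b. b \<otimes> a)"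
  and smooth_conj: "a \<in> points H \<Longrightarrow> smooth_map H H (points H) (\<lambda>b. a \<otimes> b \<otimes> inv a)"
  by (auto intro!: smooth_mult[OF H] smap_const[OF H H] smooth_idH)

text \<open>The Maurer-Cartan form, with values in the tangent space at the unit.\<close>

definition mc :: "'h \<Rightarrow> 'k \<Rightarrow> 'k" where
  "mc a = tmap H H (\<lambda>b. inv a \<otimes> b) a"

lemma linear_mc: "a \<in> points H \<Longrightarrow> linear (mc a)"
  unfolding mc_def by (rule tmap_linear[OF H H smooth_left]) auto

lemma mc_one: "mc \<one> X = X"
proof -
  have "tmap H H (\<lambda>b. inv \<one> \<otimes> b) \<one> = tmap H H (\<lambda>b. b) \<one>"
    by (rule tmap_cong[OF H H open_in_points]) (auto simp: inv_one)
  then show ?thesis by (simp add: mc_def tmap_id[OF H])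
qed

lemma mc_tmap:
  assumes N: "manifold N" and f: "smooth_map N H U f" and p: "p \<in> U"
  shows "mc (f p) (tmap N H f p v) = tmap N H (\<lambda>n. inv (f p) \<otimes> f n) p v"
  unfolding mc_def
  by (rule tmap_compose[OF N H H f smooth_left _ p, symmetric])
    (use smap_image[OF f] p in auto)

lemma left_field_mc: "a \<in> points H \<Longrightarrow> left_field G H (mc a X) a = X"
  and mc_left_field: "a \<in> points H \<Longrightarrow> mc a (left_field G H Z a) = Z"
proof -
  assume a: "a \<in> points H"
  have "tmap H H (\<lambda>b. a \<otimes> (inv a \<otimes> b)) a X = tmap H H (\<lambda>b. a \<otimes> b) (inv a \<otimes> a) (mc a X)"
    unfolding mc_def by (rule tmap_compose[OF H H H smooth_left smooth_left]) (use a in auto)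
  moreover have "tmap H H (\<lambda>b. a \<otimes> (inv a \<otimes> b)) a = tmap H H (\<lambda>b. b) a"
    by (rule tmap_cong[OF H H open_in_points]) (use a in auto)
  ultimately show "left_field G H (mc a X) a = X" using a by (simp add: left_field_def tmap_id[OF H])
  have "tmap H H (\<lambda>b. inv a \<otimes> (a \<otimes> b)) \<one> Z = tmap H H (\<lambda>b. inv a \<otimes> b) (a \<otimes> \<one>) (left_field G H Z a)"
    unfolding left_field_def by (rule tmap_compose[OF H H H smooth_left smooth_left]) (use a in auto)
  moreover have "tmap H H (\<lambda>b. inv a \<otimes> (a \<otimes> b)) \<one> = tmap H H (\<lambda>b. b) \<one>"
    by (rule tmap_cong[OF H H open_in_points]) (use a in auto)
  ultimately show "mc a (left_field G H Z a) = Z" using a by (simp add: mc_def tmap_id[OF H])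
qed

lemma mc_inj: "a \<in> points H \<Longrightarrow> mc a X = mc a X' \<Longrightarrow> X = X'"
  by (metis left_field_mc)

lemma mc_left:
  assumes a: "a \<in> points H" and b: "b \<in> points H"
  shows "mc (a \<otimes> b) (tmap H H (\<lambda>x. a \<otimes> x) b X) = mc b X"
proof -
  have "mc (a \<otimes> b) (tmap H H (\<lambda>x. a \<otimes> x) b X) = tmap H H (\<lambda>x. inv (a \<otimes> b) \<otimes> (a \<otimes> x)) b X"
    by (rule mc_tmap[OF H smooth_left[OF a] b])
  also have "\<dots> = mc b X" unfolding mc_def
    by (rule fun_cong[OF tmap_cong[OF H H open_in_points b]]) (use a b in \<open>simp add: grp_inv_mult grp_assoc\<close>)
  finally show ?thesis .
qed

abbreviation kappa where "kappa \<equiv> pref H \<one>"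

lemma kappa: "kappa \<in> H" "\<one> \<in> fst kappa"
  using pref_in[OF one_in] by auto

text \<open>For fixed \<open>w\<close>, the value at \<open>n\<close> is the partial derivative in
  \<open>z\<close>, at \<open>z = snd c n\<close>, of the jointly smooth map
  \<open>inv n \<otimes> chart_inv c z\<close>. This map takes the unit as value there, so the
  vectors can all be read in the single chart \<open>kappa\<close>.\<close>

lemma mc_form: "form_on H (points H) mc"
  unfolding form_on_def
proof (intro conjI ballI allI open_in_points linear_mc, assumption)
  fix c w assume c: "c \<in> H"
  let ?P = "prod_atlas eucl H :: ('k \<times> 'h, 'k \<times> 'k) atlas"
  let ?S = "snd c ` fst c"
  have P: "manifold ?P" by (rule manifold_prod[OF mf_eucl H])
  have oSH: "open_in ?P (?S \<times> points H)" by (rule open_in_Times) (auto simp: chart_image_open[OF H c])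
  note in_H = subsetD[OF chart_subset[OF H c]]
  have 1: "smooth_map ?P H (?S \<times> points H) (\<lambda>q. chart_inv c (fst q))"
    by (rule smooth_compose[OF P mf_eucl H smap_fst[OF mf_eucl H oSH] smap_chart_inv[OF H c]]) auto
  have 2: "smooth_map ?P H (?S \<times> points H) (\<lambda>q. inv (snd q) \<otimes> chart_inv c (fst q))"
    by (intro smooth_mult[OF P] smooth_inv[OF P] 1 smap_snd[OF mf_eucl H oSH])
  have "smooth_map H eucl (fst c) (\<lambda>n. chart_coord H kappa (inv (snd (snd c n, n)) \<otimes> chart_inv c (fst (snd c n, n)))
      (tmap eucl H (\<lambda>x. inv (snd (x, n)) \<otimes> chart_inv c (fst (x, n))) (snd c n) w))"
    by (rule smooth_partial_coord[OF H H 2 smap_chart[OF H c] kappa(1)])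
      (use kappa in_H in \<open>auto simp: chart_inv_snd[OF H c]\<close>)
  then have "smooth_map H eucl (fst c) (\<lambda>n. mc n (chart_vec H c (snd c n) w))"
  proof (rule smap_cong[OF H mf_eucl])
    fix n assume n: "n \<in> fst c"
    have "mc (chart_inv c (snd c n)) (chart_vec H c (snd c n) w) = tmap eucl H (\<lambda>z. inv (chart_inv c (snd c n)) \<otimes> chart_inv c z) (snd c n) w"
      unfolding chart_vec_tmap by (rule mc_tmap[OF mf_eucl smap_chart_inv[OF H c]]) (simp add: n)
    then show "chart_coord H kappa (inv (snd (snd c n, n)) \<otimes> chart_inv c (fst (snd c n, n)))
        (tmap eucl H (\<lambda>x. inv (snd (x, n)) \<otimes> chart_inv c (fst (x, n))) (snd c n) w) = mc n (chart_vec H c (snd c n) w)"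
      using in_H[OF n] n chart_coord_pref[OF H one_in] by (simp add: chart_inv_snd[OF H c])
  qed
  then have 3: "smooth_on (snd c ` (fst c \<inter> fst c)) (\<lambda>x. mc (chart_inv c x) (chart_vec H c (snd c (chart_inv c x)) w))"
    using c unfolding smap_eucl_iff[OF H] by blast
  show "smooth_on (snd c ` (points H \<inter> fst c)) (\<lambda>x. mc (chart_inv c x) (chart_vec H c x w))"
    using chart_subset[OF H c] 3
    by (subst smooth_on_cong[of _ _ "\<lambda>x. mc (chart_inv c x) (chart_vec H c (snd c (chart_inv c x)) w)"])
      (auto simp: inf_absorb2 chart_image_open[OF H c] chart_inv_snd[OF H c])
qed

text \<open>The Maurer-Cartan form \<open>rho\<close> and the left-invariant vector fields \<open>lam\<close> in a chart \<open>c\<close>.\<close>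

definition rho where "rho c x w = mc (chart_inv c x) (chart_vec H c x w)"

definition lam where "lam c x Z = chart_coord H c (chart_inv c x) (left_field G H Z (chart_inv c x))"

text \<open>Smoothness of \<open>mc\<close> makes \<open>rho\<close> a smooth family; its inverse
  \<open>lam\<close> thereby becomes smooth, which is the smoothness of left-invariant
  fields.\<close>

lemma inverse_family_rho:
  assumes c: "c \<in> H"
  shows "inverse_family (snd c ` fst c) (rho c) (lam c)"
proof (rule inverse_family.intro)
  let ?S = "snd c ` fst c"
  show "open ?S" by (rule chart_image_open[OF H c])
  fix x w assume x: "x \<in> ?S"
  have a: "chart_inv c x \<in> fst c" "chart_inv c x \<in> points H" using chart_inv_in[OF H c x] chart_subset[OF H c] by auto
  show "linear (rho c x)"
    unfolding rho_def using linear_compose[OF linear_chart_vec[OF H c x] linear_mc[OF a(2)]] by (simp add: o_def)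
  show "lam c x (rho c x w) = w"
    by (simp add: rho_def lam_def left_field_mc[OF a(2)] chart_coord_vec[OF H c x])
  show "rho c x (lam c x w) = w"
    using chart_vec_coord[OF H c a(1)] by (simp add: rho_def lam_def mc_left_field[OF a(2)] snd_chart_inv[OF H c x])
next
  show "smooth_on (snd c ` fst c) (\<lambda>x. rho c x w)" for w
    using form_on_smooth[OF mc_form c, of w] chart_subset[OF H c] by (simp add: rho_def inf_absorb2)
qed

lemma pref_pt_one: "pref_pt H \<one> \<in> snd kappa ` fst kappa" "chart_inv kappa (pref_pt H \<one>) = \<one>"
  using kappa by (auto simp: pref_pt_def chart_inv_snd[OF H])

lemma rho_one: "rho kappa (pref_pt H \<one>) w = w"
  by (simp add: rho_def pref_pt_one mc_one chart_vec_pref[OF H])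

lemma lam_one: "lam kappa (pref_pt H \<one>) w = w"
  using inverse_family.M_L[OF inverse_family_rho[OF kappa(1)] pref_pt_one(1)] by (metis rho_one)

text \<open>\<open>rho\<close> and \<open>lam\<close> are both the identity at the unit, so passing
  to the inverse only changes the sign of the derivative.\<close>

lemma FD_lam: "FD (\<lambda>x. lam kappa x Z) (pref_pt H \<one>) v = - FD (\<lambda>x. rho kappa x Z) (pref_pt H \<one>) v"
  using FD_eqI[OF inverse_family.M_has_derivative[OF inverse_family_rho[OF kappa(1)] pref_pt_one(1)], of Z]
  by (simp add: lam_one)

abbreviation lbr where "lbr \<equiv> lie_bracket G H"

text \<open>The bracket is built from derivatives of \<open>lam\<close>, the exterior derivative
  from derivatives of \<open>rho\<close>, and \<open>FD_lam\<close> relates the two. Bilinearity and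
  skew symmetry of the bracket are inherited from the exterior derivative.\<close>

lemma mc_structure_one: "ext_d H mc \<one> u v = - lbr u v"
proof -
  have "left_field G H Z \<one> = Z" for Z
    using left_field_mc[of \<one> Z] by (simp add: mc_one)
  then have "lbr u v = FD (\<lambda>x. lam kappa x v) (pref_pt H \<one>) u - FD (\<lambda>x. lam kappa x u) (pref_pt H \<one>) v"
    by (simp add: lie_bracket_def field_bracket_def lam_def Let_def)
  then show ?thesis by (simp add: FD_lam ext_d_def rho_def Let_def)
qed

lemma bilinear_lbr: "bilinear lbr"
proof -
  have "lbr = (\<lambda>u v. - ext_d H mc \<one> u v)" by (simp add: mc_structure_one fun_eq_iff)
  then show ?thesis
    using ext_d_bilinear[OF H mc_form one_in] by (auto simp: bilinear_def intro: linear_compose_neg)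
qed

lemma lbr_skew: "lbr u v = - lbr v u"
  using ext_d_skew[OF H, of mc \<one> u v] by (metis add.inverse_inverse mc_structure_one)

lemma lbr_self [simp]: "lbr u u = 0"
proof -
  have "2 *\<^sub>R lbr u u = 0" unfolding scaleR_2 by (metis add.right_inverse lbr_skew)
  then show ?thesis by simp
qed

lemmas lbr_simps = bilinear_ladd[OF bilinear_lbr] bilinear_radd[OF bilinear_lbr]
  bilinear_lneg[OF bilinear_lbr] bilinear_rneg[OF bilinear_lbr] bilinear_lsub[OF bilinear_lbr] bilinear_rsub[OF bilinear_lbr]
  bilinear_lmul[OF bilinear_lbr] bilinear_rmul[OF bilinear_lbr] bilinear_lzero[OF bilinear_lbr] bilinear_rzero[OF bilinear_lbr]

text \<open>Left invariance of \<open>mc\<close> moves the equation from the unit to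
  \<open>a\<close>.\<close>

lemma mc_structure:
  assumes a: "a \<in> points H"
  shows "ext_d H mc a u v = - lbr (mc a u) (mc a v)"
proof -
  have "ext_d H mc a u v = ext_d H (\<lambda>b w. mc (inv a \<otimes> b) (tmap H H (\<lambda>b. inv a \<otimes> b) b w)) a u v"
    by (rule ext_d_cong[OF H open_in_points a]) (rule mc_left[OF inv_in[OF a], symmetric])
  also have "\<dots> = ext_d H mc (inv a \<otimes> a) (mc a u) (mc a v)"
    unfolding mc_def[of a]
    by (rule ext_d_pull[OF H H smooth_left[OF inv_in[OF a]] mc_form smap_image[OF smooth_left[OF inv_in[OF a]]] a])
  finally show ?thesis using a by (simp add: mc_structure_one)
qed

section \<open>The adjoint action and its derivative\<close>

abbreviation AD where "AD \<equiv> Ad G H"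

lemma linear_Ad: "a \<in> points H \<Longrightarrow> linear (AD a)"
  unfolding Ad_def by (rule tmap_linear[OF H H smooth_conj]) auto

lemma mc_conj:
  assumes a: "a \<in> points H" and b: "b \<in> points H"
  shows "mc (a \<otimes> b \<otimes> inv a) (tmap H H (\<lambda>x. a \<otimes> x \<otimes> inv a) b X) = AD a (mc b X)"
proof -
  have "mc (a \<otimes> b \<otimes> inv a) (tmap H H (\<lambda>x. a \<otimes> x \<otimes> inv a) b X) =
      tmap H H (\<lambda>x. a \<otimes> (inv b \<otimes> x) \<otimes> inv a) b X"
    by (subst mc_tmap[OF H smooth_conj[OF a] b])
      (use a b in \<open>auto simp: grp_inv_mult grp_assoc intro!: fun_cong[OF tmap_cong[OF H H open_in_points]]\<close>)
  also have "\<dots> = tmap H H (\<lambda>x. a \<otimes> x \<otimes> inv a) (inv b \<otimes> b) (mc b X)"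
    unfolding mc_def by (rule tmap_compose[OF H H H smooth_left smooth_conj]) (use a b in auto)
  finally show ?thesis using b by (simp add: Ad_def)
qed

lemma mc_right:
  assumes a: "a \<in> points H" and b: "b \<in> points H"
  shows "mc (b \<otimes> a) (tmap H H (\<lambda>x. x \<otimes> a) b X) = AD (inv a) (mc b X)"
proof -
  have "mc (b \<otimes> a) (tmap H H (\<lambda>x. x \<otimes> a) b X) = tmap H H (\<lambda>x. inv a \<otimes> (inv b \<otimes> x) \<otimes> inv (inv a)) b X"
    by (subst mc_tmap[OF H smooth_right[OF a] b])
      (use a b in \<open>auto simp: grp_inv_mult grp_assoc intro!: fun_cong[OF tmap_cong[OF H H open_in_points]]\<close>)
  also have "\<dots> = tmap H H (\<lambda>x. inv a \<otimes> x \<otimes> inv (inv a)) (inv b \<otimes> b) (mc b X)"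
    unfolding mc_def by (rule tmap_compose[OF H H H smooth_left smooth_conj]) (use a b in auto)
  finally show ?thesis using b by (simp add: Ad_def)
qed

text \<open>Conjugation pulls the Maurer-Cartan form back to \<open>AD a\<close> applied to it; the
  claim compares the exterior derivatives of the two at the unit.\<close>

lemma Ad_lbr:
  assumes a: "a \<in> points H"
  shows "AD a (lbr u v) = lbr (AD a u) (AD a v)"
proof -
  let ?c = "\<lambda>x. a \<otimes> x \<otimes> inv a"
  have "- lbr (AD a u) (AD a v) = ext_d H mc (?c \<one>) (AD a u) (AD a v)"
    using a by (simp add: mc_structure_one)
  also have "\<dots> = ext_d H (\<lambda>b w. mc (?c b) (tmap H H ?c b w)) \<one> u v"
    unfolding Ad_def by (rule ext_d_pull[OF H H smooth_conj[OF a] mc_form smap_image[OF smooth_conj[OF a]] one_in, symmetric])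
  also have "\<dots> = ext_d H (\<lambda>b w. AD a (mc b w)) \<one> u v"
    by (rule ext_d_cong[OF H open_in_points one_in]) (simp add: mc_conj a)
  also have "\<dots> = AD a (- lbr u v)"
    by (simp add: ext_d_compose_linear[OF H linear_Ad[OF a] mc_form one_in] mc_structure_one)
  finally show ?thesis by (simp add: linear_neg[OF linear_Ad[OF a]])
qed

lemma Ad_one: "AD \<one> X = X"
proof -
  have "tmap H H (\<lambda>b. \<one> \<otimes> b \<otimes> inv \<one>) \<one> = tmap H H (\<lambda>b. b) \<one>"
    by (rule tmap_cong[OF H H open_in_points]) (auto simp: inv_one)
  then show ?thesis by (simp add: Ad_def tmap_id[OF H])
qed

lemma Ad_mult:
  assumes a: "a \<in> points H" and b: "b \<in> points H"
  shows "AD (a \<otimes> b) X = AD a (AD b X)"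
proof -
  have "AD (a \<otimes> b) X = tmap H H (\<lambda>x. a \<otimes> (b \<otimes> x \<otimes> inv b) \<otimes> inv a) \<one> X"
    unfolding Ad_def by (rule fun_cong[OF tmap_cong[OF H H open_in_points]]) (use a b in \<open>auto simp: grp_inv_mult grp_assoc\<close>)
  also have "\<dots> = tmap H H (\<lambda>x. a \<otimes> x \<otimes> inv a) (b \<otimes> \<one> \<otimes> inv b) (AD b X)"
    unfolding Ad_def[of _ _ b] by (rule tmap_compose[OF H H H smooth_conj smooth_conj]) (use a b in auto)
  finally show ?thesis using b by (simp add: Ad_def)
qed

lemma Ad_inv [simp]: "a \<in> points H \<Longrightarrow> AD (inv a) (AD a X) = X" "a \<in> points H \<Longrightarrow> AD a (AD (inv a) X) = X"
  by (simp_all add: Ad_mult[symmetric] Ad_one)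

text \<open>Writing \<open>Ad b\<^sup>-\<^sup>1\<close> as the Maurer-Cartan form applied to a right-invariant field, its derivative at the unit
  is a difference of mixed partial derivatives of the product.\<close>

lemma Ad_inv_has_derivative:
  "((\<lambda>x. AD (inv (chart_inv kappa x)) Y) has_derivative (\<lambda>X. - lbr X Y)) (at (pref_pt H \<one>))"
proof -
  let ?c = kappa and ?x = "pref_pt H \<one>"
  let ?S = "snd ?c ` fst ?c"
  note c = kappa
  interpret inverse_family ?S "rho ?c" "lam ?c" by (rule inverse_family_rho[OF c(1)])
  have oSS: "open (?S \<times> ?S)" by (intro open_Times S)
  have s0: "smooth_map eucl H (?S \<times> ?S) (\<lambda>q. chart_inv ?c (fst q))" "smooth_map eucl H (?S \<times> ?S) (\<lambda>q. chart_inv ?c (snd q))"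
    by (rule smooth_compose[OF mf_eucl mf_eucl H _ smap_chart_inv[OF H c(1)]],
        auto simp: smap_eucl_eucl oSS smooth_on_fst smooth_on_snd)+
  have s1: "smooth_map eucl H (?S \<times> ?S) (\<lambda>q. chart_inv ?c (fst q) \<otimes> chart_inv ?c (snd q))"
    by (rule smooth_mult[OF mf_eucl s0])
  let ?W = "{q \<in> ?S \<times> ?S. chart_inv ?c (fst q) \<otimes> chart_inv ?c (snd q) \<in> fst ?c}"
  have oW: "open ?W" using smap_vimage[OF s1 chart_open[OF H c(1)]] by simp
  \<comment> \<open>The product in the chart \<open>kappa\<close>. Its derivative in the second slot
    at the unit gives the left-invariant fields \<open>lam\<close>, in the first slot the
    right-invariant field \<open>r\<close> of \<open>Y\<close>.\<close>
  define m where "m q = snd ?c (chart_inv ?c (fst q) \<otimes> chart_inv ?c (snd q))" for q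
  have "smooth_map eucl eucl ?W m" unfolding m_def
    by (rule smooth_compose[OF mf_eucl H mf_eucl smap_subset[OF mf_eucl H s1] smap_chart[OF H c(1)]])
      (use oW in auto)
  then have m: "smooth_on ?W m" by (simp add: smap_eucl_eucl)
  have pt: "chart_inv ?c y \<in> fst ?c" "chart_inv ?c y \<in> points H" if "y \<in> ?S" for y
    using chart_inv_in[OF H c(1) that] chart_subset[OF H c(1)] by auto
  have xW: "(?x, y) \<in> ?W" "(y, ?x) \<in> ?W" if "y \<in> ?S" for y
    using that pt[OF that] pref_pt_one by auto
  have coordx: "chart_coord H ?c \<one> Z = Z" "chart_vec H ?c ?x Z = Z" for Z
    using chart_coord_pref[OF H one_in] chart_vec_pref[OF H one_in] by auto
  define r where "r y = FD m (?x, y) (Y, 0)" for y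
  have r: "chart_coord H ?c (chart_inv ?c y) (tmap H H (\<lambda>x. x \<otimes> chart_inv ?c y) \<one> Y) = r y" if y: "y \<in> ?S" for y
  proof -
    have d: "((\<lambda>z. (z, y)) has_derivative (\<lambda>w. (w, 0))) (at ?x)" by (auto intro!: derivative_eq_intros)
    have im: "?x \<in> ?S" "\<one> \<otimes> chart_inv ?c y \<in> fst ?c" using pref_pt_one pt[OF y] by auto
    have x': "?x \<in> snd ?c ` (points H \<inter> fst ?c \<inter> (\<lambda>x. x \<otimes> chart_inv ?c y) -` fst ?c)"
      using c im by (auto simp: pref_pt_def)
    have "tmap H H (\<lambda>x. x \<otimes> chart_inv ?c y) (chart_inv ?c ?x) (chart_vec H ?c ?x Y) =
      chart_vec H ?c (snd ?c (chart_inv ?c ?x \<otimes> chart_inv ?c y)) (FD (\<lambda>z. snd ?c (chart_inv ?c z \<otimes> chart_inv ?c y)) ?x Y)"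
      by (rule tmap_in_charts(1)[OF H H smooth_right[OF pt(2)[OF y]] c(1) c(1) x'])
    then have "tmap H H (\<lambda>x. x \<otimes> chart_inv ?c y) \<one> Y = chart_vec H ?c y (FD (\<lambda>z. m (z, y)) ?x Y)"
      using pt[OF y] by (simp add: pref_pt_one coordx snd_chart_inv[OF H c(1) y] m_def)
    moreover have "FD (\<lambda>z. m (z, y)) ?x Y = r y"
      using FD_eqI[OF has_derivative_compose[OF d smooth_on_has_FD[OF m xW(1)[OF y]]]] by (simp add: r_def)
    ultimately show ?thesis by (simp add: chart_coord_vec[OF H c(1) y])
  qed
  have l: "lam ?c y Z = FD m (y, ?x) (0, Z)" if y: "y \<in> ?S" for y Z
  proof -
    have d: "((\<lambda>z. (y, z)) has_derivative (\<lambda>w. (0, w))) (at ?x)" by (auto intro!: derivative_eq_intros)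
    have im: "?x \<in> ?S" "chart_inv ?c y \<otimes> \<one> \<in> fst ?c" using pref_pt_one pt[OF y] by auto
    have x': "?x \<in> snd ?c ` (points H \<inter> fst ?c \<inter> (\<lambda>x. chart_inv ?c y \<otimes> x) -` fst ?c)"
      using c im by (auto simp: pref_pt_def)
    have "tmap H H (\<lambda>x. chart_inv ?c y \<otimes> x) (chart_inv ?c ?x) (chart_vec H ?c ?x Z) =
      chart_vec H ?c (snd ?c (chart_inv ?c y \<otimes> chart_inv ?c ?x)) (FD (\<lambda>z. snd ?c (chart_inv ?c y \<otimes> chart_inv ?c z)) ?x Z)"
      by (rule tmap_in_charts(1)[OF H H smooth_left[OF pt(2)[OF y]] c(1) c(1) x'])
    then have "left_field G H Z (chart_inv ?c y) = chart_vec H ?c y (FD (\<lambda>z. m (y, z)) ?x Z)"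
      using pt[OF y] by (simp add: left_field_def pref_pt_one coordx snd_chart_inv[OF H c(1) y] m_def)
    moreover have "FD (\<lambda>z. m (y, z)) ?x Z = FD m (y, ?x) (0, Z)"
      using FD_eqI[OF has_derivative_compose[OF d smooth_on_has_FD[OF m xW(2)[OF y]]]] by simp
    ultimately show ?thesis by (simp add: lam_def chart_coord_vec[OF H c(1) y])
  qed
  note x = pref_pt_one(1)
  have r_x: "r ?x = Y" using r[OF x] tmap_id[OF H one_in]
    by (simp add: pref_pt_one coordx) (metis (no_types, lifting) tmap_cong[OF H H open_in_points one_in] grp_simps(2))
  have dr: "(r has_derivative (\<lambda>X. FD (\<lambda>q. FD m q (Y, 0)) (?x, ?x) (0, X))) (at ?x)"
  proof -
    have d: "((\<lambda>z. (?x, z)) has_derivative (\<lambda>w. (0, w))) (at ?x)" by (auto intro!: derivative_eq_intros)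
    show ?thesis unfolding r_def
      by (rule has_derivative_compose[OF d smooth_on_has_FD[OF smooth_on_FD[OF m] xW(1)[OF x]]])
  qed
  have dl: "FD (\<lambda>y. lam ?c y X) ?x Y = FD (\<lambda>q. FD m q (0, X)) (?x, ?x) (Y, 0)" for X
  proof -
    have d: "((\<lambda>z. (z, ?x)) has_derivative (\<lambda>w. (w, 0))) (at ?x)" by (auto intro!: derivative_eq_intros)
    have "FD (\<lambda>y. lam ?c y X) ?x = FD (\<lambda>y. FD m (y, ?x) (0, X)) ?x"
      by (rule FD_cong_open[OF S x l])
    then show ?thesis
      using FD_eqI[OF has_derivative_compose[OF d smooth_on_has_FD[OF smooth_on_FD[OF m] xW(2)[OF x]]]] by simp
  qed
  \<comment> \<open>\<open>mc\<close> of the right translate of \<open>Y\<close>: the adjoint action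
    is expressed by \<open>rho\<close> and \<open>r\<close>, both of which can be
    differentiated.\<close>
  have h: "AD (inv (chart_inv ?c y)) Y = rho ?c y (r y)" if y: "y \<in> ?S" for y
    using mc_right[OF pt(2)[OF y] one_in, of Y] pt[OF y] chart_vec_coord[OF H c(1) pt(1)[OF y]]
    by (simp add: rho_def r[OF y, symmetric] mc_one snd_chart_inv[OF H c(1) y])
  have "((\<lambda>y. rho ?c y (r y)) has_derivative (\<lambda>X. FD (\<lambda>y. rho ?c y (r ?x)) ?x X + rho ?c ?x (FD r ?x X))) (at ?x)"
    by (rule has_derivative_apply[OF S x lin smooth_on_differentiable[OF sm x]]) (use dr in \<open>auto simp: differentiable_def\<close>)
  moreover have "FD (\<lambda>y. rho ?c y (r ?x)) ?x X + rho ?c ?x (FD r ?x X) = - lbr X Y" for X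
  proof -
    \<comment> \<open>Both sides are the same mixed second derivative of \<open>m\<close>. What then
      remains is the exterior derivative of \<open>mc\<close> at the unit, which is minus the
      bracket.\<close>
    have "FD r ?x X = FD (\<lambda>y. lam ?c y X) ?x Y"
      unfolding FD_eqI[OF dr] dl by (rule second_derivative_symmetric[OF oW m xW(1)[OF x]])
    also have "\<dots> = - FD (\<lambda>y. rho ?c y X) ?x Y" by (rule FD_lam)
    finally show ?thesis
      using mc_structure_one[of X Y] unfolding ext_d_def Let_def rho_def[symmetric]
      by (simp add: rho_one r_x)
  qed
  ultimately show ?thesis
    by (subst has_derivative_cong_open[OF S x h]) auto
qed

text \<open>Moving both arguments of \<open>g\<close> by the inverse of the group element with
  coordinates \<open>x\<close> gives a constant function of \<open>x\<close>; its derivative at the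
  unit is computed by \<open>Ad_inv_has_derivative\<close>.\<close>

lemma ad_invariant:
  assumes g: "ad_invariant_form G H g"
  shows "g (lbr X Y) Z + g Y (lbr X Z) = 0"
proof -
  have bl: "bounded_bilinear g" using g by (simp add: ad_invariant_form_def bilinear_conv_bounded_bilinear)
  let ?x = "pref_pt H \<one>" and ?f = "\<lambda>Y x. AD (inv (chart_inv kappa x)) Y"
  have 1: "((\<lambda>x. g (?f Y x) (?f Z x)) has_derivative (\<lambda>X. g (?f Y ?x) (- lbr X Z) + g (- lbr X Y) (?f Z ?x))) (at ?x)"
    by (rule bounded_bilinear.FDERIV[OF bl Ad_inv_has_derivative Ad_inv_has_derivative])
  have eq: "g (?f Y x) (?f Z x) = g Y Z" if "x \<in> snd kappa ` fst kappa" for x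
    using g chart_inv_in[OF H kappa(1) that] chart_subset[OF H kappa(1)] by (auto simp: ad_invariant_form_def carrier subset_iff)
  have 2: "((\<lambda>x. g (?f Y x) (?f Z x)) has_derivative (\<lambda>X. 0)) (at ?x)"
    by (subst has_derivative_cong_open[OF chart_image_open[OF H kappa(1)] pref_pt_one(1) eq]) auto
  have "g Y (- lbr X Z) + g (- lbr X Y) Z = 0"
    using fun_cong[OF has_derivative_unique[OF 1 2], of X] by (simp add: pref_pt_one inv_one Ad_one)
  then show ?thesis using g by (simp add: ad_invariant_form_def bilinear_lneg bilinear_rneg)
qed

end

section \<open>Principal bundles\<close>

locale pb =
  fixes X :: "('h::{t2_space,second_countable_topology}, 'k::euclidean_space,
               'p::{t2_space,second_countable_topology}, 'q::euclidean_space,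
               'm::{t2_space,second_countable_topology}, 'n::euclidean_space) pbundle"
  assumes principal: "principal_bundle X"

sublocale pb \<subseteq> lie "grp X" "grpM X"
  using principal by (simp add: principal_bundle_def lie_def)

context pb
begin

abbreviation mul (infixl "\<cdot>" 70) where "a \<cdot> b \<equiv> a \<otimes>\<^bsub>grp X\<^esub> b"
abbreviation iv where "iv a \<equiv> inv\<^bsub>grp X\<^esub> a"
abbreviation HH where "HH \<equiv> grpM X"
abbreviation PP where "PP \<equiv> tot X"
abbreviation MM where "MM \<equiv> base X"
abbreviation one where "one \<equiv> \<one>\<^bsub>grp X\<^esub>"

lemma P: "manifold PP" and M: "manifold MM"
  and proj_smooth: "smooth_map PP MM (points PP) (proj X)"
  and act_smooth: "smooth_map (prod_atlas PP HH) PP (points PP \<times> points HH) (\<lambda>(\<xi>, a). act X \<xi> a)"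
  and act_one [simp]: "\<xi> \<in> points PP \<Longrightarrow> act X \<xi> one = \<xi>"
  and proj_act [simp]: "\<xi> \<in> points PP \<Longrightarrow> a \<in> points HH \<Longrightarrow> proj X (act X \<xi> a) = proj X \<xi>"
  and act_mult: "\<xi> \<in> points PP \<Longrightarrow> a \<in> points HH \<Longrightarrow> b \<in> points HH \<Longrightarrow> act X \<xi> (a \<cdot> b) = act X (act X \<xi> a) b"
  using principal by (auto simp: principal_bundle_def)

lemma act_in [simp]: "\<xi> \<in> points PP \<Longrightarrow> a \<in> points HH \<Longrightarrow> act X \<xi> a \<in> points PP"
  using smap_image[OF act_smooth] by auto

lemma proj_in [simp]: "\<xi> \<in> points PP \<Longrightarrow> proj X \<xi> \<in> points MM"
  using smap_image[OF proj_smooth] by auto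

text \<open>\<open>\<Psi>\<close> is only the group component of the inverse of
  \<open>\<Phi>\<close>; the base component is always the projection.\<close>

definition trivializes where
  "trivializes U \<Phi> \<Psi> \<longleftrightarrow> open_in MM U \<and> smooth_map (prod_atlas MM HH) PP (U \<times> points HH) \<Phi> \<and>
    smooth_map PP HH {\<xi> \<in> points PP. proj X \<xi> \<in> U} \<Psi> \<and>
    (\<forall>\<xi>\<in>points PP. proj X \<xi> \<in> U \<longrightarrow> \<Phi> (proj X \<xi>, \<Psi> \<xi>) = \<xi>) \<and>
    (\<forall>z\<in>U. \<forall>a\<in>points HH. \<Phi> (z, a) \<in> points PP \<and> proj X (\<Phi> (z, a)) = z \<and> \<Psi> (\<Phi> (z, a)) = a \<and>
      (\<forall>b\<in>points HH. \<Phi> (z, a \<cdot> b) = act X (\<Phi> (z, a)) b))"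

lemma trivializesD:
  assumes "trivializes U \<Phi> \<Psi>"
  shows "open_in MM U"
    "smooth_map (prod_atlas MM HH) PP (U \<times> points HH) \<Phi>"
    "smooth_map PP MM {\<xi> \<in> points PP. proj X \<xi> \<in> U} (\<lambda>\<xi>. proj X \<xi>)"
    "smooth_map PP HH {\<xi> \<in> points PP. proj X \<xi> \<in> U} \<Psi>"
    "\<And>\<xi>. \<xi> \<in> points PP \<Longrightarrow> proj X \<xi> \<in> U \<Longrightarrow> \<Phi> (proj X \<xi>, \<Psi> \<xi>) = \<xi>"
    "\<And>z a. z \<in> U \<Longrightarrow> a \<in> points HH \<Longrightarrow> \<Phi> (z, a) \<in> points PP \<and> proj X (\<Phi> (z, a)) = z \<and> \<Psi> (\<Phi> (z, a)) = a"
    "\<And>z a b. z \<in> U \<Longrightarrow> a \<in> points HH \<Longrightarrow> b \<in> points HH \<Longrightarrow> \<Phi> (z, a \<cdot> b) = act X (\<Phi> (z, a)) b"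
  using assms smap_subset[OF P M proj_smooth smap_vimage[OF proj_smooth, of U]]
  by (auto simp: trivializes_def)

lemma trivialization:
  assumes "x \<in> points MM"
  shows "\<exists>U \<Phi> \<Psi>. x \<in> U \<and> trivializes U \<Phi> \<Psi>"
proof -
  obtain U \<Phi> \<Psi> where t: "x \<in> U" "open_in MM U"
        "smooth_map (prod_atlas MM HH) PP (U \<times> points HH) \<Phi>"
        "smooth_map PP (prod_atlas MM HH) {\<xi> \<in> points PP. proj X \<xi> \<in> U} \<Psi>"
        "\<Phi> ` (U \<times> points HH) = {\<xi> \<in> points PP. proj X \<xi> \<in> U}" "\<Psi> ` {\<xi> \<in> points PP. proj X \<xi> \<in> U} = U \<times> points HH"
        "\<forall>t\<in>U \<times> points HH. \<Psi> (\<Phi> t) = t" "\<forall>\<xi>\<in>{\<xi> \<in> points PP. proj X \<xi> \<in> U}. \<Phi> (\<Psi> \<xi>) = \<xi>"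
        "\<forall>z\<in>U. \<forall>a\<in>points HH. proj X (\<Phi> (z, a)) = z \<and> (\<forall>b\<in>points HH. \<Phi> (z, a \<cdot> b) = act X (\<Phi> (z, a)) b)"
    using bspec[OF principal[unfolded principal_bundle_def Let_def, THEN conjunct2, THEN conjunct2, THEN conjunct2,
          THEN conjunct2, THEN conjunct2, THEN conjunct2] assms]
    by (elim exE conjE) (rule that)
  have E: "open_in PP {\<xi> \<in> points PP. proj X \<xi> \<in> U}" by (rule smap_vimage[OF proj_smooth t(2)])
  have fs: "fst (\<Psi> \<xi>) = proj X \<xi>" "\<Phi> (proj X \<xi>, snd (\<Psi> \<xi>)) = \<xi>" if "\<xi> \<in> points PP" "proj X \<xi> \<in> U" for \<xi>
  proof -
    have 1: "\<Psi> \<xi> \<in> U \<times> points HH" "\<Phi> (\<Psi> \<xi>) = \<xi>" using t(6,8) that by auto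
    have "proj X (\<Phi> (z, a)) = z" if "z \<in> U" "a \<in> points HH" for z a using t(9) that by blast
    from this[of "fst (\<Psi> \<xi>)" "snd (\<Psi> \<xi>)"] show a: "fst (\<Psi> \<xi>) = proj X \<xi>"
      using 1 by (simp add: mem_Times_iff)
    show "\<Phi> (proj X \<xi>, snd (\<Psi> \<xi>)) = \<xi>" using 1 by (simp add: a[symmetric])
  qed
  have "smooth_map PP HH {\<xi> \<in> points PP. proj X \<xi> \<in> U} (\<lambda>\<xi>. snd (\<Psi> \<xi>))"
    by (rule smooth_compose[OF P manifold_prod[OF M H] H t(4) smap_snd[OF M H open_in_Times[OF t(2) open_in_points]]])
      (simp add: t(6))
  moreover have "\<Phi> (z, a) \<in> points PP \<and> proj X (\<Phi> (z, a)) = z \<and> snd (\<Psi> (\<Phi> (z, a))) = a"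
    if "z \<in> U" "a \<in> points HH" for z a
  proof -
    have "\<Phi> (z, a) \<in> \<Phi> ` (U \<times> points HH)" using that by auto
    then show ?thesis using t(5,7,9) that by auto
  qed
  ultimately have "trivializes U \<Phi> (\<lambda>\<xi>. snd (\<Psi> \<xi>))"
    unfolding trivializes_def using t(2,3,9) fs(2) by simp
  then show ?thesis using t(1) by blast
qed

lemma smooth_act:
  assumes N: "manifold N" and f: "smooth_map N PP U f" and b: "smooth_map N HH U b"
  shows "smooth_map N PP U (\<lambda>n. act X (f n) (b n))"
  using smooth_compose[OF N manifold_prod[OF P H] P smap_Pair[OF P H N f b] act_smooth]
    smap_image[OF f] smap_image[OF b] by auto

text \<open>A trivialization turns the action on a fibre into right multiplication of the group on
  itself: \<open>act X \<xi> a = \<Phi> (proj X \<xi>, \<Psi> \<xi> \<cdot> a)\<close>.\<close>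

lemma fibre_translation:
  assumes "\<xi> \<in> points PP" "\<xi>' \<in> points PP" "proj X \<xi> = proj X \<xi>'"
  shows "\<exists>!a. a \<in> points HH \<and> act X \<xi> a = \<xi>'"
proof -
  have x: "proj X \<xi> \<in> points MM" using assms by simp
  obtain U \<Phi> \<Psi> where t1: "proj X \<xi> \<in> U" and T: "trivializes U \<Phi> \<Psi>"
    using trivialization[OF x] by blast
  note t = t1 trivializesD[OF T]
  have p: "\<Psi> \<xi> \<in> points HH" "\<Psi> \<xi>' \<in> points HH" using smap_image[OF t(5)] assms t(1) by auto
  have eq: "act X \<xi> a = \<Phi> (proj X \<xi>, \<Psi> \<xi> \<cdot> a)" if "a \<in> points HH" for a
    using t(8)[OF t(1) p(1) that] t(6)[OF assms(1) t(1)] by simp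
  show ?thesis
  proof
    show "iv (\<Psi> \<xi>) \<cdot> \<Psi> \<xi>' \<in> points HH \<and> act X \<xi> (iv (\<Psi> \<xi>) \<cdot> \<Psi> \<xi>') = \<xi>'"
      using p t(6)[OF assms(2)] t(1) assms(3) by (simp add: eq)
    show "a = iv (\<Psi> \<xi>) \<cdot> \<Psi> \<xi>'" if a: "a \<in> points HH \<and> act X \<xi> a = \<xi>'" for a
    proof -
      have "\<Psi> \<xi>' = \<Psi> \<xi> \<cdot> a" using a eq[of a] t(7)[OF t(1), of "\<Psi> \<xi> \<cdot> a"] p by simp
      then show ?thesis using p a by simp
    qed
  qed
qed

lemma translator:
  assumes "\<xi> \<in> points PP" "\<xi>' \<in> points PP" "proj X \<xi> = proj X \<xi>'"
  shows translator_in: "translator X \<xi> \<xi>' \<in> points HH" and act_translator: "act X \<xi> (translator X \<xi> \<xi>') = \<xi>'"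
  using theI'[OF fibre_translation[OF assms]] by (auto simp: translator_def)

lemma act_free: "\<xi> \<in> points PP \<Longrightarrow> a \<in> points HH \<Longrightarrow> b \<in> points HH \<Longrightarrow> act X \<xi> a = act X \<xi> b \<Longrightarrow> a = b"
  using fibre_translation[of \<xi> "act X \<xi> b"] by (metis act_in proj_act)

lemma translator_act [simp]: "\<xi> \<in> points PP \<Longrightarrow> a \<in> points HH \<Longrightarrow> translator X \<xi> (act X \<xi> a) = a"
  using act_free[of \<xi> a "translator X \<xi> (act X \<xi> a)"] translator[of \<xi> "act X \<xi> a"] by simp

text \<open>The translator is only defined on pairs of points of the same fibre; locally it extends to a smooth
  function of arbitrary pairs.\<close>

lemma translator_extension:
  assumes x: "x \<in> points MM"
  obtains U T where "x \<in> U" "open_in MM U"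
    "smooth_map (prod_atlas PP PP) HH {p \<in> points PP \<times> points PP. proj X (fst p) \<in> U \<and> proj X (snd p) \<in> U} T"
    "\<forall>\<xi>\<in>points PP. \<forall>\<xi>'\<in>points PP. proj X \<xi> = proj X \<xi>' \<and> proj X \<xi> \<in> U \<longrightarrow> T (\<xi>, \<xi>') = translator X \<xi> \<xi>'"
proof -
  obtain U \<Phi> \<Psi> where t1: "x \<in> U" and T: "trivializes U \<Phi> \<Psi>"
    using trivialization[OF x] by blast
  note t = t1 trivializesD[OF T]
  let ?E = "{\<xi> \<in> points PP. proj X \<xi> \<in> U}" and ?PP = "prod_atlas PP PP"
  have E: "open_in ?PP (?E \<times> ?E)" by (intro open_in_Times smap_vimage[OF proj_smooth t(2)])
  have eq: "{p \<in> points PP \<times> points PP. proj X (fst p) \<in> U \<and> proj X (snd p) \<in> U} = ?E \<times> ?E" by auto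
  have PPm: "manifold ?PP" by (rule manifold_prod[OF P P])
  show thesis
  proof (rule that[OF t(1,2), of "\<lambda>p. iv (\<Psi> (fst p)) \<cdot> \<Psi> (snd p)"])
    show "smooth_map ?PP HH {p \<in> points PP \<times> points PP. proj X (fst p) \<in> U \<and> proj X (snd p) \<in> U}
      (\<lambda>p. iv (\<Psi> (fst p)) \<cdot> \<Psi> (snd p))"
      unfolding eq
      by (intro smooth_mult[OF PPm] smooth_inv[OF PPm] smooth_compose[OF PPm P H smap_fst[OF P P E] t(5)]
          smooth_compose[OF PPm P H smap_snd[OF P P E] t(5)]) auto
    show "\<forall>\<xi>\<in>points PP. \<forall>\<xi>'\<in>points PP. proj X \<xi> = proj X \<xi>' \<and> proj X \<xi> \<in> U \<longrightarrow>
        iv (\<Psi> (fst (\<xi>, \<xi>'))) \<cdot> \<Psi> (snd (\<xi>, \<xi>')) = translator X \<xi> \<xi>'"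
    proof (intro ballI impI)
      fix \<xi> \<xi>' assume a': "\<xi> \<in> points PP" "\<xi>' \<in> points PP" "proj X \<xi> = proj X \<xi>' \<and> proj X \<xi> \<in> U"
      then have a: "\<xi> \<in> points PP" "\<xi>' \<in> points PP" "proj X \<xi> = proj X \<xi>'" "proj X \<xi> \<in> U" by auto
      have p: "\<Psi> \<xi> \<in> points HH" "\<Psi> \<xi>' \<in> points HH" using smap_image[OF t(5)] a by auto
      have "act X \<xi> (iv (\<Psi> \<xi>) \<cdot> \<Psi> \<xi>') = \<xi>'"
        using t(8)[OF a(4) p(1), of "iv (\<Psi> \<xi>) \<cdot> \<Psi> \<xi>'"] t(6)[OF a(1)] t(6)[OF a(2)] a p by simp
      then show "iv (\<Psi> (fst (\<xi>, \<xi>'))) \<cdot> \<Psi> (snd (\<xi>, \<xi>')) = translator X \<xi> \<xi>'"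
        using translator_act[OF a(1), of "iv (\<Psi> \<xi>) \<cdot> \<Psi> \<xi>'"] p by simp
    qed
  qed
qed

lemma smooth_translator:
  assumes N: "manifold N" and f: "smooth_map N PP U f" and h: "smooth_map N PP U h"
    and eq: "\<And>n. n \<in> U \<Longrightarrow> proj X (f n) = proj X (h n)"
  shows "smooth_map N HH U (\<lambda>n. translator X (f n) (h n))"
proof (rule smap_locally[OF N H])
  fix n assume n: "n \<in> U"
  have x: "proj X (f n) \<in> points MM" using smap_in[OF f n] by simp
  obtain W T where T: "proj X (f n) \<in> W" "open_in MM W"
    "smooth_map (prod_atlas PP PP) HH {p \<in> points PP \<times> points PP. proj X (fst p) \<in> W \<and> proj X (snd p) \<in> W} T"
    "\<forall>\<xi>\<in>points PP. \<forall>\<xi>'\<in>points PP. proj X \<xi> = proj X \<xi>' \<and> proj X \<xi> \<in> W \<longrightarrow> T (\<xi>, \<xi>') = translator X \<xi> \<xi>'"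
    using translator_extension[OF x] .
  have pf: "smooth_map N MM U (\<lambda>n. proj X (f n))"
    by (rule smooth_compose[OF N P M f proj_smooth smap_image[OF f]])
  let ?V = "{n \<in> U. proj X (f n) \<in> W}"
  have V: "open_in N ?V" by (rule smap_vimage[OF pf T(2)])
  have f': "smooth_map N PP ?V f" and h': "smooth_map N PP ?V h"
    by (rule smap_subset[OF N P f V], simp, rule smap_subset[OF N P h V], simp)
  have "smooth_map N HH ?V (\<lambda>n. T (f n, h n))"
    by (rule smooth_compose[OF N manifold_prod[OF P P] H smap_Pair[OF P P N f' h'] T(3)])
      (use eq smap_in[OF f] smap_in[OF h] in auto)
  then have "smooth_map N HH ?V (\<lambda>n. translator X (f n) (h n))"
    by (rule smap_cong[OF N H]) (use eq T(4) smap_in[OF f] smap_in[OF h] in auto)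
  then show "\<exists>V. n \<in> V \<and> V \<subseteq> U \<and> smooth_map N HH V (\<lambda>n. translator X (f n) (h n))"
    using n T(1) by (intro exI[of _ ?V]) auto
qed

lemma fibre_nonempty:
  assumes x: "x \<in> points MM"
  obtains \<xi> where "\<xi> \<in> points PP" "proj X \<xi> = x"
  using trivialization[OF x] trivializesD(6) one_in that by blast

text \<open>In a trivialization, keep the group component \<open>\<Psi> \<xi>\<close>
  constant.\<close>

lemma local_section_through:
  assumes \<xi>: "\<xi> \<in> points PP"
  obtains W s where "proj X \<xi> \<in> W" "local_section X W s" "s (proj X \<xi>) = \<xi>"
proof -
  have x: "proj X \<xi> \<in> points MM" using \<xi> by simp
  obtain U \<Phi> \<Psi> where t1: "proj X \<xi> \<in> U" and T: "trivializes U \<Phi> \<Psi>"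
    using trivialization[OF x] by blast
  note t = t1 trivializesD[OF T]
  have p: "\<Psi> \<xi> \<in> points HH" using smap_image[OF t(5)] \<xi> t(1) by auto
  show thesis
  proof (rule that[OF t(1), of "\<lambda>z. \<Phi> (z, \<Psi> \<xi>)"])
    show "local_section X U (\<lambda>z. \<Phi> (z, \<Psi> \<xi>))"
      unfolding local_section_def
      using smooth_compose[OF M manifold_prod[OF M H] P
          smap_Pair[OF M H M smap_id[OF M t(2)] smap_const[OF M H t(2) p]] t(3)] p t(7) by auto
  qed (use t(6)[OF \<xi> t(1)] in simp)
qed

lemma local_section_smooth: "local_section X W s \<Longrightarrow> smooth_map MM PP W s"
  and local_section_proj: "local_section X W s \<Longrightarrow> x \<in> W \<Longrightarrow> proj X (s x) = x"
  by (auto simp: local_section_def)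

lemma smooth_act_point: "\<xi> \<in> points PP \<Longrightarrow> smooth_map HH PP (points HH) (\<lambda>a. act X \<xi> a)"
  and smooth_act_right: "a \<in> points HH \<Longrightarrow> smooth_map PP PP (points PP) (\<lambda>\<xi>. act X \<xi> a)"
  by (intro smooth_act[OF H] smap_const[OF H P] smooth_idH, simp_all)
     (intro smooth_act[OF P] smap_const[OF P H] smap_id[OF P], simp_all)

section \<open>Vertical vectors, the infinitesimal action and right translations\<close>

lemma linear_tproj: "\<xi> \<in> points PP \<Longrightarrow> linear (tproj X \<xi>)"
  unfolding tproj_def by (rule tmap_linear[OF P M proj_smooth])

lemma linear_fund: "\<xi> \<in> points PP \<Longrightarrow> linear (fund X \<xi>)"
  unfolding fund_def by (rule tmap_linear[OF H P smooth_act_point]) auto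

lemma linear_tright: "\<xi> \<in> points PP \<Longrightarrow> a \<in> points HH \<Longrightarrow> linear (tright X a \<xi>)"
  unfolding tright_def by (rule tmap_linear[OF P P smooth_act_right])

lemma tproj_fund [simp]:
  assumes "\<xi> \<in> points PP"
  shows "tproj X \<xi> (fund X \<xi> Z) = 0"
proof -
  have "tproj X \<xi> (fund X \<xi> Z) = tmap HH MM (\<lambda>a. proj X (act X \<xi> a)) one Z"
    unfolding tproj_def fund_def using tmap_compose[OF H P M smooth_act_point[OF assms] proj_smooth smap_image[OF smooth_act_point[OF assms]] one_in]
    by (simp add: assms)
  also have "\<dots> = tmap HH MM (\<lambda>a. proj X \<xi>) one Z"
    by (rule fun_cong[OF tmap_cong[OF H M open_in_points one_in]]) (simp add: assms)
  finally show ?thesis by (simp add: tmap_const[OF H M])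
qed

lemma subspace_vert: "\<xi> \<in> points PP \<Longrightarrow> subspace (vert X \<xi>)"
  unfolding vert_def using linear_subspace_kernel[OF linear_tproj] by simp

lemma fund_translate:
  assumes \<xi>: "\<xi> \<in> points PP" and b: "b \<in> points HH"
  shows "tmap HH PP (\<lambda>a. act X \<xi> (iv b \<cdot> a)) b V = fund X \<xi> (mc b V)"
proof -
  have "tmap HH PP (\<lambda>a. act X \<xi> (iv b \<cdot> a)) b V = tmap HH PP (\<lambda>a. act X \<xi> a) (iv b \<cdot> b) (tmap HH HH (\<lambda>a. iv b \<cdot> a) b V)"
    by (rule tmap_compose[OF H H P smooth_left smooth_act_point]) (use \<xi> b in auto)
  then show ?thesis using b by (simp add: fund_def mc_def)
qed

text \<open>Injectivity: \<open>\<Psi>\<close> carries the orbit map to a left translation of the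
  group, whose differential is injective. Surjectivity onto the vertical space: differentiate
  \<open>\<Phi> (proj X \<zeta>, \<Psi> \<zeta>) = \<zeta>\<close>; on a vertical vector the base
  contribution vanishes.\<close>

lemma fund_inj_vert:
  assumes \<xi>: "\<xi> \<in> points PP"
  shows fund_eq_0: "fund X \<xi> Z = 0 \<Longrightarrow> Z = 0" and vert_fund: "u \<in> vert X \<xi> \<Longrightarrow> \<exists>Z. u = fund X \<xi> Z"
proof -
  have x: "proj X \<xi> \<in> points MM" using \<xi> by simp
  obtain U \<Phi> \<Psi> where t1: "proj X \<xi> \<in> U" and T: "trivializes U \<Phi> \<Psi>"
    using trivialization[OF x] by blast
  note t = t1 trivializesD[OF T]
  let ?E = "{\<xi> \<in> points PP. proj X \<xi> \<in> U}"
  have b: "\<Psi> \<xi> \<in> points HH" using smap_image[OF t(5)] \<xi> t(1) by auto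
  have E: "\<xi> \<in> ?E" using \<xi> t(1) by simp
  have eq: "act X \<xi> a = \<Phi> (proj X \<xi>, \<Psi> \<xi> \<cdot> a)" if "a \<in> points HH" for a
    using t(8)[OF t(1) b that] t(6)[OF \<xi> t(1)] by simp
  {
    assume 0: "fund X \<xi> Z = 0"
    have "tmap HH HH (\<lambda>a. \<Psi> (act X \<xi> a)) one Z = tmap PP HH \<Psi> (act X \<xi> one) (fund X \<xi> Z)"
      unfolding fund_def
      by (rule tmap_compose[OF H P H smooth_act_point[OF \<xi>] t(5)]) (use \<xi> t(1) in auto)
    also have "\<dots> = 0" unfolding 0 using linear_0[OF tmap_linear[OF P H t(5)]] E \<xi> by simp
    finally have "tmap HH HH (\<lambda>a. \<Psi> (act X \<xi> a)) one Z = 0" .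
    moreover have "tmap HH HH (\<lambda>a. \<Psi> (act X \<xi> a)) one = tmap HH HH (\<lambda>a. \<Psi> \<xi> \<cdot> a) one"
      by (rule tmap_cong[OF H H open_in_points one_in]) (use b t(7)[OF t(1)] in \<open>simp add: eq\<close>)
    ultimately have "left_field (grp X) HH Z (\<Psi> \<xi>) = 0" by (simp add: left_field_def)
    then show "Z = 0" using mc_left_field[OF b, of Z] linear_0[OF linear_mc[OF b]] by simp
  }
  assume u: "u \<in> vert X \<xi>"
  have "tmap PP PP (\<lambda>\<zeta>. \<Phi> (proj X \<zeta>, \<Psi> \<zeta>)) \<xi> u =
      tmap MM PP (\<lambda>z. \<Phi> (z, \<Psi> \<xi>)) (proj X \<xi>) (tmap PP MM (\<lambda>\<xi>. proj X \<xi>) \<xi> u) +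
      tmap HH PP (\<lambda>a. \<Phi> (proj X \<xi>, a)) (\<Psi> \<xi>) (tmap PP HH \<Psi> \<xi> u)"
    by (rule tmap_Pair[OF M H P P t(4) t(5) t(3) t(2) _ open_in_points smap_image[OF t(5)] E]) auto
  moreover have "tmap PP PP (\<lambda>\<zeta>. \<Phi> (proj X \<zeta>, \<Psi> \<zeta>)) \<xi> = tmap PP PP (\<lambda>\<zeta>. \<zeta>) \<xi>"
    by (rule tmap_cong[OF P P smap_open[OF t(5)] E]) (simp add: t(6))
  moreover have "tmap PP MM (\<lambda>\<xi>. proj X \<xi>) \<xi> u = 0" using u by (simp add: vert_def tproj_def)
  moreover have "linear (tmap MM PP (\<lambda>z. \<Phi> (z, \<Psi> \<xi>)) (proj X \<xi>))"
    by (rule tmap_linear[OF M P smooth_compose[OF M manifold_prod[OF M H] P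
          smap_Pair[OF M H M smap_id[OF M t(2)] smap_const[OF M H t(2) b]] t(3)] t(1)]) (use b in auto)
  moreover have "tmap HH PP (\<lambda>a. \<Phi> (proj X \<xi>, a)) (\<Psi> \<xi>) = tmap HH PP (\<lambda>a. act X \<xi> (iv (\<Psi> \<xi>) \<cdot> a)) (\<Psi> \<xi>)"
    by (rule tmap_cong[OF H P open_in_points b]) (simp add: eq b)
  ultimately have "u = fund X \<xi> (mc (\<Psi> \<xi>) (tmap PP HH \<Psi> \<xi> u))"
    using tmap_id[OF P \<xi>] by (simp add: linear_0 fund_translate[OF \<xi> b])
  then show "\<exists>Z. u = fund X \<xi> Z" ..
qed

lemma vert_iff: "\<xi> \<in> points PP \<Longrightarrow> u \<in> vert X \<xi> \<longleftrightarrow> (\<exists>Z. u = fund X \<xi> Z)"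
  using vert_fund by (auto simp: vert_def)

text \<open>The Leibniz rule behind every gauge change: the fundamental vector records the motion of
  the group element, transported to the unit by \<open>mc\<close>.\<close>

lemma tmap_act:
  assumes N: "manifold N" and f: "smooth_map N PP U f" and b: "smooth_map N HH U b" and p: "p \<in> U"
  shows "tmap N PP (\<lambda>n. act X (f n) (b n)) p v =
    tright X (b p) (f p) (tmap N PP f p v) + fund X (act X (f p) (b p)) (mc (b p) (tmap N HH b p v))"
proof -
  have fp: "f p \<in> points PP" and bp: "b p \<in> points HH" using smap_in f b p by metis+
  have "tmap N PP (\<lambda>n. (\<lambda>(\<xi>, a). act X \<xi> a) (f n, b n)) p v =
      tmap PP PP (\<lambda>\<xi>. (\<lambda>(\<xi>, a). act X \<xi> a) (\<xi>, b p)) (f p) (tmap N PP f p v) +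
      tmap HH PP (\<lambda>a. (\<lambda>(\<xi>, a). act X \<xi> a) (f p, a)) (b p) (tmap N HH b p v)"
    by (rule tmap_Pair[OF P H N P f b act_smooth open_in_points smap_image[OF f] open_in_points smap_image[OF b] p])
  moreover have "tmap HH PP (\<lambda>a. act X (f p) a) (b p) = tmap HH PP (\<lambda>a. act X (act X (f p) (b p)) (iv (b p) \<cdot> a)) (b p)"
    by (rule tmap_cong[OF H P open_in_points bp]) (simp add: fp bp act_mult[symmetric])
  ultimately show ?thesis by (simp add: tright_def fund_translate fp bp)
qed

lemma tright_fund:
  assumes \<xi>: "\<xi> \<in> points PP" and a: "a \<in> points HH"
  shows "tright X a \<xi> (fund X \<xi> Z) = fund X (act X \<xi> a) (AD (iv a) Z)"
proof -
  have "tright X a \<xi> (fund X \<xi> Z) = tmap HH PP (\<lambda>b. act X (act X \<xi> b) a) one Z"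
    unfolding tright_def fund_def
    using tmap_compose[OF H P P smooth_act_point[OF \<xi>] smooth_act_right[OF a] smap_image[OF smooth_act_point[OF \<xi>]] one_in, of Z] \<xi> by simp
  also have "\<dots> = tmap HH PP (\<lambda>b. act X (act X \<xi> a) (iv a \<cdot> b \<cdot> iv (iv a))) one Z"
    by (rule fun_cong[OF tmap_cong[OF H P open_in_points one_in]]) (simp add: \<xi> a act_mult[symmetric] grp_assoc)
  also have "\<dots> = tmap HH PP (\<lambda>b. act X (act X \<xi> a) b) (iv a \<cdot> one \<cdot> iv (iv a)) (AD (iv a) Z)"
    unfolding Ad_def by (rule tmap_compose[OF H H P smooth_conj smooth_act_point]) (use \<xi> a in auto)
  finally show ?thesis using a by (simp add: fund_def)
qed

lemma tproj_tright:
  assumes \<xi>: "\<xi> \<in> points PP" and a: "a \<in> points HH"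
  shows "tproj X (act X \<xi> a) (tright X a \<xi> u) = tproj X \<xi> u"
proof -
  have "tproj X (act X \<xi> a) (tright X a \<xi> u) = tmap PP MM (\<lambda>\<zeta>. proj X (act X \<zeta> a)) \<xi> u"
    unfolding tproj_def tright_def
    by (rule tmap_compose[OF P P M smooth_act_right[OF a] proj_smooth smap_image[OF smooth_act_right[OF a]] \<xi>, symmetric])
  also have "\<dots> = tproj X \<xi> u" unfolding tproj_def
    by (rule fun_cong[OF tmap_cong[OF P M open_in_points \<xi>]]) (simp add: a)
  finally show ?thesis .
qed

lemma tright_inverse:
  assumes \<xi>: "\<xi> \<in> points PP" and a: "a \<in> points HH"
  shows "tright X (iv a) (act X \<xi> a) (tright X a \<xi> u) = u"
proof -
  have "tright X (iv a) (act X \<xi> a) (tright X a \<xi> u) = tmap PP PP (\<lambda>\<zeta>. act X (act X \<zeta> a) (iv a)) \<xi> u"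
    unfolding tright_def
    by (rule tmap_compose[OF P P P smooth_act_right[OF a] smooth_act_right[OF inv_in[OF a]] smap_image[OF smooth_act_right[OF a]] \<xi>, symmetric])
  also have "\<dots> = tmap PP PP (\<lambda>\<zeta>. \<zeta>) \<xi> u"
    by (rule fun_cong[OF tmap_cong[OF P P open_in_points \<xi>]]) (simp add: a act_mult[symmetric])
  finally show ?thesis by (simp add: tmap_id[OF P \<xi>])
qed

text \<open>\<open>chart_inv kappa\<close> takes the place of the exponential map: any smooth family
  of group elements through the unit with the right derivative there yields the fundamental
  fields.\<close>

lemma smooth_fund: "smooth_field PP (points PP) (\<lambda>\<xi>. fund X \<xi> Z)"
proof (rule smooth_field_partial[OF P])
  let ?Q = "prod_atlas eucl PP :: ('k \<times> 'p, 'k \<times> 'q) atlas" and ?K = "snd kappa ` fst kappa"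
  have Q: "manifold ?Q" by (rule manifold_prod[OF mf_eucl P])
  have o: "open_in ?Q (?K \<times> points PP)" by (rule open_in_Times) (auto simp: chart_image_open[OF H kappa(1)])
  have "smooth_map ?Q HH (?K \<times> points PP) (\<lambda>q. chart_inv kappa (fst q))"
    by (rule smooth_compose[OF Q mf_eucl H smap_fst[OF mf_eucl P o] smap_chart_inv[OF H kappa(1)]]) auto
  then show "smooth_map ?Q PP (?K \<times> points PP) (\<lambda>q. act X (snd q) (chart_inv kappa (fst q)))"
    by (intro smooth_act[OF Q] smap_snd[OF mf_eucl P o])
  show "smooth_map PP eucl (points PP) (\<lambda>_. pref_pt HH one)" by (rule smap_const[OF P mf_eucl]) auto
  fix \<xi> assume \<xi>: "\<xi> \<in> points PP"
  then show "(pref_pt HH one, \<xi>) \<in> ?K \<times> points PP \<and> act X (snd (pref_pt HH one, \<xi>)) (chart_inv kappa (fst (pref_pt HH one, \<xi>))) = \<xi>"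
    by (simp add: pref_pt_one)
  have im: "chart_inv kappa ` ?K \<subseteq> points HH" using chart_subset[OF H kappa(1)] chart_inv_in[OF H kappa(1)] by auto
  show "fund X \<xi> Z = tmap eucl PP (\<lambda>x. act X (snd (x, \<xi>)) (chart_inv kappa (fst (x, \<xi>)))) (pref_pt HH one) Z"
    using tmap_compose[OF mf_eucl H P smap_chart_inv[OF H kappa(1)] smooth_act_point[OF \<xi>] im pref_pt_one(1), of Z]
      chart_vec_pref[OF H one_in, of Z] by (simp add: fund_def chart_vec_tmap pref_pt_one)
qed

end

section \<open>Connections\<close>

locale pb_connection = pb +
  fixes A
  assumes connection: "connection X A"
begin

abbreviation th where "th \<equiv> conn_form X A"

lemma A_subspace: "\<xi> \<in> points PP \<Longrightarrow> subspace (A \<xi>)"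
  and A_vert: "\<xi> \<in> points PP \<Longrightarrow> A \<xi> \<inter> vert X \<xi> = {0}"
  and A_decomp: "\<xi> \<in> points PP \<Longrightarrow> \<exists>u\<in>A \<xi>. \<exists>v\<in>vert X \<xi>. t = u + v"
  and A_right: "\<xi> \<in> points PP \<Longrightarrow> a \<in> points HH \<Longrightarrow> tright X a \<xi> ` A \<xi> = A (act X \<xi> a)"
  using connection by (auto simp: connection_def)

lemma th_unique:
  assumes \<xi>: "\<xi> \<in> points PP"
  shows "\<exists>!Z. u - fund X \<xi> Z \<in> A \<xi>"
proof -
  obtain h v where hv: "h \<in> A \<xi>" "v \<in> vert X \<xi>" "u = h + v" using A_decomp[OF \<xi>] by blast
  obtain Z where Z: "v = fund X \<xi> Z" using vert_fund[OF \<xi> hv(2)] by blast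
  show ?thesis
  proof
    show "u - fund X \<xi> Z \<in> A \<xi>" using hv Z by simp
    fix Z' assume Z': "u - fund X \<xi> Z' \<in> A \<xi>"
    have "(u - fund X \<xi> Z) - (u - fund X \<xi> Z') \<in> A \<xi>"
      by (rule subspace_diff[OF A_subspace[OF \<xi>] _ Z']) (use hv Z in simp)
    then have "fund X \<xi> (Z' - Z) \<in> A \<xi>" by (simp add: linear_diff[OF linear_fund[OF \<xi>]])
    then have "fund X \<xi> (Z' - Z) = 0" using A_vert[OF \<xi>] vert_iff[OF \<xi>] by blast
    then show "Z' = Z" using fund_eq_0[OF \<xi>] by fastforce
  qed
qed

lemma th_hor: "\<xi> \<in> points PP \<Longrightarrow> u - fund X \<xi> (th \<xi> u) \<in> A \<xi>"
  using theI'[OF th_unique] by (simp add: conn_form_def)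

lemma th_eqI: "\<xi> \<in> points PP \<Longrightarrow> u - fund X \<xi> Z \<in> A \<xi> \<Longrightarrow> th \<xi> u = Z"
  using th_unique th_hor by blast

lemma th_A: "\<xi> \<in> points PP \<Longrightarrow> u \<in> A \<xi> \<Longrightarrow> th \<xi> u = 0"
  by (rule th_eqI) (simp_all add: linear_0[OF linear_fund])

lemma th_fund [simp]: "\<xi> \<in> points PP \<Longrightarrow> th \<xi> (fund X \<xi> Z) = Z"
  by (rule th_eqI) (simp_all add: subspace_0[OF A_subspace])

lemma linear_th:
  assumes \<xi>: "\<xi> \<in> points PP"
  shows "linear (th \<xi>)"
proof (rule linearI)
  note L = linear_add[OF linear_fund[OF \<xi>]] linear_cmul[OF linear_fund[OF \<xi>]] and S = A_subspace[OF \<xi>]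
  fix u v c
  show "th \<xi> (u + v) = th \<xi> u + th \<xi> v"
    using subspace_add[OF S th_hor[OF \<xi>, of u] th_hor[OF \<xi>, of v]]
    by (intro th_eqI[OF \<xi>]) (simp add: L algebra_simps)
  show "th \<xi> (c *\<^sub>R u) = c *\<^sub>R th \<xi> u"
    using subspace_scale[OF S th_hor[OF \<xi>, of u], of c]
    by (intro th_eqI[OF \<xi>]) (simp add: L algebra_simps)
qed

lemma A_iff: "\<xi> \<in> points PP \<Longrightarrow> u \<in> A \<xi> \<longleftrightarrow> th \<xi> u = 0"
  using th_A th_hor[of \<xi> u] by (auto simp: linear_0[OF linear_fund])

lemma th_right:
  assumes \<xi>: "\<xi> \<in> points PP" and a: "a \<in> points HH"
  shows "th (act X \<xi> a) (tright X a \<xi> u) = AD (iv a) (th \<xi> u)"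
proof (rule th_eqI)
  have "tright X a \<xi> (u - fund X \<xi> (th \<xi> u)) \<in> A (act X \<xi> a)"
    using A_right[OF \<xi> a] th_hor[OF \<xi>, of u] by blast
  then show "tright X a \<xi> u - fund X (act X \<xi> a) (AD (iv a) (th \<xi> u)) \<in> A (act X \<xi> a)"
    by (simp add: linear_diff[OF linear_tright[OF \<xi> a]] tright_fund[OF \<xi> a])
qed (use \<xi> a in simp)

text \<open>\<open>conn_form\<close> is defined pointwise by a description, the distribution only by
  local frames. Around \<xi>, the map \<open>L x\<close> sends the frame at \<xi> to the frame at
  \<open>x\<close> and fundamental vectors to fundamental vectors, so it intertwines the connection
  forms: the form at \<open>x\<close> is the fixed form at \<xi> composed with the inverse of
  \<open>L x\<close>, which is smooth by \<open>inverse_family\<close>.\<close>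

lemma th_form: "form_on PP (points PP) th"
proof (rule form_on_local[OF P linear_th])
  fix \<xi> assume \<xi>: "\<xi> \<in> points PP"
  note c = pref_in[OF \<xi>]
  let ?c = "pref PP \<xi>"
  obtain U and k :: nat and V where V': "\<xi> \<in> U" "open_in PP U" "\<forall>i<k. smooth_field PP U (V i)"
     "\<forall>q\<in>U. A q = span ((\<lambda>i. V i q) ` {..<k}) \<and> dim (A q) = k"
    using bspec[OF conjunct1[OF connection[unfolded connection_def smooth_distribution_def]] \<xi>]
    by (elim exE conjE) (rule that)
  note V = V'(1,2) V'(3)[rule_format] V'(4)[rule_format]
  define V0 where "V0 i = V i \<xi>" for i
  let ?B = "V0 ` {..<k}"
  have A\<xi>: "A \<xi> = span ?B" "dim (A \<xi>) = k" using V(4)[OF V(1)] unfolding V0_def[abs_def] by blast+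
  \<comment> \<open>\<open>k\<close> vectors spanning a space of dimension \<open>k\<close> are
    distinct and independent, so the coordinates \<open>co\<close> below exist.\<close>
  have cardB: "card ?B = k"
  proof (rule antisym)
    show "card ?B \<le> k" using card_image_le[of "{..<k}" V0] by simp
    show "k \<le> card ?B" using dim_le_card[of "A \<xi>" ?B] A\<xi> by simp
  qed
  have inj: "inj_on V0 {..<k}" by (rule eq_card_imp_inj_on) (simp_all add: cardB)
  have indep: "independent ?B"
    by (rule card_le_dim_spanning[of _ "A \<xi>"]) (use A\<xi> cardB in \<open>auto intro: span_base\<close>)
  define hor where "hor u = u - fund X \<xi> (th \<xi> u)" for u
  have hor: "hor u \<in> span ?B" for u using th_hor[OF \<xi>, of u] A\<xi> by (simp add: hor_def)
  have lin_hor: "linear hor" unfolding hor_def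
    by (intro linear_compose_sub linear_compose[OF linear_th[OF \<xi>] linear_fund[OF \<xi>], unfolded o_def] module_hom_ident)
  define co where "co i u = representation ?B (hor u) (V0 i)" for i u
  have lin_co: "linear (co i)" for i
    unfolding co_def
    by (rule linearI) (simp_all add: linear_add[OF lin_hor] linear_cmul[OF lin_hor] hor
        representation_add[OF indep] representation_scale[OF indep])
  let ?S = "snd ?c ` (U \<inter> fst ?c)"
  have oS: "open ?S" by (rule open_chart_image[OF P c(1) V(2)])
  have pS: "chart_inv ?c x \<in> U" "chart_inv ?c x \<in> fst ?c" "chart_inv ?c x \<in> points PP" "x \<in> snd ?c ` fst ?c" if "x \<in> ?S" for x
    using that chart_subset[OF P c(1)] by (auto simp: chart_inv_snd[OF P c(1)])
  define Vc where "Vc i x = chart_coord PP ?c (chart_inv ?c x) (V i (chart_inv ?c x))" for i x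
  define Fc where "Fc x Z = chart_coord PP ?c (chart_inv ?c x) (fund X (chart_inv ?c x) Z)" for x Z
  have lin_co_scale: "linear (\<lambda>w. co i w *\<^sub>R Vc i x)" for i x
    by (rule linearI) (simp_all add: linear_add[OF lin_co] linear_cmul[OF lin_co] algebra_simps)
  define L where "L x w = (\<Sum>i<k. co i w *\<^sub>R Vc i x) + Fc x (th \<xi> w)" for x w
  have sVc: "smooth_on ?S (Vc i)" if "i < k" for i
    using V(3)[OF that] c(1) by (auto simp: smooth_field_def Vc_def[abs_def])
  have sFc: "smooth_on ?S (\<lambda>x. Fc x Z)" for Z
  proof -
    have "smooth_on (snd ?c ` (points PP \<inter> fst ?c)) (\<lambda>x. Fc x Z)"
      using smooth_fund[of Z] c(1) unfolding smooth_field_def Fc_def by blast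
    then show ?thesis by (rule smooth_on_subset) (use open_in_subset[OF V(2)] in blast)
  qed
  have linFc: "linear (Fc x)" if "x \<in> ?S" for x
    unfolding Fc_def
    by (rule linear_compose[OF linear_fund linear_chart_coord[OF P c(1)], unfolded o_def]) (use pS[OF that] in auto)
  have linL: "linear (L x)" if "x \<in> ?S" for x
    unfolding L_def
    by (intro linear_compose_add linear_compose_sum ballI lin_co_scale
        linear_compose[OF linear_th[OF \<xi>] linFc[OF that], unfolded o_def])
  have sL: "smooth_on ?S (\<lambda>x. L x w)" for w
    unfolding L_def
    by (intro smooth_on_add oS smooth_on_sum finite_lessThan sFc smooth_on_bilinear[OF bounded_bilinear_scaleR] smooth_on_const sVc) auto
  have horV: "hor (V0 i) = V0 i" "th \<xi> (V0 i) = 0" if "i < k" for i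
  proof -
    have "V0 i \<in> A \<xi>" unfolding A\<xi> using that by (intro span_base) auto
    then show "th \<xi> (V0 i) = 0" by (rule th_A[OF \<xi>])
    then show "hor (V0 i) = V0 i" by (simp add: hor_def linear_0[OF linear_fund[OF \<xi>]])
  qed
  have LV: "L x (V0 i) = Vc i x" if "x \<in> ?S" "i < k" for x i
  proof -
    have "co j (V0 i) = (if j = i then 1 else 0)" if "j < k" for j
      unfolding co_def horV(1)[OF \<open>i < k\<close>] using representation_basis[OF indep, of "V0 i"] \<open>i < k\<close> that inj_onD[OF inj, of i j] by auto
    then have "(\<Sum>j<k. co j (V0 i) *\<^sub>R Vc j x) = (\<Sum>j<k. if j = i then Vc j x else 0)"
      by (intro sum.cong) auto
    then show ?thesis using that by (simp add: L_def horV linear_0[OF linFc])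
  qed
  have LF: "L x (fund X \<xi> Z) = Fc x Z" if "x \<in> ?S" for x Z
    using representation_zero[of ?B] by (simp add: L_def co_def hor_def \<xi> th_fund)
  have thL: "th (chart_inv ?c x) (chart_vec PP ?c x (L x w)) = th \<xi> w" if x: "x \<in> ?S" for x w
  proof -
    have cv: "chart_vec PP ?c x (chart_coord PP ?c (chart_inv ?c x) u) = u" for u
      using chart_vec_coord[OF P c(1) pS(2)[OF x]] snd_chart_inv[OF P c(1) pS(4)[OF x]] by simp
    have lv: "linear (chart_vec PP ?c x)" by (rule linear_chart_vec[OF P c(1) pS(4)[OF x]])
    have "chart_vec PP ?c x (L x w) = (\<Sum>i<k. co i w *\<^sub>R V i (chart_inv ?c x)) + fund X (chart_inv ?c x) (th \<xi> w)"
      by (simp add: L_def Vc_def Fc_def linear_add[OF lv] linear_sum[OF lv] linear_cmul[OF lv] cv)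
    moreover have "(\<Sum>i<k. co i w *\<^sub>R V i (chart_inv ?c x)) \<in> A (chart_inv ?c x)"
      unfolding conjunct1[OF V(4)[OF pS(1)[OF x]]] by (intro span_sum span_scale span_base) auto
    ultimately show ?thesis by (intro th_eqI[OF pS(3)[OF x]]) simp
  qed
  \<comment> \<open>The frame spans the horizontal space and the fundamental vectors the vertical
    one; \<open>LV\<close> and \<open>LF\<close> put both into the range. Injectivity then comes
    from equality of dimensions.\<close>
  have surjL: "surj (L x)" if x: "x \<in> ?S" for x
  proof -
    let ?q = "chart_inv ?c x"
    have sub: "subspace (range (L x))" by (rule linear_subspace_image[OF linL[OF x] subspace_UNIV])
    have lc: "linear (chart_coord PP ?c ?q)" by (rule linear_chart_coord[OF P c(1) pS(2)[OF x]])
    have 1: "chart_coord PP ?c ?q u \<in> range (L x)" for u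
    proof -
      obtain h v where hv: "h \<in> A ?q" "v \<in> vert X ?q" "u = h + v" using A_decomp[OF pS(3)[OF x]] by blast
      obtain Z where Z: "v = fund X ?q Z" using vert_fund[OF pS(3)[OF x] hv(2)] by blast
      have "h \<in> span ((\<lambda>i. V i ?q) ` {..<k})"
        using hv(1) unfolding conjunct1[OF V(4)[OF pS(1)[OF x]]] .
      then have "chart_coord PP ?c ?q h \<in> chart_coord PP ?c ?q ` span ((\<lambda>i. V i ?q) ` {..<k})" by blast
      also have "\<dots> = span (chart_coord PP ?c ?q ` (\<lambda>i. V i ?q) ` {..<k})" by (rule linear_span_image[OF lc, symmetric])
      also have "\<dots> \<subseteq> range (L x)"
        by (rule span_minimal[OF _ sub]) (use LV[OF x] in \<open>auto simp: Vc_def intro: rangeI[of "L x"]\<close>, metis rangeI)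
      finally have "chart_coord PP ?c ?q h \<in> range (L x)" .
      moreover have "chart_coord PP ?c ?q v \<in> range (L x)"
        using LF[OF x, of Z] unfolding Z Fc_def by (metis rangeI)
      ultimately show ?thesis using subspace_add[OF sub] by (simp add: hv(3) linear_add[OF lc])
    qed
    have "u \<in> range (L x)" for u
      using 1[of "chart_vec PP ?c x u"] by (simp add: chart_coord_vec[OF P c(1) pS(4)[OF x]])
    then show ?thesis by auto
  qed
  have injL: "inj (L x)" if "x \<in> ?S" for x
    by (rule linear_surjective_imp_injective[OF linL[OF that] surjL[OF that]]) simp
  interpret inv: inverse_family ?S L "\<lambda>x. inv_into UNIV (L x)"
    by (rule inverse_family.intro) (simp_all add: oS linL sL inv_f_f[OF injL] surj_f_inv_f[OF surjL])
  have eq: "th (chart_inv ?c x) (chart_vec PP ?c x w) = th \<xi> (inv_into UNIV (L x) w)" if x: "x \<in> ?S" for x w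
    using thL[OF x, of "inv_into UNIV (L x) w"] by (simp add: inv.L_M[OF x])
  have "smooth_on ?S (\<lambda>x. th (chart_inv ?c x) (chart_vec PP ?c x w))" for w
    by (subst smooth_on_cong[OF oS eq], assumption)
      (rule smooth_on_linear[OF linear_th[OF \<xi>, unfolded linear_conv_bounded_linear] oS inv.smooth_inverse])
  then have *: "\<forall>w. smooth_on (snd ?c ` (U \<inter> fst ?c)) (\<lambda>x. th (chart_inv ?c x) (chart_vec PP ?c x w))" by blast
  show "\<exists>V c. \<xi> \<in> V \<and> open_in PP V \<and> V \<subseteq> points PP \<and> c \<in> PP \<and> V \<subseteq> fst c \<and>
      (\<forall>w. smooth_on (snd c ` V) (\<lambda>x. th (chart_inv c x) (chart_vec PP c x w)))"
    by (rule exI[of _ "U \<inter> fst ?c"], rule exI[of _ ?c])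
      (use c V(1,2) * chart_open[OF P c(1)] chart_subset[OF P c(1)] in \<open>auto intro: open_in_Int\<close>)
qed

end

section \<open>The Frobenius theorem\<close>

lemma family_bound:
  fixes L :: "'a::metric_space \<Rightarrow> 'b::euclidean_space \<Rightarrow> 'c::real_normed_vector"
  assumes "compact K" "\<And>x. x \<in> K \<Longrightarrow> linear (L x)" "\<And>w. continuous_on K (\<lambda>x. L x w)"
  obtains C where "C > 0" "\<And>x w. x \<in> K \<Longrightarrow> norm (L x w) \<le> C * norm w"
proof -
  have "\<exists>B. \<forall>x\<in>K. norm (L x b) \<le> B" for b
    using compact_imp_bounded[OF compact_continuous_image[OF assms(3,1), of b]]
    by (auto simp: bounded_iff)
  then obtain B where B: "\<And>b x. x \<in> K \<Longrightarrow> norm (L x b) \<le> B b" by metis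
  define C where "C = (\<Sum>b\<in>Basis. \<bar>B b\<bar>) + 1"
  show thesis
  proof
    show "C > 0" unfolding C_def by (simp add: add_nonneg_pos sum_nonneg)
    fix x w assume x: "x \<in> K"
    have "norm (L x b) \<le> \<bar>B b\<bar> * 1" for b using B[OF x, of b] by simp
    from basis_sum_bound[OF assms(2)[OF x] this, of w]
    show "norm (L x w) \<le> C * norm w" using norm_ge_zero[of w] by (simp add: C_def distrib_right del: norm_ge_zero)
  qed
qed

lemma smooth_lipschitz:
  fixes f :: "'a::euclidean_space \<Rightarrow> 'b::euclidean_space"
  assumes S: "open S" "smooth_on S f" and K: "compact K" "convex K" "K \<subseteq> S"
  obtains C where "C > 0" "\<And>x y. x \<in> K \<Longrightarrow> y \<in> K \<Longrightarrow> norm (f y - f x) \<le> C * norm (y - x)"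
    "\<And>x v. x \<in> K \<Longrightarrow> norm (FD f x v) \<le> C * norm v"
proof -
  obtain C where C: "C > 0" "\<And>x w. x \<in> K \<Longrightarrow> norm (FD f x w) \<le> C * norm w"
  proof (rule family_bound[OF K(1), of "FD f"])
    show "linear (FD f x)" if "x \<in> K" for x using smooth_on_FD_linear[OF S(2)] K that by blast
    show "continuous_on K (\<lambda>x. FD f x w)" for w
      by (rule continuous_on_subset[OF smooth_on_continuous[OF smooth_on_FD[OF S(2)]] K(3)])
  qed (rule that)
  show thesis
  proof (rule that[OF C(1) _ C(2)])
    fix x y assume xy: "x \<in> K" "y \<in> K"
    show "norm (f y - f x) \<le> C * norm (y - x)"
    proof (rule differentiable_bound[OF K(2), where f' = "FD f"])
      show "(f has_derivative FD f z) (at z within K)" if "z \<in> K" for z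
        using smooth_on_has_FD[OF S(2)] K(3) that has_derivative_at_withinI by blast
      show "onorm (FD f z) \<le> C" if "z \<in> K" for z
        by (rule onorm_bound) (use C that in auto)
    qed (use xy in auto)
  qed
qed

text \<open>Along the segment from \<open>x\<close> to \<open>y\<close>, the derivative stays within
  a Lipschitz constant times \<open>norm (y - x)\<close> of its value at \<open>x\<close>; the
  Lipschitz constants of its basis values come from \<open>smooth_lipschitz\<close>.\<close>

lemma smooth_taylor:
  fixes f :: "'a::euclidean_space \<Rightarrow> 'b::euclidean_space"
  assumes S: "open S" "smooth_on S f" and K: "compact K" "convex K" "K \<subseteq> S"
  obtains C where "C > 0"
    "\<And>x y. x \<in> K \<Longrightarrow> y \<in> K \<Longrightarrow> norm (f y - f x - FD f x (y - x)) \<le> C * norm (y - x) ^ 2"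
proof -
  have "\<exists>C>0. \<forall>x\<in>K. \<forall>y\<in>K. norm (FD f y b - FD f x b) \<le> C * norm (y - x)" for b
    using smooth_lipschitz[OF S(1) smooth_on_FD[OF S(2)] K] by metis
  then obtain c where c: "\<And>b. c b > 0"
    "\<And>b x y. x \<in> K \<Longrightarrow> y \<in> K \<Longrightarrow> norm (FD f y b - FD f x b) \<le> c b * norm (y - x)" by metis
  define C where "C = (\<Sum>b\<in>(Basis::'a set). c b)"
  have Cp: "C > 0" unfolding C_def using c(1) by (intro sum_pos) auto
  show thesis
  proof (rule that[OF Cp])
    fix x y assume xy: "x \<in> K" "y \<in> K"
    have lin: "linear (FD f z)" if "z \<in> K" for z using smooth_on_FD_linear[OF S(2)] K that by blast
    have seg: "closed_segment x y \<subseteq> K" using closed_segment_subset[OF xy K(2)] .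
    have "norm (f y - f x - FD f x (y - x)) \<le> norm (y - x) * (C * norm (y - x))"
    proof (rule differentiable_bound_linearization[where S = "closed_segment x y"])
      show "x + t *\<^sub>R (y - x) \<in> closed_segment x y" if "t \<in> {0..1}" for t
        using that by (auto simp: closed_segment_def algebra_simps intro!: exI[of _ t])
      show "(f has_derivative FD f z) (at z within closed_segment x y)" if "z \<in> closed_segment x y" for z
        using smooth_on_has_FD[OF S(2)] K(3) seg that has_derivative_at_withinI by blast
      show "onorm (FD f z - FD f x) \<le> C * norm (y - x)" if z: "z \<in> closed_segment x y" for z
      proof (rule onorm_bound)
        show "0 \<le> C * norm (y - x)" using Cp by simp
        fix v
        have zK: "z \<in> K" using seg z by blast
        have zx: "norm (z - x) \<le> norm (y - x)" using segment_bound1[OF z] by (simp add: norm_minus_commute)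
        have "norm (FD f z b - FD f x b) \<le> c b * norm (y - x)" for b
          using order_trans[OF c(2)[OF xy(1) zK] mult_left_mono[OF zx less_imp_le[OF c(1)]]] .
        from basis_sum_bound[OF linear_compose_sub[OF lin[OF zK] lin[OF xy(1)]] this, of v]
        show "norm ((FD f z - FD f x) v) \<le> C * norm (y - x) * norm v"
          using less_imp_le[OF c(1)] by (simp add: C_def)
      qed
    qed auto
    then show "norm (f y - f x - FD f x (y - x)) \<le> C * norm (y - x) ^ 2"
      by (simp add: power2_eq_square mult.left_commute)
  qed
qed

text \<open>Each estimate is linear in \<open>v\<close>, hence reduced to basis vectors. Adding up
  the constants gives a single \<open>C\<close>, which keeps the bookkeeping in
  \<open>frobenius\<close> short.\<close>

lemma family_C2_bounds:
  fixes G :: "'a::euclidean_space \<Rightarrow> 'b::euclidean_space \<Rightarrow> 'c::euclidean_space"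
  assumes S: "open S" "\<And>x. x \<in> S \<Longrightarrow> linear (G x)" "\<And>v. smooth_on S (\<lambda>x. G x v)"
    and K: "compact K" "convex K" "K \<subseteq> S"
  shows "\<exists>C>0. (\<forall>x\<in>K. \<forall>v. norm (G x v) \<le> C * norm v) \<and>
    (\<forall>x\<in>K. \<forall>y\<in>K. \<forall>v. norm (G y v - G x v) \<le> C * norm (y - x) * norm v) \<and>
    (\<forall>x\<in>K. \<forall>u v. norm (FD (\<lambda>x. G x v) x u) \<le> C * norm u * norm v) \<and>
    (\<forall>x\<in>K. \<forall>y\<in>K. \<forall>v. norm (G y v - G x v - FD (\<lambda>x. G x v) x (y - x)) \<le> C * norm (y - x) ^ 2 * norm v)"
proof -
  obtain C1 where C1: "C1 > 0" "\<And>x v. x \<in> K \<Longrightarrow> norm (G x v) \<le> C1 * norm v"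
  proof (rule family_bound[OF K(1), of G])
    show "linear (G x)" if "x \<in> K" for x using S(2) K(3) that by blast
    show "continuous_on K (\<lambda>x. G x w)" for w
      by (rule continuous_on_subset[OF smooth_on_continuous[OF S(3)] K(3)])
  qed (rule that)
  have "\<exists>C>0. (\<forall>x\<in>K. \<forall>y\<in>K. norm (G y b - G x b) \<le> C * norm (y - x)) \<and>
      (\<forall>x\<in>K. \<forall>u. norm (FD (\<lambda>x. G x b) x u) \<le> C * norm u)" for b
    using smooth_lipschitz[OF S(1) S(3)[of b] K] by metis
  then obtain c where c: "\<And>b. c b > 0"
    "\<And>b x y. x \<in> K \<Longrightarrow> y \<in> K \<Longrightarrow> norm (G y b - G x b) \<le> c b * norm (y - x)"
    "\<And>b x u. x \<in> K \<Longrightarrow> norm (FD (\<lambda>x. G x b) x u) \<le> c b * norm u" by metis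
  have "\<exists>C>0. \<forall>x\<in>K. \<forall>y\<in>K. norm (G y b - G x b - FD (\<lambda>x. G x b) x (y - x)) \<le> C * norm (y - x) ^ 2" for b
    using smooth_taylor[OF S(1) S(3)[of b] K] by metis
  then obtain d where d: "\<And>b. d b > 0"
    "\<And>b x y. x \<in> K \<Longrightarrow> y \<in> K \<Longrightarrow> norm (G y b - G x b - FD (\<lambda>x. G x b) x (y - x)) \<le> d b * norm (y - x) ^ 2" by metis
  have lin: "linear (G x)" "linear (\<lambda>v. FD (\<lambda>x. G x v) x u)" if "x \<in> K" for x u
  proof -
    have x: "x \<in> S" using K(3) that by blast
    show "linear (G x)" by (rule S(2)[OF x])
    show "linear (\<lambda>v. FD (\<lambda>x. G x v) x u)"
      by (rule FD_family_linear[OF S(1) x S(2) smooth_on_differentiable[OF S(3) x]])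
  qed
  define C2 where "C2 = (\<Sum>b\<in>(Basis::'b set). c b)"
  define C3 where "C3 = (\<Sum>b\<in>(Basis::'b set). d b)"
  have pos: "C2 \<ge> 0" "C3 \<ge> 0" unfolding C2_def C3_def by (intro sum_nonneg less_imp_le c(1) d(1))+
  have b1: "norm (G y v - G x v) \<le> C2 * norm (y - x) * norm v" if "x \<in> K" "y \<in> K" for x y v
    unfolding C2_def
    by (rule basis_sum_bound[of "\<lambda>v. G y v - G x v"]) (use c lin that in \<open>auto intro: linear_compose_sub less_imp_le\<close>)
  have b2: "norm (FD (\<lambda>x. G x v) x u) \<le> C2 * norm u * norm v" if "x \<in> K" for x u v
    unfolding C2_def
    by (rule basis_sum_bound[of "\<lambda>v. FD (\<lambda>x. G x v) x u"]) (use c lin that in \<open>auto intro: less_imp_le\<close>)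
  have b3: "norm (G y v - G x v - FD (\<lambda>x. G x v) x (y - x)) \<le> C3 * norm (y - x) ^ 2 * norm v" if "x \<in> K" "y \<in> K" for x y v
    unfolding C3_def
    by (rule basis_sum_bound[of "\<lambda>v. G y v - G x v - FD (\<lambda>x. G x v) x (y - x)"])
      (use d lin that in \<open>auto intro!: linear_compose_sub less_imp_le\<close>)
  define C where "C = C1 + C2 + C3"
  have le: "C1 \<le> C" "C2 \<le> C" "C3 \<le> C" "C > 0" using C1(1) pos by (auto simp: C_def)
  show ?thesis
  proof (intro exI[of _ C] conjI ballI allI le(4))
    show "norm (G x v) \<le> C * norm v" if "x \<in> K" for x v
      using C1(2)[OF that, of v] mult_right_mono[OF le(1) norm_ge_zero[of v]] by linarith
    show "norm (G y v - G x v) \<le> C * norm (y - x) * norm v" if "x \<in> K" "y \<in> K" for x y v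
      by (rule order_trans[OF b1[OF that]]) (intro mult_right_mono le norm_ge_zero)
    show "norm (FD (\<lambda>x. G x v) x u) \<le> C * norm u * norm v" if "x \<in> K" for x u v
      by (rule order_trans[OF b2[OF that]]) (intro mult_right_mono le norm_ge_zero)
    show "norm (G y v - G x v - FD (\<lambda>x. G x v) x (y - x)) \<le> C * norm (y - x) ^ 2 * norm v" if "x \<in> K" "y \<in> K" for x y v
      by (rule order_trans[OF b3[OF that]]) (intro mult_right_mono le norm_ge_zero zero_le_power)
  qed
qed

text \<open>Picard iteration, with time clamped to the unit interval by \<open>cl\<close> and values
  retracted to the ball by \<open>pr\<close>, so that the integral operator acts on the complete
  type of all bounded continuous functions. The Lipschitz constant 1/2 on an interval of length 1
  makes it a contraction; \<open>m \<le> R\<close> shows afterwards that the retraction does nothing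
  along the solution.\<close>

lemma ode_unit_interval:
  fixes f :: "real \<Rightarrow> 'k::euclidean_space \<Rightarrow> 'k"
  assumes cont: "continuous_on ({0..1} \<times> cball u0 R) (\<lambda>(t, u). f t u)"
    and bd: "\<And>t u. t \<in> {0..1} \<Longrightarrow> u \<in> cball u0 R \<Longrightarrow> norm (f t u) \<le> m"
    and lip: "\<And>t u u'. t \<in> {0..1} \<Longrightarrow> u \<in> cball u0 R \<Longrightarrow> u' \<in> cball u0 R \<Longrightarrow> norm (f t u - f t u') \<le> 1/2 * norm (u - u')"
    and m: "0 \<le> m" "m \<le> R"
  shows "\<exists>v. v 0 = u0 \<and> (\<forall>t\<in>{0..1}. (v has_vector_derivative f t (v t)) (at t within {0..1}) \<and> norm (v t - u0) \<le> m)"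
proof -
  have R: "R \<ge> 0" using m by simp
  define pr where "pr = closest_point (cball u0 R)"
  have ne: "cball u0 R \<noteq> {}" using R by simp
  have pr_in: "pr u \<in> cball u0 R" for u unfolding pr_def by (rule closest_point_in_set[OF closed_cball ne])
  have pr_cont: "continuous_on UNIV pr" unfolding pr_def by (rule continuous_on_closest_point[OF convex_cball closed_cball ne])
  have pr_lip: "norm (pr u - pr v) \<le> norm (u - v)" for u v
    using closest_point_lipschitz[OF convex_cball closed_cball ne, of u v] by (simp add: pr_def dist_norm)
  have pr_id: "pr u = u" if "u \<in> cball u0 R" for u using that closest_point_self unfolding pr_def by blast
  define cl :: "real \<Rightarrow> real" where "cl t = max 0 (min 1 t)" for t
  have cl: "cl t \<in> {0..1}" "t \<in> {0..1} \<Longrightarrow> cl t = t" for t by (auto simp: cl_def)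
  have cl_cont: "continuous_on UNIV cl" unfolding cl_def by (intro continuous_intros)
  define I where "I w = (\<lambda>t. f t (pr (w t)))" for w :: "real \<Rightarrow> 'k"
  have I_cont: "continuous_on {0..1} (I w)" if "continuous_on UNIV w" for w
  proof -
    have "continuous_on {0..1} (\<lambda>t. (t, pr (w t)))"
      by (intro continuous_intros continuous_on_compose2[OF pr_cont] continuous_on_subset[OF that]) auto
    from continuous_on_compose2[OF cont this] show ?thesis using pr_in by (auto simp: I_def image_subset_iff)
  qed
  have I_bd: "norm (I w t) \<le> m" if "t \<in> {0..1}" for w t unfolding I_def by (rule bd[OF that pr_in])
  have I_int: "I w integrable_on {0..s}" if "continuous_on UNIV w" "s \<le> 1" for w s
    by (rule integrable_continuous_real) (use continuous_on_subset[OF I_cont[OF that(1)]] that in auto)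
  define J where "J w s = u0 + integral {0..cl s} (I w)" for w s
  have J_cont: "continuous_on UNIV (J w)" if "continuous_on UNIV w" for w
  proof -
    have "continuous_on {0..1} (\<lambda>s. integral {0..s} (I w))"
      by (rule indefinite_integral_continuous_1[OF I_int[OF that]]) simp
    from continuous_on_compose2[OF this cl_cont] have "continuous_on UNIV (\<lambda>s. integral {0..cl s} (I w))"
      using cl(1) by blast
    then show ?thesis unfolding J_def[abs_def] by (intro continuous_intros)
  qed
  have J_bd: "norm (J w s - u0) \<le> m" if "continuous_on UNIV w" for w s
  proof -
    have "norm (integral {0..cl s} (I w)) \<le> m * (cl s - 0)"
      by (rule integral_bound) (use cl(1)[of s] I_bd continuous_on_subset[OF I_cont[OF that]] in auto)
    also have "\<dots> \<le> m" using cl(1)[of s] m by (simp add: mult_left_le)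
    finally show ?thesis by (simp add: J_def)
  qed
  have J_bcont: "J w \<in> bcontfun" if "continuous_on UNIV w" for w
  proof (rule bcontfun_normI[OF J_cont[OF that]])
    show "norm (J w s) \<le> m + norm u0" for s
      using J_bd[OF that, of s] norm_triangle_ineq2[of "J w s" u0] by linarith
  qed
  define T where "T w = Bcontfun (J (apply_bcontfun w))" for w
  have cw: "continuous_on UNIV (apply_bcontfun w)" for w :: "real \<Rightarrow>\<^sub>C 'k"
    using apply_bcontfun[of w] by (auto simp: bcontfun_def)
  have T: "apply_bcontfun (T w) = J (apply_bcontfun w)" for w
    unfolding T_def by (rule Bcontfun_inverse[OF J_bcont[OF cw]])
  have "\<exists>!w. T w = w"
  proof (rule banach_fix_type[where c = "1/2"])
    show "\<forall>w w'. dist (T w) (T w') \<le> 1/2 * dist w w'"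
    proof (intro allI dist_bound)
      fix w w' :: "real \<Rightarrow>\<^sub>C 'k" and s
      have le: "norm (I w t - I w' t) \<le> 1/2 * dist w w'" if "t \<in> {0..1}" for t
      proof -
        have "norm (I w t - I w' t) \<le> 1/2 * norm (pr (w t) - pr (w' t))"
          unfolding I_def by (rule lip[OF that pr_in pr_in])
        also have "\<dots> \<le> 1/2 * dist w w'"
          using pr_lip[of "w t" "w' t"] dist_bounded[of w t w'] by (simp add: dist_norm)
        finally show ?thesis .
      qed
      have "J w s - J w' s = integral {0..cl s} (\<lambda>t. I w t - I w' t)"
        unfolding J_def using cl(1)[of s] by (simp add: integral_diff I_int cw)
      also have "norm \<dots> \<le> 1/2 * dist w w' * (cl s - 0)"
        by (rule integral_bound)
          (use cl(1)[of s] le in \<open>auto intro!: continuous_intros continuous_on_subset[OF I_cont[OF cw]]\<close>)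
      also have "\<dots> \<le> 1/2 * dist w w'" using cl(1)[of s] by (simp add: mult_left_le)
      finally show "dist (T w s) (T w' s) \<le> 1/2 * dist w w'" by (simp add: T dist_norm)
    qed
  qed auto
  then obtain w where "T w = w" by blast
  then have w: "apply_bcontfun w = J (apply_bcontfun w)" using T by metis
  let ?v = "apply_bcontfun w"
  have vb: "norm (?v t - u0) \<le> m" for t using J_bd[OF cw, of w t] w by metis
  then have vin: "?v t \<in> cball u0 R" for t using m(2) order_trans by (auto simp: dist_norm norm_minus_commute)
  show ?thesis
  proof (intro exI[of _ ?v] conjI ballI vb)
    have "J (apply_bcontfun w) 0 = u0" by (simp add: J_def cl_def)
    then show "?v 0 = u0" using w by metis
    fix t :: real assume t: "t \<in> {0..1}"
    have "((\<lambda>s. integral {0..s} (I ?v)) has_vector_derivative I ?v t) (at t within {0..1})"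
      by (rule integral_has_vector_derivative[OF I_cont[OF cw] t])
    then have 1: "((\<lambda>s. u0 + integral {0..s} (I ?v)) has_vector_derivative I ?v t) (at t within {0..1})"
      by (auto intro!: derivative_eq_intros)
    have 2: "u0 + integral {0..s} (I ?v) = ?v s" if "s \<in> {0..1}" for s
      using fun_cong[OF w, of s] cl(2)[OF that] by (simp add: J_def)
    have "(?v has_vector_derivative I ?v t) (at t within {0..1})"
      by (rule has_vector_derivative_transform[OF t _ 1]) (use 2 in auto)
    then show "(?v has_vector_derivative f t (?v t)) (at t within {0..1})"
      by (simp add: I_def pr_id[OF vin])
  qed
qed

text \<open>At a point \<open>s\<close> where \<open>norm (z t)\<close> is maximal, the mean value
  inequality gives \<open>norm (z s) \<le> 1/2 * norm (z s) + e\<close>. The constant 1/2 replaces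
  the exponential of the usual Gronwall estimate.\<close>

lemma gronwall_half:
  fixes z :: "real \<Rightarrow> 'k::euclidean_space"
  assumes dz: "\<And>t. t \<in> {0..1} \<Longrightarrow> (z has_vector_derivative z' t) (at t within {0..1})"
    and z0: "z 0 = 0" and bd: "\<And>t. t \<in> {0..1} \<Longrightarrow> norm (z' t) \<le> 1/2 * norm (z t) + e"
  shows "norm (z 1) \<le> 2 * e"
proof -
  have "continuous_on {0..1} z"
    unfolding continuous_on_eq_continuous_within using dz has_vector_derivative_continuous by blast
  then have "continuous_on {0..1} (\<lambda>t. norm (z t))" by (intro continuous_intros)
  then obtain s where s: "s \<in> {0..1}" "\<And>t. t \<in> {0..1} \<Longrightarrow> norm (z t) \<le> norm (z s)"
    using continuous_attains_sup[of "{0..1::real}" "\<lambda>t. norm (z t)"] by auto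
  define B where "B = 1/2 * norm (z s) + e"
  have zb: "norm (z' t) \<le> B" if "t \<in> {0..1}" for t
    using bd[OF that] s(2)[OF that] by (simp add: B_def)
  have B0: "0 \<le> B" using order_trans[OF norm_ge_zero zb[of 0]] by simp
  have "norm (z s - z 0) \<le> B * norm (s - 0)"
  proof (rule differentiable_bound[of "{0..1}" z "\<lambda>t h. h *\<^sub>R z' t"])
    show "(z has_derivative (\<lambda>h. h *\<^sub>R z' t)) (at t within {0..1})" if "t \<in> {0..1}" for t
      using dz[OF that] by (simp add: has_vector_derivative_def)
    show "onorm (\<lambda>h. h *\<^sub>R z' t) \<le> B" if "t \<in> {0..1}" for t
    proof (rule onorm_bound[OF B0])
      show "norm (h *\<^sub>R z' t) \<le> B * norm h" for h :: real
        using mult_right_mono[OF zb[OF that], of "\<bar>h\<bar>"] by (simp add: mult.commute)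
    qed
  qed (use s in auto)
  also have "\<dots> \<le> B" using s B0 by (simp add: mult_left_le)
  finally have "norm (z s) \<le> 2 * e" by (simp add: z0 B_def)
  then show ?thesis using s(2)[of 1] by simp
qed

text \<open>The solution is constructed along rays by solving ordinary differential equations. If \<open>v\<close> is the solution
  on the ray in direction \<open>d\<close>, then \<open>v(t) + t F \<delta>\<close> solves the equation in direction \<open>d + \<delta>\<close> up to an error
  of second order in \<open>\<delta>\<close>, thanks to the integrability condition.\<close>

lemma frobenius:
  fixes F :: "'a::euclidean_space \<times> 'k::euclidean_space \<Rightarrow> 'a \<Rightarrow> 'k"
  assumes O: "open S0" "open Om" and lin: "\<And>x. x \<in> S0 \<times> Om \<Longrightarrow> linear (F x)"
    and sm: "\<And>v. smooth_on (S0 \<times> Om) (\<lambda>x. F x v)"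
    and integ: "\<And>x v w. x \<in> S0 \<times> Om \<Longrightarrow> FD (\<lambda>x. F x w) x (v, F x v) = FD (\<lambda>x. F x v) x (w, F x w)"
    and p0: "p0 \<in> S0" and u0: "u0 \<in> Om"
  shows "\<exists>V u. open V \<and> p0 \<in> V \<and> V \<subseteq> S0 \<and> u ` V \<subseteq> Om \<and> smooth_on V u \<and> u p0 = u0 \<and>
    (\<forall>p\<in>V. \<forall>v. FD u p v = F (p, u p) v)"
proof -
  obtain r0 where r0: "r0 > 0" "cball p0 r0 \<subseteq> S0" using O(1) p0 open_contains_cball by blast
  obtain R where R: "R > 0" "cball u0 R \<subseteq> Om" using O(2) u0 open_contains_cball by blast
  define K where "K = cball p0 r0 \<times> cball u0 R"
  have K: "compact K" "convex K" "K \<subseteq> S0 \<times> Om"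
    unfolding K_def using r0 R by (auto intro: compact_Times convex_Times)
  obtain C where C: "C > 0" "\<And>x v. x \<in> K \<Longrightarrow> norm (F x v) \<le> C * norm v"
    "\<And>x y v. x \<in> K \<Longrightarrow> y \<in> K \<Longrightarrow> norm (F y v - F x v) \<le> C * norm (y - x) * norm v"
    "\<And>x u v. x \<in> K \<Longrightarrow> norm (FD (\<lambda>x. F x v) x u) \<le> C * norm u * norm v"
    "\<And>x y v. x \<in> K \<Longrightarrow> y \<in> K \<Longrightarrow> norm (F y v - F x v - FD (\<lambda>x. F x v) x (y - x)) \<le> C * norm (y - x) ^ 2 * norm v"
    using family_C2_bounds[OF open_Times[OF O] lin sm K] by metis
  \<comment> \<open>\<open>R / (2 * C)\<close> confines the ray solutions to half the radius
    \<open>R\<close> and leaves the other half for the comparison curve \<open>w\<close>;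
    \<open>1 / (2 * C)\<close> makes the equations on the rays Lipschitz with constant 1/2.\<close>
  define r where "r = min r0 (min (R / (2 * C)) (1 / (2 * C)))"
  have r: "r > 0" "r \<le> r0" "C * r \<le> R / 2" "C * r \<le> 1/2"
  proof -
    show "r > 0" "r \<le> r0" using r0 R C by (auto simp: r_def)
    have "r \<le> R / (2 * C)" "r \<le> 1 / (2 * C)" by (auto simp: r_def)
    then show "C * r \<le> R / 2" "C * r \<le> 1/2" using C(1) by (auto simp: field_simps)
  qed
  have xK: "(p0 + t *\<^sub>R d, u) \<in> K" if "t \<in> {0..1}" "norm d \<le> r" "u \<in> cball u0 R" for t d u
  proof -
    have "norm (t *\<^sub>R d) \<le> 1 * r" using that r(1) by (simp only: norm_scaleR) (intro mult_mono, auto)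
    then show ?thesis using that r(2) by (auto simp: K_def dist_norm)
  qed
  have "\<exists>v. v 0 = u0 \<and> (\<forall>t\<in>{0..1}. (v has_vector_derivative F (p0 + t *\<^sub>R d, v t) d) (at t within {0..1}) \<and> norm (v t - u0) \<le> C * norm d)"
    if d: "norm d \<le> r" for d
  proof (rule ode_unit_interval[where R = R and f = "\<lambda>t u. F (p0 + t *\<^sub>R d, u) d"])
    have cont: "continuous_on K (\<lambda>x. F x d)" using continuous_on_subset[OF smooth_on_continuous[OF sm] K(3)] .
    have "continuous_on ({0..1} \<times> cball u0 R) (\<lambda>x. F (p0 + fst x *\<^sub>R d, snd x) d)"
      by (rule continuous_on_compose2[OF cont]) (use xK d in \<open>auto intro!: continuous_intros\<close>)
    then show "continuous_on ({0..1} \<times> cball u0 R) (\<lambda>(t, u). F (p0 + t *\<^sub>R d, u) d)"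
      by (simp add: case_prod_unfold)
    show "norm (F (p0 + t *\<^sub>R d, u) d) \<le> C * norm d" if "t \<in> {0..1}" "u \<in> cball u0 R" for t u
      by (rule C(2)[OF xK[OF that(1) d that(2)]])
    show "norm (F (p0 + t *\<^sub>R d, u) d - F (p0 + t *\<^sub>R d, u') d) \<le> 1/2 * norm (u - u')"
      if "t \<in> {0..1}" "u \<in> cball u0 R" "u' \<in> cball u0 R" for t u u'
    proof -
      have "norm (F (p0 + t *\<^sub>R d, u) d - F (p0 + t *\<^sub>R d, u') d) \<le> C * norm (u - u') * norm d"
        using C(3)[OF xK[OF that(1) d that(3)] xK[OF that(1) d that(2)], of d] by (simp add: norm_Pair)
      also have "\<dots> \<le> C * norm (u - u') * r" using C(1) d by (intro mult_left_mono) auto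
      also have "\<dots> \<le> 1/2 * norm (u - u')" using mult_right_mono[OF r(4), of "norm (u - u')"] by (simp add: algebra_simps)
      finally show ?thesis .
    qed
    have "C * norm d \<le> C * r" using d C(1) by (intro mult_left_mono) auto
    then show "C * norm d \<le> R" using r(3) R(1) by linarith
  qed (use C(1) in auto)
  then obtain sol where sol: "\<And>d. norm d \<le> r \<Longrightarrow> sol d 0 = u0"
    "\<And>d t. norm d \<le> r \<Longrightarrow> t \<in> {0..1} \<Longrightarrow> (sol d has_vector_derivative F (p0 + t *\<^sub>R d, sol d t) d) (at t within {0..1})"
    "\<And>d t. norm d \<le> r \<Longrightarrow> t \<in> {0..1} \<Longrightarrow> norm (sol d t - u0) \<le> C * norm d"
    by metis
  \<comment> \<open>The ray towards \<open>p\<close> is traversed in unit time with velocity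
    \<open>p - p0\<close>, so it arrives at \<open>p\<close> at time 1.\<close>
  define u where "u p = sol (p - p0) 1" for p
  let ?V = "ball p0 r"
  have solR: "norm (sol d t - u0) \<le> R / 2" if "norm d \<le> r" "t \<in> {0..1}" for d t
    using sol(3)[OF that] mult_left_mono[OF that(1), of C] C(1) r(3) by linarith
  have solR': "sol d t \<in> cball u0 R" if "norm d \<le> r" "t \<in> {0..1}" for d t
    using solR[OF that] R(1) by (simp add: dist_norm norm_minus_commute)
  have xK': "(p0 + t *\<^sub>R d, sol d t) \<in> K" if "norm d \<le> r" "t \<in> {0..1}" for d t
    by (rule xK[OF that(2,1) solR'[OF that]])
  \<comment> \<open>In the constant, the first summand bounds the Taylor remainder and the second
    the mixed term in which \<open>t\<close> multiplies a derivative of \<open>F\<close> in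
    direction \<eta>. The powers of \<open>1 + C\<close> come from the size of \<eta>, the factor 2
    from \<open>gronwall_half\<close>.\<close>
  have main: "norm (sol (d + e) 1 - (sol d 1 + F (p0 + d, sol d 1) e)) \<le> 2 * ((C * (1 + C)^2 * r + C * (1 + C)) * norm e ^ 2)"
    if d: "norm d \<le> r" and de: "norm (d + e) \<le> r" and e: "C * norm e \<le> R / 2" for d e
  proof -
    define x where "x t = (p0 + t *\<^sub>R d, sol d t)" for t
    define w where "w t = sol d t + t *\<^sub>R F (x t) e" for t
    define w' where "w' t = F (x t) d + (F (x t) e + t *\<^sub>R FD (\<lambda>x. F x e) (x t) (d, F (x t) d))" for t
    have xt: "x t \<in> K" if "t \<in> {0..1}" for t unfolding x_def by (rule xK'[OF d that])
    have xS: "x t \<in> S0 \<times> Om" if "t \<in> {0..1}" for t using xt[OF that] K(3) by blast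
    have dw: "(w has_vector_derivative w' t) (at t within {0..1})" if t: "t \<in> {0..1}" for t
    proof -
      have ds: "(sol d has_vector_derivative F (x t) d) (at t within {0..1})"
        using sol(2)[OF d t] by (simp add: x_def)
      have "((\<lambda>t. p0 + t *\<^sub>R d) has_vector_derivative d) (at t within {0..1})"
        by (auto intro!: derivative_eq_intros)
      then have dx: "(x has_vector_derivative (d, F (x t) d)) (at t within {0..1})"
        unfolding x_def by (intro has_vector_derivative_Pair ds[unfolded x_def]) auto
      have "((\<lambda>x. F x e) \<circ> x has_vector_derivative FD (\<lambda>x. F x e) (x t) (d, F (x t) d)) (at t within {0..1})"
        by (rule vector_derivative_diff_chain_within[OF dx has_derivative_at_withinI[OF smooth_on_has_FD[OF sm xS[OF t]]]])
      then have "((\<lambda>t. F (x t) e) has_vector_derivative FD (\<lambda>x. F x e) (x t) (d, F (x t) d)) (at t within {0..1})"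
        by (simp add: o_def)
      then show ?thesis unfolding w_def w'_def
        by (auto intro!: derivative_eq_intros ds simp: algebra_simps)
    qed
    define z where "z t = sol (d + e) t - w t" for t
    have dz: "(z has_vector_derivative (F (p0 + t *\<^sub>R (d + e), sol (d + e) t) (d + e) - w' t)) (at t within {0..1})"
      if t: "t \<in> {0..1}" for t
      unfolding z_def by (intro has_vector_derivative_diff sol(2)[OF de t] dw[OF t])
    have "norm (z 1) \<le> 2 * ((C * (1 + C)^2 * r + C * (1 + C)) * norm e ^ 2)"
    proof (rule gronwall_half[OF dz])
      show "z 0 = 0" by (simp add: z_def w_def sol(1)[OF d] sol(1)[OF de])
      fix t :: real assume t: "t \<in> {0..1}"
      define \<eta> where "\<eta> = (e, F (x t) e)"
      define y where "y = (p0 + t *\<^sub>R (d + e), w t)"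
      have yx: "y - x t = t *\<^sub>R \<eta>" by (simp add: y_def x_def w_def \<eta>_def algebra_simps)
      have Fe: "norm (F (x t) e) \<le> C * norm e" by (rule C(2)[OF xt[OF t]])
      have \<eta>: "norm \<eta> \<le> (1 + C) * norm e" unfolding \<eta>_def using norm_Pair_le[of e "F (x t) e"] Fe by (simp add: algebra_simps)
      have tF: "norm (t *\<^sub>R F (x t) e) \<le> C * norm e"
        using t Fe mult_mono[of t 1 "norm (F (x t) e)" "C * norm e"] by simp
      have "norm (w t - u0) \<le> norm (sol d t - u0) + norm (t *\<^sub>R F (x t) e)"
        unfolding w_def using norm_triangle_ineq[of "sol d t - u0" "t *\<^sub>R F (x t) e"] by (simp add: algebra_simps)
      also have "\<dots> \<le> R" using solR[OF d t] tF e by linarith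
      finally have wR: "w t \<in> cball u0 R" by (simp add: dist_norm norm_minus_commute)
      have yK: "y \<in> K" unfolding y_def by (rule xK[OF t de wR])
      have "norm (F (p0 + t *\<^sub>R (d + e), sol (d + e) t) (d + e) - F y (d + e)) \<le>
          C * norm ((p0 + t *\<^sub>R (d + e), sol (d + e) t) - y) * norm (d + e)"
        by (rule C(3)[OF yK xK'[OF de t]])
      also have "\<dots> = C * norm (z t) * norm (d + e)" by (simp add: y_def z_def norm_Pair)
      also have "\<dots> \<le> C * norm (z t) * r" using C(1) de by (intro mult_left_mono) auto
      also have "\<dots> \<le> 1/2 * norm (z t)" using mult_right_mono[OF r(4), of "norm (z t)"] by (simp add: algebra_simps)
      finally have b1: "norm (F (p0 + t *\<^sub>R (d + e), sol (d + e) t) (d + e) - F y (d + e)) \<le> 1/2 * norm (z t)" .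
      have lx: "linear (F (x t))" by (rule lin[OF xS[OF t]])
      have FDl: "linear (\<lambda>v. FD (\<lambda>x. F x v) (x t) \<eta>)"
        by (rule FD_family_linear[OF open_Times[OF O] xS[OF t] lin smooth_on_differentiable[OF sm xS[OF t]]])
      have FDs: "FD (\<lambda>x. F x v) (x t) (t *\<^sub>R \<eta>) = t *\<^sub>R FD (\<lambda>x. F x v) (x t) \<eta>" for v
        by (rule linear_cmul[OF smooth_on_FD_linear[OF sm xS[OF t]]])
      \<comment> \<open>The point where integrability enters: the derivative in the displaced
        direction \<eta> is exchanged for the derivative along the ray, which occurs in
        \<open>w'\<close>.\<close>
      have int: "FD (\<lambda>x. F x d) (x t) \<eta> = FD (\<lambda>x. F x e) (x t) (d, F (x t) d)"
        unfolding \<eta>_def by (rule integ[OF xS[OF t]])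
      have "F y (d + e) - w' t = (F y (d + e) - F (x t) (d + e) - FD (\<lambda>x. F x (d + e)) (x t) (y - x t)) +
          t *\<^sub>R FD (\<lambda>x. F x e) (x t) \<eta>"
        unfolding yx FDs linear_add[OF FDl] linear_add[OF lx] w'_def int by (simp add: algebra_simps)
      also have "norm \<dots> \<le> norm (F y (d + e) - F (x t) (d + e) - FD (\<lambda>x. F x (d + e)) (x t) (y - x t)) +
          norm (t *\<^sub>R FD (\<lambda>x. F x e) (x t) \<eta>)" by (rule norm_triangle_ineq)
      also have "\<dots> \<le> C * (1 + C)^2 * r * norm e ^ 2 + C * (1 + C) * norm e ^ 2"
      proof (rule add_mono)
        have n: "norm (y - x t) \<le> (1 + C) * norm e"
          unfolding yx using t \<eta> mult_mono[of t 1 "norm \<eta>" "(1 + C) * norm e"] by simp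
        have "norm (F y (d + e) - F (x t) (d + e) - FD (\<lambda>x. F x (d + e)) (x t) (y - x t)) \<le> C * norm (y - x t) ^ 2 * norm (d + e)"
          by (rule C(5)[OF xt[OF t] yK])
        also have "\<dots> \<le> C * ((1 + C) * norm e) ^ 2 * r"
          using C(1) n de r(1) by (intro mult_mono mult_left_mono power_mono) auto
        finally show "norm (F y (d + e) - F (x t) (d + e) - FD (\<lambda>x. F x (d + e)) (x t) (y - x t)) \<le> C * (1 + C)^2 * r * norm e ^ 2"
          by (simp add: power_mult_distrib mult.assoc mult.left_commute mult.commute)
        have "norm (t *\<^sub>R FD (\<lambda>x. F x e) (x t) \<eta>) \<le> 1 * norm (FD (\<lambda>x. F x e) (x t) \<eta>)"
          using t by (simp only: norm_scaleR) (intro mult_right_mono, auto)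
        also have "\<dots> \<le> C * norm \<eta> * norm e" using C(4)[OF xt[OF t]] by simp
        also have "\<dots> \<le> C * ((1 + C) * norm e) * norm e" using C(1) \<eta> by (intro mult_right_mono mult_left_mono) auto
        finally show "norm (t *\<^sub>R FD (\<lambda>x. F x e) (x t) \<eta>) \<le> C * (1 + C) * norm e ^ 2"
          by (simp add: power2_eq_square mult.assoc)
      qed
      finally have b2: "norm (F y (d + e) - w' t) \<le> (C * (1 + C)^2 * r + C * (1 + C)) * norm e ^ 2"
        by (simp add: algebra_simps)
      show "norm (F (p0 + t *\<^sub>R (d + e), sol (d + e) t) (d + e) - w' t) \<le> 1/2 * norm (z t) + (C * (1 + C)^2 * r + C * (1 + C)) * norm e ^ 2"
        using b1 b2 norm_triangle_ineq[of "F (p0 + t *\<^sub>R (d + e), sol (d + e) t) (d + e) - F y (d + e)" "F y (d + e) - w' t"]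
        by simp
    qed
    then show ?thesis by (simp add: z_def w_def x_def)
  qed
  have du: "(u has_derivative F (p, u p)) (at p)" if p: "p \<in> ?V" for p
    unfolding has_derivative_at_alt
  proof (intro conjI allI impI)
    have d: "norm (p - p0) < r" using p by (simp add: dist_norm norm_minus_commute)
    have up: "(p, u p) \<in> K" using xK'[of "p - p0" 1] d by (simp add: u_def)
    then show "bounded_linear (F (p, u p))" using lin K(3) linear_conv_bounded_linear by blast
    fix \<epsilon> :: real assume \<epsilon>: "\<epsilon> > 0"
    define Q where "Q = 2 * (C * (1 + C)^2 * r + C * (1 + C))"
    have Q: "Q > 0" unfolding Q_def using C(1) r(1) by (intro mult_pos_pos add_pos_pos) auto
    \<comment> \<open>The three bounds keep \<open>y\<close> in the ball, meet the condition of
      \<open>main\<close> on the size of the displacement, and make the quadratic error at most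
      \<epsilon> times the distance.\<close>
    define \<delta> where "\<delta> = min (r - norm (p - p0)) (min (R / (2 * C)) (\<epsilon> / Q))"
    have \<delta>: "\<delta> > 0" using d R(1) C(1) \<epsilon> Q by (simp add: \<delta>_def)
    show "\<exists>\<delta>>0. \<forall>y. norm (y - p) < \<delta> \<longrightarrow> norm (u y - u p - F (p, u p) (y - p)) \<le> \<epsilon> * norm (y - p)"
    proof (intro exI[of _ \<delta>] conjI allI impI \<delta>)
      fix y assume y: "norm (y - p) < \<delta>"
      have 1: "norm (p - p0 + (y - p)) \<le> r" using y norm_triangle_ineq[of "p - p0" "y - p"] by (simp add: \<delta>_def)
      have "norm (y - p) \<le> R / (2 * C)" using y by (simp add: \<delta>_def)
      then have 2: "C * norm (y - p) \<le> R / 2" using C(1) by (simp add: field_simps)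
      have "norm (y - p) \<le> \<epsilon> / Q" using y by (simp add: \<delta>_def)
      then have 3: "Q * norm (y - p) \<le> \<epsilon>" using Q by (simp add: field_simps)
      have "norm (u y - u p - F (p, u p) (y - p)) \<le> Q * norm (y - p) ^ 2"
        using main[OF less_imp_le[OF d] 1 2] by (simp add: u_def Q_def algebra_simps)
      also have "\<dots> = (Q * norm (y - p)) * norm (y - p)" by (simp add: power2_eq_square)
      also have "\<dots> \<le> \<epsilon> * norm (y - p)" using 3 by (intro mult_right_mono) auto
      finally show "norm (u y - u p - F (p, u p) (y - p)) \<le> \<epsilon> * norm (y - p)" .
    qed
  qed
  have VS: "?V \<subseteq> S0" using r0 r(2) by (auto simp: subset_iff)
  have uOm: "u p \<in> Om" if "p \<in> ?V" for p
    using solR'[of "p - p0" 1] R(2) that by (auto simp: u_def dist_norm norm_minus_commute)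
  \<comment> \<open>Bootstrapping: the derivative of \<open>u\<close> is \<open>F (p, u p)\<close>,
    which is of class C^k as soon as \<open>u\<close> is.\<close>
  have "Ck_on k ?V u" for k
  proof (induction k)
    case 0
    show ?case using du by (auto intro!: continuous_at_imp_continuous_on has_derivative_continuous)
  next
    case (Suc k)
    have "Ck_on k ?V (\<lambda>p. F (p, u p) v)" for v
      by (rule Ck_on_compose[OF open_ball open_Times[OF O] Ck_on_Pair[OF open_ball smooth_on_Ck[OF smooth_on_id[OF open_ball]] Suc]
            smooth_on_Ck[OF sm]]) (use VS uOm in auto)
    then have "Ck_on k ?V (\<lambda>p. FD u p v)" for v
      by (subst Ck_on_cong[OF open_ball, of _ _ _ "\<lambda>p. F (p, u p) v"]) (simp_all add: FD_eqI[OF du])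
    moreover have "\<forall>p\<in>?V. u differentiable (at p)" unfolding differentiable_def using du by blast
    ultimately show ?case by simp
  qed
  then have "smooth_on ?V u" by (simp add: smooth_on_def)
  moreover have "u p0 = u0" using sol(3)[of 0 1] r(1) by (simp add: u_def)
  ultimately show ?thesis
    using VS uOm r(1) FD_eqI[OF du] by (intro exI[of _ ?V] exI[of _ u]) auto
qed

section \<open>Monodromy\<close>

text \<open>Simple connectedness asks any two loops to be freely homotopic, constant loops included;
  the trace of the base point under such a homotopy is a path.\<close>

lemma simply_connected_path:
  fixes S :: "'y::topological_space set"
  assumes "simply_connected S" "x \<in> S" "y \<in> S"
  obtains \<gamma> where "path \<gamma>" "path_image \<gamma> \<subseteq> S" "\<gamma> 0 = x" "\<gamma> 1 = y"
proof -
  have "homotopic_loops S (\<lambda>_. x) (\<lambda>_. y)"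
    by (rule assms(1)[unfolded simply_connected_def, rule_format])
      (use assms in \<open>auto simp: pathstart_def pathfinish_def path_def path_image_def\<close>)
  then obtain h where h: "continuous_on ({0..1::real} \<times> {0..1::real}) h" "h \<in> ({0..1} \<times> {0..1}) \<rightarrow> S"
    "\<forall>r\<in>{0..1}. h (0, r) = x" "\<forall>r\<in>{0..1}. h (1, r) = y"
    unfolding homotopic_loops by auto
  have "continuous_on {0..1} (\<lambda>t. h (t, 0))"
    by (rule continuous_on_compose2[OF h(1)]) (auto intro!: continuous_intros)
  then show thesis
    using h(2-4) by (intro that[of "\<lambda>t. h (t, 0)"]) (auto simp: path_def path_image_def)
qed

text \<open>A sheaf of local sections \<open>I\<close> whose space of germs is a covering of \<open>S\<close> with fibres \<open>E y\<close>; \<open>lift T h \<sigma>\<close>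
  says that \<open>\<sigma>\<close> is a lift of \<open>h : T \<rightarrow> S\<close> to this covering.\<close>

locale section_cover =
  fixes S :: "'y::topological_space set" and I :: "('y set \<times> ('y \<Rightarrow> 'p)) set" and E :: "'y \<Rightarrow> 'p set"
  assumes I_open: "(U, s) \<in> I \<Longrightarrow> openin (top_of_set S) U"
    and I_in: "(U, s) \<in> I \<Longrightarrow> y \<in> U \<Longrightarrow> s y \<in> E y"
    and agree: "(U, s) \<in> I \<Longrightarrow> (V, t) \<in> I \<Longrightarrow> y \<in> U \<Longrightarrow> y \<in> V \<Longrightarrow> s y = t y \<Longrightarrow>
      \<exists>W. openin (top_of_set S) W \<and> y \<in> W \<and> W \<subseteq> U \<inter> V \<and> (\<forall>z\<in>W. s z = t z)"
    and disagree: "(U, s) \<in> I \<Longrightarrow> (V, t) \<in> I \<Longrightarrow> y \<in> U \<Longrightarrow> y \<in> V \<Longrightarrow> s y \<noteq> t y \<Longrightarrow>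
      \<exists>W. openin (top_of_set S) W \<and> y \<in> W \<and> W \<subseteq> U \<inter> V \<and> (\<forall>z\<in>W. s z \<noteq> t z)"
    and cover: "y \<in> S \<Longrightarrow> \<exists>U. openin (top_of_set S) U \<and> y \<in> U \<and> (\<forall>z\<in>U. \<forall>\<xi>\<in>E z. \<exists>s. (U, s) \<in> I \<and> s z = \<xi>)"
begin

definition lift :: "'z::topological_space set \<Rightarrow> ('z \<Rightarrow> 'y) \<Rightarrow> ('z \<Rightarrow> 'p) \<Rightarrow> bool" where
  "lift T h \<sigma> \<longleftrightarrow> continuous_on T h \<and> h ` T \<subseteq> S \<and>
    (\<forall>t\<in>T. \<exists>W U s. openin (top_of_set T) W \<and> t \<in> W \<and> (U, s) \<in> I \<and> h ` W \<subseteq> U \<and> (\<forall>r\<in>W. \<sigma> r = s (h r)))"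

lemma lift_in: "lift T h \<sigma> \<Longrightarrow> t \<in> T \<Longrightarrow> \<sigma> t \<in> E (h t)"
  unfolding lift_def using I_in by (metis image_subset_iff)

lemma preimage_openin:
  assumes "continuous_on T h" "h ` T \<subseteq> S" "openin (top_of_set S) V"
  shows "openin (top_of_set T) {t \<in> T. h t \<in> V}"
proof -
  have "openin (top_of_set T) (T \<inter> h -` V)"
    by (rule continuous_openin_preimage[OF assms(1) _ assms(3)]) (use assms(2) in auto)
  moreover have "T \<inter> h -` V = {t \<in> T. h t \<in> V}" by auto
  ultimately show ?thesis by simp
qed

text \<open>\<open>agree\<close> makes the set where the lifts coincide open, and
  \<open>disagree\<close>, a separation property of the space of germs, does the same for its
  complement.\<close>

lemma lift_unique:
  assumes T: "connected T" and l: "lift T h \<sigma>" "lift T h \<tau>" and t0: "t0 \<in> T" "\<sigma> t0 = \<tau> t0" and t: "t \<in> T"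
  shows "\<sigma> t = \<tau> t"
proof -
  let ?A = "{t \<in> T. \<sigma> t = \<tau> t}" and ?B = "{t \<in> T. \<sigma> t \<noteq> \<tau> t}"
  have h: "continuous_on T h" "h ` T \<subseteq> S" using l by (auto simp: lift_def)
  have *: "\<exists>N. openin (top_of_set T) N \<and> r \<in> N \<and> (\<forall>q\<in>N. (\<sigma> q = \<tau> q) = (\<sigma> r = \<tau> r))" if r: "r \<in> T" for r
  proof -
    obtain W U s where 1: "openin (top_of_set T) W" "r \<in> W" "(U, s) \<in> I" "h ` W \<subseteq> U" "\<forall>r\<in>W. \<sigma> r = s (h r)"
      using l(1) r unfolding lift_def by blast
    obtain W' U' s' where 2: "openin (top_of_set T) W'" "r \<in> W'" "(U', s') \<in> I" "h ` W' \<subseteq> U'" "\<forall>r\<in>W'. \<tau> r = s' (h r)"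
      using l(2) r unfolding lift_def by blast
    have hr: "h r \<in> U" "h r \<in> U'" using 1 2 by auto
    obtain V where V: "openin (top_of_set S) V" "h r \<in> V" "(\<forall>z\<in>V. s z = s' z) \<or> (\<forall>z\<in>V. s z \<noteq> s' z)"
      using agree[OF 1(3) 2(3) hr] disagree[OF 1(3) 2(3) hr] by metis
    let ?N = "W \<inter> W' \<inter> {t \<in> T. h t \<in> V}"
    have "openin (top_of_set T) ?N" using preimage_openin[OF h V(1)] 1(1) 2(1) by (intro openin_Int)
    moreover have "r \<in> ?N" using 1 2 V r by auto
    moreover have "\<forall>q\<in>?N. (\<sigma> q = \<tau> q) = (\<sigma> r = \<tau> r)" using V(2,3) 1(2,5) 2(2,5) by auto
    ultimately show ?thesis by blast
  qed
  have op: "openin (top_of_set T) {t \<in> T. (\<sigma> t = \<tau> t) = b}" for b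
  proof (subst openin_subopen, intro ballI)
    fix r assume r: "r \<in> {t \<in> T. (\<sigma> t = \<tau> t) = b}"
    then have "r \<in> T" and b: "(\<sigma> r = \<tau> r) = b" by auto
    from *[OF this(1)] obtain N where N: "openin (top_of_set T) N" "r \<in> N" "\<forall>q\<in>N. (\<sigma> q = \<tau> q) = b"
      unfolding b by blast
    then have "N \<subseteq> {t \<in> T. (\<sigma> t = \<tau> t) = b}" using openin_imp_subset[OF N(1)] by auto
    then show "\<exists>N. openin (top_of_set T) N \<and> r \<in> N \<and> N \<subseteq> {t \<in> T. (\<sigma> t = \<tau> t) = b}" using N by blast
  qed
  have "T \<subseteq> ?A \<union> ?B" "?A \<inter> ?B = {}" by auto
  moreover have "?A \<noteq> {}" using t0 by blast
  ultimately have "?B = {}"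
    using T op[of True] op[of False] unfolding connected_openin by simp blast
  then show ?thesis using t by blast
qed

lemma lift_subset:
  assumes l: "lift T h \<sigma>" and T: "T' \<subseteq> T"
  shows "lift T' h \<sigma>"
  unfolding lift_def
proof (intro conjI ballI)
  show "continuous_on T' h" "h ` T' \<subseteq> S" using l T by (auto simp: lift_def intro: continuous_on_subset)
  fix t assume "t \<in> T'"
  then obtain W U s where W: "openin (top_of_set T) W" "t \<in> W" "(U, s) \<in> I" "h ` W \<subseteq> U" "\<forall>r\<in>W. \<sigma> r = s (h r)"
    using l T unfolding lift_def by blast
  have "openin (top_of_set T') (T' \<inter> W)" using W(1) T by (auto simp: openin_open)
  then show "\<exists>W U s. openin (top_of_set T') W \<and> t \<in> W \<and> (U, s) \<in> I \<and> h ` W \<subseteq> U \<and> (\<forall>r\<in>W. \<sigma> r = s (h r))"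
    using W \<open>t \<in> T'\<close> by (intro exI[of _ "T' \<inter> W"] exI[of _ U] exI[of _ s]) auto
qed

lemma lift_compose:
  assumes l: "lift T h \<sigma>" and k: "continuous_on T' k" "k ` T' \<subseteq> T"
  shows "lift T' (\<lambda>t. h (k t)) (\<lambda>t. \<sigma> (k t))"
  unfolding lift_def
proof (intro conjI ballI)
  show "continuous_on T' (\<lambda>t. h (k t))" using l k by (auto simp: lift_def intro: continuous_on_compose2)
  show "(\<lambda>t. h (k t)) ` T' \<subseteq> S" using l k by (auto simp: lift_def)
  fix t assume t: "t \<in> T'"
  then obtain W U s where W: "openin (top_of_set T) W" "k t \<in> W" "(U, s) \<in> I" "h ` W \<subseteq> U" "\<forall>r\<in>W. \<sigma> r = s (h r)"
    using l image_subset_iff[of k T' T] k(2) unfolding lift_def by metis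
  have "openin (top_of_set T') (T' \<inter> k -` W)"
    by (rule continuous_openin_preimage[OF k(1) _ W(1)]) (use k(2) in auto)
  then show "\<exists>W U s. openin (top_of_set T') W \<and> t \<in> W \<and> (U, s) \<in> I \<and> (\<lambda>t. h (k t)) ` W \<subseteq> U \<and> (\<forall>r\<in>W. \<sigma> (k r) = s (h (k r)))"
    using W t by (intro exI[of _ "T' \<inter> k -` W"] exI[of _ U] exI[of _ s]) auto
qed

lemma lift_const:
  assumes "y \<in> S" "\<xi> \<in> E y"
  shows "lift T (\<lambda>_. y) (\<lambda>_. \<xi>)"
proof -
  obtain U s where "(U, s) \<in> I" "y \<in> U" "s y = \<xi>" using cover[OF assms(1)] assms(2) by blast
  then show ?thesis using assms(1)
    unfolding lift_def by (auto intro!: exI[of _ T] exI[of _ U] exI[of _ s])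
qed

lemma lift_cong:
  assumes "lift T h \<sigma>" "\<And>t. t \<in> T \<Longrightarrow> h t = h' t" "\<And>t. t \<in> T \<Longrightarrow> \<sigma> t = \<tau> t"
  shows "lift T h' \<tau>"
  unfolding lift_def
proof (intro conjI ballI)
  show "continuous_on T h'" using assms(1,2) continuous_on_cong[of T T h h'] by (auto simp: lift_def)
  show "h' ` T \<subseteq> S" using assms(1,2) by (auto simp: lift_def)
  fix t assume "t \<in> T"
  then obtain W U s where W: "openin (top_of_set T) W" "t \<in> W" "(U, s) \<in> I" "h ` W \<subseteq> U" "\<forall>r\<in>W. \<sigma> r = s (h r)"
    using assms(1) unfolding lift_def by blast
  moreover have "W \<subseteq> T" by (rule openin_imp_subset[OF W(1)])
  ultimately show "\<exists>W U s. openin (top_of_set T) W \<and> t \<in> W \<and> (U, s) \<in> I \<and> h' ` W \<subseteq> U \<and> (\<forall>r\<in>W. \<tau> r = s (h' r))"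
    using assms(2,3) by (intro exI[of _ W] exI[of _ U] exI[of _ s]) (auto simp: subset_iff image_subset_iff)
qed

text \<open>On the connected overlap the lifts coincide by uniqueness. At an overlap point the two
  sections describing them have the same value and agree nearby, so one of them describes the glued
  lift on both sides; off the overlap, the other piece is closed and can be avoided.\<close>

lemma lift_glue:
  assumes T: "closed T1" "closed T2" and h: "continuous_on (T1 \<union> T2) h"
    and l: "lift T1 h \<sigma>" "lift T2 h \<tau>" and conn: "connected (T1 \<inter> T2)" and t0: "t0 \<in> T1 \<inter> T2" "\<sigma> t0 = \<tau> t0"
  shows "lift (T1 \<union> T2) h (\<lambda>t. if t \<in> T1 then \<sigma> t else \<tau> t)"
proof -
  define \<rho> where "\<rho> t = (if t \<in> T1 then \<sigma> t else \<tau> t)" for t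
  have eq: "\<sigma> t = \<tau> t" if "t \<in> T1 \<inter> T2" for t
    by (rule lift_unique[OF conn lift_subset[OF l(1)] lift_subset[OF l(2)] t0 that]) auto
  have l': "lift T1 h \<rho>" "lift T2 h \<rho>"
    by (rule lift_cong[OF l(1)], auto simp: \<rho>_def, rule lift_cong[OF l(2)], auto simp: \<rho>_def eq)
  have hS: "h ` (T1 \<union> T2) \<subseteq> S" using l by (auto simp: lift_def)
  have one: "\<exists>N U s. openin (top_of_set (A \<union> B)) N \<and> t \<in> N \<and> (U, s) \<in> I \<and> h ` N \<subseteq> U \<and> (\<forall>r\<in>N. \<rho> r = s (h r))"
    if t: "t \<in> A" "t \<notin> B" and B: "closed B" and lA: "lift A h \<rho>" for A B t
  proof -
    obtain W U s where W: "openin (top_of_set A) W" "t \<in> W" "(U, s) \<in> I" "h ` W \<subseteq> U" "\<forall>r\<in>W. \<rho> r = s (h r)"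
      using lA t unfolding lift_def by blast
    obtain O1 where O1: "open O1" "W = A \<inter> O1" using W(1) by (auto simp: openin_open)
    have "openin (top_of_set (A \<union> B)) ((A \<union> B) \<inter> (O1 - B))"
      using O1(1) B by (auto simp: openin_open intro!: exI[of _ "O1 - B"] open_Diff)
    then show ?thesis
      using W O1 t by (intro exI[of _ "(A \<union> B) \<inter> (O1 - B)"] exI[of _ U] exI[of _ s]) auto
  qed
  have "\<exists>N U s. openin (top_of_set (T1 \<union> T2)) N \<and> t \<in> N \<and> (U, s) \<in> I \<and> h ` N \<subseteq> U \<and> (\<forall>r\<in>N. \<rho> r = s (h r))"
    if t: "t \<in> T1 \<union> T2" for t
  proof (cases "t \<in> T1 \<and> t \<in> T2")
    case False
    then show ?thesis
      using one[of t T1 T2, OF _ _ T(2) l'(1)] one[of t T2 T1, OF _ _ T(1) l'(2)] t by (auto simp: Un_commute)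
  next
    case True
    obtain W U s where 1: "openin (top_of_set T1) W" "t \<in> W" "(U, s) \<in> I" "h ` W \<subseteq> U" "\<forall>r\<in>W. \<rho> r = s (h r)"
      using l'(1) True unfolding lift_def by blast
    obtain W' U' s' where 2: "openin (top_of_set T2) W'" "t \<in> W'" "(U', s') \<in> I" "h ` W' \<subseteq> U'" "\<forall>r\<in>W'. \<rho> r = s' (h r)"
      using l'(2) True unfolding lift_def by blast
    have hr: "h t \<in> U" "h t \<in> U'" using 1 2 by auto
    have "s (h t) = s' (h t)" using 1 2 by metis
    then obtain V where V: "openin (top_of_set S) V" "h t \<in> V" "V \<subseteq> U \<inter> U'" "\<forall>z\<in>V. s z = s' z"
      using agree[OF 1(3) 2(3) hr] by blast
    obtain O1 where O1: "open O1" "W = T1 \<inter> O1" using 1(1) by (auto simp: openin_open)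
    obtain O2 where O2: "open O2" "W' = T2 \<inter> O2" using 2(1) by (auto simp: openin_open)
    let ?N = "((T1 \<union> T2) \<inter> (O1 \<inter> O2)) \<inter> {r \<in> T1 \<union> T2. h r \<in> V}"
    have "openin (top_of_set (T1 \<union> T2)) ?N"
      by (intro openin_Int preimage_openin[OF h hS V(1)] openin_open_Int open_Int O1(1) O2(1))
    moreover have "\<forall>r\<in>?N. \<rho> r = s (h r)" using 1(5) 2(5) O1(2) O2(2) V(4) by auto
    ultimately show ?thesis
      using True 1 2 O1 O2 V by (intro exI[of _ ?N] exI[of _ U] exI[of _ s]) auto
  qed
  then show ?thesis unfolding \<rho>_def[symmetric] lift_def using h hS by blast
qed

text \<open>\<open>T j\<close> is the box attached at stage \<open>j\<close>, \<open>U j\<close> the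
  union of the boxes up to \<open>T j\<close>, and \<open>p j\<close> a point where
  \<open>T j\<close> meets what is already there. Used for a row of squares and again for a column
  of rows.\<close>

lemma lift_chain:
  assumes U: "U 0 = T 0" "\<And>j. U (Suc j) = U j \<union> T (Suc j)"
    and cl: "\<And>j. closed (U j)" "\<And>j. closed (T j)" and h: "\<And>j. j < n \<Longrightarrow> continuous_on (U j) h"
    and p: "\<And>j. p 0 \<in> U j" "\<And>j. p (Suc j) \<in> U j \<inter> T (Suc j)" and conn: "\<And>j. connected (U j \<inter> T (Suc j))"
    and box: "\<And>j \<zeta>. j < n \<Longrightarrow> \<zeta> \<in> E (h (p j)) \<Longrightarrow> \<exists>\<sigma>. lift (T j) h \<sigma> \<and> \<sigma> (p j) = \<zeta>"
    and \<zeta>: "\<zeta> \<in> E (h (p 0))" and j: "j < n"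
  shows "\<exists>\<sigma>. lift (U j) h \<sigma> \<and> \<sigma> (p 0) = \<zeta>"
  using j
proof (induction j)
  case 0
  then show ?case using box[OF 0 \<zeta>] by (simp add: U(1))
next
  case (Suc j)
  then obtain \<sigma> where \<sigma>: "lift (U j) h \<sigma>" "\<sigma> (p 0) = \<zeta>" by auto
  obtain \<tau> where \<tau>: "lift (T (Suc j)) h \<tau>" "\<tau> (p (Suc j)) = \<sigma> (p (Suc j))"
    using box[OF Suc.prems lift_in[OF \<sigma>(1)]] p(2) by blast
  have "lift (U (Suc j)) h (\<lambda>t. if t \<in> U j then \<sigma> t else \<tau> t)"
    unfolding U(2)
    by (rule lift_glue[OF cl(1) cl(2) h[OF Suc.prems, unfolded U(2)] \<sigma>(1) \<tau>(1) conn p(2) \<tau>(2)[symmetric]])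
  then show ?case using \<sigma>(2) p(1)[of j]
    by (intro exI[of _ "\<lambda>t. if t \<in> U j then \<sigma> t else \<tau> t"]) simp
qed

text \<open>A Lebesgue number provides a subdivision into squares each of which is mapped into a set
  over which sections with all initial values exist; \<open>lift_chain\<close> joins the
  pieces.\<close>

lemma lift_square:
  fixes h :: "real \<times> real \<Rightarrow> 'y"
  assumes h: "continuous_on ({0..1} \<times> {0..1}) h" "h ` ({0..1} \<times> {0..1}) \<subseteq> S" and \<xi>: "\<xi> \<in> E (h (0, 0))"
  shows "\<exists>\<sigma>. lift ({0..1} \<times> {0..1}) h \<sigma> \<and> \<sigma> (0, 0) = \<xi>"
proof -
  let ?Q = "{0..1::real} \<times> {0..1::real}"
  define good where "good U \<longleftrightarrow> openin (top_of_set S) U \<and> (\<forall>z\<in>U. \<forall>\<xi>\<in>E z. \<exists>s. (U, s) \<in> I \<and> s z = \<xi>)" for U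
  define \<C> where "\<C> = {O1. open O1 \<and> (\<exists>U. good U \<and> h ` (?Q \<inter> O1) \<subseteq> U)}"
  have cov: "?Q \<subseteq> \<Union>\<C>"
  proof
    fix q assume q: "q \<in> ?Q"
    then obtain U where U: "good U" "h q \<in> U" using cover[of "h q"] h(2) unfolding good_def by blast
    have "openin (top_of_set ?Q) {t \<in> ?Q. h t \<in> U}"
      by (rule preimage_openin[OF h]) (use U in \<open>simp add: good_def\<close>)
    then obtain O1 where O1: "open O1" "{t \<in> ?Q. h t \<in> U} = ?Q \<inter> O1" by (auto simp: openin_open)
    then have "O1 \<in> \<C>" unfolding \<C>_def using U by blast
    moreover have "q \<in> O1" using O1 q U by blast
    ultimately show "q \<in> \<Union>\<C>" by blast
  qed
  obtain \<delta> where \<delta>: "\<delta> > 0" "\<And>T. T \<subseteq> ?Q \<Longrightarrow> diameter T < \<delta> \<Longrightarrow> \<exists>B\<in>\<C>. T \<subseteq> B"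
  proof (rule Lebesgue_number_lemma[of ?Q \<C>])
    show "compact ?Q" by (intro compact_Times) auto
    show "\<C> \<noteq> {}" using cov by auto
  qed (use cov in \<open>auto simp: \<C>_def\<close>)
  \<comment> \<open>Squares of side 1/n have diameter at most 2/n, by the sum bound for the norm of
    a pair.\<close>
  obtain n :: nat where n: "n > 0" "2 / n < \<delta>"
  proof -
    obtain n :: nat where "2 / \<delta> < n" using reals_Archimedean2 by blast
    moreover from this have "n > 0" using \<delta>(1) by (metis divide_pos_pos gr0I less_asym of_nat_0 zero_less_numeral)
    ultimately show thesis using \<delta>(1) by (intro that[of n]) (auto simp: field_simps)
  qed
  define g :: "nat \<Rightarrow> real" where "g i = i / n" for i
  have g: "g 0 = 0" "g n = 1" "g i \<le> g (Suc i)" "0 \<le> g i" "i \<le> j \<Longrightarrow> g i \<le> g j" "g (Suc i) - g i = 1 / n" for i j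
    using n(1) by (auto simp: g_def field_simps)
  have g1: "i \<le> n \<Longrightarrow> g i \<le> 1" for i using g(5)[of i n] by (simp add: g(2))
  have box: "\<exists>\<sigma>. lift ({g i..g (Suc i)} \<times> {g j..g (Suc j)}) h \<sigma> \<and> \<sigma> (g i, g j) = \<zeta>"
    if ij: "i < n" "j < n" and \<zeta>: "\<zeta> \<in> E (h (g i, g j))" for i j \<zeta>
  proof -
    let ?T = "{g i..g (Suc i)} \<times> {g j..g (Suc j)}"
    have TQ: "?T \<subseteq> ?Q" using g(4)[of i] g(4)[of j] g1[of "Suc i"] g1[of "Suc j"] ij by auto
    have "diameter ?T \<le> 2 / n"
    proof (rule diameter_le)
      fix p q assume "p \<in> ?T" "q \<in> ?T"
      then have "\<bar>fst p - fst q\<bar> \<le> 1 / n" "\<bar>snd p - snd q\<bar> \<le> 1 / n"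
        using g(6)[of i] g(6)[of j] by (auto simp: abs_le_iff)
      moreover have "norm (p - q) \<le> \<bar>fst p - fst q\<bar> + \<bar>snd p - snd q\<bar>"
        using norm_Pair_le[of "fst p - fst q" "snd p - snd q"] by (simp add: minus_prod_def)
      ultimately show "norm (p - q) \<le> 2 / n" by simp
    qed simp
    then obtain B where "B \<in> \<C>" "?T \<subseteq> B" using \<delta>(2)[OF TQ] n(2) by force
    then obtain U where U: "good U" "h ` ?T \<subseteq> U" unfolding \<C>_def using TQ by blast
    have c: "(g i, g j) \<in> ?T" using g(3) by auto
    then obtain s where s: "(U, s) \<in> I" "s (h (g i, g j)) = \<zeta>" using U \<zeta> unfolding good_def by blast
    have "lift ?T h (\<lambda>t. s (h t))" unfolding lift_def
      using h TQ U s by (auto intro: continuous_on_subset intro!: exI[of _ ?T] exI[of _ U] exI[of _ s])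
    then show ?thesis using s(2) by blast
  qed
  have cont: "continuous_on T h" if "T \<subseteq> ?Q" for T by (rule continuous_on_subset[OF h(1) that])
  have sub: "{a..b} \<times> {c..d} \<subseteq> ?Q" if "0 \<le> a" "b \<le> 1" "0 \<le> c" "d \<le> 1" for a b c d using that by auto
  have ivl: "{0..g (Suc (Suc i))} = {0..g (Suc i)} \<union> {g (Suc i)..g (Suc (Suc i))}"
    "{0..g (Suc i)} \<inter> {g (Suc i)..g (Suc (Suc i))} = {g (Suc i)}" for i
    using g(3,4) by (auto intro: antisym order_trans[OF _ g(3)] order_trans[OF g(4)])
  have row: "\<exists>\<sigma>. lift ({0..1} \<times> {g j..g (Suc j)}) h \<sigma> \<and> \<sigma> (0, g j) = \<zeta>"
    if j: "j < n" and \<zeta>: "\<zeta> \<in> E (h (0, g j))" for j \<zeta>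
  proof -
    \<comment> \<open>Boxes are counted from 0, so the union of all \<open>n\<close> of them has
      index \<open>n - 1\<close> and ends at \<open>g n = 1\<close>.\<close>
    have "\<exists>\<sigma>. lift ({0..g (Suc (n - 1))} \<times> {g j..g (Suc j)}) h \<sigma> \<and> \<sigma> (g 0, g j) = \<zeta>"
    proof (rule lift_chain[where n = n and U = "\<lambda>i. {0..g (Suc i)} \<times> {g j..g (Suc j)}"
          and T = "\<lambda>i. {g i..g (Suc i)} \<times> {g j..g (Suc j)}" and p = "\<lambda>i. (g i, g j)"])
      show "continuous_on ({0..g (Suc i)} \<times> {g j..g (Suc j)}) h" if "i < n" for i
        by (intro cont sub g1 g(4)) (use that j in auto)
      show "\<exists>\<sigma>. lift ({g i..g (Suc i)} \<times> {g j..g (Suc j)}) h \<sigma> \<and> \<sigma> (g i, g j) = \<xi>"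
        if "i < n" "\<xi> \<in> E (h (g i, g j))" for i \<xi> by (rule box[OF that(1) j that(2)])
    qed (use g(3,4) n \<zeta> in \<open>auto simp: g(1) ivl Sigma_Un_distrib1 Times_Int_Times closed_Times connected_Times\<close>)
    then show ?thesis using n(1) by (simp add: g(1,2))
  qed
  have "\<exists>\<sigma>. lift ({0..1} \<times> {0..g (Suc (n - 1))}) h \<sigma> \<and> \<sigma> (0, g 0) = \<xi>"
  proof (rule lift_chain[where n = n and U = "\<lambda>j. {0..1} \<times> {0..g (Suc j)}"
        and T = "\<lambda>j. {0..1} \<times> {g j..g (Suc j)}" and p = "\<lambda>j. (0, g j)"])
    show "continuous_on ({0..1} \<times> {0..g (Suc j)}) h" if "j < n" for j
      by (intro cont sub g1) (use that in auto)
    show "\<exists>\<sigma>. lift ({0..1} \<times> {g j..g (Suc j)}) h \<sigma> \<and> \<sigma> (0, g j) = \<xi>"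
      if "j < n" "\<xi> \<in> E (h (0, g j))" for j \<xi> by (rule row[OF that])
  qed (use g(3,4) n \<xi> in \<open>auto simp: g(1) ivl Sigma_Un_distrib2 Times_Int_Times closed_Times connected_Times\<close>)
  then show ?thesis using n(1) by (simp add: g(1,2))
qed

text \<open>A path is a square that is constant in the second variable.\<close>

lemma lift_path:
  fixes \<gamma> :: "real \<Rightarrow> 'y"
  assumes "path \<gamma>" "path_image \<gamma> \<subseteq> S" "\<xi> \<in> E (\<gamma> 0)"
  shows "\<exists>\<sigma>. lift {0..1} \<gamma> \<sigma> \<and> \<sigma> 0 = \<xi>"
proof -
  have "continuous_on ({0..1} \<times> {0..1::real}) (\<lambda>q. \<gamma> (fst q))"
    using assms(1) unfolding path_def by (rule continuous_on_compose2) (auto intro!: continuous_intros)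
  moreover have "(\<lambda>q. \<gamma> (fst q)) ` ({0..1} \<times> {0..1::real}) \<subseteq> S"
    using assms(2) by (auto simp: path_image_def)
  ultimately obtain \<sigma> where \<sigma>: "lift ({0..1} \<times> {0..1::real}) (\<lambda>q. \<gamma> (fst q)) \<sigma>" "\<sigma> (0, 0) = \<xi>"
    using lift_square[of "\<lambda>q. \<gamma> (fst q)" \<xi>] assms(3) by auto
  have "lift {0..1} (\<lambda>t. \<gamma> (fst (t, 0::real))) (\<lambda>t. \<sigma> (t, 0))"
    by (rule lift_compose[OF \<sigma>(1)]) (auto intro!: continuous_intros)
  then show ?thesis using \<sigma>(2) by (intro exI[of _ "\<lambda>t. \<sigma> (t, 0)"]) simp
qed

text \<open>The homotopy is free, so the base point moves: the left and right edges of the lifted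
  square lift the same path. They meet at the far end, where the loop and hence its lift are
  constant, so they coincide also at the end belonging to \<gamma>.\<close>

lemma lift_loop_closed:
  assumes sc: "simply_connected S" and \<gamma>: "path \<gamma>" "path_image \<gamma> \<subseteq> S" "\<gamma> 0 = \<gamma> 1"
    and l: "lift {0..1} \<gamma> \<sigma>"
  shows "\<sigma> 0 = \<sigma> 1"
proof -
  define y0 where "y0 = \<gamma> 0"
  have y0: "y0 \<in> S" using \<gamma>(2) by (auto simp: y0_def path_image_def)
  have "homotopic_loops S \<gamma> (\<lambda>_. y0)"
    by (rule sc[unfolded simply_connected_def, rule_format])
      (use \<gamma> y0 in \<open>auto simp: pathstart_def pathfinish_def path_def path_image_def\<close>)
  then obtain h where h': "continuous_on ({0..1::real} \<times> {0..1::real}) h" "h \<in> ({0..1} \<times> {0..1}) \<rightarrow> S"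
     "\<forall>x\<in>{0..1}. h (0, x) = \<gamma> x" "\<forall>x\<in>{0..1}. h (1, x) = y0"
     "\<forall>t\<in>{0..1}. pathfinish (h \<circ> Pair t) = pathstart (h \<circ> Pair t)"
    unfolding homotopic_loops by blast
  then have h: "continuous_on ({0..1::real} \<times> {0..1}) h" "h ` ({0..1} \<times> {0..1}) \<subseteq> S"
     "\<And>x. x \<in> {0..1} \<Longrightarrow> h (0, x) = \<gamma> x" "\<And>x. x \<in> {0..1} \<Longrightarrow> h (1, x) = y0"
     "\<And>t. t \<in> {0..1} \<Longrightarrow> h (t, 1) = h (t, 0)"
    by (simp_all add: pathstart_def pathfinish_def image_subset_iff_funcset)
  have "\<sigma> 0 \<in> E (h (0, 0))" using lift_in[OF l, of 0] h(3) by simp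
  then obtain \<tau> where \<tau>: "lift ({0..1} \<times> {0..1}) h \<tau>" "\<tau> (0, 0) = \<sigma> 0"
    using lift_square[OF h(1,2)] by blast
  have bottom: "lift {0..1} \<gamma> (\<lambda>x. \<tau> (0, x))"
    by (rule lift_cong[OF lift_compose[OF \<tau>(1), of "{0..1}" "\<lambda>x. (0, x)"]]) (auto intro!: continuous_intros simp: h(3))
  have top: "lift {0..1} (\<lambda>_. y0) (\<lambda>x. \<tau> (1, x))"
    by (rule lift_cong[OF lift_compose[OF \<tau>(1), of "{0..1}" "\<lambda>x. (1, x)"]]) (auto intro!: continuous_intros simp: h(4))
  have left: "lift {0..1} (\<lambda>t. h (t, 0)) (\<lambda>t. \<tau> (t, 0))"
    by (rule lift_compose[OF \<tau>(1), of "{0..1}" "\<lambda>t. (t, 0)"]) (auto intro!: continuous_intros)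
  have right: "lift {0..1} (\<lambda>t. h (t, 0)) (\<lambda>t. \<tau> (t, 1))"
    by (rule lift_cong[OF lift_compose[OF \<tau>(1), of "{0..1}" "\<lambda>t. (t, 1)"]]) (auto intro!: continuous_intros simp: h(5))
  have E1: "\<tau> (1, 0) \<in> E y0" using lift_in[OF top, of 0] by simp
  have "\<tau> (1, 1) = \<tau> (1, 0)"
    by (rule lift_unique[OF connected_Icc top lift_const[OF y0 E1], of 0 1]) auto
  then have "\<tau> (0, 0) = \<tau> (0, 1)"
    by (intro lift_unique[OF connected_Icc left right, of 1 0]) auto
  moreover have "\<sigma> 1 = \<tau> (0, 1)"
    by (rule lift_unique[OF connected_Icc l bottom, of 0 1]) (auto simp: \<tau>(2))
  ultimately show ?thesis using \<tau>(2) by simp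
qed

text \<open>The first path followed by the reverse of the second is a loop. Both end values are the
  value of its closed lift at time 1/2.\<close>

lemma lift_endpoint:
  assumes sc: "simply_connected S"
    and \<gamma>: "lift {0..1::real} \<gamma> \<sigma>" and \<gamma>': "lift {0..1::real} \<gamma>' \<sigma>'"
    and eq: "\<gamma> 0 = \<gamma>' 0" "\<gamma> 1 = \<gamma>' 1" "\<sigma> 0 = \<sigma>' 0"
  shows "\<sigma> 1 = \<sigma>' 1"
proof -
  have p: "path \<gamma>" "path \<gamma>'" "path_image \<gamma> \<subseteq> S" "path_image \<gamma>' \<subseteq> S"
    using \<gamma> \<gamma>' by (auto simp: lift_def path_def path_image_def)
  let ?j = "\<gamma> +++ reversepath \<gamma>'"
  have j: "path ?j" "path_image ?j \<subseteq> S" "?j 0 = ?j 1"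
  proof -
    have "pathfinish \<gamma> = pathstart (reversepath \<gamma>')" using eq by (simp add: pathfinish_def)
    then show "path ?j" using p by simp
    show "path_image ?j \<subseteq> S" using path_image_join_subset[of \<gamma> "reversepath \<gamma>'"] p by auto
    show "?j 0 = ?j 1" using eq by (simp add: joinpaths_def reversepath_def)
  qed
  have "\<sigma> 0 \<in> E (?j 0)" using lift_in[OF \<gamma>, of 0] by (simp add: joinpaths_def)
  then obtain \<tau> where \<tau>: "lift {0..1} ?j \<tau>" "\<tau> 0 = \<sigma> 0" using lift_path[OF j(1,2)] by blast
  have "lift {0..1} \<gamma> (\<lambda>t. \<tau> (t / 2))"
    by (rule lift_cong[OF lift_compose[OF \<tau>(1), of "{0..1}" "\<lambda>t. t / 2"]])
      (auto intro!: continuous_intros simp: joinpaths_def)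
  then have 1: "\<sigma> 1 = \<tau> (1 / 2)"
    by (intro lift_unique[OF connected_Icc \<gamma>, of _ 0 1]) (auto simp: \<tau>(2))
  have "lift {0..1} \<gamma>' (\<lambda>t. \<tau> (1 - t / 2))"
    by (rule lift_cong[OF lift_compose[OF \<tau>(1), of "{0..1}" "\<lambda>t. 1 - t / 2"]])
      (auto intro!: continuous_intros simp: joinpaths_def reversepath_def eq(2))
  then have 2: "\<sigma>' 1 = \<tau> (1 / 2)"
    using lift_loop_closed[OF sc j \<tau>(1)] lift_unique[OF connected_Icc \<gamma>', of "\<lambda>t. \<tau> (1 - t / 2)" 0 1]
    by (auto simp: \<tau>(2) eq(3))
  show ?thesis using 1 2 by simp
qed

theorem monodromy:
  assumes sc: "simply_connected S" and y0: "y0 \<in> S" "\<xi>0 \<in> E y0"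
    and lpc: "\<And>y U. openin (top_of_set S) U \<Longrightarrow> y \<in> U \<Longrightarrow>
      \<exists>V. openin (top_of_set S) V \<and> y \<in> V \<and> V \<subseteq> U \<and> path_connected V"
  shows "\<exists>f. f y0 = \<xi>0 \<and> (\<forall>y\<in>S. \<exists>V U s. openin (top_of_set S) V \<and> y \<in> V \<and> V \<subseteq> U \<and> (U, s) \<in> I \<and> (\<forall>z\<in>V. f z = s z))"
proof -
  \<comment> \<open>The end values of lifts along paths from \<open>y0\<close>: existence is path
    lifting, uniqueness is \<open>lift_endpoint\<close>.\<close>
  define R where "R y \<xi> \<longleftrightarrow> (\<exists>\<gamma> \<sigma>. lift {0..1} \<gamma> \<sigma> \<and> \<gamma> 0 = y0 \<and> \<gamma> 1 = y \<and> \<sigma> 0 = \<xi>0 \<and> \<sigma> (1::real) = \<xi>)" for y \<xi>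
  have ex: "\<exists>\<xi>. R y \<xi>" if y: "y \<in> S" for y
  proof -
    obtain \<gamma> where \<gamma>: "path \<gamma>" "path_image \<gamma> \<subseteq> S" "\<gamma> 0 = y0" "\<gamma> 1 = y"
      using simply_connected_path[OF sc y0(1) y] .
    then obtain \<sigma> where "lift {0..1} \<gamma> \<sigma>" "\<sigma> 0 = \<xi>0" using lift_path[of \<gamma> \<xi>0] y0 by blast
    then show ?thesis unfolding R_def using \<gamma> by blast
  qed
  have uniq: "\<xi> = \<xi>'" if "R y \<xi>" "R y \<xi>'" for y \<xi> \<xi>'
    using that lift_endpoint[OF sc] unfolding R_def by metis
  define f where "f y = (THE \<xi>. R y \<xi>)" for y
  have f: "R y (f y)" if "y \<in> S" for y
    unfolding f_def using theI'[of "R y"] ex[OF that] uniq by blast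
  have "R y0 \<xi>0" unfolding R_def using lift_const[OF y0] by blast
  then have f0: "f y0 = \<xi>0" using uniq f y0 by blast
  have "\<exists>V U s. openin (top_of_set S) V \<and> y \<in> V \<and> V \<subseteq> U \<and> (U, s) \<in> I \<and> (\<forall>z\<in>V. f z = s z)" if y: "y \<in> S" for y
  proof -
    obtain \<gamma> \<sigma> where \<gamma>: "lift {0..1} \<gamma> \<sigma>" "\<gamma> 0 = y0" "\<gamma> 1 = y" "\<sigma> 0 = \<xi>0" "\<sigma> (1::real) = f y"
      using f[OF y] unfolding R_def by blast
    have fE: "f y \<in> E y" using lift_in[OF \<gamma>(1), of 1] \<gamma> by auto
    obtain U s where U: "openin (top_of_set S) U" "y \<in> U" "(U, s) \<in> I" "s y = f y"
      using cover[OF y] fE by blast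
    obtain V where V: "openin (top_of_set S) V" "y \<in> V" "V \<subseteq> U" "path_connected V" using lpc[OF U(1,2)] by blast
    \<comment> \<open>A path to \<open>y\<close> is prolonged inside the path-connected
      \<open>V\<close>. Over the added path, the lift and the section \<open>s\<close> are two lifts
      that agree where it starts.\<close>
    have "f z = s z" if z: "z \<in> V" for z
    proof -
      obtain \<delta> where \<delta>: "path \<delta>" "path_image \<delta> \<subseteq> V" "pathstart \<delta> = y" "pathfinish \<delta> = z"
        using V(2,4) z unfolding path_connected_def by blast
      have VS: "V \<subseteq> S" by (rule openin_imp_subset[OF V(1)])
      let ?j = "\<gamma> +++ \<delta>"
      have pg: "path \<gamma>" "path_image \<gamma> \<subseteq> S" using \<gamma>(1) by (auto simp: lift_def path_def path_image_def)
      have j: "path ?j" "path_image ?j \<subseteq> S" "?j 0 = y0" "?j 1 = z"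
      proof -
        have "pathfinish \<gamma> = pathstart \<delta>" using \<delta>(3) \<gamma>(3) by (simp add: pathfinish_def)
        then show "path ?j" using pg(1) \<delta>(1) by simp
        show "path_image ?j \<subseteq> S" using path_image_join_subset[of \<gamma> \<delta>] pg(2) \<delta>(2) VS by blast
        show "?j 0 = y0" "?j 1 = z" using \<gamma>(2) \<delta>(4) by (simp_all add: joinpaths_def pathfinish_def)
      qed
      obtain \<tau> where \<tau>: "lift {0..1} ?j \<tau>" "\<tau> 0 = \<xi>0" using lift_path[OF j(1,2)] y0 j(3) by metis
      have "R z (\<tau> 1)" unfolding R_def using \<tau> j by blast
      then have fz: "f z = \<tau> 1" using uniq f z VS by blast
      have "lift {0..1} \<gamma> (\<lambda>t. \<tau> (t / 2))"
        by (rule lift_cong[OF lift_compose[OF \<tau>(1), of "{0..1}" "\<lambda>t. t / 2"]])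
          (auto intro!: continuous_intros simp: joinpaths_def)
      then have h: "\<tau> (1 / 2) = f y"
        using lift_unique[OF connected_Icc \<gamma>(1), of "\<lambda>t. \<tau> (t / 2)" 0 1] by (auto simp: \<tau>(2) \<gamma>)
      have d0: "\<delta> 0 = \<gamma> 1" using \<delta>(3) \<gamma>(3) by (simp add: pathstart_def)
      have l1: "lift {0..1} \<delta> (\<lambda>t. \<tau> (1 / 2 + t / 2))"
        by (rule lift_cong[OF lift_compose[OF \<tau>(1), of "{0..1}" "\<lambda>t. 1 / 2 + t / 2"]])
          (auto intro!: continuous_intros simp: joinpaths_def d0)
      have im: "\<delta> ` {0..1} \<subseteq> V" using \<delta>(2) by (simp add: path_image_def)
      then have im': "\<delta> ` {0..1} \<subseteq> U" "\<delta> ` {0..1} \<subseteq> S" using V(3) VS by auto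
      have l2: "lift {0..1} \<delta> (\<lambda>t. s (\<delta> t))"
        unfolding lift_def using \<delta>(1) U(3) im'
        by (auto simp: path_def intro!: exI[of _ "{0..1::real}"] exI[of _ U] exI[of _ s])
      have "\<tau> 1 = s (\<delta> 1)"
        using lift_unique[OF connected_Icc l1 l2, of 0 1] h U(4) \<delta>(3) by (auto simp: pathstart_def)
      then show ?thesis using fz \<delta>(4) by (simp add: pathfinish_def)
    qed
    then show ?thesis using U V by blast
  qed
  then show ?thesis using f0 by blast
qed

end

section \<open>Admissible tensorial forms\<close>

locale geom = pb_connection +
  fixes al g
  assumes tensorial: "tensorial_form X al" and admissible: "admissible X al"
    and cov_d_0: "\<xi> \<in> points (tot X) \<Longrightarrow> cov_d X A al \<xi> u v = 0"
    and curvature_eq: "\<xi> \<in> points (tot X) \<Longrightarrow>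
      curvature X A \<xi> u v = (1/2) *\<^sub>R wedge_br (brk X) (al \<xi>) (al \<xi>) u v"
    and g: "ad_invariant_form (grp X) (grpM X) g"
begin

abbreviation "gM \<equiv> metricM X al g"
abbreviation "gP \<equiv> metricP X A al g"

lemma al_form: "form_on PP (points PP) al"
  and al_vert: "\<xi> \<in> points PP \<Longrightarrow> u \<in> vert X \<xi> \<Longrightarrow> al \<xi> u = 0"
  and al_right: "\<xi> \<in> points PP \<Longrightarrow> a \<in> points HH \<Longrightarrow> al (act X \<xi> a) (tright X a \<xi> u) = AD (iv a) (al \<xi> u)"
  using tensorial by (auto simp: tensorial_form_def smooth_form_iff[OF P])

lemma linear_al: "\<xi> \<in> points PP \<Longrightarrow> linear (al \<xi>)"
  by (rule form_on_linear[OF al_form])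

lemma al_fund [simp]: "\<xi> \<in> points PP \<Longrightarrow> al \<xi> (fund X \<xi> Z) = 0"
  by (rule al_vert) (auto simp: vert_iff)

lemma al_surj:
  assumes \<xi>: "\<xi> \<in> points PP"
  shows "\<exists>u. al \<xi> u = Z"
proof -
  have "\<exists>!C. C \<in> range (\<lambda>u. (\<lambda>v. u + v) ` vert X \<xi>) \<and> al \<xi> ` C = {Z}"
    using admissible \<xi> by (simp add: admissible_def)
  then obtain u where u: "al \<xi> ` ((\<lambda>v. u + v) ` vert X \<xi>) = {Z}" by (elim ex1E conjE imageE) simp
  have "u + 0 \<in> (\<lambda>v. u + v) ` vert X \<xi>" using subspace_0[OF subspace_vert[OF \<xi>]] by blast
  then show ?thesis using u by fastforce
qed

text \<open>Admissibility speaks of cosets of the vertical space: those of \<open>u\<close> and of 0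
  both have image {0}, hence are equal.\<close>

lemma al_eq_0:
  assumes \<xi>: "\<xi> \<in> points PP" and u: "al \<xi> u = 0"
  shows "u \<in> vert X \<xi>"
proof -
  let ?C = "\<lambda>u. (\<lambda>v. u + v) ` vert X \<xi>"
  have 0: "0 \<in> vert X \<xi>" by (rule subspace_0[OF subspace_vert[OF \<xi>]])
  have z: "al \<xi> ` ?C w = {0}" if "al \<xi> w = 0" for w
    using 0 that al_vert[OF \<xi>] by (auto simp: image_image linear_add[OF linear_al[OF \<xi>]])
  note z[OF u] z[OF linear_0[OF linear_al[OF \<xi>]]]
  moreover have "\<exists>!C. C \<in> range ?C \<and> al \<xi> ` C = {0}"
    using admissible \<xi> by (simp add: admissible_def)
  ultimately have "?C u = ?C 0" by (elim ex1E) (metis rangeI)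
  moreover have "u + 0 \<in> ?C u" using 0 by blast
  ultimately show ?thesis by auto
qed

lemma al_eq_iff: "\<xi> \<in> points PP \<Longrightarrow> al \<xi> u = al \<xi> v \<longleftrightarrow> tproj X \<xi> u = tproj X \<xi> v"
  using al_eq_0[of \<xi> "u - v"] al_vert[of \<xi> "u - v"]
  by (auto simp: vert_def linear_diff[OF linear_al] linear_diff[OF linear_tproj])

text \<open>The pair (\<theta>, \<alpha>) identifies each tangent space of the bundle with two
  copies of the Lie algebra; together with \<open>pair_inj\<close> it allows identities between
  tangent vectors to be checked on the two components.\<close>

lemma pair_ex:
  assumes \<xi>: "\<xi> \<in> points PP"
  shows "\<exists>u. th \<xi> u = Z \<and> al \<xi> u = V"
proof -
  obtain u where u: "al \<xi> u = V" using al_surj[OF \<xi>] by blast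
  show ?thesis
    by (rule exI[of _ "u + fund X \<xi> (Z - th \<xi> u)"])
      (simp add: u \<xi> linear_add[OF linear_th[OF \<xi>]] linear_add[OF linear_al[OF \<xi>]])
qed

lemma pair_inj:
  assumes \<xi>: "\<xi> \<in> points PP" and eq: "th \<xi> u = th \<xi> v" "al \<xi> u = al \<xi> v"
  shows "u = v"
proof -
  have "u - v \<in> vert X \<xi>" using al_eq_0[OF \<xi>, of "u - v"] eq by (simp add: linear_diff[OF linear_al[OF \<xi>]])
  then obtain Z where Z: "u - v = fund X \<xi> Z" using vert_fund[OF \<xi>] by blast
  have "Z = th \<xi> (u - v)" by (simp add: Z \<xi>)
  then have "Z = 0" using eq by (simp add: linear_diff[OF linear_th[OF \<xi>]])
  then show ?thesis using Z linear_0[OF linear_fund[OF \<xi>]] by simp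
qed

text \<open>In the components (\<theta>, \<alpha>) the structure sends (x, y) to (y, -x), which is
  multiplication by \<i> on \<theta> - \<i> \<alpha>. From here on this replaces the decomposition
  into horizontal and vertical parts.\<close>

lemma cplxJ_iff:
  assumes \<xi>: "\<xi> \<in> points PP"
  shows "cplxJ X A al \<xi> t = r \<longleftrightarrow> th \<xi> r = al \<xi> t \<and> al \<xi> r = - th \<xi> t"
proof -
  let ?Q = "\<lambda>r. \<exists>u v s w. t = u + v \<and> u \<in> A \<xi> \<and> v \<in> vert X \<xi> \<and>
     s \<in> vert X \<xi> \<and> th \<xi> s = al \<xi> u \<and> w \<in> A \<xi> \<and> al \<xi> w = th \<xi> v \<and> r = s - w"
  note lt = linear_th[OF \<xi>] and la = linear_al[OF \<xi>]
  have 1: "th \<xi> r = al \<xi> t \<and> al \<xi> r = - th \<xi> t" if "?Q r" for r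
    using that by (auto simp: linear_add[OF lt] linear_diff[OF lt] linear_add[OF la] linear_diff[OF la] th_A[OF \<xi>] al_vert[OF \<xi>])
  obtain w where w: "th \<xi> w = 0" "al \<xi> w = th \<xi> t" using pair_ex[OF \<xi>] by blast
  have 2: "?Q (fund X \<xi> (al \<xi> t) - w)"
    by (rule exI[of _ "t - fund X \<xi> (th \<xi> t)"], rule exI[of _ "fund X \<xi> (th \<xi> t)"],
        rule exI[of _ "fund X \<xi> (al \<xi> t)"], rule exI[of _ w])
      (use w \<xi> in \<open>auto simp: A_iff vert_iff linear_diff[OF la] linear_diff[OF lt]\<close>)
  have "?Q (cplxJ X A al \<xi> t)"
    unfolding cplxJ_def
  proof (rule theI[of ?Q, OF 2])
    show "r = fund X \<xi> (al \<xi> t) - w" if "?Q r" for r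
      using 1[OF that] 1[OF 2] by (intro pair_inj[OF \<xi>]) simp_all
  qed
  from 1[OF this] have J: "th \<xi> (cplxJ X A al \<xi> t) = al \<xi> t" "al \<xi> (cplxJ X A al \<xi> t) = - th \<xi> t" by auto
  show ?thesis
  proof
    assume "th \<xi> r = al \<xi> t \<and> al \<xi> r = - th \<xi> t"
    then show "cplxJ X A al \<xi> t = r" using J by (intro pair_inj[OF \<xi>]) simp_all
  qed (use J in auto)
qed

text \<open>Another point of the fibre is a right translate of \<xi>, where both values of
  \<open>al\<close> change by the same \<open>AD (iv a)\<close>, under which \<open>g\<close> is
  invariant.\<close>

lemma metricM_eq:
  assumes \<xi>: "\<xi> \<in> points PP"
  shows "gM (proj X \<xi>) (tproj X \<xi> u) (tproj X \<xi> v) = g (al \<xi> u) (al \<xi> v)"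
  unfolding metricM_def
proof (rule the_equality)
  fix r assume "\<exists>\<zeta> u' v'. \<zeta> \<in> points PP \<and> proj X \<zeta> = proj X \<xi> \<and>
     tproj X \<zeta> u' = tproj X \<xi> u \<and> tproj X \<zeta> v' = tproj X \<xi> v \<and> r = g (al \<zeta> u') (al \<zeta> v')"
  then obtain \<zeta> u' v' where z: "\<zeta> \<in> points PP" "proj X \<zeta> = proj X \<xi>"
     "tproj X \<zeta> u' = tproj X \<xi> u" "tproj X \<zeta> v' = tproj X \<xi> v" "r = g (al \<zeta> u') (al \<zeta> v')" by blast
  obtain a where a: "a \<in> points HH" "\<zeta> = act X \<xi> a" using translator[OF \<xi> z(1)] z(2) by metis
  have "al \<zeta> u' = AD (iv a) (al \<xi> u)" "al \<zeta> v' = AD (iv a) (al \<xi> v)"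
    using al_eq_iff[OF z(1)] z(3,4) tproj_tright[OF \<xi> a(1)] al_right[OF \<xi> a(1)] a(2) by metis+
  then show "r = g (al \<xi> u) (al \<xi> v)" using z(5) g a(1) by (auto simp: ad_invariant_form_def carrier)
qed (use \<xi> in blast)

lemma brk_lbr: "brk X = lbr"
  by (simp add: brk_def)

text \<open>Independence of the point of the fibre as for the metric, with \<open>Ad_lbr\<close> in
  place of the invariance of \<open>g\<close>.\<close>

lemma bracketM_eq:
  assumes \<xi>: "\<xi> \<in> points PP" and w: "al \<xi> w = lbr (al \<xi> u) (al \<xi> v)"
  shows "bracketM X al (proj X \<xi>) (tproj X \<xi> u) (tproj X \<xi> v) = tproj X \<xi> w"
  unfolding bracketM_def
proof (rule the_equality)
  fix r assume "\<exists>\<zeta> u' v' w'. \<zeta> \<in> points PP \<and> proj X \<zeta> = proj X \<xi> \<and>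
     tproj X \<zeta> u' = tproj X \<xi> u \<and> tproj X \<zeta> v' = tproj X \<xi> v \<and> al \<zeta> w' = brk X (al \<zeta> u') (al \<zeta> v') \<and> r = tproj X \<zeta> w'"
  then obtain \<zeta> u' v' w' where z: "\<zeta> \<in> points PP" "proj X \<zeta> = proj X \<xi>"
     "tproj X \<zeta> u' = tproj X \<xi> u" "tproj X \<zeta> v' = tproj X \<xi> v" "al \<zeta> w' = brk X (al \<zeta> u') (al \<zeta> v')" "r = tproj X \<zeta> w'" by blast
  obtain a where a: "a \<in> points HH" "\<zeta> = act X \<xi> a" using translator[OF \<xi> z(1)] z(2) by metis
  have "al \<zeta> u' = AD (iv a) (al \<xi> u)" "al \<zeta> v' = AD (iv a) (al \<xi> v)"
    using al_eq_iff[OF z(1)] z(3,4) tproj_tright[OF \<xi> a(1)] al_right[OF \<xi> a(1)] a(2) by metis+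
  then have "al \<zeta> w' = al \<zeta> (tright X a \<xi> w)"
    using z(5) a by (simp add: brk_lbr Ad_lbr[symmetric] w al_right[OF \<xi> a(1)])
  then show "r = tproj X \<xi> w"
    using al_eq_iff[OF z(1)] z(6) tproj_tright[OF \<xi> a(1)] a(2) by metis
qed (use \<xi> w in \<open>auto simp: brk_lbr\<close>)

text \<open>With the convention of \<open>wedge_br\<close>, a form wedged with itself gives twice
  the bracket of its values, which cancels the factors 1/2.\<close>

lemma d_th: "\<xi> \<in> points PP \<Longrightarrow> ext_d PP th \<xi> u v = lbr (al \<xi> u) (al \<xi> v) - lbr (th \<xi> u) (th \<xi> v)"
proof -
  assume \<xi>: "\<xi> \<in> points PP"
  have w: "(1/2) *\<^sub>R wedge_br lbr \<beta> \<beta> u v = lbr (\<beta> u) (\<beta> v)" for \<beta>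
  proof -
    have "wedge_br lbr \<beta> \<beta> u v = 2 *\<^sub>R lbr (\<beta> u) (\<beta> v)"
      unfolding wedge_br_def using lbr_skew[of "\<beta> v" "\<beta> u"] by (simp add: scaleR_2)
    then show ?thesis by simp
  qed
  show "ext_d PP th \<xi> u v = lbr (al \<xi> u) (al \<xi> v) - lbr (th \<xi> u) (th \<xi> v)"
    using curvature_eq[OF \<xi>, of u v] by (simp only: curvature_def brk_lbr w) (simp add: eq_diff_eq)
qed

lemma d_al: "\<xi> \<in> points PP \<Longrightarrow> ext_d PP al \<xi> u v = lbr (th \<xi> v) (al \<xi> u) - lbr (th \<xi> u) (al \<xi> v)"
  using cov_d_0[of \<xi> u v] by (simp add: cov_d_def brk_lbr wedge_br_def add_eq_0_iff2 algebra_simps)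

lemma bounded_bilinear_g: "bounded_bilinear g"
  using g by (simp add: ad_invariant_form_def bilinear_conv_bounded_bilinear)

lemma g_sym: "g Z Z' = g Z' Z" and g_nondeg: "(\<And>Z'. g Z Z' = 0) \<Longrightarrow> Z = 0"
  using g by (auto simp: ad_invariant_form_def)

lemma bilinear_g: "bilinear g"
  using g by (simp add: ad_invariant_form_def)

lemmas g_simps = bilinear_ladd[OF bilinear_g] bilinear_radd[OF bilinear_g]
  bilinear_lneg[OF bilinear_g] bilinear_rneg[OF bilinear_g] bilinear_lsub[OF bilinear_g] bilinear_rsub[OF bilinear_g]
  bilinear_lmul[OF bilinear_g] bilinear_rmul[OF bilinear_g] bilinear_lzero[OF bilinear_g] bilinear_rzero[OF bilinear_g]

lemma g_inv: "g (lbr U V) Z = - g V (lbr U Z)"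
  using ad_invariant[OF g, of U V Z] by simp

end

section \<open>Holomorphic lifts in terms of connection forms\<close>

locale geom_surface = geom +
  fixes Y :: "('y::{t2_space,second_countable_topology}, complex) atlas"
  assumes Y_surface: "riemann_surface Y"
begin

abbreviation "ind \<phi> \<equiv> pullback_metric Y MM gM \<phi>"

lemma Y: "manifold Y"
  by (rule riemann_manifold[OF Y_surface])

text \<open>For a lift \<open>f\<close> of \<open>\<phi>\<close>, \<open>beta f\<close> is the pull-back by \<open>f\<close> of the connection form of the connection
  \<open>B\<^sub>\<phi>\<close>; it vanishes iff \<open>f\<close> is holomorphic.\<close>

definition beta where
  "beta f y v = th (f y) (tmap Y PP f y v) + al (f y) (tmap Y PP f y (\<i> * v))"

lemma beta_form:
  assumes f: "smooth_map Y PP U f"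
  shows "form_on Y U (beta f)"
  unfolding beta_def
  by (intro form_on_add[OF Y] form_on_mult_i[OF Y_surface] form_on_pull[OF Y P f th_form smap_image[OF f]]
      form_on_pull[OF Y P f al_form smap_image[OF f]])

text \<open>Holomorphy consists of one equation for \<theta> and one for \<alpha>. Replacing
  \<open>v\<close> by \<open>\<i> * v\<close> in \<open>beta f y v = 0\<close> exchanges the two, so
  a single form with values in the Lie algebra captures both.\<close>

lemma holomorphic_iff_beta:
  assumes f: "smooth_map Y PP U f"
  shows "holomorphic_map Y X A al U f \<longleftrightarrow> (\<forall>y\<in>U. \<forall>v. beta f y v = 0)"
proof -
  have "(\<forall>v. tmap Y PP f y (surfJ v) = cplxJ X A al (f y) (tmap Y PP f y v)) \<longleftrightarrow> (\<forall>v. beta f y v = 0)" if y: "y \<in> U" for y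
  proof -
    have fy: "f y \<in> points PP" by (rule smap_in[OF f y])
    note lin = tmap_linear[OF Y P f y]
    have J: "tmap Y PP f y (surfJ v) = cplxJ X A al (f y) (tmap Y PP f y v) \<longleftrightarrow>
       th (f y) (tmap Y PP f y (\<i> * v)) = al (f y) (tmap Y PP f y v) \<and>
       al (f y) (tmap Y PP f y (\<i> * v)) = - th (f y) (tmap Y PP f y v)" for v
      using cplxJ_iff[OF fy, of "tmap Y PP f y v" "tmap Y PP f y (\<i> * v)"] by (metis surfJ_def)
    have "beta f y (\<i> * v) = th (f y) (tmap Y PP f y (\<i> * v)) - al (f y) (tmap Y PP f y v)" for v
    proof -
      have "tmap Y PP f y (\<i> * (\<i> * v)) = - tmap Y PP f y v"
        using linear_neg[OF lin, of v] by (simp add: mult.assoc[symmetric])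
      then show ?thesis by (simp add: beta_def linear_neg[OF linear_al[OF fy]])
    qed
    then show ?thesis unfolding J unfolding beta_def
      by (metis (no_types, lifting) add.commute add.right_inverse eq_iff_diff_eq_0 eq_neg_iff_add_eq_0)
  qed
  then show ?thesis using f by (auto simp: holomorphic_map_def)
qed

text \<open>Under right translation \<open>th\<close> and \<open>al\<close> both transform by
  \<open>AD (iv (b y))\<close>, while the fundamental vector in \<open>tmap_act\<close> is seen by
  \<open>th\<close> only.\<close>

lemma beta_gauge:
  assumes f: "smooth_map Y PP U f" and b: "smooth_map Y HH U b" and y: "y \<in> U"
  shows "beta (\<lambda>y. act X (f y) (b y)) y v = AD (iv (b y)) (beta f y v) + mc (b y) (tmap Y HH b y v)"
proof -
  have fy: "f y \<in> points PP" and byH: "b y \<in> points HH" using smap_in[OF f y] smap_in[OF b y] by auto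
  have q: "act X (f y) (b y) \<in> points PP" using fy byH by simp
  show ?thesis
    unfolding beta_def tmap_act[OF Y f b y] linear_add[OF linear_th[OF q]] linear_add[OF linear_al[OF q]]
    by (simp add: q th_right[OF fy byH] al_right[OF fy byH] linear_add[OF linear_Ad[OF inv_in[OF byH]]])
qed

end

section \<open>Mean curvature in a gauge\<close>

lemma ext_d_eucl: "ext_d eucl \<beta> x u v = FD (\<lambda>x. \<beta> x v) x u - FD (\<lambda>x. \<beta> x u) x v"
  by (simp add: ext_d_def chart_vec_tmap)

lemma bilinear_complex:
  assumes "bilinear (B :: complex \<Rightarrow> complex \<Rightarrow> 'a::real_vector)"
  shows "B u v = (Re u * Re v) *\<^sub>R B 1 1 + (Re u * Im v) *\<^sub>R B 1 \<i> + (Im u * Re v) *\<^sub>R B \<i> 1 + (Im u * Im v) *\<^sub>R B \<i> \<i>"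
proof -
  have e: "w = Re w *\<^sub>R 1 + Im w *\<^sub>R \<i>" for w by (simp add: complex_eq_iff)
  have "B u v = B (Re u *\<^sub>R 1 + Im u *\<^sub>R \<i>) (Re v *\<^sub>R 1 + Im v *\<^sub>R \<i>)" by (simp flip: e)
  then show ?thesis
    by (simp only: bilinear_ladd[OF assms] bilinear_radd[OF assms] bilinear_lmul[OF assms] bilinear_rmul[OF assms])
      (simp add: scaleR_add_right algebra_simps)
qed

lemma linear_complex:
  assumes "linear L"
  shows "L w = Re w *\<^sub>R L 1 + Im w *\<^sub>R L \<i>"
proof -
  have "w = Re w *\<^sub>R 1 + Im w *\<^sub>R \<i>" by (simp add: complex_eq_iff)
  then have "L w = L (Re w *\<^sub>R 1 + Im w *\<^sub>R \<i>)" by simp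
  then show ?thesis by (simp only: linear_add[OF assms] linear_cmul[OF assms])
qed

text \<open>For orthonormal vectors the real part of \<open>cnj u * v\<close> vanishes, so its
  imaginary part has modulus \<open>cmod u * cmod v\<close>, which gives the normalization.
  Uniqueness comes from evaluation on one positively oriented orthonormal pair.\<close>

lemma vol_form_conformal:
  assumes q: "\<And>u v. q u v = l * Re (cnj u * v)" and l: "l > 0"
  shows "vol_form q u v = l * Im (cnj u * v)"
proof -
  let ?v = "\<lambda>u v. l * Im (cnj u * v)"
  have bl: "bilinear ?v" unfolding bilinear_def by (auto intro!: linearI simp: algebra_simps)
  have on: "orthonormal_pair q u v \<and> Im (cnj u * v) > 0 \<Longrightarrow> ?v u v = 1" for u v
  proof -
    assume a: "orthonormal_pair q u v \<and> Im (cnj u * v) > 0"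
    have cm: "(cmod w)\<^sup>2 = Re w * Re w + Im w * Im w" for w
      by (simp add: cmod_power2 power2_eq_square[of "Re w"] power2_eq_square[of "Im w"])
    have 1: "l * (cmod u)\<^sup>2 = 1" "l * (cmod v)\<^sup>2 = 1" "Re (cnj u * v) = 0"
      using l a by (auto simp: orthonormal_pair_def q cm)
    have "(l * Im (cnj u * v))\<^sup>2 = l\<^sup>2 * (cmod (cnj u * v))\<^sup>2"
      using 1(3) by (simp add: cmod_power2 power_mult_distrib del: times_complex.sel)
    also have "\<dots> = (l * (cmod u)\<^sup>2) * (l * (cmod v)\<^sup>2)" by (simp add: norm_mult power_mult_distrib power2_eq_square)
    finally have "(l * Im (cnj u * v))\<^sup>2 = 1" using 1 by simp
    moreover have "l * Im (cnj u * v) > 0" using a l by simp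
    ultimately show "?v u v = 1" by (simp add: power2_eq_1_iff)
  qed
  \<comment> \<open>Rescales 1 and \<i> to an orthonormal pair for \<open>q\<close>.\<close>
  define r where "r = 1 / sqrt l"
  have r: "r > 0" "l * (r * r) = 1" using l by (auto simp: r_def)
  have o: "orthonormal_pair q (of_real r) (of_real r * \<i>) \<and> Im (cnj (of_real r) * (of_real r * \<i>)) > 0"
    using r by (simp add: orthonormal_pair_def q)
  have "vol_form q = ?v"
    unfolding vol_form_def
  proof (rule the_equality)
    show "bilinear ?v \<and> (\<forall>u. ?v u u = 0) \<and> (\<forall>u v. orthonormal_pair q u v \<and> Im (cnj u * v) > 0 \<longrightarrow> ?v u v = 1)"
      using bl on by auto
    fix \<nu> :: "complex \<Rightarrow> complex \<Rightarrow> real" assume n: "bilinear \<nu> \<and> (\<forall>u. \<nu> u u = 0) \<and> (\<forall>u v. orthonormal_pair q u v \<and> Im (cnj u * v) > 0 \<longrightarrow> \<nu> u v = 1)"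
    then have b: "bilinear \<nu>" and alt: "\<nu> u u = 0" for u by auto
    have sk: "\<nu> \<i> 1 = - \<nu> 1 \<i>"
    proof -
      have "\<nu> (1 + \<i>) (1 + \<i>) = \<nu> 1 1 + \<nu> 1 \<i> + (\<nu> \<i> 1 + \<nu> \<i> \<i>)"
        by (simp add: bilinear_ladd[OF b] bilinear_radd[OF b])
      then have "\<nu> 1 \<i> + \<nu> \<i> 1 = 0" by (simp add: alt)
      then show ?thesis by linarith
    qed
    have "\<nu> (of_real r) (of_real r * \<i>) = 1" using n o by blast
    moreover have "\<nu> (of_real r) (of_real r * \<i>) = (r * r) * \<nu> 1 \<i>"
      using bilinear_lmul[OF b, of r 1] bilinear_rmul[OF b, of _ r \<i>] by (simp add: scaleR_conv_of_real)
    moreover have "l * ((r * r) * \<nu> 1 \<i>) = \<nu> 1 \<i>" using r(2) by (simp add: mult.assoc[symmetric])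
    ultimately have l1: "\<nu> 1 \<i> = l" by simp
    show "\<nu> = ?v"
    proof (intro ext)
      show "\<nu> u v = l * Im (cnj u * v)" for u v
        using bilinear_complex[OF b, of u v] by (simp add: alt sk l1 algebra_simps)
    qed
  qed
  then show ?thesis by simp
qed

lemma smooth_field_in_chart:
  assumes A: "manifold A" and c: "c \<in> A" and U: "open_in A U" "U \<subseteq> fst c" and F: "smooth_on (snd c ` U) F"
  shows "smooth_field A U (\<lambda>p. chart_vec A c (snd c p) (F (snd c p)))"
  unfolding smooth_field_def
proof (intro conjI ballI U)
  fix c' assume c': "c' \<in> A"
  let ?t = "\<lambda>x. snd c (chart_inv c' x)" and ?t' = "\<lambda>x. snd c' (chart_inv c x)"
  let ?S = "snd c' ` (U \<inter> fst c')" and ?T = "snd c ` (U \<inter> fst c')"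
  have W: "open_in A (U \<inter> fst c')" by (intro open_in_Int U chart_open[OF A c'])
  have oS: "open ?S" by (rule open_chart_image[OF A c' U(1)])
  have oT: "open ?T" by (rule open_chart_image'[OF A c W]) (use U in auto)
  have st: "smooth_on ?S ?t" by (rule smooth_on_subset[OF chart_transition[OF A c' c]]) (use U in auto)
  have st': "smooth_on ?T ?t'" by (rule smooth_on_subset[OF chart_transition[OF A c c']]) (use U in auto)
  have FT: "smooth_on ?T F" by (rule smooth_on_subset[OF F]) auto
  have 1: "smooth_on ?T (\<lambda>y. FD ?t' y (F y))"
    by (rule smooth_on_apply[where L = "FD ?t'", OF oT smooth_on_FD_linear[OF st'] smooth_on_FD[OF st'] FT])
  have 2: "smooth_on ?S (\<lambda>x. FD ?t' (?t x) (F (?t x)))"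
    by (rule smooth_on_compose[OF oS oT st 1]) (auto simp: chart_inv_snd[OF A c'])
  have eq: "chart_coord A c' (chart_inv c' x) (chart_vec A c (snd c (chart_inv c' x)) (F (snd c (chart_inv c' x)))) =
      FD ?t' (?t x) (F (?t x))" if x: "x \<in> ?S" for x
  proof -
    obtain p where p: "p \<in> U" "p \<in> fst c'" "x = snd c' p" using x by auto
    have pc: "p \<in> fst c" using p U by auto
    have t: "smooth_map eucl A ?T (chart_inv c)"
      by (rule smap_subset[OF mf_eucl A smap_chart_inv[OF A c]]) (use oT U in auto)
    have "tmap A eucl (snd c') (chart_inv c (snd c p)) (tmap eucl A (chart_inv c) (snd c p) (F (snd c p))) = tmap eucl eucl ?t' (snd c p) (F (snd c p))"
      by (rule tmap_compose[OF mf_eucl A mf_eucl t smap_chart[OF A c'], symmetric])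
        (use p U in \<open>auto simp: chart_inv_snd[OF A c] subset_iff\<close>)
    then show ?thesis
      by (simp add: p chart_inv_snd[OF A c'] chart_inv_snd[OF A c] pc chart_coord_tmap chart_vec_tmap)
  qed
  show "smooth_on ?S (\<lambda>x. chart_coord A c' (chart_inv c' x) (chart_vec A c (snd c (chart_inv c' x)) (F (snd c (chart_inv c' x)))))"
    by (subst smooth_on_cong[OF oS eq]) (assumption | rule 2)+
qed

locale conformal_map = geom_surface +
  fixes \<phi>
  assumes phi: "smooth_map Y (base X) (points Y) \<phi>"
    and spacelike: "\<And>y v. y \<in> points Y \<Longrightarrow> v \<noteq> 0 \<Longrightarrow> ind \<phi> y v v > 0"
    and conformal: "\<And>y u v. y \<in> points Y \<Longrightarrow> ind \<phi> y (\<i> * u) (\<i> * v) = ind \<phi> y u v"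

text \<open>Everything is computed at one point \<open>y0\<close>, in the preferred charts
  \<open>c\<close> of the surface and \<open>d\<close> of the base and in the gauge given by a local
  section \<open>s\<close>. \<open>E\<close> and \<open>Th\<close> are \<alpha> and \<theta> pulled
  back to the chart of the base: \<open>E x\<close> identifies the tangent space isometrically with
  the Lie algebra, and \<open>Th\<close> is the connection form in this frame. \<open>a\<close> and
  \<open>t\<close> are their further pull-backs to the chart of the surface by \<open>psi\<close>,
  which is \<phi> in charts.\<close>

locale gauge = conformal_map +
  fixes y0 W s
  assumes y0: "y0 \<in> points Y" and sec: "local_section X W s" and y0W: "\<phi> y0 \<in> W"
begin

abbreviation "c \<equiv> pref Y y0"
abbreviation "d \<equiv> pref MM (\<phi> y0)"
abbreviation "z0 \<equiv> pref_pt Y y0"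
definition "D = snd d ` (W \<inter> fst d)"
definition "Om = snd c ` {y \<in> fst c. \<phi> y \<in> W \<inter> fst d}"
definition "psi z = snd d (\<phi> (chart_inv c z))"
definition "S x = s (chart_inv d x)"
definition "E x b = al (S x) (tmap eucl PP S x b)"
definition "Th x b = th (S x) (tmap eucl PP S x b)"
definition "a z w = E (psi z) (FD psi z w)"
definition "t z w = Th (psi z) (FD psi z w)"

lemma c: "c \<in> Y" "y0 \<in> fst c" and d: "d \<in> MM" "\<phi> y0 \<in> fst d"
  using pref_in[OF y0] pref_in[OF smap_in[OF phi y0]] by auto

lemma W: "open_in MM W"
  using smap_open[OF local_section_smooth[OF sec]] .

lemma oD: "open D"
  unfolding D_def by (rule open_chart_image[OF M d(1) W])

lemma dW: "open_in Y {y \<in> fst c. \<phi> y \<in> W \<inter> fst d}"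
proof -
  have "open_in Y ({y \<in> points Y. \<phi> y \<in> W \<inter> fst d} \<inter> fst c)"
    by (intro open_in_Int smap_vimage[OF phi] W chart_open[OF M d(1)] chart_open[OF Y c(1)])
  moreover have "{y \<in> points Y. \<phi> y \<in> W \<inter> fst d} \<inter> fst c = {y \<in> fst c. \<phi> y \<in> W \<inter> fst d}"
    using chart_subset[OF Y c(1)] by auto
  ultimately show ?thesis by simp
qed

lemma oOm: "open Om"
  unfolding Om_def by (rule open_chart_image'[OF Y c(1) dW]) auto

lemma z0: "z0 \<in> Om" "chart_inv c z0 = y0" "psi z0 = pref_pt MM (\<phi> y0)" "psi z0 \<in> D"
  using c d y0W by (auto simp: Om_def pref_pt_def psi_def D_def chart_inv_snd[OF Y c(1)])

lemma OmD: "z \<in> Om \<Longrightarrow> chart_inv c z \<in> fst c" "z \<in> Om \<Longrightarrow> chart_inv c z \<in> points Y" "z \<in> Om \<Longrightarrow> \<phi> (chart_inv c z) \<in> W \<inter> fst d"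
    "z \<in> Om \<Longrightarrow> psi z \<in> D" "z \<in> Om \<Longrightarrow> chart_inv d (psi z) = \<phi> (chart_inv c z)" "z \<in> Om \<Longrightarrow> z \<in> snd c ` fst c"
  using chart_subset[OF Y c(1)]
  by (auto simp: Om_def chart_inv_snd[OF Y c(1)] psi_def D_def chart_inv_snd[OF M d(1)])

lemma psi_smooth: "smooth_on Om psi"
  unfolding psi_def[abs_def]
  by (rule smooth_on_subset[OF smooth_mapD[OF phi c(1) d(1)]])
    (use chart_subset[OF Y c(1)] in \<open>auto simp: Om_def\<close>)

lemma DD: "x \<in> D \<Longrightarrow> chart_inv d x \<in> W" "x \<in> D \<Longrightarrow> chart_inv d x \<in> fst d" "x \<in> D \<Longrightarrow> x \<in> snd d ` fst d"
  by (auto simp: D_def chart_inv_snd[OF M d(1)])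

lemma S_smooth: "smooth_map eucl PP D S"
  unfolding S_def[abs_def]
  by (rule smooth_compose[OF mf_eucl M P smap_subset[OF mf_eucl M smap_chart_inv[OF M d(1)]]
        local_section_smooth[OF sec]]) (use oD DD in auto)

lemma S_in: "x \<in> D \<Longrightarrow> S x \<in> points PP" and S_proj: "x \<in> D \<Longrightarrow> proj X (S x) = chart_inv d x"
  using smap_in[OF S_smooth] local_section_proj[OF sec] DD by (auto simp: S_def)

lemma E_form: "form_on eucl D E" and Th_form: "form_on eucl D Th"
  unfolding E_def[abs_def] Th_def[abs_def]
  by (rule form_on_pull[OF mf_eucl P S_smooth al_form smap_image[OF S_smooth]],
      rule form_on_pull[OF mf_eucl P S_smooth th_form smap_image[OF S_smooth]])

lemma tproj_S:
  assumes x: "x \<in> D"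
  shows "tproj X (S x) (tmap eucl PP S x b) = chart_vec MM d x b"
proof -
  have "tproj X (S x) (tmap eucl PP S x b) = tmap eucl MM (\<lambda>x. proj X (S x)) x b"
    unfolding tproj_def by (rule tmap_compose[OF mf_eucl P M S_smooth proj_smooth smap_image[OF S_smooth] x, symmetric])
  also have "\<dots> = tmap eucl MM (chart_inv d) x b"
    by (rule fun_cong[OF tmap_cong[OF mf_eucl M _ x]]) (simp_all add: oD S_proj)
  finally show ?thesis by (simp add: chart_vec_tmap)
qed

lemma q_E: "x \<in> D \<Longrightarrow> gM (chart_inv d x) (chart_vec MM d x b) (chart_vec MM d x b') = g (E x b) (E x b')"
  using metricM_eq[OF S_in, of x "tmap eucl PP S x b" "tmap eucl PP S x b'"]
  by (simp add: S_proj tproj_S E_def)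

lemma E_inj:
  assumes x: "x \<in> D" and "E x b = E x b'"
  shows "b = b'"
proof -
  have "chart_vec MM d x b = chart_vec MM d x b'"
    using assms al_eq_iff[OF S_in[OF x]] by (simp add: E_def tproj_S)
  then show ?thesis using chart_coord_vec[OF M d(1) DD(3)[OF x]] by metis
qed

lemma E_surj:
  assumes x: "x \<in> D"
  shows "\<exists>b. E x b = Z"
proof -
  obtain u where u: "al (S x) u = Z" using al_surj[OF S_in[OF x]] by blast
  let ?b = "chart_coord MM d (chart_inv d x) (tproj X (S x) u)"
  have "chart_vec MM d x ?b = tproj X (S x) u"
    using chart_vec_coord[OF M d(1) DD(2)[OF x]] snd_chart_inv[OF M d(1) DD(3)[OF x]] by simp
  then have "al (S x) (tmap eucl PP S x ?b) = al (S x) u"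
    by (intro iffD2[OF al_eq_iff[OF S_in[OF x]]]) (simp add: tproj_S[OF x])
  then have "E x ?b = Z" by (simp add: u E_def)
  then show ?thesis ..
qed

lemma linear_E: "x \<in> D \<Longrightarrow> linear (E x)" and linear_Th: "x \<in> D \<Longrightarrow> linear (Th x)"
  and smooth_E: "smooth_on D (\<lambda>x. E x b)" and smooth_Th: "smooth_on D (\<lambda>x. Th x b)"
  using E_form Th_form by (auto simp: form_on_eucl)

text \<open>The equation D_A \<alpha> = 0 in the gauge; it says that the connection d + [Th, .] in
  the frame \<open>E\<close> is free of torsion.\<close>

lemma d_E: "x \<in> D \<Longrightarrow> FD (\<lambda>x. E x v) x u - FD (\<lambda>x. E x u) x v = lbr (Th x v) (E x u) - lbr (Th x u) (E x v)"
  using ext_d_pull[OF mf_eucl P S_smooth al_form smap_image[OF S_smooth], of x u v] d_al[OF S_in]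
  by (simp add: ext_d_eucl E_def Th_def)

lemma d_Th: "x \<in> D \<Longrightarrow> FD (\<lambda>x. Th x v) x u - FD (\<lambda>x. Th x u) x v = lbr (E x u) (E x v) - lbr (Th x u) (Th x v)"
  using ext_d_pull[OF mf_eucl P S_smooth th_form smap_image[OF S_smooth], of x u v] d_th[OF S_in]
  by (simp add: ext_d_eucl E_def Th_def)

lemma psi_map: "smooth_map eucl eucl Om psi"
  by (simp add: smap_eucl_eucl oOm psi_smooth)

lemma psi_im: "psi ` Om \<subseteq> D"
  using OmD(4) by auto

lemma a_form: "form_on eucl Om a" and t_form: "form_on eucl Om t"
  unfolding a_def[abs_def] t_def[abs_def]
  using form_on_pull[OF mf_eucl mf_eucl psi_map E_form psi_im]
    form_on_pull[OF mf_eucl mf_eucl psi_map Th_form psi_im] by simp_all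

lemma linear_a: "z \<in> Om \<Longrightarrow> linear (a z)" and linear_t: "z \<in> Om \<Longrightarrow> linear (t z)"
  and smooth_a: "smooth_on Om (\<lambda>z. a z w)" and smooth_t: "smooth_on Om (\<lambda>z. t z w)"
  using a_form t_form by (auto simp: form_on_eucl)

lemma d_a: "z \<in> Om \<Longrightarrow> FD (\<lambda>z. a z v) z u - FD (\<lambda>z. a z u) z v = lbr (t z v) (a z u) - lbr (t z u) (a z v)"
  using ext_d_pull[OF mf_eucl mf_eucl psi_map E_form psi_im, of z u v] d_E[OF OmD(4)]
  by (simp add: ext_d_eucl a_def t_def)

lemma d_t: "z \<in> Om \<Longrightarrow> FD (\<lambda>z. t z v) z u - FD (\<lambda>z. t z u) z v = lbr (a z u) (a z v) - lbr (t z u) (t z v)"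
  using ext_d_pull[OF mf_eucl mf_eucl psi_map Th_form psi_im, of z u v] d_Th[OF OmD(4)]
  by (simp add: ext_d_eucl a_def t_def)

lemma phi_vec:
  assumes z: "z \<in> Om"
  shows "tmap Y MM \<phi> (chart_inv c z) (chart_vec Y c z w) = chart_vec MM d (psi z) (FD psi z w)"
proof -
  obtain y where y: "y \<in> fst c" "\<phi> y \<in> W \<inter> fst d" "z = snd c y" using z by (auto simp: Om_def)
  show ?thesis
    unfolding psi_def by (rule tmap_in_charts(1)[OF Y M phi c(1) d(1)]) (use y chart_subset[OF Y c(1)] in auto)
qed

lemma pb_metric_a: "z \<in> Om \<Longrightarrow>
    ind \<phi> (chart_inv c z) (chart_vec Y c z w) (chart_vec Y c z w') = g (a z w) (a z w')"
  unfolding pullback_metric_def phi_vec OmD(5)[symmetric] by (simp add: q_E OmD(4) a_def)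

lemma g_a_pos: "z \<in> Om \<Longrightarrow> w \<noteq> 0 \<Longrightarrow> g (a z w) (a z w) > 0"
proof -
  assume z: "z \<in> Om" and w: "w \<noteq> 0"
  have "chart_vec Y c z w \<noteq> 0"
    using w chart_coord_vec[OF Y c(1) OmD(6)[OF z], of w] linear_0[OF linear_chart_coord[OF Y c(1) OmD(1)[OF z]]] by auto
  then show "g (a z w) (a z w) > 0" using spacelike[OF OmD(2)[OF z]] pb_metric_a[OF z, of w w] by metis
qed

lemma g_a_conf: "z \<in> Om \<Longrightarrow> g (a z (\<i> * w)) (a z (\<i> * w')) = g (a z w) (a z w')"
  using conformal[OF OmD(2), of z] chart_vec_mult_i[OF Y_surface c(1) OmD(6)] by (simp add: pb_metric_a[symmetric])

definition "cf z = g (a z 1) (a z 1)"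

lemma cf_pos: "z \<in> Om \<Longrightarrow> cf z > 0"
  by (simp add: cf_def g_a_pos)

lemma g_a:
  assumes z: "z \<in> Om"
  shows "g (a z u) (a z v) = cf z * Re (cnj u * v)"
proof -
  have bl: "bilinear (\<lambda>u v. g (a z u) (a z v))"
    unfolding bilinear_def using linear_a[OF z]
    by (auto intro!: linearI simp: linear_add linear_cmul g_simps)
  have 1: "g (a z \<i>) (a z \<i>) = cf z" using g_a_conf[OF z, of 1 1] by (simp add: cf_def)
  have "a z (- 1) = - a z 1" by (rule linear_neg[OF linear_a[OF z]])
  then have "g (a z \<i>) (a z 1) = 0"
    using g_a_conf[OF z, of 1 \<i>] g_sym[of "a z 1" "a z \<i>"] by (simp add: g_simps)
  then show ?thesis
    using bilinear_complex[OF bl, of u v] g_sym[of "a z 1" "a z \<i>"] 1 by (simp add: cf_def[symmetric] algebra_simps)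
qed

lemma smooth_cf: "smooth_on Om cf"
  unfolding cf_def[abs_def] by (rule smooth_on_bilinear[OF bounded_bilinear_g oOm smooth_a smooth_a])

text \<open>The second fundamental form, including its tangential part.\<close>

definition "b v w = FD (\<lambda>z. a z w) z0 v + lbr (t z0 v) (a z0 w)"

definition "trb = b 1 1 + b \<i> \<i>"

text \<open>Vanishing of the torsion, in the form \<open>d_a\<close>.\<close>

lemma b_sym: "b v w = b w v"
  using d_a[OF z0(1), of w v] by (simp add: b_def algebra_simps)

text \<open>Obtained by differentiating \<open>g_a\<close>; the bracket terms contained in
  \<open>b\<close> cancel by the invariance of \<open>g\<close>, as for a metric connection.\<close>

lemma g_b: "g (b v w) (a z0 u) + g (a z0 w) (b v u) = FD cf z0 v * Re (cnj w * u)"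
proof -
  have da: "(\<lambda>z. a z w) differentiable (at z0)" for w by (rule smooth_on_differentiable[OF smooth_a z0(1)])
  have "FD (\<lambda>z. g (a z w) (a z u)) z0 v = g (a z0 w) (FD (\<lambda>z. a z u) z0 v) + g (FD (\<lambda>z. a z w) z0 v) (a z0 u)"
    by (rule FD_bilinear[OF bounded_bilinear_g da da])
  moreover have "FD (\<lambda>z. g (a z w) (a z u)) z0 = FD (\<lambda>z. cf z * Re (cnj w * u)) z0"
    by (rule FD_cong_open[OF oOm z0(1) g_a])
  moreover have "FD (\<lambda>z. cf z * Re (cnj w * u)) z0 v = FD cf z0 v * Re (cnj w * u)"
    by (rule FD_linear_comp[OF bounded_linear_mult_left smooth_on_differentiable[OF smooth_cf z0(1)]])
  ultimately show ?thesis by (simp add: b_def g_simps g_inv)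
qed

text \<open>For a conformal parametrization, \<open>g_b\<close> gives
  \<open>g (b 1 1) (a z0 1)\<close> as half the derivative of \<open>cf\<close> in direction 1 and,
  with the symmetry of \<open>b\<close>, \<open>g (b \<i> \<i>) (a z0 1)\<close> as minus the same
  number; likewise for direction \<i>.\<close>

lemma trb_normal: "g trb (a z0 w) = 0"
proof -
  have 1: "g trb (a z0 1) = 0"
    using g_b[of 1 1 1] g_b[of \<i> \<i> 1] g_b[of 1 \<i> \<i>] b_sym[of \<i> 1] g_sym[of "a z0 1"] g_sym[of "a z0 \<i>"]
    by (simp add: trb_def g_simps)
  have 2: "g trb (a z0 \<i>) = 0"
    using g_b[of \<i> \<i> \<i>] g_b[of 1 1 \<i>] g_b[of \<i> 1 1] b_sym[of \<i> 1] g_sym[of "a z0 1"] g_sym[of "a z0 \<i>"]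
    by (simp add: trb_def g_simps)
  show ?thesis
    using linear_complex[OF linear_a[OF z0(1)], of w] 1 2 by (simp add: g_simps)
qed

section \<open>The Levi-Civita connection and the mean curvature vector in the frame
  \<open>E\<close>\<close>

abbreviation "E0 \<equiv> E (psi z0)"

lemma pref_vec: "chart_vec MM d (psi z0) w = w" "chart_inv d (psi z0) = \<phi> y0"
  using chart_vec_pref[OF M smap_in[OF phi y0], of w] OmD(5)[OF z0(1)] by (simp_all add: z0)

lemma q_E0: "gM (\<phi> y0) v w = g (E0 v) (E0 w)"
  using q_E[OF z0(4), of v w] by (simp add: pref_vec)

lemma dE: "(\<lambda>x. E x w) differentiable (at (psi z0))"
  by (rule smooth_on_differentiable[OF smooth_E z0(4)])

text \<open>The map \<open>Ga\<close> that corresponds to d + [Th, .] under the frame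
  \<open>E\<close> is symmetric by \<open>d_E\<close> and compatible with the metric by the
  invariance of \<open>g\<close>; these two properties determine the Christoffel symbol.\<close>

lemma christoffel_E: "E0 (christoffel MM gM (\<phi> y0) v w) = FD (\<lambda>x. E x w) (psi z0) v + lbr (Th (psi z0) v) (E0 w)"
proof -
  let ?x = "psi z0"
  define R where "R v w = FD (\<lambda>x. E x w) ?x v + lbr (Th ?x v) (E0 w)" for v w
  define Ga where "Ga v w = (SOME b. E0 b = R v w)" for v w
  have EG: "E0 (Ga v w) = R v w" for v w unfolding Ga_def by (rule someI_ex[OF E_surj[OF z0(4)]])
  note lE = linear_E[OF z0(4)] and lT = linear_Th[OF z0(4)]
  have blR: "bilinear R"
    unfolding bilinear_def R_def
  proof (intro conjI allI linear_compose_add)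
    show "linear (\<lambda>w. FD (\<lambda>x. E x w) ?x v)" for v by (rule FD_family_linear[OF oD z0(4) linear_E dE])
    show "linear (\<lambda>v. FD (\<lambda>x. E x w) ?x v)" for w by (rule FD_linear[OF dE])
  qed (auto intro!: linearI simp: linear_add[OF lE] linear_cmul[OF lE] linear_add[OF lT] linear_cmul[OF lT] lbr_simps)
  have blG: "bilinear Ga"
    unfolding bilinear_def
    by (auto intro!: linearI E_inj[OF z0(4)] simp: linear_add[OF lE] linear_cmul[OF lE] EG
        bilinear_ladd[OF blR] bilinear_radd[OF blR] bilinear_lmul[OF blR] bilinear_rmul[OF blR])
  have sym: "Ga v w = Ga w v" for v w
    by (rule E_inj[OF z0(4)]) (use d_E[OF z0(4), of w v] in \<open>simp add: EG R_def algebra_simps\<close>)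
  have compat: "FD (\<lambda>z. gM (chart_inv d z) (chart_vec MM d z v) (chart_vec MM d z w)) ?x u = gM (\<phi> y0) (Ga u v) w + gM (\<phi> y0) v (Ga u w)" for u v w
  proof -
    have "FD (\<lambda>z. gM (chart_inv d z) (chart_vec MM d z v) (chart_vec MM d z w)) ?x = FD (\<lambda>z. g (E z v) (E z w)) ?x"
      by (rule FD_cong_open[OF oD z0(4) q_E])
    moreover have "FD (\<lambda>z. g (E z v) (E z w)) ?x u = g (E0 v) (FD (\<lambda>z. E z w) ?x u) + g (FD (\<lambda>z. E z v) ?x u) (E0 w)"
      by (rule FD_bilinear[OF bounded_bilinear_g dE dE])
    ultimately show ?thesis by (simp add: q_E0 EG R_def g_simps g_inv)
  qed
  have "christoffel MM gM (\<phi> y0) = Ga"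
    unfolding christoffel_def
  proof (rule the_equality)
    show "bilinear Ga \<and> (\<forall>a b. Ga a b = Ga b a) \<and> (\<forall>a b c. FD (\<lambda>z. gM (chart_inv d z) (chart_vec MM d z b) (chart_vec MM d z c))
        (pref_pt MM (\<phi> y0)) a = gM (\<phi> y0) (Ga a b) c + gM (\<phi> y0) b (Ga a c))"
      using blG sym compat by (simp add: z0(3)[symmetric])
    fix G' assume G': "bilinear G' \<and> (\<forall>a b. G' a b = G' b a) \<and> (\<forall>a b c. FD (\<lambda>z. gM (chart_inv d z) (chart_vec MM d z b) (chart_vec MM d z c))
        (pref_pt MM (\<phi> y0)) a = gM (\<phi> y0) (G' a b) c + gM (\<phi> y0) b (G' a c))"
    \<comment> \<open>The difference of two candidates, lowered by \<open>g\<close>: symmetric in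
      the first two arguments and skew in the last two, hence zero after six exchanges.\<close>
    define T where "T a b c = g (E0 (G' a b) - E0 (Ga a b)) (E0 c)" for a b c
    have T1: "T a b c = T b a c" for a b c using G' sym by (simp add: T_def)
    have T2: "T a b c = - T a c b" for a b c
    proof -
      have "gM (\<phi> y0) (G' a b) c + gM (\<phi> y0) b (G' a c) = gM (\<phi> y0) (Ga a b) c + gM (\<phi> y0) b (Ga a c)"
        using G' compat[of b c a] by (simp add: z0(3)[symmetric])
      then show ?thesis
        using g_sym[of "E0 b"] by (simp add: T_def q_E0 g_simps)
    qed
    have T0: "T a b c = 0" for a b c
      using T1[of a b c] T2[of b a c] T1[of b c a] T2[of c b a] T1[of c a b] T2[of a c b] by simp
    have "E0 (G' a b) - E0 (Ga a b) = 0" for a b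
    proof (rule g_nondeg)
      fix Z
      obtain c' where "E0 c' = Z" using E_surj[OF z0(4)] by blast
      then show "g (E0 (G' a b) - E0 (Ga a b)) Z = 0" using T0[of a b c'] by (simp add: T_def)
    qed
    then show "G' = Ga" by (intro ext E_inj[OF z0(4)]) simp
  qed
  then show ?thesis by (simp add: EG R_def)
qed

lemma phi_y0: "tmap Y MM \<phi> y0 w = FD psi z0 w"
  using phi_vec[OF z0(1), of w] by (simp add: z0 chart_vec_pref[OF Y y0] chart_vec_pref[OF M smap_in[OF phi y0]])

lemma E0_phi: "E0 (tmap Y MM \<phi> y0 w) = a z0 w"
  by (simp add: phi_y0 a_def)

text \<open>The vector \<open>w\<close> comes from differentiating the coordinates of
  \<open>V\<close>. It is tangential, so after projection to the normal space only \<open>b\<close>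
  at the value of \<open>V\<close> at \<open>y0\<close> matters.\<close>

lemma nabla_E:
  assumes V: "smooth_field Y U V" and yU: "y0 \<in> U"
  shows "\<exists>w. E0 (pullback_nabla Y MM gM \<phi> (\<lambda>z. tmap Y MM \<phi> z (V z)) y0 v) = b v (V y0) + a z0 w"
proof -
  define Vc where "Vc z = chart_coord Y c (chart_inv c z) (V (chart_inv c z))" for z
  let ?N = "snd c ` (U \<inter> fst c)" and ?l = "\<lambda>z. FD psi z (Vc z)"
  have U: "open_in Y U" using V by (simp add: smooth_field_def)
  have sV: "smooth_on ?N Vc" using V c(1) by (simp add: smooth_field_def Vc_def[abs_def])
  have oN: "open ?N" by (rule open_chart_image[OF Y c(1) U])
  have zN: "z0 \<in> ?N" using yU c by (auto simp: pref_pt_def)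
  have o: "open (?N \<inter> Om)" by (intro open_Int oN oOm)
  have z: "z0 \<in> ?N \<inter> Om" using zN z0 by auto
  have Vc0: "Vc z0 = V y0" by (simp add: Vc_def z0 chart_coord_pref[OF Y y0])
  have dV: "Vc differentiable (at z0)" by (rule smooth_on_differentiable[OF sV zN])
  have dl: "?l differentiable (at z0)"
    using has_derivative_apply[where L = "FD psi", OF oOm z0(1) smooth_on_FD_linear[OF psi_smooth] smooth_on_differentiable[OF smooth_on_FD[OF psi_smooth] z0(1)] dV]
    unfolding differentiable_def by blast
  have l: "chart_coord MM d (\<phi> (chart_inv c z)) (tmap Y MM \<phi> (chart_inv c z) (V (chart_inv c z))) = ?l z"
    if z: "z \<in> ?N \<inter> Om" for z
  proof -
    have zO: "z \<in> Om" using z by auto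
    have "V (chart_inv c z) = chart_vec Y c z (Vc z)"
      using chart_vec_coord[OF Y c(1) OmD(1)[OF zO]] snd_chart_inv[OF Y c(1) OmD(6)[OF zO]] by (simp add: Vc_def)
    then show ?thesis
      using chart_coord_vec[OF M d(1) DD(3)[OF OmD(4)[OF zO]]] OmD(5)[OF zO] by (simp add: phi_vec[OF zO])
  qed
  have ps: "psi differentiable (at z0)" by (rule smooth_on_differentiable[OF psi_smooth z0(1)])
  have dEp: "(\<lambda>z. E (psi z) w) differentiable (at z0)" for w
    by (rule smooth_on_differentiable[OF smooth_on_compose[OF oOm oD psi_smooth smooth_E psi_im] z0(1)])
  have "pullback_nabla Y MM gM \<phi> (\<lambda>z. tmap Y MM \<phi> z (V z)) y0 v =
      FD ?l z0 v + christoffel MM gM (\<phi> y0) (FD psi z0 v) (FD psi z0 (V y0))"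
    unfolding pullback_nabla_def phi_y0 using FD_cong_open[OF o z l] by simp
  then have "E0 (pullback_nabla Y MM gM \<phi> (\<lambda>z. tmap Y MM \<phi> z (V z)) y0 v) =
      E0 (FD ?l z0 v) + FD (\<lambda>x. E x (?l z0)) (psi z0) (FD psi z0 v) + lbr (t z0 v) (a z0 (V y0))"
    by (simp add: linear_add[OF linear_E[OF z0(4)]] christoffel_E Vc0 t_def a_def)
  \<comment> \<open>The two terms are those of the product rule for \<open>E (psi z)\<close> applied
    to the moving vector; the bracket term is kept for \<open>b\<close>.\<close>
  also have "E0 (FD ?l z0 v) + FD (\<lambda>x. E x (?l z0)) (psi z0) (FD psi z0 v) = FD (\<lambda>z. E (psi z) (?l z)) z0 v"
    using FD_apply[where L = "\<lambda>z. E (psi z)" and f = ?l, OF oOm z0(1) linear_E[OF OmD(4)] dEp dl, of v]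
      FD_compose[OF ps dE, of "?l z0" v] by simp
  also have "(\<lambda>z. E (psi z) (?l z)) = (\<lambda>z. a z (Vc z))" by (simp add: a_def fun_eq_iff)
  also have "FD (\<lambda>z. a z (Vc z)) z0 v = FD (\<lambda>z. a z (V y0)) z0 v + a z0 (FD Vc z0 v)"
    using FD_apply[where L = a and f = Vc, OF oOm z0(1) linear_a smooth_on_differentiable[OF smooth_a z0(1)] dV, of v] by (simp add: Vc0)
  finally show ?thesis by (intro exI[of _ "FD Vc z0 v"]) (simp add: b_def)
qed

text \<open>The metric of the base may be indefinite, but on the image of the tangent plane it is
  positive definite; this gives existence and uniqueness of the orthogonal projection.\<close>

lemma normal_part_E:
  "\<exists>w. E0 (normal_part Y MM gM \<phi> y0 x) = E0 x + a z0 w \<and> (\<forall>v. g (E0 (normal_part Y MM gM \<phi> y0 x)) (a z0 v) = 0)"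
proof -
  let ?R = "\<lambda>n. x - n \<in> range (tmap Y MM \<phi> y0) \<and> (\<forall>v. gM (\<phi> y0) n (tmap Y MM \<phi> y0 v) = 0)"
  note lE = linear_E[OF z0(4)] and la = linear_a[OF z0(1)]
  have l: "linear (tmap Y MM \<phi> y0)" by (rule tmap_linear[OF Y M phi y0])
  define k where "k = cf z0"
  have k: "k > 0" by (simp add: k_def cf_pos z0)
  \<comment> \<open>The coefficients of the projection: \<open>a z0 1\<close> and
    \<open>a z0 \<i>\<close> are orthogonal with common square length \<open>k\<close>.\<close>
  define w where "w = Complex (g (E0 x) (a z0 1) / k) (g (E0 x) (a z0 \<i>) / k)"
  have ga: "g (a z0 u) (a z0 v) = k * Re (cnj u * v)" for u v by (simp add: k_def g_a z0(1))
  have gx: "g (E0 x) (a z0 v) = Re v * g (E0 x) (a z0 1) + Im v * g (E0 x) (a z0 \<i>)" for v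
    using linear_complex[OF la, of v] by (simp add: g_simps)
  have "g (E0 x - a z0 w) (a z0 v) = 0" for v
    unfolding g_simps ga[of w v] gx[of v] using k by (simp add: w_def field_simps)
  then have ex: "?R (x - tmap Y MM \<phi> y0 w)"
    by (simp add: q_E0 linear_diff[OF lE] E0_phi)
  have un: "n = n'" if n: "?R n" and n': "?R n'" for n n'
  proof -
    obtain u u' where u: "x - n = tmap Y MM \<phi> y0 u" "x - n' = tmap Y MM \<phi> y0 u'" using n n' by blast
    have 1: "n' - n = tmap Y MM \<phi> y0 (u - u')" by (simp add: linear_diff[OF l] u[symmetric])
    have 2: "E0 n' - E0 n = a z0 (u - u')" using 1 E0_phi[of "u - u'"] by (simp add: linear_diff[OF lE, symmetric])
    have "g (E0 n' - E0 n) (a z0 (u - u')) = 0" using n n' by (simp add: q_E0 E0_phi g_simps)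
    then have "u - u' = 0" using g_a_pos[OF z0(1), of "u - u'"] 2 by force
    then show ?thesis using 1 linear_0[OF l] by simp
  qed
  have "?R (normal_part Y MM gM \<phi> y0 x)"
    unfolding normal_part_def by (rule theI[of ?R, OF ex]) (rule un[OF _ ex])
  then obtain u where u: "x - normal_part Y MM gM \<phi> y0 x = tmap Y MM \<phi> y0 u"
      "\<forall>v. gM (\<phi> y0) (normal_part Y MM gM \<phi> y0 x) (tmap Y MM \<phi> y0 v) = 0" by blast
  show ?thesis
  proof (intro exI[of _ "- u"] conjI allI)
    have "E0 x - E0 (normal_part Y MM gM \<phi> y0 x) = a z0 u"
      using E0_phi[of u] by (simp add: u(1)[symmetric] linear_diff[OF lE])
    then show "E0 (normal_part Y MM gM \<phi> y0 x) = E0 x + a z0 (- u)"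
      by (simp add: linear_neg[OF la] algebra_simps)
    show "g (E0 (normal_part Y MM gM \<phi> y0 x)) (a z0 v) = 0" for v
      using u(2) by (simp add: q_E0 E0_phi)
  qed
qed

lemma pb_metric_y0: "ind \<phi> y0 u v = cf z0 * Re (cnj u * v)"
  using pb_metric_a[OF z0(1), of u v] by (simp add: z0 chart_vec_pref[OF Y y0] g_a)

lemma bilinear_b: "bilinear b"
proof -
  have da: "(\<lambda>z. a z w) differentiable (at z0)" for w by (rule smooth_on_differentiable[OF smooth_a z0(1)])
  note lt = linear_t[OF z0(1)] and la = linear_a[OF z0(1)]
  show ?thesis
    unfolding bilinear_def b_def
  proof (intro conjI allI linear_compose_add)
    show "linear (\<lambda>w. FD (\<lambda>x. a x w) z0 v)" for v by (rule FD_family_linear[OF oOm z0(1) linear_a da])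
    show "linear (\<lambda>v. FD (\<lambda>x. a x w) z0 v)" for w by (rule FD_linear[OF da])
  qed (auto intro!: linearI simp: linear_add[OF la] linear_cmul[OF la] linear_add[OF lt] linear_cmul[OF lt] lbr_simps)
qed

text \<open>\<open>mean_curvature\<close> admits any orthonormal frame, so its description has a
  unique solution only if the trace is the same for all frames.\<close>

lemma trace_b:
  assumes "orthonormal_pair (ind \<phi> y0) u v"
  shows "b u u + b v v = (1 / cf z0) *\<^sub>R trb"
proof -
  define k where "k = cf z0"
  have k: "k > 0" by (simp add: k_def cf_pos z0)
  have o: "k * (Re u * Re u + Im u * Im u) = 1" "k * (Re v * Re v + Im v * Im v) = 1" "Re u * Re v + Im u * Im v = 0"
    using assms k unfolding orthonormal_pair_def pb_metric_y0 k_def[symmetric] by auto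
  define x y where "x = Re u" and "y = Im u"
  define x' y' where "x' = Re v" and "y' = Im v"
  note o' = o[folded x_def y_def x'_def y'_def]
  \<comment> \<open>Two orthonormal vectors of the plane form the columns of an orthogonal matrix, so its rows are orthonormal too.\<close>
  have r: "k * (x * x + x' * x') = 1 \<and> k * (y * y + y' * y') = 1 \<and> x * y + x' * y' = 0"
  proof -
    \<comment> \<open>The determinant, scaled by \<open>k\<close>. Its square is 1 by the Gram
      identity, and the second vector is the first one turned by a right angle in the sense given by
      the sign \<open>e\<close>.\<close>
    define e where "e = k * (x * y' - y * x')"
    have "e * e = (k * (x * x + y * y)) * (k * (x' * x' + y' * y')) - (k * (x * x' + y * y')) * (k * (x * x' + y * y'))"
      by (simp add: e_def algebra_simps)
    then have e: "e * e = 1" using o' by simp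
    have 1: "x' = - e * y"
    proof -
      have "e * y = k * (x * y' * y) - k * (y * y) * x'" by (simp add: e_def algebra_simps)
      also have "k * (x * y' * y) = k * x * (y * y')" by simp
      also have "y * y' = - (x * x')" using o'(3) by linarith
      also have "k * x * - (x * x') - k * (y * y) * x' = - (k * (x * x + y * y)) * x'" by (simp add: algebra_simps)
      finally show ?thesis using o'(1) by simp
    qed
    have 2: "y' = e * x"
    proof -
      have "e * x = k * (x * x) * y' - k * y * (x * x')" by (simp add: e_def algebra_simps)
      also have "x * x' = - (y * y')" using o'(3) by linarith
      also have "k * (x * x) * y' - k * y * - (y * y') = (k * (x * x + y * y)) * y'" by (simp add: algebra_simps)
      finally show ?thesis using o'(1) by simp
    qed
    have 3: "x' * x' = y * y" "y' * y' = x * x" "x' * y' = - (x * y)"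
    proof -
      have "x' * x' = (e * e) * (y * y)" "y' * y' = (e * e) * (x * x)" "x' * y' = - ((e * e) * (x * y))"
        unfolding 1 2 by (simp_all add: algebra_simps)
      then show "x' * x' = y * y" "y' * y' = x * x" "x' * y' = - (x * y)" using e by simp_all
    qed
    show ?thesis using o'(1) by (simp add: 3 add.commute)
  qed
  have "b u u + b v v = (x * x + x' * x') *\<^sub>R b 1 1 + (x * y + x' * y') *\<^sub>R b 1 \<i> + (x * y + x' * y') *\<^sub>R b \<i> 1 + (y * y + y' * y') *\<^sub>R b \<i> \<i>"
    unfolding bilinear_complex[OF bilinear_b, of u u] bilinear_complex[OF bilinear_b, of v v]
    by (simp add: x_def y_def x'_def y'_def algebra_simps)
  also have "\<dots> = (1 / k) *\<^sub>R trb"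
  proof -
    have "x * x + x' * x' = 1 / k" "y * y + y' * y' = 1 / k" using r k by (simp_all add: field_simps)
    then show ?thesis using r by (simp add: trb_def scaleR_add_right)
  qed
  finally show ?thesis by (simp add: k_def)
qed

text \<open>Each normal part differs from the value of \<open>b\<close> by a tangential vector. The
  sum of the two is normal, and so is \<open>trb\<close>; hence the total tangential error is
  orthogonal to itself and vanishes.\<close>

lemma mean_curvature_E: "E0 (mean_curvature Y MM gM \<phi> y0) = (1 / (2 * cf z0)) *\<^sub>R trb"
proof -
  let ?N = "\<lambda>V. normal_part Y MM gM \<phi> y0 (pullback_nabla Y MM gM \<phi> (\<lambda>z. tmap Y MM \<phi> z (V z)) y0 (V y0))"
  let ?Q = "\<lambda>h. \<exists>U V\<^sub>1 V\<^sub>2. y0 \<in> U \<and> smooth_field Y U V\<^sub>1 \<and> smooth_field Y U V\<^sub>2 \<and>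
     (\<forall>z\<in>U. orthonormal_pair (ind \<phi> z) (V\<^sub>1 z) (V\<^sub>2 z)) \<and> h = (1/2) *\<^sub>R (?N V\<^sub>1 + ?N V\<^sub>2)"
  note lE = linear_E[OF z0(4)] and la = linear_a[OF z0(1)]
  have val: "E0 h = (1 / (2 * cf z0)) *\<^sub>R trb" if Q: "?Q h" for h
  proof -
    obtain U V1 V2 where V: "y0 \<in> U" "smooth_field Y U V1" "smooth_field Y U V2"
       "\<forall>z\<in>U. orthonormal_pair (ind \<phi> z) (V1 z) (V2 z)" "h = (1/2) *\<^sub>R (?N V1 + ?N V2)"
      using Q by (elim exE conjE)
    have N: "\<exists>w. E0 (?N V) = b (V y0) (V y0) + a z0 w \<and> (\<forall>v. g (E0 (?N V)) (a z0 v) = 0)" if sV: "smooth_field Y U V" for V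
    proof -
      obtain w1 where w1: "E0 (pullback_nabla Y MM gM \<phi> (\<lambda>z. tmap Y MM \<phi> z (V z)) y0 (V y0)) = b (V y0) (V y0) + a z0 w1"
        using nabla_E[OF sV V(1)] by blast
      obtain w2 where w2: "E0 (?N V) = E0 (pullback_nabla Y MM gM \<phi> (\<lambda>z. tmap Y MM \<phi> z (V z)) y0 (V y0)) + a z0 w2"
         "\<And>v. g (E0 (?N V)) (a z0 v) = 0"
        using normal_part_E[of "pullback_nabla Y MM gM \<phi> (\<lambda>z. tmap Y MM \<phi> z (V z)) y0 (V y0)"] by blast
      show ?thesis using w1 w2 by (intro exI[of _ "w1 + w2"]) (simp add: linear_add[OF la])
    qed
    obtain w1 where w1: "E0 (?N V1) = b (V1 y0) (V1 y0) + a z0 w1" "\<And>v. g (E0 (?N V1)) (a z0 v) = 0" using N[OF V(2)] by blast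
    obtain w2 where w2: "E0 (?N V2) = b (V2 y0) (V2 y0) + a z0 w2" "\<And>v. g (E0 (?N V2)) (a z0 v) = 0" using N[OF V(3)] by blast
    have tr: "b (V1 y0) (V1 y0) + b (V2 y0) (V2 y0) = (1 / cf z0) *\<^sub>R trb"
      by (rule trace_b) (use V in blast)
    have sum: "E0 (?N V1) + E0 (?N V2) = (1 / cf z0) *\<^sub>R trb + a z0 (w1 + w2)"
      unfolding w1(1) w2(1) tr[symmetric] linear_add[OF la] by simp
    have "g (E0 (?N V1) + E0 (?N V2)) (a z0 (w1 + w2)) = 0" using w1(2) w2(2) by (simp add: g_simps)
    then have "g (a z0 (w1 + w2)) (a z0 (w1 + w2)) = 0"
      unfolding sum by (simp only: g_simps trb_normal) simp
    then have "w1 + w2 = 0" using g_a_pos[OF z0(1), of "w1 + w2"] by force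
    then have "E0 (?N V1) + E0 (?N V2) = (1 / cf z0) *\<^sub>R trb" using sum linear_0[OF la] by simp
    then show ?thesis unfolding V(5) by (simp add: linear_cmul[OF lE] linear_add[OF lE])
  qed
  \<comment> \<open>Scaling the coordinate frame by the inverse square root of the conformal factor
    gives an orthonormal frame, so the description in \<open>mean_curvature\<close> has a
    solution.\<close>
  define r where "r z = cf z powr (- 1/2)" for z
  have r: "r z * r z * cf z = 1" if "z \<in> Om" for z
  proof -
    have "r z * r z * cf z = cf z powr (- 1/2 + - 1/2 + 1)"
      unfolding powr_add using cf_pos[OF that] by (simp add: r_def)
    then show ?thesis using cf_pos[OF that] by simp
  qed
  have sr: "smooth_on Om (\<lambda>z. r z *\<^sub>R e)" for e :: complex
  proof -
    have "smooth_on Om r" unfolding r_def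
      by (rule smooth_on_compose[OF oOm open_greaterThan smooth_cf smooth_on_powr]) (use cf_pos in auto)
    then show ?thesis by (intro smooth_on_bilinear[OF bounded_bilinear_scaleR oOm] smooth_on_const[OF oOm])
  qed
  let ?U = "{y \<in> fst c. \<phi> y \<in> W \<inter> fst d}"
  define V where "V e y = chart_vec Y c (snd c y) (r (snd c y) *\<^sub>R e)" for e y
  have V: "smooth_field Y ?U (V e)" for e
    unfolding V_def by (rule smooth_field_in_chart[OF Y c(1) dW]) (use sr in \<open>auto simp: Om_def\<close>)
  have "orthonormal_pair (ind \<phi> y) (V 1 y) (V \<i> y)" if y: "y \<in> ?U" for y
  proof -
    have z: "snd c y \<in> Om" "chart_inv c (snd c y) = y" using y by (auto simp: Om_def chart_inv_snd[OF Y c(1)])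
    have "ind \<phi> y (V e y) (V e' y) = cf (snd c y) * (r (snd c y) * r (snd c y)) * Re (cnj e * e')" for e e'
      using pb_metric_a[OF z(1), of "r (snd c y) *\<^sub>R e" "r (snd c y) *\<^sub>R e'"] z
      by (simp add: V_def g_a algebra_simps)
    then show ?thesis using r[OF z(1)] by (simp add: orthonormal_pair_def mult.commute)
  qed
  then have ex: "?Q ((1/2) *\<^sub>R (?N (V 1) + ?N (V \<i>)))"
    using V c y0W d by (intro exI[of _ ?U] exI[of _ "V 1"] exI[of _ "V \<i>"]) auto
  have "mean_curvature Y MM gM \<phi> y0 = (1/2) *\<^sub>R (?N (V 1) + ?N (V \<i>))"
    unfolding mean_curvature_def
  proof (rule the_equality)
    show "?Q ((1/2) *\<^sub>R (?N (V 1) + ?N (V \<i>)))" by (rule ex)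
    show "h = (1/2) *\<^sub>R (?N (V 1) + ?N (V \<i>))" if "?Q h" for h
      by (rule E_inj[OF z0(4)]) (simp only: val[OF that] val[OF ex])
  qed
  then show ?thesis using val[OF ex] by simp
qed

section \<open>The curvature of \<open>beta\<close> and the mean curvature equation\<close>

lemma section_lift_smooth: "smooth_map Y PP {y \<in> points Y. \<phi> y \<in> W} (\<lambda>y. s (\<phi> y))"
  by (rule smooth_compose[OF Y M P smap_subset[OF Y M phi smap_vimage[OF phi W]] local_section_smooth[OF sec]]) auto

lemma beta_in_chart:
  assumes z: "z \<in> Om"
  shows "beta (\<lambda>y. s (\<phi> y)) (chart_inv c z) (chart_vec Y c z w) = t z w + a z (\<i> * w)"
proof -
  have im: "chart_inv c z \<in> {y \<in> points Y. \<phi> y \<in> W}" using OmD[OF z] by auto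
  have Sz: "S (psi z) = s (\<phi> (chart_inv c z))" by (simp add: S_def OmD(5)[OF z])
  have "tmap Y PP (\<lambda>y. s (\<phi> y)) (chart_inv c z) (chart_vec Y c z w) = tmap eucl PP S (psi z) (FD psi z w)" for w
  proof -
    have "tmap Y PP (\<lambda>y. s (\<phi> y)) (chart_inv c z) (chart_vec Y c z w) = tmap eucl PP (\<lambda>z. s (\<phi> (chart_inv c z))) z w"
      unfolding chart_vec_tmap
      by (rule tmap_compose[OF mf_eucl Y P smap_subset[OF mf_eucl Y smap_chart_inv[OF Y c(1)]] section_lift_smooth, of Om, symmetric])
        (use OmD oOm z in auto)
    also have "\<dots> = tmap eucl PP (\<lambda>z. S (psi z)) z w"
      by (rule fun_cong[OF tmap_cong[OF mf_eucl P _ z]]) (simp_all add: oOm S_def OmD(5))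
    also have "\<dots> = tmap eucl PP S (psi z) (tmap eucl eucl psi z w)"
      by (rule tmap_compose[OF mf_eucl mf_eucl P psi_map S_smooth psi_im z])
    finally show ?thesis by simp
  qed
  from this[of w] this[of "\<i> * w"] show ?thesis
    by (simp add: beta_def chart_vec_mult_i[OF Y_surface c(1) OmD(6)[OF z], symmetric] a_def t_def E_def Th_def Sz)
qed

text \<open>In the chart, \<open>beta\<close> is t(w) + a(\<i> w). From dt come [a 1, a \<i>] -
  [t 1, t \<i>], from da minus the diagonal derivatives of \<open>a\<close>. In the bracket of the
  values, [t 1, t \<i>] cancels, the mixed terms complete the derivatives to minus
  \<open>trb\<close>, and [a \<i>, -a 1] is the second copy of [a 1, a \<i>].\<close>

lemma d_beta: "ext_d Y (beta (\<lambda>y. s (\<phi> y))) y0 1 \<i> + lbr (beta (\<lambda>y. s (\<phi> y)) y0 1) (beta (\<lambda>y. s (\<phi> y)) y0 \<i>) =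
    2 *\<^sub>R lbr (a z0 1) (a z0 \<i>) - trb"
proof -
  let ?l = "\<lambda>w z. t z w + a z (\<i> * w)"
  have F: "FD (\<lambda>z. beta (\<lambda>y. s (\<phi> y)) (chart_inv c z) (chart_vec Y c z w)) z0 v = FD (\<lambda>z. t z w) z0 v + FD (\<lambda>z. a z (\<i> * w)) z0 v" for w v
  proof -
    have "FD (\<lambda>z. beta (\<lambda>y. s (\<phi> y)) (chart_inv c z) (chart_vec Y c z w)) z0 = FD (?l w) z0"
      by (rule FD_cong_open[OF oOm z0(1) beta_in_chart])
    then show ?thesis
      by (simp add: FD_add[OF smooth_on_differentiable[OF smooth_t z0(1)] smooth_on_differentiable[OF smooth_a z0(1)]])
  qed
  have neg: "FD (\<lambda>z. a z (- 1)) z0 v = - FD (\<lambda>z. a z 1) z0 v" for v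
    using linear_neg[OF FD_family_linear[OF oOm z0(1) linear_a smooth_on_differentiable[OF smooth_a z0(1)]], of 1 v] .
  have "ext_d Y (beta (\<lambda>y. s (\<phi> y))) y0 1 \<i> =
      (FD (\<lambda>z. t z \<i>) z0 1 - FD (\<lambda>z. t z 1) z0 \<i>) - (FD (\<lambda>z. a z 1) z0 1 + FD (\<lambda>z. a z \<i>) z0 \<i>)"
    by (simp add: ext_d_def Let_def F neg)
  also have "FD (\<lambda>z. t z \<i>) z0 1 - FD (\<lambda>z. t z 1) z0 \<i> = lbr (a z0 1) (a z0 \<i>) - lbr (t z0 1) (t z0 \<i>)"
    by (rule d_t[OF z0(1)])
  finally have 1: "ext_d Y (beta (\<lambda>y. s (\<phi> y))) y0 1 \<i> = lbr (a z0 1) (a z0 \<i>) - lbr (t z0 1) (t z0 \<i>) -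
      (trb - lbr (t z0 1) (a z0 1) - lbr (t z0 \<i>) (a z0 \<i>))"
    by (simp add: trb_def b_def)
  have be: "beta (\<lambda>y. s (\<phi> y)) y0 w = t z0 w + a z0 (\<i> * w)" for w
    using beta_in_chart[OF z0(1), of w] by (simp add: z0 chart_vec_pref[OF Y y0])
  have m: "a z0 (- 1) = - a z0 1" by (rule linear_neg[OF linear_a[OF z0(1)]])
  have 2: "lbr (beta (\<lambda>y. s (\<phi> y)) y0 1) (beta (\<lambda>y. s (\<phi> y)) y0 \<i>) =
      lbr (t z0 1) (t z0 \<i>) - lbr (t z0 1) (a z0 1) - lbr (t z0 \<i>) (a z0 \<i>) + lbr (a z0 1) (a z0 \<i>)"
    unfolding be by (simp add: m lbr_simps) (use lbr_skew[of "a z0 \<i>"] in simp)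
  show ?thesis unfolding 1 2 by (simp add: scaleR_2)
qed

lemma bracket_E0: "E0 (bracketM X al (\<phi> y0) (tmap Y MM \<phi> y0 u) (tmap Y MM \<phi> y0 v)) = lbr (a z0 u) (a z0 v)"
proof -
  let ?x = "psi z0"
  note \<xi> = S_in[OF z0(4)]
  have pr: "tproj X (S ?x) (tmap eucl PP S ?x w) = w" for w using tproj_S[OF z0(4), of w] by (simp add: pref_vec)
  obtain w where w: "E0 w = lbr (a z0 u) (a z0 v)" using E_surj[OF z0(4)] by blast
  have "bracketM X al (proj X (S ?x)) (tproj X (S ?x) (tmap eucl PP S ?x (FD psi z0 u))) (tproj X (S ?x) (tmap eucl PP S ?x (FD psi z0 v))) =
      tproj X (S ?x) (tmap eucl PP S ?x w)"
    by (rule bracketM_eq[OF \<xi>]) (use w in \<open>simp add: E_def a_def\<close>)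
  then show ?thesis using w by (simp add: pr S_proj z0(4) pref_vec phi_y0)
qed

text \<open>Both sides of the mean curvature equation are alternating, so only the pair
  \<open>(1, \<i>)\<close> counts; there the factor \<open>cf\<close> of the volume form cancels the
  one in \<open>mean_curvature_E\<close>, and what is left is the vanishing of the right side of
  \<open>d_beta\<close>.\<close>

lemma mean_curvature_eq_iff:
  "(\<forall>u v. bracketM X al (\<phi> y0) (tmap Y MM \<phi> y0 u) (tmap Y MM \<phi> y0 v) =
      vol_form (ind \<phi> y0) u v *\<^sub>R mean_curvature Y MM gM \<phi> y0) \<longleftrightarrow>
   ext_d Y (beta (\<lambda>y. s (\<phi> y))) y0 1 \<i> + lbr (beta (\<lambda>y. s (\<phi> y)) y0 1) (beta (\<lambda>y. s (\<phi> y)) y0 \<i>) = 0"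
proof -
  have vol: "vol_form (ind \<phi> y0) u v = cf z0 * Im (cnj u * v)" for u v
    by (rule vol_form_conformal[OF pb_metric_y0 cf_pos[OF z0(1)]])
  note lE = linear_E[OF z0(4)]
  have bl: "bilinear (\<lambda>u v. lbr (a z0 u) (a z0 v))"
    unfolding bilinear_def using linear_a[OF z0(1)] by (auto intro!: linearI simp: linear_add linear_cmul lbr_simps)
  have br: "lbr (a z0 u) (a z0 v) = Im (cnj u * v) *\<^sub>R lbr (a z0 1) (a z0 \<i>)" for u v
    using bilinear_complex[OF bl, of u v] lbr_skew[of "a z0 \<i>" "a z0 1"] by (simp add: algebra_simps)
  have l: "cf z0 > 0" by (rule cf_pos[OF z0(1)])
  have "bracketM X al (\<phi> y0) (tmap Y MM \<phi> y0 u) (tmap Y MM \<phi> y0 v) =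
      vol_form (ind \<phi> y0) u v *\<^sub>R mean_curvature Y MM gM \<phi> y0 \<longleftrightarrow>
      Im (cnj u * v) *\<^sub>R lbr (a z0 1) (a z0 \<i>) = Im (cnj u * v) *\<^sub>R ((1/2) *\<^sub>R trb)" for u v
  proof -
    have "bracketM X al (\<phi> y0) (tmap Y MM \<phi> y0 u) (tmap Y MM \<phi> y0 v) =
        vol_form (ind \<phi> y0) u v *\<^sub>R mean_curvature Y MM gM \<phi> y0 \<longleftrightarrow>
      E0 (bracketM X al (\<phi> y0) (tmap Y MM \<phi> y0 u) (tmap Y MM \<phi> y0 v)) =
        E0 (vol_form (ind \<phi> y0) u v *\<^sub>R mean_curvature Y MM gM \<phi> y0)"
      using E_inj[OF z0(4)] by metis
    then show ?thesis
      unfolding bracket_E0 vol linear_cmul[OF lE] mean_curvature_E br[of u v] using l by simp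
  qed
  then have "(\<forall>u v. bracketM X al (\<phi> y0) (tmap Y MM \<phi> y0 u) (tmap Y MM \<phi> y0 v) =
      vol_form (ind \<phi> y0) u v *\<^sub>R mean_curvature Y MM gM \<phi> y0) \<longleftrightarrow>
    (\<forall>u v. Im (cnj u * v) *\<^sub>R lbr (a z0 1) (a z0 \<i>) = Im (cnj u * v) *\<^sub>R ((1/2) *\<^sub>R trb))" by simp
  also have "\<dots> \<longleftrightarrow> lbr (a z0 1) (a z0 \<i>) = (1/2) *\<^sub>R trb"
  proof
    assume "\<forall>u v. Im (cnj u * v) *\<^sub>R lbr (a z0 1) (a z0 \<i>) = Im (cnj u * v) *\<^sub>R ((1/2) *\<^sub>R trb)"
    from this[rule_format, of 1 \<i>] show "lbr (a z0 1) (a z0 \<i>) = (1/2) *\<^sub>R trb" by simp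
  qed simp
  also have "\<dots> \<longleftrightarrow> 2 *\<^sub>R lbr (a z0 1) (a z0 \<i>) - trb = 0"
  proof -
    have "2 *\<^sub>R lbr (a z0 1) (a z0 \<i>) - trb = 2 *\<^sub>R (lbr (a z0 1) (a z0 \<i>) - (1/2) *\<^sub>R trb)"
      by (simp add: scaleR_diff_right)
    then show ?thesis by simp
  qed
  finally show ?thesis unfolding d_beta .
qed

end

section \<open>Local and global holomorphic lifts\<close>

lemma zero_tmap_locally_constant:
  assumes A: "manifold A" and B: "manifold B" and f: "smooth_map A B U f"
    and 0: "\<And>p v. p \<in> U \<Longrightarrow> tmap A B f p v = 0" and p: "p \<in> U"
  shows "\<exists>V. p \<in> V \<and> open_in A V \<and> V \<subseteq> U \<and> (\<forall>q\<in>V. f q = f p)"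
proof -
  let ?c = "pref A p" and ?d = "pref B (f p)"
  note c = pref_in[OF smap_dom[OF f p]] and d = pref_in[OF smap_in[OF f p]]
  obtain V where V: "p \<in> V" "open_in A V" "V \<subseteq> U" "V \<subseteq> fst ?c" "f ` V \<subseteq> fst ?d"
    "open (snd ?c ` V)" "smooth_on (snd ?c ` V) (\<lambda>x. snd ?d (f (chart_inv ?c x)))"
    using smap_chartwise[OF A B f p c d] .
  let ?f = "\<lambda>x. snd ?d (f (chart_inv ?c x))" and ?x = "snd ?c p"
  obtain r where r: "r > 0" "ball ?x r \<subseteq> snd ?c ` V"
    using V(1,6) open_contains_ball by (metis image_eqI)
  have im: "chart_inv ?c x \<in> V" "snd ?c (chart_inv ?c x) = x" if "x \<in> snd ?c ` V" for x
    using that V(4) by (auto simp: chart_inv_snd[OF A c(1)] subset_iff)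
  have "FD ?f x w = 0" if x: "x \<in> snd ?c ` V" for x w
  proof -
    have x': "x \<in> snd ?c ` (U \<inter> fst ?c \<inter> f -` fst ?d)" using im[OF x] V by (intro image_eqI[of _ _ "chart_inv ?c x"]) auto
    have i: "snd ?d (f (chart_inv ?c x)) \<in> snd ?d ` fst ?d" using im[OF x] V(5) by auto
    have "chart_vec B ?d (?f x) (FD ?f x w) = 0"
      using tmap_in_charts(1)[OF A B f c(1) d(1) x', of w] 0 im[OF x] V(3) by (metis subsetD)
    then have "chart_coord B ?d (chart_inv ?d (?f x)) 0 = FD ?f x w"
      using chart_coord_vec[OF B d(1) i, of "FD ?f x w"] by simp
    then show ?thesis using linear_0[OF linear_chart_coord[OF B d(1) chart_inv_in[OF B d(1) i]]] by simp
  qed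
  then have D: "(?f has_derivative (\<lambda>w. 0)) (at x within ball ?x r)" if "x \<in> ball ?x r" for x
    using smooth_on_has_FD[OF V(7)] r(2) that has_derivative_at_withinI by (metis (no_types, lifting) ext subsetD)
  obtain k where k: "\<And>x. x \<in> ball ?x r \<Longrightarrow> ?f x = k"
    using has_derivative_zero_constant[OF convex_ball D] by blast
  let ?V = "{q \<in> fst ?c. snd ?c q \<in> ball ?x r}"
  have sV: "?V \<subseteq> V"
  proof
    fix q assume "q \<in> ?V"
    then show "q \<in> V" using im(1)[of "snd ?c q"] r(2) by (auto simp: chart_inv_snd[OF A c(1)])
  qed
  have "f q = f p" if q: "q \<in> ?V" for q
  proof -
    have "snd ?d (f q) = snd ?d (f p)"
      using k[of "snd ?c q"] k[of ?x] q r(1) c by (simp add: chart_inv_snd[OF A c(1)])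
    then have "chart_inv ?d (snd ?d (f q)) = chart_inv ?d (snd ?d (f p))" by simp
    moreover have "f q \<in> fst ?d" using sV q V(5) by blast
    ultimately show ?thesis using d(2) by (simp add: chart_inv_snd[OF B d(1)])
  qed
  then have "\<forall>q\<in>?V. f q = f p" by blast
  moreover have "open_in A ?V" by (rule smap_vimage[OF smap_chart[OF A c(1)]]) simp
  moreover have "p \<in> ?V" "?V \<subseteq> U" using sV V(3) c r(1) by auto
  ultimately show ?thesis by (intro exI[of _ ?V] conjI)
qed

lemma manifold_locally_path_connected:
  assumes A: "manifold A" and U: "open_in A U" and p: "p \<in> U"
  shows "\<exists>V. open_in A V \<and> p \<in> V \<and> V \<subseteq> U \<and> path_connected V"
proof -
  let ?c = "pref A p"
  note c = pref_in[OF open_in_mem[OF U p]]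
  have o: "open (snd ?c ` (U \<inter> fst ?c))" by (rule open_chart_image[OF A c(1) U])
  obtain r where r: "r > 0" "ball (snd ?c p) r \<subseteq> snd ?c ` (U \<inter> fst ?c)"
    using o p c(2) open_contains_ball by (metis IntI image_eqI)
  let ?B = "ball (snd ?c p) r"
  have im: "chart_inv ?c x \<in> U \<inter> fst ?c" "snd ?c (chart_inv ?c x) = x" if "x \<in> ?B" for x
    using subsetD[OF r(2) that] by (auto simp: chart_inv_snd[OF A c(1)])
  have eq: "chart_inv ?c ` ?B = {q \<in> fst ?c. snd ?c q \<in> ?B}"
  proof (intro Set.set_eqI iffI)
    fix q assume "q \<in> {q \<in> fst ?c. snd ?c q \<in> ?B}"
    then show "q \<in> chart_inv ?c ` ?B" by (intro image_eqI[of _ _ "snd ?c q"]) (auto simp: chart_inv_snd[OF A c(1)])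
  qed (use im in auto)
  have "path_connected (chart_inv ?c ` ?B)"
    by (rule path_connected_continuous_image[OF continuous_on_subset[OF continuous_chart_inv[OF A c(1)]]])
      (use r(2) in \<open>auto simp: convex_imp_path_connected\<close>)
  moreover have "open_in A (chart_inv ?c ` ?B)"
    unfolding eq by (rule smap_vimage[OF smap_chart[OF A c(1)]]) simp
  moreover have "p \<in> chart_inv ?c ` ?B" unfolding eq using r(1) c by simp
  moreover have "chart_inv ?c ` ?B \<subseteq> U" using im(1) by blast
  ultimately show ?thesis by blast
qed

text \<open>The Maurer-Cartan equation in a chart; it supplies the group part of the integrability
  condition in \<open>local_lift\<close>.\<close>

lemma (in lie) rho_structure:
  assumes c: "c \<in> H" and x: "x \<in> snd c ` fst c"
  shows "FD (\<lambda>x. rho c x v) x u - FD (\<lambda>x. rho c x u) x v = - lbr (rho c x u) (rho c x v)"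
proof -
  have im: "chart_inv c ` snd c ` fst c \<subseteq> points H"
    using chart_inv_in[OF H c] chart_subset[OF H c] by auto
  have "ext_d eucl (\<lambda>x w. mc (chart_inv c x) (tmap eucl H (chart_inv c) x w)) x u v =
      ext_d H mc (chart_inv c x) (tmap eucl H (chart_inv c) x u) (tmap eucl H (chart_inv c) x v)"
    by (rule ext_d_pull[OF mf_eucl H smap_chart_inv[OF H c] mc_form im x])
  moreover have "chart_inv c x \<in> points H" using im x by blast
  ultimately show ?thesis by (simp add: ext_d_eucl rho_def chart_vec_tmap mc_structure)
qed

section \<open>Holomorphic lifts and their differences\<close>

context geom_surface
begin

lemma beta_cong:
  assumes "open_in Y U" "y \<in> U" "\<And>z. z \<in> U \<Longrightarrow> f z = f' z"
  shows "beta f y v = beta f' y v"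
  using tmap_cong[OF Y P assms] assms(3)[OF assms(2)] by (simp add: beta_def)

text \<open>Holomorphy is expressed by \<open>beta\<close>, and values outside \<open>U\<close> are
  left arbitrary, so that lifts can be restricted and compared freely.\<close>

definition lift_on where
  "lift_on \<phi> U f \<longleftrightarrow> smooth_map Y PP U f \<and> (\<forall>y\<in>U. proj X (f y) = \<phi> y) \<and> (\<forall>y\<in>U. \<forall>v. beta f y v = 0)"

lemma lift_on_iff: "lift_on \<phi> U f \<longleftrightarrow> holomorphic_map Y X A al U f \<and> (\<forall>y\<in>U. proj X (f y) = \<phi> y)"
  using holomorphic_iff_beta[of U f] by (auto simp: lift_on_def holomorphic_map_def)

lemma lift_onD: "lift_on \<phi> U f \<Longrightarrow> smooth_map Y PP U f" "lift_on \<phi> U f \<Longrightarrow> y \<in> U \<Longrightarrow> proj X (f y) = \<phi> y"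
  "lift_on \<phi> U f \<Longrightarrow> y \<in> U \<Longrightarrow> beta f y v = 0"
  by (auto simp: lift_on_def)

lemma lift_on_cong:
  assumes "lift_on \<phi> U f" "\<And>y. y \<in> U \<Longrightarrow> f y = f' y"
  shows "lift_on \<phi> U f'"
  using assms beta_cong[OF smap_open[OF lift_onD(1)[OF assms(1)]] _ assms(2)] smap_cong[OF Y P lift_onD(1)[OF assms(1)] assms(2)]
  by (simp add: lift_on_def)

lemma lift_on_subset:
  assumes "lift_on \<phi> U f" "open_in Y V" "V \<subseteq> U"
  shows "lift_on \<phi> V f"
  using assms smap_subset[OF Y P lift_onD(1)[OF assms(1)] assms(2,3)] by (auto simp: lift_on_def)

lemma lift_on_translate:
  assumes f: "lift_on \<phi> U f" and a: "a \<in> points HH"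
  shows "lift_on \<phi> U (\<lambda>y. act X (f y) a)"
proof -
  note sf = lift_onD(1)[OF f]
  have b: "smooth_map Y HH U (\<lambda>_. a)" by (rule smap_const[OF Y H smap_open[OF sf] a])
  have "beta (\<lambda>y. act X (f y) a) y v = 0" if y: "y \<in> U" for y v
    using beta_gauge[OF sf b y, of v] lift_onD(3)[OF f y] tmap_const[OF Y H smap_dom[OF sf y]]
    by (simp add: linear_0[OF linear_mc[OF a]] linear_0[OF linear_Ad[OF inv_in[OF a]]])
  then show ?thesis
    using smooth_act[OF Y sf b] lift_onD(2)[OF f] smap_in[OF sf] a by (auto simp: lift_on_def)
qed

text \<open>With \<open>beta\<close> zero for both lifts, \<open>beta_gauge\<close> makes
  \<open>mc\<close> vanish on the derivative of the group element \<open>b\<close> relating them, so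
  \<open>b\<close> is locally constant.\<close>

lemma lift_on_difference:
  assumes f: "lift_on \<phi> U f" and f': "lift_on \<phi> U f'" and y: "y \<in> U"
  shows "\<exists>V. y \<in> V \<and> open_in Y V \<and> V \<subseteq> U \<and> (\<forall>z\<in>V. f' z = act X (f z) (translator X (f y) (f' y)))"
proof -
  note sf = lift_onD(1)[OF f] and sf' = lift_onD(1)[OF f']
  define b where "b z = translator X (f z) (f' z)" for z
  have sb: "smooth_map Y HH U b" unfolding b_def
    by (rule smooth_translator[OF Y sf sf']) (simp add: lift_onD(2)[OF f] lift_onD(2)[OF f'])
  have fb: "f' z = act X (f z) (b z)" if "z \<in> U" for z
    unfolding b_def using act_translator[OF smap_in[OF sf that] smap_in[OF sf' that]] that
    by (simp add: lift_onD(2)[OF f] lift_onD(2)[OF f'])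
  have "tmap Y HH b z v = 0" if z: "z \<in> U" for z v
  proof -
    have bz: "b z \<in> points HH" by (rule smap_in[OF sb z])
    have "mc (b z) (tmap Y HH b z v) = 0"
      using beta_gauge[OF sf sb z, of v] beta_cong[where f = f' and f' = "\<lambda>z. act X (f z) (b z)" and v = v, OF smap_open[OF sf] z fb] lift_onD(3)[OF f z] lift_onD(3)[OF f' z]
      by (simp add: linear_0[OF linear_Ad[OF inv_in[OF bz]]])
    then show ?thesis using mc_inj[OF bz, of "tmap Y HH b z v" 0] by (simp add: linear_0[OF linear_mc[OF bz]])
  qed
  from zero_tmap_locally_constant[OF Y H sb this y] obtain V where
    V: "y \<in> V" "open_in Y V" "V \<subseteq> U" "\<forall>q\<in>V. b q = b y" by blast
  have "f' z = act X (f z) (b y)" if z: "z \<in> V" for z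
    using fb[OF subsetD[OF V(3) z]] bspec[OF V(4) z] by simp
  then show ?thesis using V(1-3) unfolding b_def by (intro exI[of _ V] conjI ballI)
qed

end

section \<open>Existence of lifts from the mean curvature equation\<close>

locale mean_curvature_map = conformal_map +
  assumes mean_curvature: "mean_curvature_eq Y X al g \<phi>"
begin

text \<open>The mean curvature equation gives the case of the pair \<open>(1, \<i>)\<close>. The
  difference of the two sides is an alternating bilinear map on a plane, so this case decides all
  others.\<close>

lemma flat_beta:
  assumes s: "local_section X W s" and y: "y \<in> points Y" "\<phi> y \<in> W"
  shows "ext_d Y (beta (\<lambda>y. s (\<phi> y))) y u v = - lbr (beta (\<lambda>y. s (\<phi> y)) y u) (beta (\<lambda>y. s (\<phi> y)) y v)"
proof -
  interpret gauge X A al g Y \<phi> y W s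
    by (intro gauge.intro gauge_axioms.intro conformal_map_axioms y s)
  let ?be = "beta (\<lambda>y. s (\<phi> y))"
  let ?B = "\<lambda>u v. ext_d Y ?be y u v + lbr (?be y u) (?be y v)"
  have yU: "y \<in> {y \<in> points Y. \<phi> y \<in> W}" using y by simp
  note be = beta_form[OF section_lift_smooth]
  have lb: "linear (?be y)" by (rule form_on_linear[OF be yU])
  have be2: "bilinear (ext_d Y ?be y)" by (rule ext_d_bilinear[OF Y be yU])
  have bl: "bilinear ?B"
    unfolding bilinear_def
    by (auto intro!: linearI simp: bilinear_ladd[OF be2] bilinear_radd[OF be2] bilinear_lmul[OF be2] bilinear_rmul[OF be2]
        linear_add[OF lb] linear_cmul[OF lb] lbr_simps algebra_simps)
  have alt: "?B w w = 0" for w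
  proof -
    have "ext_d Y ?be y w w = 0" by (simp add: ext_d_def Let_def)
    then show ?thesis by simp
  qed
  have 1: "?B 1 \<i> = 0"
    using mean_curvature_eq_iff mean_curvature y(1) unfolding mean_curvature_eq_def by blast
  moreover have "?B \<i> 1 = 0"
    using 1 ext_d_skew[OF Y, of ?be y \<i> 1] lbr_skew[of "?be y \<i>" "?be y 1"] by (simp add: neg_eq_iff_add_eq_0)
  ultimately have "?B u v = 0" using bilinear_complex[OF bl, of u v] alt by simp
  then show ?thesis by (simp add: eq_neg_iff_add_eq_0)
qed

text \<open>For a section \<sigma> through \<xi>0, the gauge rule makes \<sigma> b^-1 a lift as soon
  as \<open>mc\<close> of the derivative of \<open>b\<close> equals \<open>beta \<sigma>\<close>. In
  the chart \<open>kappa\<close> this is a total differential equation with right side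
  \<open>F\<close>, to which \<open>frobenius\<close> applies.\<close>

lemma local_lift:
  assumes y0: "y0 \<in> points Y" and \<xi>0: "\<xi>0 \<in> points PP" "proj X \<xi>0 = \<phi> y0"
  shows "\<exists>U f. y0 \<in> U \<and> lift_on \<phi> U f \<and> f y0 = \<xi>0"
proof -
  obtain W s where W: "\<phi> y0 \<in> W" and s: "local_section X W s" and sx: "s (\<phi> y0) = \<xi>0"
    using local_section_through[OF \<xi>0(1)] \<xi>0(2) by metis
  define \<sigma> where "\<sigma> y = s (\<phi> y)" for y
  let ?c = "pref Y y0"
  note c = pref_in[OF y0]
  let ?D = "{y \<in> points Y. \<phi> y \<in> W}"
  have oW: "open_in MM W" by (rule smap_open[OF local_section_smooth[OF s]])
  have oU0: "open_in Y ?D" by (rule smap_vimage[OF phi oW])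
  have s\<sigma>: "smooth_map Y PP ?D \<sigma>" unfolding \<sigma>_def
    by (rule smooth_compose[OF Y M P smap_subset[OF Y M phi oU0] local_section_smooth[OF s]]) auto
  note be = beta_form[OF s\<sigma>]
  let ?O = "snd ?c ` (?D \<inter> fst ?c)"
  have oO: "open ?O" by (rule open_chart_image[OF Y c(1) oU0])
  have ci: "chart_inv ?c z \<in> ?D" "chart_inv ?c z \<in> fst ?c" "snd ?c (chart_inv ?c z) = z" if "z \<in> ?O" for z
    using that by (auto simp: chart_inv_snd[OF Y c(1)])
  define B where "B z w = beta \<sigma> (chart_inv ?c z) (tmap eucl Y (chart_inv ?c) z w)" for z w
  have sc: "smooth_map eucl Y ?O (chart_inv ?c)"
    by (rule smap_subset[OF mf_eucl Y smap_chart_inv[OF Y c(1)]]) (use oO in auto)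
  have im: "chart_inv ?c ` ?O \<subseteq> ?D" using ci by blast
  have Bf: "form_on eucl ?O B" unfolding B_def by (rule form_on_pull[OF mf_eucl Y sc be im])
  then have lB: "linear (B z)" if z: "z \<in> ?O" for z using Bf z unfolding form_on_eucl by blast
  have sB: "smooth_on ?O (\<lambda>z. B z w)" for w using Bf by (simp add: form_on_eucl)
  have dB: "FD (\<lambda>z. B z w) z v - FD (\<lambda>z. B z v) z w = - lbr (B z v) (B z w)" if z: "z \<in> ?O" for z v w
  proof -
    have "ext_d eucl B z v w = ext_d Y (beta \<sigma>) (chart_inv ?c z) (tmap eucl Y (chart_inv ?c) z v) (tmap eucl Y (chart_inv ?c) z w)"
      unfolding B_def by (rule ext_d_pull[OF mf_eucl Y sc be im z])
    also have "\<dots> = - lbr (B z v) (B z w)"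
      unfolding B_def \<sigma>_def by (rule flat_beta[OF s]) (use ci(1)[OF z] in auto)
    finally show ?thesis by (simp add: ext_d_eucl)
  qed
  let ?K = "snd kappa ` fst kappa"
  interpret inv: inverse_family ?K "rho kappa" "lam kappa" by (rule inverse_family_rho[OF kappa(1)])
  \<comment> \<open>The requirement that \<open>rho\<close>, applied to the derivative of the
    unknown, be \<open>B\<close>, solved for the derivative by the inverse \<open>lam\<close> of
    \<open>rho\<close>.\<close>
  define F where "F q w = lam kappa (snd q) (B (fst q) w)" for q w
  have oOK: "open (?O \<times> ?K)" by (intro open_Times oO inv.S)
  have linF: "linear (F q)" if "q \<in> ?O \<times> ?K" for q
    unfolding F_def by (rule linear_compose[OF lB inv.M_linear, unfolded o_def]) (use that in auto)
  have sB': "smooth_on (?O \<times> ?K) (\<lambda>q. B (fst q) w)" for w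
    by (rule smooth_on_compose[OF oOK oO smooth_on_fst[OF oOK] sB]) auto
  have srho: "smooth_on (?O \<times> ?K) (\<lambda>q. rho kappa (snd q) w)" and slam: "smooth_on (?O \<times> ?K) (\<lambda>q. lam kappa (snd q) w)" for w
    by (rule smooth_on_compose[OF oOK inv.S smooth_on_snd[OF oOK] inv.sm], auto,
        rule smooth_on_compose[OF oOK inv.S smooth_on_snd[OF oOK] inv.smooth_inverse], auto)
  have sF: "smooth_on (?O \<times> ?K) (\<lambda>q. F q w)" for w
    unfolding F_def
    by (rule smooth_on_apply[where L = "\<lambda>q. lam kappa (snd q)", OF oOK inv.M_linear slam sB']) auto
  \<comment> \<open>Differentiate \<open>rho kappa (snd q) (F q w) = B (fst q) w\<close>. After
    antisymmetrization the derivatives of \<open>B\<close> give a bracket by flatness, those of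
    \<open>rho\<close> the same bracket by the Maurer-Cartan equation; injectivity of
    \<open>rho\<close> finishes.\<close>
  have integ: "FD (\<lambda>q. F q w) q (v, F q v) = FD (\<lambda>q. F q v) q (w, F q w)" if q: "q \<in> ?O \<times> ?K" for q v w
  proof -
    obtain z x where zx: "q = (z, x)" "z \<in> ?O" "x \<in> ?K" using q by auto
    have rF: "rho kappa (snd q) (F q w) = B (fst q) w" if "q \<in> ?O \<times> ?K" for q w
      unfolding F_def by (rule inv.L_M) (use that in auto)
    have key: "rho kappa x (FD (\<lambda>q. F q w) q (v, F q v)) = FD (\<lambda>z. B z w) z v - FD (\<lambda>x. rho kappa x (F q w)) x (F q v)" for v w
    proof -
      have "FD (\<lambda>q. rho kappa (snd q) (F q w)) q (v, F q v) =
          FD (\<lambda>p. rho kappa (snd p) (F q w)) q (v, F q v) + rho kappa (snd q) (FD (\<lambda>q. F q w) q (v, F q v))"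
        by (rule FD_apply[where L = "\<lambda>q. rho kappa (snd q)", OF oOK q _ smooth_on_differentiable[OF srho q] smooth_on_differentiable[OF sF q]])
          (rule inv.lin, auto)
      moreover have "FD (\<lambda>p. rho kappa (snd p) (F q w)) q (v, F q v) = FD (\<lambda>x. rho kappa x (F q w)) x (F q v)"
      proof -
        have "(\<lambda>x. rho kappa x (F q w)) differentiable (at (snd q))"
          by (rule smooth_on_differentiable[OF inv.sm]) (simp add: zx)
        from FD_compose[OF bounded_linear_imp_differentiable[OF bounded_linear_snd] this, of "(v, F q v)"]
        show ?thesis using FD_eqI[OF bounded_linear_imp_has_derivative[OF bounded_linear_snd], of q] by (simp add: zx(1))
      qed
      moreover have "FD (\<lambda>q. rho kappa (snd q) (F q w)) q (v, F q v) = FD (\<lambda>z. B z w) z v"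
      proof -
        have "FD (\<lambda>q. rho kappa (snd q) (F q w)) q = FD (\<lambda>q. B (fst q) w) q"
          by (rule FD_cong_open[OF oOK q rF])
        moreover have "(\<lambda>z. B z w) differentiable (at (fst q))"
          by (rule smooth_on_differentiable[OF sB]) (simp only: zx fst_conv)
        from FD_compose[OF bounded_linear_imp_differentiable[OF bounded_linear_fst] this, of "(v, F q v)"]
        have "FD (\<lambda>q. B (fst q) w) q (v, F q v) = FD (\<lambda>z. B z w) z v"
          using FD_eqI[OF bounded_linear_imp_has_derivative[OF bounded_linear_fst], of q] by (simp add: zx(1))
        ultimately show ?thesis by simp
      qed
      ultimately show ?thesis by (simp add: zx(1) eq_diff_eq add.commute)
    qed
    have r: "rho kappa x (F q w) = B z w" for w using rF[OF q] by (simp add: zx(1))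
    have "rho kappa x (FD (\<lambda>q. F q w) q (v, F q v)) - rho kappa x (FD (\<lambda>q. F q v) q (w, F q w)) =
        (FD (\<lambda>z. B z w) z v - FD (\<lambda>z. B z v) z w) - (FD (\<lambda>x. rho kappa x (F q w)) x (F q v) - FD (\<lambda>x. rho kappa x (F q v)) x (F q w))"
      unfolding key by simp
    also have "\<dots> = 0"
      unfolding dB[OF zx(2)] rho_structure[OF kappa(1) zx(3)] r by simp
    finally have "rho kappa x (FD (\<lambda>q. F q w) q (v, F q v)) = rho kappa x (FD (\<lambda>q. F q v) q (w, F q w))" by simp
    then show ?thesis by (metis inv.M_L[OF zx(3)])
  qed
  \<comment> \<open>The initial value is the unit, so that the lift takes the value \<xi>0 at
    \<open>y0\<close>.\<close>
  let ?zz = "snd ?c y0" and ?e = "pref_pt HH one"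
  have z0: "?zz \<in> ?O" using y0 W c by auto
  obtain V u where V: "open V" "?zz \<in> V" "V \<subseteq> ?O" "u ` V \<subseteq> ?K" "smooth_on V u" "u ?zz = ?e"
      "\<forall>z\<in>V. \<forall>v. FD u z v = F (z, u z) v"
    using frobenius[OF oO inv.S linF sF integ z0 pref_pt_one(1)] by blast
  let ?U = "{y \<in> fst ?c. snd ?c y \<in> V}"
  have oU: "open_in Y ?U" by (rule smap_vimage[OF smap_chart[OF Y c(1)]]) (simp add: V)
  have U: "y \<in> ?D" "y \<in> fst ?c" "snd ?c y \<in> V" "snd ?c y \<in> ?O" "chart_inv ?c (snd ?c y) = y" "u (snd ?c y) \<in> ?K" if y: "y \<in> ?U" for y
  proof -
    show "y \<in> fst ?c" "snd ?c y \<in> V" "snd ?c y \<in> ?O" "chart_inv ?c (snd ?c y) = y" "u (snd ?c y) \<in> ?K"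
      using y V(3,4) by (auto simp: chart_inv_snd[OF Y c(1)])
    then show "y \<in> ?D" using ci(1)[of "snd ?c y"] by simp
  qed
  define b where "b y = chart_inv kappa (u (snd ?c y))" for y
  have scU: "smooth_map Y eucl ?U (snd ?c)" by (rule smap_subset[OF Y mf_eucl smap_chart[OF Y c(1)] oU]) auto
  have su: "smooth_map eucl eucl V u" using V by (simp add: smap_eucl_eucl)
  have suc: "smooth_map Y eucl ?U (\<lambda>y. u (snd ?c y))"
    by (rule smooth_compose[OF Y mf_eucl mf_eucl scU su]) auto
  have imK: "(\<lambda>y. u (snd ?c y)) ` ?U \<subseteq> ?K" using U(6) by blast
  have sb: "smooth_map Y HH ?U b" unfolding b_def
    by (rule smooth_compose[OF Y mf_eucl H suc smap_chart_inv[OF H kappa(1)] imK])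
  have mcb: "mc (b y) (tmap Y HH b y v) = beta \<sigma> y v" if y: "y \<in> ?U" for y v
  proof -
    let ?z = "snd ?c y"
    have "tmap Y HH b y v = tmap eucl HH (chart_inv kappa) (u ?z) (tmap Y eucl (\<lambda>y. u (snd ?c y)) y v)"
      unfolding b_def by (rule tmap_compose[OF Y mf_eucl H suc smap_chart_inv[OF H kappa(1)] imK y])
    also have "tmap Y eucl (\<lambda>y. u (snd ?c y)) y v = tmap eucl eucl u ?z (tmap Y eucl (snd ?c) y v)"
      by (rule tmap_compose[OF Y mf_eucl mf_eucl scU su _ y]) auto
    also have "\<dots> = F (?z, u ?z) (chart_coord Y ?c y v)"
      using V(7) U(3)[OF y] by (simp add: chart_coord_tmap)
    finally have "mc (b y) (tmap Y HH b y v) = rho kappa (u ?z) (F (?z, u ?z) (chart_coord Y ?c y v))"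
      unfolding rho_def b_def[of y] chart_vec_tmap by (rule arg_cong)
    also have "\<dots> = B ?z (chart_coord Y ?c y v)" using inv.L_M[OF U(6)[OF y]] by (simp add: F_def)
    also have "\<dots> = beta \<sigma> y v"
      unfolding B_def U(5)[OF y] chart_vec_tmap[symmetric] chart_vec_coord[OF Y c(1) U(2)[OF y]] ..
    finally show ?thesis .
  qed
  \<comment> \<open>The inverse puts the gauge change into the form \<sigma> = f b, where
    \<open>beta_gauge\<close> can be solved for \<open>beta f\<close>.\<close>
  define f where "f y = act X (\<sigma> y) (iv (b y))" for y
  have "?U \<subseteq> ?D" using U(1) by blast
  then have s\<sigma>U: "smooth_map Y PP ?U \<sigma>" by (rule smap_subset[OF Y P s\<sigma> oU])
  have sf: "smooth_map Y PP ?U f" unfolding f_def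
    by (intro smooth_act[OF Y s\<sigma>U] smooth_inv[OF Y sb])
  have fb: "act X (f y) (b y) = \<sigma> y" if y: "y \<in> ?U" for y
    using smap_in[OF s\<sigma>U y] smap_in[OF sb y] by (simp add: f_def act_mult[symmetric])
  have "beta f y v = 0" if y: "y \<in> ?U" for y v
  proof -
    have by': "b y \<in> points HH" by (rule smap_in[OF sb y])
    have "AD (iv (b y)) (beta f y v) + mc (b y) (tmap Y HH b y v) = beta \<sigma> y v"
      using beta_gauge[OF sf sb y, of v] beta_cong[where f = "\<lambda>y. act X (f y) (b y)" and f' = \<sigma> and v = v, OF oU y fb] by simp
    then have "AD (iv (b y)) (beta f y v) = 0" by (simp add: mcb[OF y])
    then have "AD (b y) (AD (iv (b y)) (beta f y v)) = 0" by (simp add: linear_0[OF linear_Ad[OF by']])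
    then show ?thesis by (simp add: by')
  qed
  moreover have "proj X (f y) = \<phi> y" if y: "y \<in> ?U" for y
    using smap_in[OF s\<sigma>U y] smap_in[OF sb y] local_section_proj[OF s, of "\<phi> y"] U(1)[OF y]
    by (simp add: f_def \<sigma>_def)
  ultimately have "lift_on \<phi> ?U f" using sf by (simp add: lift_on_def)
  moreover have "b y0 = one" by (simp add: b_def V(6) pref_pt_one)
  then have "f y0 = \<xi>0" by (simp add: f_def \<sigma>_def sx inv_one \<xi>0)
  moreover have "y0 \<in> ?U" using c V(2) by simp
  ultimately show ?thesis by (intro exI conjI)
qed

text \<open>By \<open>lift_on_difference\<close> two lifts differ near a point by a constant group
  element, so they agree or disagree on a whole neighbourhood; the right translates of one local
  lift fill all fibres over its domain.\<close>

lemma section_cover_lifts: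
  "section_cover (points Y) {(U, f). lift_on \<phi> U f} (\<lambda>y. {\<xi> \<in> points PP. proj X \<xi> = \<phi> y})"
proof (rule section_cover.intro)
  let ?I = "{(U, f). lift_on \<phi> U f}"
  show "openin (top_of_set (points Y)) U" if "(U, f) \<in> ?I" for U f
    using smap_open[OF lift_onD(1)[of \<phi> U f]] that by (simp add: open_in_def)
  show "f y \<in> {\<xi> \<in> points PP. proj X \<xi> = \<phi> y}" if "(U, f) \<in> ?I" "y \<in> U" for U f y
    using that lift_onD(2)[of \<phi> U f y] smap_in[OF lift_onD(1)[of \<phi> U f]] by simp
  have *: "\<exists>W. openin (top_of_set (points Y)) W \<and> y \<in> W \<and> W \<subseteq> U \<inter> V \<and> (\<forall>z\<in>W. f z = h z \<longleftrightarrow> f y = h y)"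
    if I: "(U, f) \<in> ?I" "(V, h) \<in> ?I" and y: "y \<in> U" "y \<in> V" for U f V h y
  proof -
    have l: "lift_on \<phi> U f" "lift_on \<phi> V h" using I by auto
    have o: "open_in Y (U \<inter> V)" by (intro open_in_Int smap_open[OF lift_onD(1)[OF l(1)]] smap_open[OF lift_onD(1)[OF l(2)]])
    have l': "lift_on \<phi> (U \<inter> V) f" "lift_on \<phi> (U \<inter> V) h" using lift_on_subset l o by auto
    let ?a = "translator X (f y) (h y)"
    obtain W where W: "y \<in> W" "open_in Y W" "W \<subseteq> U \<inter> V" "\<forall>z\<in>W. h z = act X (f z) ?a"
      using lift_on_difference[OF l'] y by blast
    have p: "f z \<in> points PP" if "z \<in> W" for z using smap_in[OF lift_onD(1)[OF l'(1)]] that W(3) by blast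
    have q: "h y \<in> points PP" using smap_in[OF lift_onD(1)[OF l(2)]] y by blast
    have a: "?a \<in> points HH" using translator_in[OF p[OF W(1)] q] lift_onD(2)[OF l(1) y(1)] lift_onD(2)[OF l(2) y(2)] by simp
    have "f z = h z \<longleftrightarrow> ?a = one" if "z \<in> W" for z
      using W(4) that act_free[OF p[OF that] a one_in] act_one[OF p[OF that]] by metis
    then have "\<forall>z\<in>W. f z = h z \<longleftrightarrow> f y = h y" using W(1) by blast
    then show ?thesis using W(1-3) unfolding open_in_def by blast
  qed
  show "\<exists>W. openin (top_of_set (points Y)) W \<and> y \<in> W \<and> W \<subseteq> U \<inter> V \<and> (\<forall>z\<in>W. f z = h z)"
    if "(U, f) \<in> ?I" "(V, h) \<in> ?I" "y \<in> U" "y \<in> V" "f y = h y" for U f V h y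
    using *[OF that(1-4)] that(5) by blast
  show "\<exists>W. openin (top_of_set (points Y)) W \<and> y \<in> W \<and> W \<subseteq> U \<inter> V \<and> (\<forall>z\<in>W. f z \<noteq> h z)"
    if "(U, f) \<in> ?I" "(V, h) \<in> ?I" "y \<in> U" "y \<in> V" "f y \<noteq> h y" for U f V h y
    using *[OF that(1-4)] that(5) by blast
  show "\<exists>U. openin (top_of_set (points Y)) U \<and> y \<in> U \<and>
      (\<forall>z\<in>U. \<forall>\<xi>\<in>{\<xi> \<in> points PP. proj X \<xi> = \<phi> z}. \<exists>f. (U, f) \<in> ?I \<and> f z = \<xi>)" if y: "y \<in> points Y" for y
  proof -
    obtain \<xi>0 where "\<xi>0 \<in> points PP" "proj X \<xi>0 = \<phi> y" using fibre_nonempty[OF smap_in[OF phi y]] .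
    then obtain U f where f: "y \<in> U" "lift_on \<phi> U f" using local_lift[OF y] by blast
    have "\<exists>h. lift_on \<phi> U h \<and> h z = \<xi>" if z: "z \<in> U" and \<xi>: "\<xi> \<in> points PP" "proj X \<xi> = \<phi> z" for z \<xi>
    proof -
      have fz: "f z \<in> points PP" "proj X (f z) = proj X \<xi>"
        using smap_in[OF lift_onD(1)[OF f(2)] z] lift_onD(2)[OF f(2) z] \<xi> by auto
      show ?thesis
        using lift_on_translate[OF f(2) translator_in[OF fz(1) \<xi>(1) fz(2)]] act_translator[OF fz(1) \<xi>(1) fz(2)] by blast
    qed
    then show ?thesis
      using f smap_open[OF lift_onD(1)[OF f(2)]] by (intro exI[of _ U]) (auto simp: open_in_def)
  qed
qed

lemma global_lift:
  assumes sc: "simply_connected (points Y)"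
  shows "\<exists>f. lift_on \<phi> (points Y) f \<and>
    (\<forall>f'. lift_on \<phi> (points Y) f' \<longrightarrow> (\<exists>a\<in>points HH. \<forall>y\<in>points Y. f' y = act X (f y) a))"
proof (cases "points Y = {}")
  \<comment> \<open>The empty surface counts as simply connected; any function is a lift over
    it.\<close>
  case True
  have "lift_on \<phi> {} (\<lambda>_. undefined)"
    by (auto simp: lift_on_def intro!: smap_local[OF Y P])
  then show ?thesis using True one_in by (metis empty_iff)
next
  case False
  interpret section_cover "points Y" "{(U, f). lift_on \<phi> U f}" "\<lambda>y. {\<xi> \<in> points PP. proj X \<xi> = \<phi> y}"
    by (rule section_cover_lifts)
  obtain y0 where y0: "y0 \<in> points Y" using False by blast
  obtain \<xi>0 where \<xi>0: "\<xi>0 \<in> points PP" "proj X \<xi>0 = \<phi> y0" using fibre_nonempty[OF smap_in[OF phi y0]] .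
  have lpc: "\<exists>V. openin (top_of_set (points Y)) V \<and> y \<in> V \<and> V \<subseteq> U \<and> path_connected V"
    if "openin (top_of_set (points Y)) U" "y \<in> U" for y U
    using manifold_locally_path_connected[OF Y _ that(2)] that(1) by (auto simp: open_in_def)
  obtain f where f: "\<forall>y\<in>points Y. \<exists>V U s. openin (top_of_set (points Y)) V \<and> y \<in> V \<and> V \<subseteq> U \<and>
      (U, s) \<in> {(U, f). lift_on \<phi> U f} \<and> (\<forall>z\<in>V. f z = s z)"
    using monodromy[OF sc y0 _ lpc, of \<xi>0] \<xi>0 by blast
  have loc: "\<exists>V. y \<in> V \<and> V \<subseteq> points Y \<and> lift_on \<phi> V f" if y: "y \<in> points Y" for y
  proof -
    obtain V U s where V: "openin (top_of_set (points Y)) V" "y \<in> V" "V \<subseteq> U" "lift_on \<phi> U s" "\<forall>z\<in>V. f z = s z"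
      using bspec[OF f y] by (elim exE conjE) simp
    have oV: "open_in Y V" using V(1) by (simp add: open_in_def)
    have "lift_on \<phi> V f" by (rule lift_on_cong[OF lift_on_subset[OF V(4) oV V(3)]]) (simp add: V(5))
    then show ?thesis using V(2) open_in_subset[OF oV] by blast
  qed
  have "smooth_map Y PP (points Y) f"
  proof (rule smap_locally[OF Y P])
    fix y assume "y \<in> points Y"
    then obtain V where "y \<in> V" "V \<subseteq> points Y" "lift_on \<phi> V f" using loc[of y] by meson
    then show "\<exists>V. y \<in> V \<and> V \<subseteq> points Y \<and> smooth_map Y PP V f" using lift_onD(1)[of \<phi> V f] by (intro exI[of _ V]) simp
  qed
  moreover have "proj X (f y) = \<phi> y \<and> beta f y v = 0" if y: "y \<in> points Y" for y v
  proof -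
    obtain V where V: "y \<in> V" "lift_on \<phi> V f" using loc[OF y] by (elim exE conjE) simp
    show ?thesis using lift_onD(2,3)[OF V(2,1)] by simp
  qed
  ultimately have lf: "lift_on \<phi> (points Y) f" by (simp add: lift_on_def)
  have "\<exists>a\<in>points HH. \<forall>y\<in>points Y. f' y = act X (f y) a" if lf': "lift_on \<phi> (points Y) f'" for f'
  proof -
    let ?a = "translator X (f y0) (f' y0)"
    have p: "f y0 \<in> points PP" "f' y0 \<in> points PP" "proj X (f y0) = proj X (f' y0)"
      using smap_in[OF lift_onD(1)[OF lf] y0] smap_in[OF lift_onD(1)[OF lf'] y0] lift_onD(2)[OF lf y0] lift_onD(2)[OF lf' y0] by auto
    have a: "?a \<in> points HH" by (rule translator_in[OF p])
    \<comment> \<open>The translate of \<open>f\<close> that agrees with \<open>f'\<close> at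
      \<open>y0\<close>. Along a path from \<open>y0\<close> both give lifts of this path to the
      covering, and these are equal.\<close>
    have lg: "lift_on \<phi> (points Y) (\<lambda>y. act X (f y) ?a)" by (rule lift_on_translate[OF lf a])
    have "f' y = act X (f y) ?a" if y: "y \<in> points Y" for y
    proof -
      obtain \<gamma> where \<gamma>: "path \<gamma>" "path_image \<gamma> \<subseteq> points Y" "\<gamma> 0 = y0" "\<gamma> 1 = y"
        using simply_connected_path[OF sc y0 y] .
      have l: "lift {0..1} \<gamma> (\<lambda>t. h (\<gamma> t))" if h: "lift_on \<phi> (points Y) h" for h
        unfolding lift_def
      proof (intro conjI ballI)
        show "continuous_on {0..1} \<gamma>" using \<gamma>(1) by (simp add: path_def)
        show im: "\<gamma> ` {0..1} \<subseteq> points Y" using \<gamma>(2) by (simp add: path_image_def)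
        fix t :: real assume "t \<in> {0..1}"
        then show "\<exists>W U s. openin (top_of_set {0..1}) W \<and> t \<in> W \<and> (U, s) \<in> {(U, f). lift_on \<phi> U f} \<and> \<gamma> ` W \<subseteq> U \<and> (\<forall>r\<in>W. h (\<gamma> r) = s (\<gamma> r))"
          using h im by (intro exI[of _ "{0..1}"] exI[of _ "points Y"] exI[of _ h]) simp
      qed
      show ?thesis
        using lift_unique[OF connected_Icc l[OF lf'] l[OF lg], of 0 1] \<gamma>(3,4) act_translator[OF p] by simp
    qed
    then show ?thesis using a by blast
  qed
  then show ?thesis using lf by blast
qed

end

section \<open>Pull-back bundles\<close>

text \<open>The points of the pull-back form a subspace of a product that is not yet known to be a
  manifold; continuity of its charts needs a purely topological version of
  \<open>smooth_translator\<close>.\<close>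

lemma (in pb) continuous_translator:
  fixes S :: "'a::t2_space set"
  assumes f: "continuous_on S f" "f ` S \<subseteq> points PP" and h: "continuous_on S h" "h ` S \<subseteq> points PP"
    and eq: "\<And>x. x \<in> S \<Longrightarrow> proj X (f x) = proj X (h x)"
  shows "continuous_on S (\<lambda>x. translator X (f x) (h x))"
  unfolding continuous_on_eq_continuous_within
proof
  fix x assume x: "x \<in> S"
  have fx: "proj X (f x) \<in> points MM" using x f(2) by auto
  obtain U T where U: "proj X (f x) \<in> U" "open_in MM U"
    "smooth_map (prod_atlas PP PP) HH {p \<in> points PP \<times> points PP. proj X (fst p) \<in> U \<and> proj X (snd p) \<in> U} T"
    "\<forall>\<xi>\<in>points PP. \<forall>\<xi>'\<in>points PP. proj X \<xi> = proj X \<xi>' \<and> proj X \<xi> \<in> U \<longrightarrow> T (\<xi>, \<xi>') = translator X \<xi> \<xi>'"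
    using translator_extension[OF fx] .
  let ?S = "{y \<in> S. proj X (f y) \<in> U}"
  have "openin (top_of_set (points PP)) {\<xi> \<in> points PP. proj X \<xi> \<in> U}"
    using smap_vimage[OF proj_smooth U(2)] by (simp add: open_in_def)
  then have "openin (top_of_set S) (S \<inter> f -` {\<xi> \<in> points PP. proj X \<xi> \<in> U})"
    using continuous_on_open_gen[OF image_subset_iff_funcset[THEN iffD1, OF f(2)]] f(1) by blast
  moreover have "S \<inter> f -` {\<xi> \<in> points PP. proj X \<xi> \<in> U} = ?S" using f(2) by auto
  ultimately obtain G where G: "open G" "?S = S \<inter> G" by (auto simp: openin_open)
  have "continuous_on ?S (\<lambda>y. T (f y, h y))"
  proof (rule continuous_on_compose2[OF smap_continuous[OF U(3)]])
    show "continuous_on ?S (\<lambda>y. (f y, h y))"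
      by (intro continuous_on_Pair continuous_on_subset[OF f(1)] continuous_on_subset[OF h(1)]) auto
    show "(\<lambda>y. (f y, h y)) ` ?S \<subseteq> {p \<in> points PP \<times> points PP. proj X (fst p) \<in> U \<and> proj X (snd p) \<in> U}"
      using f(2) h(2) eq by auto
  qed
  moreover have "T (f y, h y) = translator X (f y) (h y)" if "y \<in> ?S" for y
    using U(4) that f(2) h(2) eq[of y] by (auto simp: image_subset_iff)
  ultimately have "continuous_on ?S (\<lambda>y. translator X (f y) (h y))" by (rule continuous_on_eq)
  moreover have "x \<in> ?S" using x U(1) by simp
  ultimately have "continuous (at x within ?S) (\<lambda>y. translator X (f y) (h y))"
    unfolding continuous_on_eq_continuous_within by blast
  moreover have "at x within ?S = at x within S"
    by (rule at_within_nhd[of x G]) (use G \<open>x \<in> ?S\<close> in auto)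
  ultimately show "continuous (at x within S) (\<lambda>y. translator X (f y) (h y))" by simp
qed

locale pb_pullback = pb +
  fixes Y and \<phi>
  assumes Y: "manifold Y" and phi: "smooth_map Y (base X) (points Y) \<phi>"
begin

abbreviation NN where "NN \<equiv> pullback_atlas Y X \<phi>"
abbreviation PB where "PB \<equiv> pullback_bundle Y X \<phi>"

definition pchart where
  "pchart c W s d = ({(y, \<xi>). y \<in> fst c \<and> \<phi> y \<in> W \<and> \<xi> \<in> points PP \<and> proj X \<xi> = \<phi> y \<and>
      translator X (s (\<phi> y)) \<xi> \<in> fst d}, \<lambda>(y, \<xi>). (snd c y, snd d (translator X (s (\<phi> y)) \<xi>)))"

definition pchart_data where
  "pchart_data c W s d \<longleftrightarrow> c \<in> Y \<and> local_section X W s \<and> d \<in> HH"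

lemma NN_iff: "e \<in> NN \<longleftrightarrow> (\<exists>c W s d. e = pchart c W s d \<and> pchart_data c W s d)"
  by (auto simp: pullback_atlas_def pchart_def pchart_data_def)

lemma points_NN: "points NN = {n. fst n \<in> points Y \<and> snd n \<in> points PP \<and> proj X (snd n) = \<phi> (fst n)}"
proof (intro Set.set_eqI iffI)
  fix n assume "n \<in> points NN"
  then obtain e where "e \<in> NN" "n \<in> fst e" unfolding points_def by blast
  moreover then obtain c W s d where "e = pchart c W s d" "pchart_data c W s d" unfolding NN_iff by blast
  ultimately show "n \<in> {n. fst n \<in> points Y \<and> snd n \<in> points PP \<and> proj X (snd n) = \<phi> (fst n)}"
    by (auto simp: pchart_def pchart_data_def intro: subsetD[OF chart_subset[OF Y]])
next
  fix n assume n: "n \<in> {n. fst n \<in> points Y \<and> snd n \<in> points PP \<and> proj X (snd n) = \<phi> (fst n)}"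
  then have "snd n \<in> points PP" by simp
  from local_section_through[OF this] obtain W s where
    W: "proj X (snd n) \<in> W" "local_section X W s" "s (proj X (snd n)) = snd n" .
  let ?c = "pref Y (fst n)" and ?d = "pref HH one"
  have c: "?c \<in> Y" "fst n \<in> fst ?c" using pref_in[of "fst n" Y] n by auto
  have d: "?d \<in> HH" "one \<in> fst ?d" using pref_in[OF one_in] by auto
  \<comment> \<open>The section passes through \<open>snd n\<close>, so the group coordinate of
    \<open>n\<close> is the unit and a chart around the unit contains it.\<close>
  have "translator X (snd n) (snd n) = one" using translator_act[of "snd n" one] n by simp
  then have "n \<in> fst (pchart ?c W s ?d)" using n W c d by (simp add: pchart_def split: prod.split) (metis fst_conv snd_conv)
  moreover have "pchart ?c W s ?d \<in> NN" unfolding NN_iff pchart_data_def using c d W by blast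
  ultimately show "n \<in> points NN" unfolding points_def by blast
qed

lemma base_open:
  assumes "open_in Y U"
  shows "open_in NN {n \<in> points NN. fst n \<in> U}"
  by (rule open_in_vimage[OF open_in_points continuous_on_fst[OF continuous_on_id] _ assms]) (auto simp: points_NN)

context
  fixes c W s d
  assumes data: "pchart_data c W s d"
begin

lemma cY: "c \<in> Y" and sW: "local_section X W s" and dH: "d \<in> HH"
  using data by (auto simp: pchart_data_def)

abbreviation "over \<equiv> {y \<in> points Y. \<phi> y \<in> W}"
abbreviation "img \<equiv> (snd c ` (over \<inter> fst c)) \<times> (snd d ` fst d)"
abbreviation "chart \<equiv> pchart c W s d"

lemma over_open: "open_in Y over"
  by (rule smap_vimage[OF phi smap_open[OF local_section_smooth[OF sW]]])

lemma over_smooth: "smooth_map Y PP over (\<lambda>y. s (\<phi> y))"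
  by (rule smooth_compose[OF Y M P smap_subset[OF Y M phi over_open] local_section_smooth[OF sW]]) auto

lemma over_in: "y \<in> over \<Longrightarrow> s (\<phi> y) \<in> points PP" and over_proj: "y \<in> over \<Longrightarrow> proj X (s (\<phi> y)) = \<phi> y"
  using smap_in[OF over_smooth] local_section_proj[OF sW] by auto

lemma chart_dom: "n \<in> fst chart \<longleftrightarrow> n \<in> points NN \<and> fst n \<in> fst c \<and> fst n \<in> over \<and> translator X (s (\<phi> (fst n))) (snd n) \<in> fst d"
  using subsetD[OF chart_subset[OF Y cY]] by (cases n) (auto simp: pchart_def points_NN)

lemma chart_val: "snd chart n = (snd c (fst n), snd d (translator X (s (\<phi> (fst n))) (snd n)))"
  by (simp add: pchart_def split_beta)

lemma image_open: "open img"
  by (intro open_Times open_chart_image[OF Y cY over_open] chart_image_open[OF H dH])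

lemma trans_in:
  assumes "n \<in> points NN" "fst n \<in> over"
  shows "translator X (s (\<phi> (fst n))) (snd n) \<in> points HH" "act X (s (\<phi> (fst n))) (translator X (s (\<phi> (fst n))) (snd n)) = snd n"
  using assms translator_in[OF over_in[OF assms(2)], of "snd n"] act_translator[OF over_in[OF assms(2)], of "snd n"] over_proj[OF assms(2)]
  by (auto simp: points_NN)

text \<open>An explicit form of the inverse chart, whose two components are visibly smooth as maps
  to \<open>Y\<close> and to the bundle.\<close>

definition pinv where "pinv q = (chart_inv c (fst q), act X (s (\<phi> (chart_inv c (fst q)))) (chart_inv d (snd q)))"

lemma pinv_chart:
  assumes "n \<in> fst chart"
  shows "snd chart n \<in> img" "pinv (snd chart n) = n"
  using assms trans_in[of n] unfolding chart_dom chart_val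
  by (auto simp: pinv_def chart_inv_snd[OF Y cY] chart_inv_snd[OF H dH] prod_eq_iff)

lemma chart_pinv:
  assumes q: "q \<in> img"
  shows "pinv q \<in> fst chart" "snd chart (pinv q) = q"
proof -
  obtain y a where y: "y \<in> over" "y \<in> fst c" "a \<in> fst d" "q = (snd c y, snd d a)" using q by auto
  have a: "a \<in> points HH" using chart_subset[OF H dH] y(3) by auto
  have p: "pinv q = (y, act X (s (\<phi> y)) a)"
    using y by (simp add: pinv_def chart_inv_snd[OF Y cY] chart_inv_snd[OF H dH])
  show "pinv q \<in> fst chart" "snd chart (pinv q) = q"
    using y a over_in[OF y(1)] over_proj[OF y(1)] unfolding p chart_dom chart_val by (auto simp: points_NN)
qed

lemma chart_image: "snd chart ` fst chart = img"
proof (intro subset_antisym subsetI)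
  fix q assume q: "q \<in> img"
  show "q \<in> snd chart ` fst chart" using imageI[OF chart_pinv(1)[OF q], of "snd chart"] unfolding chart_pinv(2)[OF q] .
qed (elim imageE, simp only: pinv_chart(1))

lemma chart_inv_pinv: "q \<in> img \<Longrightarrow> chart_inv chart q = pinv q"
  unfolding chart_inv_def
  by (rule inv_into_f_eq) (auto simp del: mem_Times_iff simp: chart_pinv intro: inj_on_inverseI[of _ pinv] pinv_chart)

lemma pinv_fst_smooth: "smooth_map eucl Y img (\<lambda>q. fst (pinv q))"
  and pinv_snd_smooth: "smooth_map eucl PP img (\<lambda>q. snd (pinv q))"
proof -
  have o: "open_in (prod_atlas eucl eucl) img" using image_open by simp
  have f: "smooth_map eucl eucl img fst" and g: "smooth_map eucl eucl img snd"
    using smap_fst[OF mf_eucl mf_eucl o] smap_snd[OF mf_eucl mf_eucl o] by auto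
  have 1: "smooth_map eucl Y img (\<lambda>q. chart_inv c (fst q))"
    by (rule smooth_compose[OF mf_eucl mf_eucl Y f smap_chart_inv[OF Y cY]]) auto
  then show "smooth_map eucl Y img (\<lambda>q. fst (pinv q))" by (simp add: pinv_def)
  have 2: "smooth_map eucl HH img (\<lambda>q. chart_inv d (snd q))"
    by (rule smooth_compose[OF mf_eucl mf_eucl H g smap_chart_inv[OF H dH]]) auto
  have "smooth_map eucl PP img (\<lambda>q. s (\<phi> (chart_inv c (fst q))))"
    by (rule smooth_compose[OF mf_eucl Y P 1 over_smooth]) (auto simp: chart_inv_snd[OF Y cY])
  then show "smooth_map eucl PP img (\<lambda>q. snd (pinv q))"
    using smooth_act[OF mf_eucl _ 2] by (simp add: pinv_def)
qed

text \<open>Before the pull-back is known to be a manifold, maps into it can be handled only through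
  their two components.\<close>

lemma chart_comp_smooth:
  assumes N: "manifold N" and p: "smooth_map N Y U p" and r: "smooth_map N PP U r"
    and in_chart: "\<And>n. n \<in> U \<Longrightarrow> (p n, r n) \<in> fst chart"
  shows "smooth_map N eucl U (\<lambda>n. snd chart (p n, r n))"
proof -
  have i: "p n \<in> fst c" "p n \<in> over" "translator X (s (\<phi> (p n))) (r n) \<in> fst d" "proj X (r n) = \<phi> (p n)" if "n \<in> U" for n
    using in_chart[OF that] unfolding chart_dom by (auto simp: points_NN)
  have 1: "smooth_map N eucl U (\<lambda>n. snd c (p n))"
    by (rule smooth_compose[OF N Y mf_eucl p smap_chart[OF Y cY]]) (use i in auto)
  have "smooth_map N PP U (\<lambda>n. s (\<phi> (p n)))"
    by (rule smooth_compose[OF N Y P p over_smooth]) (use i in auto)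
  then have "smooth_map N HH U (\<lambda>n. translator X (s (\<phi> (p n))) (r n))"
    by (rule smooth_translator[OF N _ r]) (use i over_proj in auto)
  then have "smooth_map N eucl U (\<lambda>n. snd d (translator X (s (\<phi> (p n))) (r n)))"
    by (rule smooth_compose[OF N H mf_eucl _ smap_chart[OF H dH]]) (use i in auto)
  from smap_Pair[OF mf_eucl mf_eucl N 1 this] show ?thesis by (simp add: chart_val)
qed

lemma trans_continuous: "continuous_on {n \<in> points NN. fst n \<in> over} (\<lambda>n. translator X (s (\<phi> (fst n))) (snd n))"
proof (rule continuous_translator)
  show "continuous_on {n \<in> points NN. fst n \<in> over} (\<lambda>n. s (\<phi> (fst n)))"
    by (rule continuous_on_compose2[OF smap_continuous[OF over_smooth] continuous_on_fst[OF continuous_on_id]]) auto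
qed (use over_in over_proj in \<open>auto simp: points_NN intro!: continuous_on_snd[OF continuous_on_id]\<close>)

lemma chart_open_in: "open_in NN (fst chart)"
proof -
  have "open_in NN {n \<in> {n \<in> points NN. fst n \<in> over}. translator X (s (\<phi> (fst n))) (snd n) \<in> fst d}"
    by (rule open_in_vimage[OF base_open[OF over_open] trans_continuous _ chart_open[OF H dH]]) (use trans_in in auto)
  from open_in_Int[OF base_open[OF chart_open[OF Y cY]] this] show ?thesis
    by (rule back_subst[of "open_in NN"]) (auto simp: chart_dom)
qed

lemma chart_homeomorphism: "homeomorphism (fst chart) img (snd chart) (chart_inv chart)"
proof (rule homeomorphismI)
  have "continuous_on (fst chart) (\<lambda>n. (snd c (fst n), snd d (translator X (s (\<phi> (fst n))) (snd n))))"
  proof (intro continuous_on_Pair)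
    show "continuous_on (fst chart) (\<lambda>n. snd c (fst n))"
      by (rule continuous_on_compose2[OF continuous_chart[OF Y cY] continuous_on_fst[OF continuous_on_id]]) (auto simp: chart_dom)
    show "continuous_on (fst chart) (\<lambda>n. snd d (translator X (s (\<phi> (fst n))) (snd n)))"
      by (rule continuous_on_compose2[OF continuous_chart[OF H dH] continuous_on_subset[OF trans_continuous]]) (auto simp: chart_dom)
  qed
  then show "continuous_on (fst chart) (snd chart)"
    by (rule continuous_on_eq) (simp add: chart_val)
  have "continuous_on img (\<lambda>q. (fst (pinv q), snd (pinv q)))"
    by (intro continuous_on_Pair smap_continuous[OF pinv_fst_smooth] smap_continuous[OF pinv_snd_smooth])
  then show "continuous_on img (chart_inv chart)"
    by (rule continuous_on_eq) (simp add: chart_inv_pinv del: mem_Times_iff)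
  show "snd chart ` fst chart \<subseteq> img" using chart_image by blast
  show "chart_inv chart ` img \<subseteq> fst chart" using chart_inv_pinv chart_pinv(1) by fastforce
  show "chart_inv chart (snd chart n) = n" if "n \<in> fst chart" for n
    using chart_inv_pinv[OF pinv_chart(1)[OF that]] pinv_chart(2)[OF that] by simp
  show "snd chart (chart_inv chart q) = q" if "q \<in> img" for q
    using chart_inv_pinv[OF that] chart_pinv(2)[OF that] by simp
qed

end

lemma NN: "manifold NN"
  unfolding manifold_def
proof (intro conjI ballI)
  fix e assume "e \<in> NN"
  then obtain c W s d where e: "e = pchart c W s d" and D: "pchart_data c W s d" by (auto simp: NN_iff)
  show "open_in NN (fst e)" unfolding e by (rule chart_open_in[OF D])
  show oe: "open (snd e ` fst e)" unfolding e chart_image[OF D] by (rule image_open[OF D])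
  show "homeomorphism (fst e) (snd e ` fst e) (snd e) (chart_inv e)"
    using chart_homeomorphism[OF D] unfolding e chart_image[OF D] .
  fix e' assume "e' \<in> NN"
  then obtain c' W' s' d' where e': "e' = pchart c' W' s' d'" and D': "pchart_data c' W' s' d'" by (auto simp: NN_iff)
  let ?S = "snd e ` (fst e \<inter> fst e')"
  have h: "homeomorphism (fst e) (snd e ` fst e) (snd e) (chart_inv e)"
    using chart_homeomorphism[OF D] unfolding e chart_image[OF D] .
  have "open_in NN (fst e \<inter> fst e')" unfolding e e' by (intro open_in_Int chart_open_in[OF D] chart_open_in[OF D'])
  then have "openin (top_of_set (points NN)) (fst e \<inter> fst e')" by (simp add: open_in_def)
  then have "openin (top_of_set (fst e)) (fst e \<inter> fst e')"
    by (rule openin_subset_trans) (use open_in_subset[OF chart_open_in[OF D]] e in auto)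
  from homeomorphism_imp_open_map[OF h this] have oS: "open ?S"
    unfolding openin_open_eq[OF oe] ..
  have SI: "?S \<subseteq> snd e ` fst e" by auto
  then have SS: "?S \<subseteq> snd c ` ({y \<in> points Y. \<phi> y \<in> W} \<inter> fst c) \<times> snd d ` fst d"
    unfolding e chart_image[OF D] .
  note SI' = subsetD[OF SS]
  have inv: "chart_inv e q = pinv c s d q" if "q \<in> ?S" for q
    unfolding e by (rule chart_inv_pinv[OF D SI'[OF that]])
  have oS': "open_in eucl ?S" using oS by simp
  \<comment> \<open>A transition map is the new chart applied to the two components of
    \<open>pinv\<close> for the old one.\<close>
  have "smooth_map eucl eucl ?S (\<lambda>q. snd (pchart c' W' s' d') (fst (pinv c s d q), snd (pinv c s d q)))"
  proof (rule chart_comp_smooth[OF D' mf_eucl])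
    show "smooth_map eucl Y ?S (\<lambda>q. fst (pinv c s d q))"
      by (rule smap_subset[OF mf_eucl Y pinv_fst_smooth[OF D] oS' SS])
    show "smooth_map eucl PP ?S (\<lambda>q. snd (pinv c s d q))"
      by (rule smap_subset[OF mf_eucl P pinv_snd_smooth[OF D] oS' SS])
    fix q assume q: "q \<in> ?S"
    then have "chart_inv e q \<in> fst e'" using h by (auto simp: homeomorphism_def)
    then show "(fst (pinv c s d q), snd (pinv c s d q)) \<in> fst (pchart c' W' s' d')" using inv[OF q] e' by simp
  qed
  then have "smooth_map eucl eucl ?S (snd e' \<circ> chart_inv e)"
    by (rule smap_cong[OF mf_eucl mf_eucl]) (simp add: inv e'[symmetric])
  then show "smooth_on ?S (snd e' \<circ> chart_inv e)" by (simp add: smap_eucl_eucl)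
qed

lemma NN_components:
  assumes R: "manifold R" and pinv: "\<And>c W s d. pchart_data c W s d \<Longrightarrow>
      smooth_map eucl R (snd c ` ({y \<in> points Y. \<phi> y \<in> W} \<inter> fst c) \<times> snd d ` fst d) (\<lambda>q. \<pi> (pinv c s d q))"
  shows "smooth_map NN R (points NN) \<pi>"
proof (rule smap_locally[OF NN R])
  fix n assume n: "n \<in> points NN"
  let ?e = "pref NN n"
  note e = pref_in[OF n]
  obtain c W s d where c: "?e = pchart c W s d" and D: "pchart_data c W s d" using e(1) by (auto simp: NN_iff)
  have "smooth_map NN R (fst ?e) (\<lambda>n. \<pi> (pinv c s d (snd ?e n)))"
    by (rule smooth_compose[OF NN mf_eucl R smap_chart[OF NN e(1)] pinv[OF D]])
      (unfold c, use pinv_chart(1)[OF D] in blast)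
  then have "smooth_map NN R (fst ?e) \<pi>"
    by (rule smap_cong[OF NN R]) (unfold c, simp add: pinv_chart(2)[OF D])
  then show "\<exists>V. n \<in> V \<and> V \<subseteq> points NN \<and> smooth_map NN R V \<pi>"
    using e chart_subset[OF NN e(1)] by (intro exI[of _ "fst ?e"] conjI)
qed

lemma fst_smooth: "smooth_map NN Y (points NN) fst" and snd_smooth: "smooth_map NN PP (points NN) snd"
  by (rule NN_components[OF Y pinv_fst_smooth], assumption, rule NN_components[OF P pinv_snd_smooth], assumption)

text \<open>The universal property of the fibre product: together with \<open>fst_smooth\<close> and
  \<open>snd_smooth\<close> it takes over from explicit computations in the charts of
  \<open>NN\<close>.\<close>

lemma smooth_into_NN:
  assumes N: "manifold N" and p: "smooth_map N Y U p" and r: "smooth_map N PP U r"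
    and eq: "\<And>n. n \<in> U \<Longrightarrow> proj X (r n) = \<phi> (p n)"
  shows "smooth_map N NN U (\<lambda>n. (p n, r n))"
proof (rule smap_locally[OF N NN])
  fix n assume n: "n \<in> U"
  have in_NN: "(p m, r m) \<in> points NN" if "m \<in> U" for m
    using smap_in[OF p that] smap_in[OF r that] eq[OF that] by (simp add: points_NN)
  let ?e = "pref NN (p n, r n)"
  note e = pref_in[OF in_NN[OF n]]
  obtain c W s d where c: "?e = pchart c W s d" and D: "pchart_data c W s d" using e(1) by (auto simp: NN_iff)
  let ?V = "{m \<in> U. (p m, r m) \<in> fst ?e}"
  have oV: "open_in N ?V"
    by (rule open_in_vimage[OF smap_open[OF p] continuous_on_Pair[OF smap_continuous[OF p] smap_continuous[OF r]] _ chart_open[OF NN e(1)]])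
      (use in_NN in auto)
  have "smooth_map N eucl ?V (\<lambda>n. snd ?e (p n, r n))"
    unfolding c
    by (rule chart_comp_smooth[OF D N smap_subset[OF N Y p oV[unfolded c]] smap_subset[OF N P r oV[unfolded c]]]) auto
  then have "smooth_map N NN ?V (\<lambda>n. chart_inv ?e (snd ?e (p n, r n)))"
    by (rule smooth_compose[OF N mf_eucl NN _ smap_chart_inv[OF NN e(1)]]) auto
  then have "smooth_map N NN ?V (\<lambda>n. (p n, r n))"
    by (rule smap_cong[OF N NN]) (auto simp: chart_inv_snd[OF NN e(1)])
  then show "\<exists>V. n \<in> V \<and> V \<subseteq> U \<and> smooth_map N NN V (\<lambda>n. (p n, r n))"
    using n e by (intro exI[of _ ?V] conjI) simp_all
qed

lemma PB_simps [simp]: "grp PB = grp X" "grpM PB = HH" "tot PB = NN" "base PB = Y" "proj PB = fst"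
    "act PB n a = (fst n, act X (snd n) a)"
  by (simp_all add: pullback_bundle_def split_beta)

lemma PB: "principal_bundle PB"
  unfolding principal_bundle_def PB_simps
proof (intro conjI ballI)
  note NH = manifold_prod[OF NN H] and YH = manifold_prod[OF Y H]
  show "lie_group (grp X) HH" using principal by (simp add: principal_bundle_def)
  show "manifold NN" "manifold Y" "smooth_map NN Y (points NN) fst" by (fact NN Y fst_smooth)+
  have o: "open_in (prod_atlas NN HH) (points NN \<times> points HH)" by (intro open_in_Times) auto
  note sf = smap_fst[OF NN H o] and ss = smap_snd[OF NN H o]
  have "smooth_map (prod_atlas NN HH) NN (points NN \<times> points HH) (\<lambda>q. (fst (fst q), act X (snd (fst q)) (snd q)))"
  proof (rule smooth_into_NN[OF NH])
    show "smooth_map (prod_atlas NN HH) Y (points NN \<times> points HH) (\<lambda>q. fst (fst q))"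
      by (rule smooth_compose[OF NH NN Y sf fst_smooth]) auto
    have "smooth_map (prod_atlas NN HH) PP (points NN \<times> points HH) (\<lambda>q. snd (fst q))"
      by (rule smooth_compose[OF NH NN P sf snd_smooth]) auto
    then show "smooth_map (prod_atlas NN HH) PP (points NN \<times> points HH) (\<lambda>q. act X (snd (fst q)) (snd q))"
      by (rule smooth_act[OF NH _ ss])
  qed (auto simp: points_NN)
  then show "smooth_map (prod_atlas NN HH) NN (points NN \<times> points HH) (\<lambda>(\<xi>, a). (fst \<xi>, act X (snd \<xi>) a))"
    by (simp add: case_prod_unfold)
next
  fix n assume n: "n \<in> points NN"
  then have s: "snd n \<in> points PP" by (simp add: points_NN)
  show "(fst n, act X (snd n) one) = n" using s by simp
  fix a assume a: "a \<in> points HH"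
  show "fst (fst n, act X (snd n) a) = fst n" by simp
  fix b assume b: "b \<in> points HH"
  show "(fst n, act X (snd n) (a \<cdot> b)) = (fst (fst n, act X (snd n) a), act X (snd (fst n, act X (snd n) a)) b)"
    using act_mult[OF s a b] by simp
next
  fix y0 assume y0: "y0 \<in> points Y"
  obtain \<xi> where \<xi>: "\<xi> \<in> points PP" "proj X \<xi> = \<phi> y0" using fibre_nonempty[OF smap_in[OF phi y0]] .
  obtain W s where W: "proj X \<xi> \<in> W" "local_section X W s" using local_section_through[OF \<xi>(1)] .
  have D: "pchart_data (pref Y y0) W s (pref HH one)"
    using W(2) pref_in(1)[OF y0] pref_in(1)[OF one_in] by (simp add: pchart_data_def)
  let ?U = "{y \<in> points Y. \<phi> y \<in> W}" and ?E = "{n \<in> points NN. fst n \<in> {y \<in> points Y. \<phi> y \<in> W}}"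
  let ?\<sigma> = "\<lambda>y. s (\<phi> y)"
  note oU = over_open[OF D] and s = over_smooth[OF D] and i = over_in[OF D] and pr = over_proj[OF D] and tr = trans_in[OF D]
  \<comment> \<open>The trivialization given by the pulled back section \<open>?\<sigma>\<close>;
    its inverse reads off the group element with the translator.\<close>
  define \<Phi> where "\<Phi> = (\<lambda>q. (fst q, act X (?\<sigma> (fst q)) (snd q)))"
  define \<Psi> where "\<Psi> = (\<lambda>n. (fst n, translator X (?\<sigma> (fst n)) (snd n)))"
  have YH: "manifold (prod_atlas Y HH)" by (rule manifold_prod[OF Y H])
  have o: "open_in (prod_atlas Y HH) (?U \<times> points HH)" by (intro open_in_Times oU) auto
  note sf = smap_fst[OF Y H o] and ss = smap_snd[OF Y H o]
  have "smooth_map (prod_atlas Y HH) PP (?U \<times> points HH) (\<lambda>q. ?\<sigma> (fst q))"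
    by (rule smooth_compose[OF YH Y P sf s]) auto
  from smooth_act[OF YH this ss] have s\<Phi>: "smooth_map (prod_atlas Y HH) NN (?U \<times> points HH) \<Phi>"
    unfolding \<Phi>_def by (rule smooth_into_NN[OF YH sf]) (use i pr in auto)
  have oE: "open_in NN ?E" by (rule base_open[OF oU])
  have EN: "?E \<subseteq> points NN" by auto
  note sfE = smap_subset[OF NN Y fst_smooth oE EN] and ssE = smap_subset[OF NN P snd_smooth oE EN]
  have "smooth_map NN PP ?E (\<lambda>n. ?\<sigma> (fst n))"
    by (rule smooth_compose[OF NN Y P sfE s]) auto
  then have "smooth_map NN HH ?E (\<lambda>n. translator X (?\<sigma> (fst n)) (snd n))"
    by (rule smooth_translator[OF NN _ ssE]) (use pr in \<open>auto simp: points_NN\<close>)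
  then have s\<Psi>: "smooth_map NN (prod_atlas Y HH) ?E \<Psi>"
    unfolding \<Psi>_def by (rule smap_Pair[OF Y H NN sfE])
  have \<Phi>E: "\<Phi> q \<in> ?E" "\<Psi> (\<Phi> q) = q" if "q \<in> ?U \<times> points HH" for q
    using that i[of "fst q"] pr[of "fst q"] smap_in[OF phi] by (auto simp: \<Phi>_def \<Psi>_def points_NN)
  have \<Psi>E: "\<Psi> n \<in> ?U \<times> points HH" "\<Phi> (\<Psi> n) = n" if "n \<in> ?E" for n
    using that tr[of n] by (auto simp: \<Phi>_def \<Psi>_def)
  have "\<Phi> ` (?U \<times> points HH) = ?E" "\<Psi> ` ?E = ?U \<times> points HH"
  proof -
    have 1: "q \<in> \<Psi> ` ?E" if "q \<in> ?U \<times> points HH" for q using imageI[OF \<Phi>E(1)[OF that], of \<Psi>] unfolding \<Phi>E(2)[OF that] .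
    have 2: "n \<in> \<Phi> ` (?U \<times> points HH)" if "n \<in> ?E" for n using imageI[OF \<Psi>E(1)[OF that], of \<Phi>] unfolding \<Psi>E(2)[OF that] .
    show "\<Phi> ` (?U \<times> points HH) = ?E" by (rule subset_antisym[OF image_subsetI[OF \<Phi>E(1)] subsetI[OF 2]])
    show "\<Psi> ` ?E = ?U \<times> points HH" by (rule subset_antisym[OF image_subsetI[OF \<Psi>E(1)] subsetI[OF 1]])
  qed
  moreover have "\<Phi> (z, a \<cdot> b) = (fst (\<Phi> (z, a)), act X (snd (\<Phi> (z, a))) b)"
    if "z \<in> ?U" "a \<in> points HH" "b \<in> points HH" for z a b
    using act_mult[OF i that(2,3)] that by (simp add: \<Phi>_def)
  moreover have "fst (\<Phi> (z, a)) = z" for z a by (simp add: \<Phi>_def)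
  ultimately show "\<exists>U \<Phi> \<Psi>. y0 \<in> U \<and> open_in Y U \<and>
        (let E = {\<xi> \<in> points NN. fst \<xi> \<in> U} in
          smooth_map (prod_atlas Y HH) NN (U \<times> points HH) \<Phi> \<and>
          smooth_map NN (prod_atlas Y HH) E \<Psi> \<and>
          \<Phi> ` (U \<times> points HH) = E \<and> \<Psi> ` E = U \<times> points HH \<and>
          (\<forall>t\<in>U \<times> points HH. \<Psi> (\<Phi> t) = t) \<and> (\<forall>\<xi>\<in>E. \<Phi> (\<Psi> \<xi>) = \<xi>) \<and>
          (\<forall>z\<in>U. \<forall>a\<in>points HH. fst (\<Phi> (z, a)) = z \<and>
             (\<forall>b\<in>points HH. \<Phi> (z, a \<cdot> b) = (fst (\<Phi> (z, a)), act X (snd (\<Phi> (z, a))) b))))"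
    using oU s\<Phi> s\<Psi> \<Phi>E(2) \<Psi>E(2) y0 W(1) \<xi>(2) unfolding Let_def
    by (intro exI[of _ ?U] exI[of _ \<Phi>] exI[of _ \<Psi>]) auto
qed

end

section \<open>The flat connection and the main theorem\<close>

context mean_curvature_map
begin

interpretation pull: pb_pullback X Y \<phi>
  by (intro pb_pullback.intro pb_pullback_axioms.intro pb_axioms Y phi)
interpretation bun: pb pull.PB
  by (rule pb.intro[OF pull.PB])

abbreviation NN where "NN \<equiv> pullback_atlas Y X \<phi>"
abbreviation PB where "PB \<equiv> pullback_bundle Y X \<phi>"
abbreviation graph where "graph f y v \<equiv> tmap Y NN (\<lambda>y. (y, f y)) y v"

text \<open>The connection is given through its parallel sections: the horizontal space at
  \<open>n\<close> is the tangent plane of the graph of any lift through \<open>n\<close>. In this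
  way \<open>beta\<close>, which is attached to sections, need not be extended to a form on the
  total space.\<close>

definition hor where
  "hor n = {t. \<exists>U f v. lift_on \<phi> U f \<and> fst n \<in> U \<and> f (fst n) = snd n \<and> t = graph f (fst n) v}"

lemma graph_smooth:
  assumes f: "lift_on \<phi> U f"
  shows "smooth_map Y NN U (\<lambda>y. (y, f y))"
  by (rule pull.smooth_into_NN[OF Y smap_id[OF Y smap_open[OF lift_onD(1)[OF f]]] lift_onD(1)[OF f]]) (rule lift_onD(2)[OF f])

lemma graph_components:
  assumes f: "lift_on \<phi> U f" and y: "y \<in> U"
  shows "tmap NN Y fst (y, f y) (graph f y v) = v" "tmap NN PP snd (y, f y) (graph f y v) = tmap Y PP f y v"
proof -
  note s = graph_smooth[OF f]
  have im: "(\<lambda>y. (y, f y)) ` U \<subseteq> points NN" by (rule smap_image[OF s])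
  show "tmap NN Y fst (y, f y) (graph f y v) = v"
    using tmap_compose[OF Y pull.NN Y s pull.fst_smooth im y, of v] tmap_id[OF Y smap_dom[OF s y], of v] by simp
  show "tmap NN PP snd (y, f y) (graph f y v) = tmap Y PP f y v"
    using tmap_compose[OF Y pull.NN P s pull.snd_smooth im y, of v] by simp
qed

text \<open>Two lifts with the same value at \<open>y\<close> coincide near \<open>y\<close>, so the
  choice of the lift in \<open>hor\<close> does not matter.\<close>

lemma hor_eq:
  assumes f: "lift_on \<phi> U f" and y: "y \<in> U"
  shows "hor (y, f y) = range (graph f y)"
proof (intro subset_antisym subsetI)
  fix t assume "t \<in> hor (y, f y)"
  then obtain U' f' v where f': "lift_on \<phi> U' f'" "y \<in> U'" "f' y = f y" and t: "t = graph f' y v"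
    unfolding hor_def by auto
  have o: "open_in Y (U \<inter> U')" by (intro open_in_Int smap_open[OF lift_onD(1)[OF f]] smap_open[OF lift_onD(1)[OF f'(1)]])
  have l: "lift_on \<phi> (U \<inter> U') f" "lift_on \<phi> (U \<inter> U') f'"
    by (rule lift_on_subset[OF f o], simp, rule lift_on_subset[OF f'(1) o], simp)
  have fp: "f z \<in> points PP" if "z \<in> U \<inter> U'" for z by (rule smap_in[OF lift_onD(1)[OF l(1)] that])
  obtain V where V: "y \<in> V" "open_in Y V" "V \<subseteq> U \<inter> U'" "\<forall>z\<in>V. f' z = act X (f z) (translator X (f y) (f' y))"
    using lift_on_difference[OF l] y f'(2) by blast
  have "translator X (f y) (f' y) = one"
    using translator_act[OF fp one_in, of y] act_one[OF fp, of y] y f' by simp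
  then have eq: "(z, f' z) = (z, f z)" if z: "z \<in> V" for z
    using V(4) z act_one[OF fp[OF subsetD[OF V(3) z]]] by simp
  have "graph f' y v = graph f y v" using tmap_cong[OF Y pull.NN V(2,1) eq] by simp
  then show "t \<in> range (graph f y)" using t by simp
next
  fix t assume "t \<in> range (graph f y)"
  then obtain v where "t = graph f y v" by blast
  then show "t \<in> hor (y, f y)" unfolding hor_def using f y by auto
qed

lemma lift_through:
  assumes n: "n \<in> points NN"
  shows "\<exists>U f. lift_on \<phi> U f \<and> fst n \<in> U \<and> f (fst n) = snd n"
  using local_lift[of "fst n" "snd n"] n unfolding pull.points_NN by auto

text \<open>Right translates of lifts are lifts, and right translation carries the graph of one to
  the graph of the other.\<close>

lemma tright_hor:
  assumes n: "n \<in> points NN" and a: "a \<in> points HH" and t: "t \<in> hor n"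
  shows "tright PB a n t \<in> hor (act PB n a)"
proof -
  obtain U f v where f: "lift_on \<phi> U f" and y: "fst n \<in> U" and fn: "f (fst n) = snd n" and t: "t = graph f (fst n) v"
    using t unfolding hor_def by auto
  have n': "(fst n, f (fst n)) = n" using fn by simp
  have s: "smooth_map NN NN (points NN) (\<lambda>m. act PB m a)" using bun.smooth_act_right[of a] a by simp
  have im: "(\<lambda>y. (y, f y)) ` U \<subseteq> points NN" by (rule smap_image[OF graph_smooth[OF f]])
  have "tmap Y NN (\<lambda>y. act PB (y, f y) a) (fst n) v = tmap NN NN (\<lambda>m. act PB m a) (fst n, f (fst n)) t"
    unfolding t by (rule tmap_compose[OF Y pull.NN pull.NN graph_smooth[OF f] s im y])
  then have "tright PB a n t = graph (\<lambda>y. act X (f y) a) (fst n) v"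
    unfolding tright_def n' by simp
  also have "\<dots> \<in> hor (fst n, act X (f (fst n)) a)"
    using hor_eq[OF lift_on_translate[OF f a] y] by simp
  finally show ?thesis by (simp add: fn)
qed

text \<open>Every point of the fibre is a translate of a lift \<open>f\<close> by a unique group element; this is the
  parallel trivialization in which the connection form becomes the Maurer--Cartan form.\<close>

lemma lift_translator:
  assumes f: "lift_on \<phi> U f"
  shows "open_in Y U" "open_in NN {n \<in> points NN. fst n \<in> U}"
    and "smooth_map NN HH {n \<in> points NN. fst n \<in> U} (\<lambda>n. translator X (f (fst n)) (snd n))"
    and "n \<in> points NN \<Longrightarrow> fst n \<in> U \<Longrightarrow> act X (f (fst n)) (translator X (f (fst n)) (snd n)) = snd n"
    and "n \<in> points NN \<Longrightarrow> fst n \<in> U \<Longrightarrow> translator X (f (fst n)) (snd n) \<in> points HH"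
proof -
  let ?V = "{n \<in> points NN. fst n \<in> U}"
  note sf = lift_onD(1)[OF f] and pf = lift_onD(2)[OF f]
  show oU: "open_in Y U" by (rule smap_open[OF sf])
  show oV: "open_in NN ?V" by (rule pull.base_open[OF oU])
  have V: "?V \<subseteq> points NN" by auto
  have 1: "smooth_map NN PP ?V (\<lambda>n. f (fst n))"
    by (rule smooth_compose[OF pull.NN Y P smap_subset[OF pull.NN Y pull.fst_smooth oV V] sf]) auto
  show s: "smooth_map NN HH ?V (\<lambda>n. translator X (f (fst n)) (snd n))"
    by (rule smooth_translator[OF pull.NN 1 smap_subset[OF pull.NN P pull.snd_smooth oV V]])
      (auto simp: pull.points_NN pf)
  assume n: "n \<in> points NN" "fst n \<in> U"
  then have nV: "n \<in> ?V" by simp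
  show "translator X (f (fst n)) (snd n) \<in> points HH" using smap_in[OF s nV] .
  show "act X (f (fst n)) (translator X (f (fst n)) (snd n)) = snd n"
    by (rule act_translator[OF smap_in[OF 1 nV]]) (use n in \<open>auto simp: pull.points_NN pf\<close>)
qed

text \<open>Every nearby point lies on the graph of a translate of one fixed lift \<open>f\<close>.
  The derivatives of this graph in the chart directions 1 and \<i> span the horizontal plane and
  depend smoothly on the point by \<open>smooth_field_partial\<close>.\<close>

lemma hor_frame:
  assumes n0: "n0 \<in> points NN"
  shows "\<exists>U (k::nat) V. n0 \<in> U \<and> open_in NN U \<and> (\<forall>i<k. smooth_field NN U (V i)) \<and>
     (\<forall>q\<in>U. hor q = span ((\<lambda>i. V i q) ` {..<k}) \<and> dim (hor q) = k)"
proof -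
  obtain U f where f: "lift_on \<phi> U f" and y0: "fst n0 \<in> U" "f (fst n0) = snd n0" using lift_through[OF n0] by blast
  define b where "b n = translator X (f (fst n)) (snd n)" for n
  note tr = lift_translator[OF f, folded b_def]
  let ?c = "pref Y (fst n0)"
  note c = pref_in[OF open_in_mem[OF tr(1) y0(1)]]
  let ?U = "U \<inter> fst ?c"
  have oU: "open_in Y ?U" by (intro open_in_Int tr chart_open[OF Y c(1)])
  let ?V = "{n \<in> points NN. fst n \<in> ?U}"
  have oV: "open_in NN ?V" by (rule pull.base_open[OF oU])
  have oS: "open_in eucl (snd ?c ` ?U)" using open_chart_image[OF Y c(1) tr(1)] by simp
  have VN: "?V \<subseteq> points NN" "?V \<subseteq> {n \<in> points NN. fst n \<in> U}" by auto
  let ?E = "prod_atlas (eucl :: (complex, complex) atlas) NN" and ?W = "(snd ?c ` ?U) \<times> ?V"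
  have EM: "manifold ?E" by (rule manifold_prod[OF mf_eucl pull.NN])
  have oW: "open_in ?E ?W" by (rule open_in_Times[OF oS oV])
  \<comment> \<open>For a fixed point \<open>n\<close> this is, in the chart of the surface, the
    graph of the translate of \<open>f\<close> through \<open>n\<close>; at the parameter
    \<open>snd ?c (fst n)\<close> it returns \<open>n\<close>.\<close>
  define F where "F p = (chart_inv ?c (fst p), act X (f (chart_inv ?c (fst p))) (b (snd p)))" for p
  have sb: "smooth_map NN HH ?V b" by (rule smap_subset[OF pull.NN H tr(3) oV VN(2)])
  have ci: "smooth_map eucl Y (snd ?c ` ?U) (chart_inv ?c)"
    by (rule smap_subset[OF mf_eucl Y smap_chart_inv[OF Y c(1)] oS]) auto
  have ciU: "chart_inv ?c z \<in> ?U" if "z \<in> snd ?c ` ?U" for z using that by (auto simp: chart_inv_snd[OF Y c(1)])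
  have p: "smooth_map ?E Y ?W (\<lambda>p. chart_inv ?c (fst p))"
    by (rule smooth_compose[OF EM mf_eucl Y smap_fst[OF mf_eucl pull.NN oW] ci]) auto
  have "smooth_map ?E PP ?W (\<lambda>p. f (chart_inv ?c (fst p)))"
    by (rule smooth_compose[OF EM Y P p lift_onD(1)[OF f]]) (use ciU in auto)
  moreover have "smooth_map ?E HH ?W (\<lambda>p. b (snd p))"
    by (rule smooth_compose[OF EM pull.NN H smap_snd[OF mf_eucl pull.NN oW] sb]) auto
  ultimately have r: "smooth_map ?E PP ?W (\<lambda>p. act X (f (chart_inv ?c (fst p))) (b (snd p)))"
    by (rule smooth_act[OF EM])
  have sF: "smooth_map ?E NN ?W F" unfolding F_def
  proof (rule pull.smooth_into_NN[OF EM p r])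
    fix q assume "q \<in> ?W"
    then have "chart_inv ?c (fst q) \<in> U" "snd q \<in> points NN" "fst (snd q) \<in> U" using ciU by auto
    then show "proj X (act X (f (chart_inv ?c (fst q))) (b (snd q))) = \<phi> (chart_inv ?c (fst q))"
      using tr(5)[of "snd q"] smap_in[OF lift_onD(1)[OF f]] lift_onD(2)[OF f] by simp
  qed
  have z: "smooth_map NN eucl ?V (\<lambda>n. snd ?c (fst n))"
    by (rule smooth_compose[OF pull.NN Y mf_eucl smap_subset[OF pull.NN Y pull.fst_smooth oV VN(1)] smap_chart[OF Y c(1)]]) auto
  define L where "L n w = tmap eucl NN (\<lambda>x. F (x, n)) (snd ?c (fst n)) w" for n w
  have field: "smooth_field NN ?V (\<lambda>n. L n w)" for w unfolding L_def
    by (rule smooth_field_partial[OF pull.NN sF z])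
      (use tr(4) in \<open>auto simp: F_def chart_inv_snd[OF Y c(1)]\<close>)
  have "hor n = span {L n 1, L n \<i>} \<and> dim (hor n) = 2" if n: "n \<in> ?V" for n
  proof -
    let ?y = "fst n" and ?z = "snd ?c (fst n)"
    have nU: "?y \<in> U" "?y \<in> fst ?c" "n \<in> points NN" using n by auto
    have zU: "?z \<in> snd ?c ` ?U" using nU by auto
    have zc: "?z \<in> snd ?c ` fst ?c" using nU by auto
    have fb: "lift_on \<phi> U (\<lambda>y. act X (f y) (b n))" by (rule lift_on_translate[OF f tr(5)[OF nU(3,1)]])
    have G: "smooth_map Y NN U (\<lambda>y. (y, act X (f y) (b n)))" by (rule graph_smooth[OF fb])
    have im: "chart_inv ?c ` snd ?c ` ?U \<subseteq> U" using ciU by auto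
    have L: "L n w = graph (\<lambda>y. act X (f y) (b n)) ?y (chart_vec Y ?c ?z w)" for w
      using tmap_compose[OF mf_eucl Y pull.NN ci G im zU, of w] chart_inv_snd[OF Y c(1) nU(2)]
      unfolding L_def F_def chart_vec_tmap by simp
    have lG: "linear (graph (\<lambda>y. act X (f y) (b n)) ?y)" by (rule tmap_linear[OF Y pull.NN G nU(1)])
    have lin: "linear (L n)" unfolding L
      by (rule linear_compose[OF linear_chart_vec[OF Y c(1) zc] lG, unfolded o_def])
    have inj: "inj (L n)"
    proof (rule injI)
      fix w w' assume eq: "L n w = L n w'"
      have fG: "tmap NN Y fst (?y, act X (f ?y) (b n)) (L n w) = chart_vec Y ?c ?z w" for w
        unfolding L by (rule graph_components(1)[OF fb nU(1)])
      have "chart_vec Y ?c ?z w = chart_vec Y ?c ?z w'" using fG[of w, symmetric] fG[of w'] unfolding eq by (rule trans)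
      from arg_cong[OF this, of "chart_coord Y ?c (chart_inv ?c ?z)"] show "w = w'"
        unfolding chart_coord_vec[OF Y c(1) zc] .
    qed
    have nn: "(?y, act X (f ?y) (b n)) = n" using tr(4)[OF nU(3,1)] by (simp add: prod_eq_iff)
    have "range (graph (\<lambda>y. act X (f y) (b n)) ?y) = range (L n)"
    proof (intro subset_antisym image_subsetI)
      fix v
      have "L n (chart_coord Y ?c ?y v) = graph (\<lambda>y. act X (f y) (b n)) ?y v"
        unfolding L by (simp add: chart_vec_coord[OF Y c(1) nU(2)])
      from this[symmetric] show "graph (\<lambda>y. act X (f y) (b n)) ?y v \<in> range (L n)" by (rule range_eqI)
    qed (simp add: L)
    then have hL: "hor n = range (L n)" using hor_eq[OF fb nU(1)] nn by simp
    have "span {1, \<i>} = UNIV"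
    proof -
      have "z \<in> span {1, \<i>}" for z
      proof -
        have "z = Re z *\<^sub>R 1 + Im z *\<^sub>R \<i>" by (simp add: complex_eq_iff)
        then show ?thesis by (metis insertI1 insertI2 span_add span_base span_scale)
      qed
      then show ?thesis by auto
    qed
    then have "range (L n) = span {L n 1, L n \<i>}"
      using linear_span_image[OF lin, of "{1, \<i>}"] by simp
    moreover have "dim (range (L n)) = 2"
      using dim_image_eq[OF lin, of UNIV] inj by (simp add: inj_on_subset)
    ultimately show ?thesis using hL by simp
  qed
  then have "\<forall>n\<in>?V. hor n = span {L n 1, L n \<i>} \<and> dim (hor n) = 2" by blast
  moreover have "(\<lambda>i. (if i = 0 then L n 1 else L n \<i>)) ` {..<2::nat} = {L n 1, L n \<i>}" for n
    by (simp add: numeral_2_eq_2 lessThan_Suc insert_commute)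
  moreover have "smooth_field NN ?V (\<lambda>n. if i = 0 then L n 1 else L n \<i>)" for i :: nat
    using field by (cases "i = 0") simp_all
  moreover have "n0 \<in> ?V" using n0 y0 c by simp
  ultimately show ?thesis using oV
    by (intro exI[of _ ?V] exI[of _ "2::nat"] exI[of _ "\<lambda>i n. if i = 0 then L n 1 else L n \<i>"]) (simp only: simp_thms Ball_def)
qed

lemma hor_connection: "connection PB hor"
  unfolding connection_def
proof (intro conjI ballI allI)
  show "smooth_distribution (tot PB) hor"
    unfolding smooth_distribution_def using hor_frame by simp
  fix n assume "n \<in> points (tot PB)"
  then have n: "n \<in> points NN" by simp
  obtain U f where f: "lift_on \<phi> U f" and y: "fst n \<in> U" and fn: "f (fst n) = snd n" using lift_through[OF n] by blast
  have nn: "(fst n, f (fst n)) = n" using fn by simp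
  have h: "hor n = range (graph f (fst n))" using hor_eq[OF f y] nn by simp
  have lG: "linear (graph f (fst n))" by (rule tmap_linear[OF Y pull.NN graph_smooth[OF f] y])
  have fG: "tmap NN Y fst n (graph f (fst n) v) = v" for v using graph_components(1)[OF f y] nn by simp
  have lF: "linear (tmap NN Y fst n)" by (rule tmap_linear[OF pull.NN Y pull.fst_smooth n])
  have v: "u \<in> vert PB n \<longleftrightarrow> tmap NN Y fst n u = 0" for u by (simp add: vert_def tproj_def)
  show "subspace (hor n)" unfolding h by (rule linear_subspace_image[OF lG subspace_UNIV])
  show "hor n \<inter> vert PB n = {0}"
  proof (intro subset_antisym)
    show "hor n \<inter> vert PB n \<subseteq> {0}"
    proof
    fix t assume t: "t \<in> hor n \<inter> vert PB n"
    then obtain w where "t = graph f (fst n) w" unfolding h by auto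
    then show "t \<in> {0}" using t fG[of w] linear_0[OF lG] by (simp add: v)
    qed
  next
    show "{0} \<subseteq> hor n \<inter> vert PB n"
      using linear_0[OF lG] linear_0[OF lF] by (auto simp: v h intro: range_eqI[of _ _ 0])
  qed
  show "\<exists>u\<in>hor n. \<exists>v\<in>vert PB n. t = u + v" for t
  proof (intro bexI)
    \<comment> \<open>The horizontal part of \<open>t\<close> is the graph vector over its
      projection to the surface.\<close>
    let ?u = "graph f (fst n) (tmap NN Y fst n t)"
    show "t = ?u + (t - ?u)" by simp
    show "t - ?u \<in> vert PB n" by (simp add: v linear_diff[OF lF] fG)
    show "?u \<in> hor n" unfolding h by simp
  qed
  fix a assume "a \<in> points (grpM PB)"
  then have a: "a \<in> points HH" by simp
  show "tright PB a n ` hor n = hor (act PB n a)"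
  proof (intro subset_antisym image_subsetI subsetI)
    show "tright PB a n t \<in> hor (act PB n a)" if "t \<in> hor n" for t by (rule tright_hor[OF n a that])
    fix t assume t: "t \<in> hor (act PB n a)"
    have na: "act PB n a \<in> points NN" using bun.act_in[of n a] n a by simp
    have na_inv: "act PB (act PB n a) (iv a) = n"
      using bun.act_mult[of n a "iv a"] bun.act_one[of n] n a by (simp del: pull.PB_simps(6))
    have "tright PB (iv a) (act PB n a) t \<in> hor n" using tright_hor[OF na inv_in[OF a] t] unfolding na_inv .
    moreover have "tright PB a n (tright PB (iv a) (act PB n a) t) = t"
      using bun.tright_inverse[of "act PB n a" "iv a" t] na na_inv a by (simp del: pull.PB_simps(6))
    ultimately show "t \<in> tright PB a n ` hor n" by (metis imageI)
  qed
qed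

text \<open>Every \<open>m\<close> over \<open>U\<close> is the graph of \<open>f\<close> at its
  base point, moved by \<open>b m\<close>. Differentiating this with the Leibniz rule splits
  \<open>t\<close> into a horizontal vector and the fundamental vector of \<open>mc\<close> on the
  derivative of \<open>b\<close>.\<close>

lemma conn_form_hor:
  assumes f: "lift_on \<phi> U f" and n: "n \<in> points NN" "fst n \<in> U"
  shows "conn_form PB hor n t = mc (translator X (f (fst n)) (snd n)) (tmap NN HH (\<lambda>n. translator X (f (fst n)) (snd n)) n t)"
proof -
  interpret con: pb_connection PB hor by (intro pb_connection.intro pb_connection_axioms.intro bun.pb_axioms hor_connection)
  define b where "b n = translator X (f (fst n)) (snd n)" for n
  note tr = lift_translator[OF f, folded b_def]
  let ?V = "{n \<in> points NN. fst n \<in> U}"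
  have nV: "n \<in> ?V" using n by simp
  let ?\<sigma> = "\<lambda>n. (fst n, f (fst n))"
  have s\<phi>: "smooth_map NN Y ?V fst" by (rule smap_subset[OF pull.NN Y pull.fst_smooth tr(2)]) auto
  have s\<sigma>: "smooth_map NN NN ?V ?\<sigma>"
    by (rule smooth_compose[OF pull.NN Y pull.NN s\<phi> graph_smooth[OF f]]) auto
  have t\<sigma>: "tmap NN NN ?\<sigma> n t = graph f (fst n) (tmap NN Y fst n t)"
    by (rule tmap_compose[OF pull.NN Y pull.NN s\<phi> graph_smooth[OF f] _ nV]) auto
  have act: "act PB (?\<sigma> m) (b m) = m" if "m \<in> ?V" for m using tr(4)[of m] that by (simp add: prod_eq_iff)
  have bn: "b n \<in> points HH" by (rule tr(5)[OF n])
  have \<sigma>n: "?\<sigma> n \<in> points NN" by (rule smap_in[OF s\<sigma> nV])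
  have 1: "tmap NN NN (\<lambda>n. act PB (?\<sigma> n) (b n)) n t =
      tright PB (b n) (?\<sigma> n) (tmap NN NN ?\<sigma> n t) + fund PB (act PB (?\<sigma> n) (b n)) (mc (b n) (tmap NN HH b n t))"
    using bun.tmap_act[OF pull.NN _ _ nV, of ?\<sigma> b t] s\<sigma> tr(3) by (simp del: pull.PB_simps(6))
  have 2: "tmap NN NN (\<lambda>n. act PB (?\<sigma> n) (b n)) n t = t"
    using tmap_cong[OF pull.NN pull.NN tr(2) nV act] tmap_id[OF pull.NN n(1), of t] by simp
  have 3: "tright PB (b n) (?\<sigma> n) (tmap NN NN ?\<sigma> n t) \<in> hor (act PB (?\<sigma> n) (b n))"
  proof (rule tright_hor[OF \<sigma>n bn])
    have "graph f (fst n) (tmap NN Y fst n t) \<in> hor (fst n, f (fst n))" unfolding hor_eq[OF f n(2)] by simp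
    then show "tmap NN NN ?\<sigma> n t \<in> hor (?\<sigma> n)" unfolding t\<sigma> .
  qed
  have "t - fund PB n (mc (b n) (tmap NN HH b n t)) = tright PB (b n) (?\<sigma> n) (tmap NN NN ?\<sigma> n t)"
    using 1[unfolded 2 act[OF nV]] by (simp add: diff_eq_eq)
  then have "t - fund PB n (mc (b n) (tmap NN HH b n t)) \<in> hor n" using 3 unfolding act[OF nV] by simp
  then have "conn_form PB hor n t = mc (b n) (tmap NN HH b n t)" using con.th_eqI[of n t] n(1) by simp
  then show ?thesis unfolding b_def[abs_def] .
qed

text \<open>By \<open>conn_form_hor\<close> the connection form is locally a pull-back of the
  Maurer-Cartan form, so the curvature vanishes by \<open>mc_structure\<close>.\<close>

lemma flat_hor: "flat_connection PB hor"
  unfolding flat_connection_def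
proof (intro conjI ballI allI hor_connection)
  fix n u v assume "n \<in> points (tot PB)"
  then have n: "n \<in> points NN" by simp
  obtain U f where f: "lift_on \<phi> U f" and y: "fst n \<in> U" using lift_through[OF n] by blast
  define b where "b n = translator X (f (fst n)) (snd n)" for n
  note tr = lift_translator[OF f, folded b_def]
  let ?V = "{n \<in> points NN. fst n \<in> U}"
  have nV: "n \<in> ?V" using n y by simp
  have c: "conn_form PB hor m t = mc (b m) (tmap NN HH b m t)" if "m \<in> ?V" for m t
    using conn_form_hor[OF f, of m t] that by (simp add: b_def[abs_def])
  have im: "b ` ?V \<subseteq> points HH" by (rule smap_image[OF tr(3)])
  have "ext_d NN (conn_form PB hor) n u v = ext_d NN (\<lambda>m t. mc (b m) (tmap NN HH b m t)) n u v"
    by (rule ext_d_cong[OF pull.NN tr(2) nV c])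
  also have "\<dots> = ext_d HH mc (b n) (tmap NN HH b n u) (tmap NN HH b n v)"
    by (rule ext_d_pull[OF pull.NN H tr(3) mc_form im nV])
  also have "\<dots> = - lbr (conn_form PB hor n u) (conn_form PB hor n v)"
    using mc_structure[OF tr(5)[OF n y]] c[OF nV] by simp
  finally have "ext_d NN (conn_form PB hor) n u v = - lbr (conn_form PB hor n u) (conn_form PB hor n v)" .
  then show "curvature PB hor n u v = 0"
    using lbr_skew[of "conn_form PB hor n v" "conn_form PB hor n u"]
    by (simp add: curvature_def wedge_br_def brk_def scaleR_2[symmetric])
qed

lemma holomorphic_lifts_eq: "holomorphic_lifts Y X A al \<phi> U = {f \<in> extensional U. lift_on \<phi> U f}"
  by (simp add: holomorphic_lifts_def lift_on_iff)

lemma graph_parallel: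
  assumes f: "lift_on \<phi> U f"
  shows "restrict (\<lambda>y. (y, f y)) U \<in> parallel_sections PB hor U"
proof -
  let ?s = "restrict (\<lambda>y. (y, f y)) U"
  have s: "smooth_map Y NN U ?s" by (rule smap_cong[OF Y pull.NN graph_smooth[OF f]]) simp
  have "tmap Y NN ?s y v \<in> hor (?s y)" if y: "y \<in> U" for y v
  proof -
    have "tmap Y NN ?s y = tmap Y NN (\<lambda>y. (y, f y)) y"
      by (rule tmap_cong[OF Y pull.NN smap_open[OF s] y]) simp
    then show ?thesis using hor_eq[OF f y] y by simp
  qed
  then show ?thesis using s by (simp add: parallel_sections_def local_section_def)
qed

text \<open>At each point the section has the same value and first derivative as a lift through that
  point, and \<open>beta\<close> depends on nothing else.\<close>

lemma parallel_lift:
  assumes s: "s \<in> parallel_sections PB hor U"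
  shows "lift_on \<phi> U (\<lambda>y. snd (s y))" "y \<in> U \<Longrightarrow> fst (s y) = y"
proof -
  have sm: "smooth_map Y NN U s" and fs: "\<And>y. y \<in> U \<Longrightarrow> fst (s y) = y"
    and par: "\<And>y v. y \<in> U \<Longrightarrow> tmap Y NN s y v \<in> hor (s y)"
    using s by (auto simp: parallel_sections_def local_section_def)
  show "y \<in> U \<Longrightarrow> fst (s y) = y" by (rule fs)
  have im: "s ` U \<subseteq> points NN" by (rule smap_image[OF sm])
  have "smooth_map Y PP U (\<lambda>y. snd (s y))" by (rule smooth_compose[OF Y pull.NN P sm pull.snd_smooth im])
  moreover have "proj X (snd (s y)) = \<phi> y" if "y \<in> U" for y
    using smap_in[OF sm that] fs[OF that] by (simp add: pull.points_NN)
  moreover have "beta (\<lambda>y. snd (s y)) y v = 0" if y: "y \<in> U" for y v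
  proof -
    obtain V f where f: "lift_on \<phi> V f" and yV: "y \<in> V" and fy: "f y = snd (s y)"
      using lift_through[OF smap_in[OF sm y]] fs[OF y] by auto
    have sy: "s y = (y, f y)" using fs[OF y] fy by (simp add: prod_eq_iff)
    have "tmap Y PP (\<lambda>y. snd (s y)) y w = tmap Y PP f y w" for w
    proof -
      obtain w' where w': "tmap Y NN s y w = graph f y w'" using par[OF y, of w] unfolding sy hor_eq[OF f yV] by auto
      have "tmap Y Y (\<lambda>y. fst (s y)) y w = tmap NN Y fst (s y) (tmap Y NN s y w)"
        by (rule tmap_compose[OF Y pull.NN Y sm pull.fst_smooth im y])
      also have "\<dots> = w'" unfolding w' sy by (rule graph_components(1)[OF f yV])
      finally have "w' = w"
        using tmap_cong[OF Y Y smap_open[OF sm] y fs] tmap_id[OF Y smap_dom[OF sm y], of w] by simp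
      moreover have "tmap Y PP (\<lambda>y. snd (s y)) y w = tmap NN PP snd (s y) (tmap Y NN s y w)"
        by (rule tmap_compose[OF Y pull.NN P sm pull.snd_smooth im y])
      ultimately show ?thesis unfolding w' sy using graph_components(2)[OF f yV, of w] by simp
    qed
    then show ?thesis using lift_onD(3)[OF f yV, of v] by (simp add: beta_def fy)
  qed
  ultimately show "lift_on \<phi> U (\<lambda>y. snd (s y))" by (simp add: lift_on_def)
qed

lemma sheaves: "sheaves_isomorphic Y (holomorphic_lifts Y X A al \<phi>) (parallel_sections PB hor)"
  unfolding sheaves_isomorphic_def holomorphic_lifts_eq
proof (intro exI[of _ "\<lambda>U f. restrict (\<lambda>y. (y, f y)) U"] conjI allI impI ballI)
  fix U
  let ?F = "{f \<in> extensional U. lift_on \<phi> U f}"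
  show "bij_betw (\<lambda>f. restrict (\<lambda>y. (y, f y)) U) ?F (parallel_sections PB hor U)"
  proof (rule bij_betw_byWitness[where f' = "\<lambda>s. restrict (\<lambda>y. snd (s y)) U"])
    show "\<forall>f\<in>?F. restrict (\<lambda>y. snd (restrict (\<lambda>y. (y, f y)) U y)) U = f"
      by (auto simp: restrict_def extensional_def fun_eq_iff)
    show "\<forall>s\<in>parallel_sections PB hor U. restrict (\<lambda>y. (y, restrict (\<lambda>y. snd (s y)) U y)) U = s"
    proof
      fix s assume s: "s \<in> parallel_sections PB hor U"
      then have "s y = undefined" if "y \<notin> U" for y using that by (auto simp: parallel_sections_def extensional_def)
      then show "restrict (\<lambda>y. (y, restrict (\<lambda>y. snd (s y)) U y)) U = s"
        using parallel_lift(2)[OF s] by (auto simp: restrict_def fun_eq_iff prod_eq_iff)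
    qed
    show "(\<lambda>f. restrict (\<lambda>y. (y, f y)) U) ` ?F \<subseteq> parallel_sections PB hor U" using graph_parallel by auto
    show "(\<lambda>s. restrict (\<lambda>y. snd (s y)) U) ` parallel_sections PB hor U \<subseteq> ?F"
    proof (intro image_subsetI)
      fix s assume "s \<in> parallel_sections PB hor U"
      from parallel_lift(1)[OF this] show "restrict (\<lambda>y. snd (s y)) U \<in> ?F"
        using lift_on_cong[of \<phi> U "\<lambda>y. snd (s y)" "restrict (\<lambda>y. snd (s y)) U"] by simp
    qed
  qed
next
  fix U V f assume "open_in Y U \<and> open_in Y V \<and> V \<subseteq> U"
  then show "restrict (\<lambda>y. (y, restrict f V y)) V = restrict (restrict (\<lambda>y. (y, f y)) U) V"
    by (auto simp: restrict_def fun_eq_iff)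
qed

end

section \<open>Induced metrics of a lift and of its projection; the mean curvature of the
  projection\<close>

context geom_surface
begin

lemma pullback_metricM:
  assumes f: "smooth_map Y PP U f" and pf: "\<And>y. y \<in> U \<Longrightarrow> proj X (f y) = \<phi> y" and y: "y \<in> U"
  shows "ind \<phi> y u v = g (al (f y) (tmap Y PP f y u)) (al (f y) (tmap Y PP f y v))"
proof -
  have im: "f ` U \<subseteq> points PP" by (rule smap_image[OF f])
  have "tmap Y MM \<phi> y w = tproj X (f y) (tmap Y PP f y w)" for w
    using tmap_compose[OF Y P M f proj_smooth im y, of w] tmap_cong[OF Y M smap_open[OF f] y pf]
    by (simp add: tproj_def)
  then show ?thesis
    unfolding pullback_metric_def pf[OF y, symmetric] using metricM_eq[OF smap_in[OF f y]] by simp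
qed

text \<open>For a lift, \<open>\<theta>(f\<^sub>* v) = - \<alpha>(f\<^sub>* \<i>v)\<close>; so isotropy of \<open>f\<close> is the conformality of \<open>\<phi>\<close>.\<close>

lemma lift_metric:
  assumes f: "lift_on \<phi> U f" and y: "y \<in> U"
  shows "gP (f y) (tmap Y PP f y u) (tmap Y PP f y v) =
      ind \<phi> y u v + ind \<phi> y (\<i> * u) (\<i> * v)"
    and "omega X A al g (f y) (tmap Y PP f y v) (tmap Y PP f y v) =
      Complex (ind \<phi> y (\<i> * v) (\<i> * v) - ind \<phi> y v v)
        (2 * ind \<phi> y (\<i> * v) v)"
proof -
  note pm = pullback_metricM[OF lift_onD(1)[OF f] lift_onD(2)[OF f] y]
  have th: "th (f y) (tmap Y PP f y v) = - al (f y) (tmap Y PP f y (\<i> * v))" for v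
    using lift_onD(3)[OF f y, of v] by (simp add: beta_def eq_neg_iff_add_eq_0)
  note gs = bilinear_lneg[OF bilinear_g] bilinear_rneg[OF bilinear_g]
  show "gP (f y) (tmap Y PP f y u) (tmap Y PP f y v) =
      ind \<phi> y u v + ind \<phi> y (\<i> * u) (\<i> * v)"
    by (simp add: metricP_def pm th gs)
  show "omega X A al g (f y) (tmap Y PP f y v) (tmap Y PP f y v) =
      Complex (ind \<phi> y (\<i> * v) (\<i> * v) - ind \<phi> y v v)
        (2 * ind \<phi> y (\<i> * v) v)"
    using g_sym[of "al (f y) (tmap Y PP f y v)" "al (f y) (tmap Y PP f y (\<i> * v))"]
    by (simp add: omega_def eta_def complexify_form_def pm th gs)
qed

lemma pullback_metric_bilinear:
  assumes f: "smooth_map Y PP U f" and pf: "\<And>y. y \<in> U \<Longrightarrow> proj X (f y) = \<phi> y" and y: "y \<in> U"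
  shows "bilinear (ind \<phi> y)"
    and "ind \<phi> y u v = ind \<phi> y v u"
proof -
  note pm = pullback_metricM[OF f pf y]
  have l: "linear (\<lambda>v. al (f y) (tmap Y PP f y v))"
    by (rule linear_compose[OF tmap_linear[OF Y P f y] linear_al[OF smap_in[OF f y]], unfolded o_def])
  show "bilinear (ind \<phi> y)"
    unfolding bilinear_def
    by (auto intro!: linearI simp: pm linear_add[OF l] linear_cmul[OF l] bilinear_ladd[OF bilinear_g]
        bilinear_radd[OF bilinear_g] bilinear_lmul[OF bilinear_g] bilinear_rmul[OF bilinear_g])
  show "ind \<phi> y u v = ind \<phi> y v u"
    using g_sym[of "al (f y) (tmap Y PP f y u)" "al (f y) (tmap Y PP f y v)"] by (simp add: pm)
qed

text \<open>From right to left this is polarization. From left to right, orthogonality of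
  \<open>\<i> * v\<close> and \<open>v\<close> follows from symmetry because \<i> squares to
  -1.\<close>

lemma conformal_orthogonal:
  fixes q :: "complex \<Rightarrow> complex \<Rightarrow> real"
  assumes bl: "bilinear q" and sym: "\<And>u v. q u v = q v u"
  shows "(\<forall>u v. q (\<i> * u) (\<i> * v) = q u v) \<longleftrightarrow> (\<forall>v. q (\<i> * v) (\<i> * v) = q v v \<and> q (\<i> * v) v = 0)"
proof (intro iffI allI conjI)
  assume c: "\<forall>u v. q (\<i> * u) (\<i> * v) = q u v"
  fix v
  show "q (\<i> * v) (\<i> * v) = q v v" using c by blast
  have "q (\<i> * (\<i> * v)) (\<i> * v) = - q v (\<i> * v)" by (simp add: mult.assoc[symmetric] bilinear_lneg[OF bl])
  then show "q (\<i> * v) v = 0" using c[rule_format, of "\<i> * v" v] sym[of v "\<i> * v"] by simp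
next
  assume c: "\<forall>v. q (\<i> * v) (\<i> * v) = q v v \<and> q (\<i> * v) v = 0"
  fix u v
  have "q (\<i> * (u + v)) (\<i> * (u + v)) = q (u + v) (u + v)" using c by blast
  then show "q (\<i> * u) (\<i> * v) = q u v"
    using c[rule_format, of u] c[rule_format, of v] sym[of v u] sym[of "\<i> * v" "\<i> * u"]
    by (simp add: distrib_left bilinear_ladd[OF bl] bilinear_radd[OF bl])
qed

text \<open>A vector in the kernel has length 0.\<close>

lemma inj_tmap_pullback:
  assumes f: "smooth_map Y B U f" and B: "manifold B" and y: "y \<in> U"
    and pos: "\<And>v. v \<noteq> 0 \<Longrightarrow> pullback_metric Y B q f y v v > 0"
    and q0: "q (f y) 0 0 = 0"
  shows "inj (tmap Y B f y)"
proof (rule injI)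
  note l = tmap_linear[OF Y B f y]
  fix v w assume "tmap Y B f y v = tmap Y B f y w"
  then have "tmap Y B f y (v - w) = 0" by (simp add: linear_diff[OF l])
  then have "pullback_metric Y B q f y (v - w) (v - w) = 0" by (simp add: pullback_metric_def q0)
  then show "v = w" using pos[of "v - w"] by fastforce
qed

text \<open>By \<open>lift_metric\<close>, conformality of \<phi> makes the square length of a
  vector for \<open>f\<close> twice the one for \<phi>, and makes both parts of \<open>omega\<close>
  vanish.\<close>

lemma lift_spacelike_isotropic:
  assumes f: "lift_on \<phi> U f"
    and pos: "\<And>y v. y \<in> U \<Longrightarrow> v \<noteq> 0 \<Longrightarrow> ind \<phi> y v v > 0"
    and conf: "\<And>y u v. y \<in> U \<Longrightarrow> ind \<phi> y (\<i> * u) (\<i> * v) =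
      ind \<phi> y u v"
  shows "spacelike_immersion Y PP gP U f" "isotropic Y X A al g U f"
proof -
  note sf = lift_onD(1)[OF f]
  have p: "pullback_metric Y PP gP f y v v > 0" if y: "y \<in> U" and v: "v \<noteq> 0" for y v
    using pos[OF y v] conf[OF y, of v v] lift_metric(1)[OF f y, of v v] by (simp add: pullback_metric_def[of Y PP])
  have "inj (tmap Y PP f y)" if y: "y \<in> U" for y
    by (rule inj_tmap_pullback[OF sf P y p[OF y]], assumption, subst metricP_def)
      (simp add: linear_0[OF linear_al[OF smap_in[OF sf y]]] linear_0[OF linear_th[OF smap_in[OF sf y]]]
        bilinear_lzero[OF bilinear_g])
  then show "spacelike_immersion Y PP gP U f"
    using p sf by (simp add: spacelike_immersion_def immersion_def)
  have "omega X A al g (f y) (tmap Y PP f y v) (tmap Y PP f y v) = 0" if y: "y \<in> U" for y v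
  proof -
    have "\<forall>v. ind \<phi> y (\<i> * v) (\<i> * v) = ind \<phi> y v v \<and>
        ind \<phi> y (\<i> * v) v = 0"
      using conformal_orthogonal[OF pullback_metric_bilinear[OF sf lift_onD(2)[OF f] y]] conf[OF y] by simp
    then show ?thesis unfolding lift_metric(2)[OF f y] by (simp add: complex_eq_iff)
  qed
  then show "isotropic Y X A al g U f" by (simp add: isotropic_def)
qed

text \<open>Isotropy alone gives conformality of \<phi>; square lengths for \<open>f\<close> are
  then twice those for \<phi>, so positivity passes from \<open>f\<close> to \<phi>.\<close>

lemma isotropic_lift_metric:
  assumes f: "lift_on \<phi> U f" and iso: "isotropic Y X A al g U f"
    and sp: "spacelike_immersion Y PP gP U f" and y: "y \<in> U"
  shows "ind \<phi> y (\<i> * u) (\<i> * v) = ind \<phi> y u v"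
    and "v \<noteq> 0 \<Longrightarrow> ind \<phi> y v v > 0"
proof -
  let ?q = "ind \<phi> y"
  have i: "\<forall>v. ?q (\<i> * v) (\<i> * v) = ?q v v \<and> ?q (\<i> * v) v = 0"
    using iso y lift_metric(2)[OF f y] by (simp add: isotropic_def complex_eq_iff)
  then show "?q (\<i> * u) (\<i> * v) = ?q u v"
    using conformal_orthogonal[OF pullback_metric_bilinear[OF lift_onD(1)[OF f] lift_onD(2)[OF f] y]] by simp
  assume "v \<noteq> 0"
  then have "pullback_metric Y PP gP f y v v > 0" using sp y by (simp add: spacelike_immersion_def)
  then show "?q v v > 0" using lift_metric(1)[OF f y, of v v] i by (simp add: pullback_metric_def[of Y PP])
qed

text \<open>A section through \<open>f(y\<^sub>0)\<close> differs from \<open>f\<close> by a gauge transformation \<open>b\<close>, and \<open>\<beta> = b\<^sup>*\<omega>\<close> satisfies the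
  Maurer--Cartan equation.\<close>

lemma lift_mean_curvature:
  assumes f: "lift_on \<phi> (points Y) f" and iso: "isotropic Y X A al g (points Y) f"
    and sp: "spacelike_immersion Y PP gP (points Y) f"
  shows "smooth_map Y MM (points Y) \<phi>" "mean_curvature_eq Y X al g \<phi>"
    "y0 \<in> points Y \<Longrightarrow> orthonormal_pair (ind \<phi> y0) u (\<i> * u) \<Longrightarrow>
      vol_form (ind \<phi> y0) u (\<i> * u) = 1"
proof -
  note sf = lift_onD(1)[OF f] and pf = lift_onD(2)[OF f]
  have "smooth_map Y MM (points Y) (\<lambda>y. proj X (f y))"
    by (rule smooth_compose[OF Y P M sf proj_smooth smap_image[OF sf]])
  then show phi: "smooth_map Y MM (points Y) \<phi>" by (rule smap_cong[OF Y M]) (rule pf)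
  have *: "(\<forall>u v. bracketM X al (\<phi> y0) (tmap Y MM \<phi> y0 u) (tmap Y MM \<phi> y0 v) =
      vol_form (ind \<phi> y0) u v *\<^sub>R mean_curvature Y MM gM \<phi> y0) \<and>
    (\<forall>u. orthonormal_pair (ind \<phi> y0) u (\<i> * u) \<longrightarrow>
      vol_form (ind \<phi> y0) u (\<i> * u) = 1)" if y0: "y0 \<in> points Y" for y0
  proof -
    have fy: "f y0 \<in> points PP" by (rule smap_in[OF sf y0])
    obtain W s where fW: "proj X (f y0) \<in> W" and s: "local_section X W s" using local_section_through[OF fy] .
    interpret gauge X A al g Y \<phi> y0 W s
      by (intro gauge.intro gauge_axioms.intro conformal_map.intro conformal_map_axioms.intro geom_surface_axioms phi y0 s isotropic_lift_metric[OF f iso sp])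
        (use fW pf[OF y0] in auto)
    let ?U = "{y \<in> points Y. \<phi> y \<in> W}" and ?\<sigma> = "\<lambda>y. s (\<phi> y)"
    note s\<sigma> = section_lift_smooth
    have oU: "open_in Y ?U" by (rule smap_open[OF s\<sigma>])
    have yU: "y0 \<in> ?U" using y0 fW pf[OF y0] by simp
    have sfU: "smooth_map Y PP ?U f" by (rule smap_subset[OF Y P sf oU]) auto
    define b where "b y = translator X (f y) (?\<sigma> y)" for y
    have pe: "proj X (f y) = proj X (?\<sigma> y)" if "y \<in> ?U" for y using that pf[of y] local_section_proj[OF s, of "\<phi> y"] by simp
    have sb: "smooth_map Y HH ?U b" unfolding b_def by (rule smooth_translator[OF Y sfU s\<sigma> pe])
    have fb: "act X (f y) (b y) = ?\<sigma> y" if y: "y \<in> ?U" for y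
      unfolding b_def by (rule act_translator[OF smap_in[OF sfU y] smap_in[OF s\<sigma> y] pe[OF y]])
    \<comment> \<open>Since \<open>beta f\<close> vanishes, only the inhomogeneous term of the gauge
      change is left.\<close>
    have be: "beta ?\<sigma> y v = mc (b y) (tmap Y HH b y v)" if y: "y \<in> ?U" for y v
      using beta_gauge[OF sfU sb y, of v] lift_onD(3)[OF f, of y v] y
        beta_cong[where f = "\<lambda>y. act X (f y) (b y)" and f' = ?\<sigma> and v = v, OF oU y fb]
      by (simp add: linear_0[OF linear_Ad[OF inv_in[OF smap_in[OF sb y]]]])
    have "ext_d Y (beta ?\<sigma>) y0 1 \<i> = ext_d Y (\<lambda>y v. mc (b y) (tmap Y HH b y v)) y0 1 \<i>"
      by (rule ext_d_cong[OF Y oU yU be])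
    also have "\<dots> = ext_d HH mc (b y0) (tmap Y HH b y0 1) (tmap Y HH b y0 \<i>)"
      by (rule ext_d_pull[OF Y H sb mc_form smap_image[OF sb] yU])
    also have "\<dots> = - lbr (beta ?\<sigma> y0 1) (beta ?\<sigma> y0 \<i>)"
      using mc_structure[OF smap_in[OF sb yU]] be[OF yU] by simp
    finally have "ext_d Y (beta ?\<sigma>) y0 1 \<i> + lbr (beta ?\<sigma> y0 1) (beta ?\<sigma> y0 \<i>) = 0" by simp
    moreover have "vol_form (ind \<phi> y0) u (\<i> * u) = 1"
      if u: "orthonormal_pair (ind \<phi> y0) u (\<i> * u)" for u
    proof -
      have "cf z0 * Re (cnj u * u) = 1" using u unfolding orthonormal_pair_def pb_metric_y0 by simp
      moreover have "Im (cnj u * (\<i> * u)) = Re (cnj u * u)" by simp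
      ultimately show ?thesis using vol_form_conformal[OF pb_metric_y0 cf_pos[OF z0(1)], of u "\<i> * u"] by simp
    qed
    ultimately show ?thesis using mean_curvature_eq_iff by blast
  qed
  then show "mean_curvature_eq Y X al g \<phi>" unfolding mean_curvature_eq_def by blast
  show "y0 \<in> points Y \<Longrightarrow> orthonormal_pair (ind \<phi> y0) u (\<i> * u) \<Longrightarrow>
      vol_form (ind \<phi> y0) u (\<i> * u) = 1" using * by blast
qed

end

theorem theorem4p1:
  fixes X :: "('h::{t2_space,second_countable_topology}, 'k::euclidean_space,
               'p::{t2_space,second_countable_topology}, 'q::euclidean_space,
               'm::{t2_space,second_countable_topology}, 'n::euclidean_space) pbundle"
    and \<alpha> :: "'p \<Rightarrow> 'q \<Rightarrow> 'k"
    and A :: "'p \<Rightarrow> 'q set"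
    and g :: "'k \<Rightarrow> 'k \<Rightarrow> real"
    and Y :: "('y::{t2_space,second_countable_topology}, complex) atlas"
  assumes "principal_bundle X"
    and "tensorial_form X \<alpha>" and "admissible X \<alpha>"
    and "connection X A"
    and "\<forall>\<xi>\<in>points (tot X). \<forall>u v. cov_d X A \<alpha> \<xi> u v = 0"
    and "\<forall>\<xi>\<in>points (tot X). \<forall>u v.
           curvature X A \<xi> u v = (1/2) *\<^sub>R wedge_br (brk X) (\<alpha> \<xi>) (\<alpha> \<xi>) u v"
    and "ad_invariant_form (grp X) (grpM X) g"
    and "riemann_surface Y"
  shows
   "(\<forall>f. spacelike_immersion Y (tot X) (metricP X A \<alpha> g) (points Y) f \<and>
         isotropic Y X A \<alpha> g (points Y) f \<and>
         holomorphic_map Y X A \<alpha> (points Y) f \<longrightarrow>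
        (let \<phi> = proj X \<circ> f in
         spacelike_immersion Y (base X) (metricM X \<alpha> g) (points Y) \<phi> \<and>
         conformal Y (base X) (metricM X \<alpha> g) (points Y) \<phi> \<and>
         mean_curvature_eq Y X \<alpha> g \<phi> \<and>
         (\<forall>y\<in>points Y. \<forall>u v. v = surfJ u \<and>
            orthonormal_pair (pullback_metric Y (base X) (metricM X \<alpha> g) \<phi> y) u v \<longrightarrow>
            mean_curvature Y (base X) (metricM X \<alpha> g) \<phi> y =
            bracketM X \<alpha> (\<phi> y) (tmap Y (base X) \<phi> y u) (tmap Y (base X) \<phi> y v)))) \<and>
    (\<forall>\<phi>. spacelike_immersion Y (base X) (metricM X \<alpha> g) (points Y) \<phi> \<and>
         conformal Y (base X) (metricM X \<alpha> g) (points Y) \<phi> \<and>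
         mean_curvature_eq Y X \<alpha> g \<phi> \<longrightarrow>
         (\<forall>U. open_in Y U \<longrightarrow> holomorphic_lifts Y X A \<alpha> \<phi> U =
            {f \<in> holomorphic_lifts Y X A \<alpha> \<phi> U.
               spacelike_immersion Y (tot X) (metricP X A \<alpha> g) U f \<and>
               isotropic Y X A \<alpha> g U f}) \<and>
         (\<exists>B. flat_connection (pullback_bundle Y X \<phi>) B \<and>
            sheaves_isomorphic Y (holomorphic_lifts Y X A \<alpha> \<phi>)
              (parallel_sections (pullback_bundle Y X \<phi>) B)) \<and>
         (simply_connected (points Y) \<longrightarrow>
            (\<exists>f \<in> holomorphic_lifts Y X A \<alpha> \<phi> (points Y).
               spacelike_immersion Y (tot X) (metricP X A \<alpha> g) (points Y) f \<and>
               isotropic Y X A \<alpha> g (points Y) f \<and>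
               (\<forall>f' \<in> holomorphic_lifts Y X A \<alpha> \<phi> (points Y).
                  \<exists>a\<in>points (grpM X). \<forall>y\<in>points Y. f' y = act X (f y) a))))"
proof -
  interpret geom_surface X A \<alpha> g Y
    by (intro geom_surface.intro geom_surface_axioms.intro geom.intro geom_axioms.intro pb_connection.intro
        pb_connection_axioms.intro pb.intro) (use assms in auto)
  show ?thesis
  proof ((rule conjI; intro allI impI; elim conjE), goal_cases)
    case (1 f)
    note sp = this(1) and iso = this(2) and hol = this(3)
    define \<phi> where "\<phi> = proj X \<circ> f"
    have f: "lift_on \<phi> (points Y) f" using hol by (simp add: lift_on_iff \<phi>_def)
    note phi = lift_mean_curvature(1)[OF f iso sp] and mc = lift_mean_curvature(2)[OF f iso sp]
    note met = isotropic_lift_metric[OF f iso sp]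
    have "inj (tmap Y MM \<phi> y)" if y: "y \<in> points Y" for y
    proof (rule inj_tmap_pullback[OF phi M y met(2)[OF y]])
      have fy: "f y \<in> points PP" by (rule smap_in[OF lift_onD(1)[OF f] y])
      show "gM (\<phi> y) 0 0 = 0"
        using metricM_eq[OF fy, of 0 0] lift_onD(2)[OF f y]
        by (simp add: linear_0[OF linear_tproj[OF fy]] linear_0[OF linear_al[OF fy]] bilinear_lzero[OF bilinear_g])
    qed
    then have "spacelike_immersion Y MM gM (points Y) \<phi>"
      using phi met(2) by (simp add: spacelike_immersion_def immersion_def)
    moreover have "conformal Y MM gM (points Y) \<phi>"
      using met(1) by (simp add: conformal_def surfJ_def)
    moreover have "mean_curvature Y MM gM \<phi> y = bracketM X \<alpha> (\<phi> y) (tmap Y MM \<phi> y u) (tmap Y MM \<phi> y v)"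
      if y: "y \<in> points Y" and v: "v = surfJ u" "orthonormal_pair (ind \<phi> y) u v" for y u v
    proof -
      \<comment> \<open>The pair \<open>(u, surfJ u)\<close> is positively oriented, so the volume
        form disappears from the equation.\<close>
      have "vol_form (ind \<phi> y) u v = 1"
        using lift_mean_curvature(3)[OF f iso sp y, of u] v by (simp add: surfJ_def)
      moreover have "bracketM X \<alpha> (\<phi> y) (tmap Y MM \<phi> y u) (tmap Y MM \<phi> y v) =
          vol_form (ind \<phi> y) u v *\<^sub>R mean_curvature Y MM gM \<phi> y"
        using mc y unfolding mean_curvature_eq_def by blast
      ultimately show ?thesis by simp
    qed
    ultimately show ?case using mc unfolding Let_def \<phi>_def by blast
  next
    case (2 \<phi>)
    note sp = this(1) and conf = this(2) and mc = this(3)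
    interpret mean_curvature_map X A \<alpha> g Y \<phi>
    proof (intro mean_curvature_map.intro mean_curvature_map_axioms.intro conformal_map.intro conformal_map_axioms.intro geom_surface_axioms mc)
      show "smooth_map Y (base X) (points Y) \<phi>" using sp by (simp add: spacelike_immersion_def immersion_def)
    qed (use sp conf in \<open>auto simp: spacelike_immersion_def conformal_def surfJ_def\<close>)
    have l: "spacelike_immersion Y PP gP U f" "isotropic Y X A \<alpha> g U f" if f: "lift_on \<phi> U f" for U f
    proof -
      have "y \<in> points Y" if "y \<in> U" for y by (rule smap_dom[OF lift_onD(1)[OF f] that])
      then show "spacelike_immersion Y PP gP U f" "isotropic Y X A \<alpha> g U f"
        using lift_spacelike_isotropic[OF f spacelike conformal] by simp_all
    qed
    have "\<exists>f\<in>holomorphic_lifts Y X A \<alpha> \<phi> (points Y). spacelike_immersion Y PP gP (points Y) f \<and>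
        isotropic Y X A \<alpha> g (points Y) f \<and>
        (\<forall>f'\<in>holomorphic_lifts Y X A \<alpha> \<phi> (points Y). \<exists>a\<in>points HH. \<forall>y\<in>points Y. f' y = act X (f y) a)"
      if sc: "simply_connected (points Y)"
    proof -
      obtain f where f: "lift_on \<phi> (points Y) f"
        and u: "\<forall>f'. lift_on \<phi> (points Y) f' \<longrightarrow> (\<exists>a\<in>points HH. \<forall>y\<in>points Y. f' y = act X (f y) a)"
        using global_lift[OF sc] by blast
      \<comment> \<open>Elements of \<open>holomorphic_lifts\<close> have to be
        \<open>undefined\<close> outside the surface.\<close>
      let ?f = "restrict f (points Y)"
      have f': "lift_on \<phi> (points Y) ?f" by (rule lift_on_cong[OF f]) simp
      show ?thesis
      proof (intro bexI[of _ ?f] conjI ballI l[OF f'])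
        show "?f \<in> holomorphic_lifts Y X A \<alpha> \<phi> (points Y)" using f' by (simp add: holomorphic_lifts_eq)
        fix h assume "h \<in> holomorphic_lifts Y X A \<alpha> \<phi> (points Y)"
        then have "lift_on \<phi> (points Y) h" by (simp add: holomorphic_lifts_eq)
        then show "\<exists>a\<in>points HH. \<forall>y\<in>points Y. h y = act X (?f y) a" using u by simp
      qed
    qed
    moreover have "holomorphic_lifts Y X A \<alpha> \<phi> U =
        {f \<in> holomorphic_lifts Y X A \<alpha> \<phi> U. spacelike_immersion Y PP gP U f \<and> isotropic Y X A \<alpha> g U f}" for U
      using l[of U] unfolding holomorphic_lifts_eq by blast
    ultimately show ?case using flat_hor sheaves by blast
  qed
qed

end
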